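(* Let $d\geq2$. Let $A$ be a compact convex subset of $\mathbb{R}^d$ containing the origin. Let $G$ be a probability measure on $[0,+\infty[$ such that $G(\{0\})<1-p_c(d)$ and $G$ admits an exponential moment. Let $\mathcal{I}(A)=\int_{\partial A}\nu(n_A(x))\,d\mathcal{H}^{d-1}(x)$. For each $\lambda>\mathcal{I}(A)$, there exist positive constants $C_1$ and $C_2$ depending only on $\lambda$, $A$ and $G$ such that for all integers $n\geq1$, $$\mathbb{P}\left[\phi_n(A,\infty)\geq\lambda n^{d-1}\right]\leq C_1\exp(-C_2n^{d-1}).$$
   Context: For an integer $n\geq1$, $\mathbb{Z}^d_n=\mathbb{Z}^d/n$ and $\mathbb{E}^d_n$ is the set of pairs $\langle x,y\rangle$ of points of $\mathbb{Z}^d_n$ at Euclidean distance $1/n$. Each edge $e\in\mathbb{E}^d_n$ gets a random capacity $t(e)$, i.i.d. with law $G$. $p_c(d)$ is the critical probability of Bernoulli bond percolation on $\mathbb{Z}^d$; $G$ admits an exponential moment means $\int_{\mathbb{R}^+}e^{\theta x}dG(x)<\infty$ for some $\theta>0$. For a set of edges $E$, $V(E)=\sum_{e\in E}t(e)$. $E\subset\mathbb{E}^d_n$ separates $A$ from infinity if every infinite path in $(\mathbb{Z}^d_n,\mathbb{E}^d_n)$ starting at a vertex of $A\cap\mathbb{Z}^d_n$ and leaving every bounded set uses an edge of $E$; $\phi_n(A,\infty)$ is the infimum of $V(E)$ over all such $E\subset\mathbb{E}^d_n$. $n_A(x)$ is the outward unit normal to $A$ at $x$ ($\mathcal{H}^{d-1}$-a.e.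 $x\in\partial A$), $\mathcal{H}^{d-1}$ the $(d-1)$-dimensional Hausdorff measure. Flow constant $\nu:\mathbb{S}^{d-1}\to\mathbb{R}^+$: for a unit vector $v$, a non-degenerate $(d-1)$-dimensional hyperrectangle $R$ normal to $v$ and $h>0$, let $\mathrm{cyl}(R,h)=\{x+tv:x\in R,\,t\in[-h,h]\}$, let $C_1,C_2$ be the two connected components of $\mathrm{cyl}(R,h)\setminus R$, $C'_{i,n}=\{x\in\mathbb{Z}^d_n\cap C_i:\exists y\notin\mathrm{cyl}(R,h),\ \langle x,y\rangle\in\mathbb{E}^d_n\}$, and $\tau_n(R,h)$ the minimal capacity of a set of edges of $\mathbb{E}^d_n$ separating $C'_{1,n}$ from $C'_{2,n}$ inside $\mathrm{cyl}(R,h)$. Then $\nu(v)=\lim_{n\to\infty}\mathbb{E}[\tau_n(R,h)]/(\mathcal{H}^{d-1}(R)n^{d-1})$, which exists and does not depend on $R,h$ (Rossignol–Théret).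
   Formalization: It is assumed that A has a unique outward unit normal at almost every boundary point; this excludes only flat (d−1)-dimensional A, where n_A is undefined (two opposite normals) and, with either choice, the bound fails since a cut must cover both sides. *)

theory Defs
  imports "HOL-Analysis.Analysis" "HOL-Probability.Probability"
begin

text \<open>Vertices of Z^d_n are encoded by integer vectors z, standing for the point z/n.
  An edge of E^d_n is encoded by a pair (z,i): the edge between z/n and (z+e_i)/n.\<close>

type_synonym 'd edge = "(int^'d) \<times> 'd"

definition pt :: "nat \<Rightarrow> int^'d \<Rightarrow> real^'d" where
  "pt n z = (\<chi> j. real_of_int (z$j) / real n)"

definition shift :: "int^'d \<Rightarrow> 'd \<Rightarrow> int^'d" where
  "shift z i = (\<chi> j. if j = i then z$j + 1 else z$j)"

definition uses_edge :: "'d edge set \<Rightarrow> int^'d \<Rightarrow> int^'d \<Rightarrow> bool" where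
  "uses_edge E z w \<longleftrightarrow> (\<exists>i. ((z,i) \<in> E \<and> w = shift z i) \<or> ((w,i) \<in> E \<and> z = shift w i))"

abbreviation adj :: "int^'d \<Rightarrow> int^'d \<Rightarrow> bool" where
  "adj \<equiv> uses_edge UNIV"

definition V :: "('d edge \<Rightarrow> real) \<Rightarrow> 'd edge set \<Rightarrow> ennreal" where
  "V t E = infsum (\<lambda>e. ennreal (t e)) E"

definition bond_measure :: "real \<Rightarrow> ('d::finite edge \<Rightarrow> bool) measure" where
  "bond_measure p = (\<Pi>\<^sub>M e\<in>UNIV. measure_pmf (bernoulli_pmf p))"

definition open_adj :: "('d edge \<Rightarrow> bool) \<Rightarrow> int^'d \<Rightarrow> int^'d \<Rightarrow> bool" where
  "open_adj \<omega> = uses_edge {e. \<omega> e}"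

definition perc_theta :: "'d::finite itself \<Rightarrow> real \<Rightarrow> real" where
  "perc_theta _ p = measure (bond_measure p :: ('d edge \<Rightarrow> bool) measure)
      {\<omega> \<in> space (bond_measure p). infinite {z. (open_adj \<omega>)\<^sup>*\<^sup>* 0 z}}"

definition p_c :: "'d::finite itself \<Rightarrow> real" where
  "p_c d = Sup {p \<in> {0..1}. perc_theta d p = 0}"

definition cap_measure :: "real measure \<Rightarrow> ('d::finite edge \<Rightarrow> real) measure" where
  "cap_measure G = (\<Pi>\<^sub>M e\<in>UNIV. G)"

definition haus_alpha :: "real \<Rightarrow> real" where
  "haus_alpha s = pi powr (s/2) / Gamma (s/2 + 1)"

definition hausdorff_outer :: "real \<Rightarrow> ('a::euclidean_space) set \<Rightarrow> ennreal" where
  "hausdorff_outer s E = (SUP \<delta>\<in>{0<..}. INF C \<in> {C :: nat \<Rightarrow> 'a set.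
       E \<subseteq> (\<Union>i. C i) \<and> (\<forall>i. bounded (C i) \<and> diameter (C i) \<le> \<delta>)}.
       (\<Sum>i. ennreal (haus_alpha s * (diameter (C i) / 2) powr s)))"

definition hausdorff_measure :: "real \<Rightarrow> ('a::euclidean_space) measure" where
  "hausdorff_measure s = measure_of UNIV (sets borel) (hausdorff_outer s)"

definition is_outer_normal :: "(real^'d) set \<Rightarrow> real^'d \<Rightarrow> real^'d \<Rightarrow> bool" where
  "is_outer_normal A x v \<longleftrightarrow> norm v = 1 \<and> (\<forall>y\<in>A. inner (y - x) v \<le> 0)"

definition has_normal :: "(real^'d) set \<Rightarrow> real^'d \<Rightarrow> bool" where
  "has_normal A x \<longleftrightarrow> (\<exists>!v. is_outer_normal A x v)"

definition normal :: "(real^'d) set \<Rightarrow> real^'d \<Rightarrow> real^'d" where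
  "normal A x = (THE v. is_outer_normal A x v)"

definition hyperrect_normal :: "(real^'d) set \<Rightarrow> real^'d \<Rightarrow> bool" where
  "hyperrect_normal R v \<longleftrightarrow> (\<exists>(b::'d \<Rightarrow> real^'d) i0 x0 a.
      (\<forall>i j. inner (b i) (b j) = (if i = j then 1 else 0)) \<and> b i0 = v \<and>
      (\<forall>i. i \<noteq> i0 \<longrightarrow> a i > (0::real)) \<and>
      R = {x0 + (\<Sum>i\<in>UNIV - {i0}. s i *\<^sub>R b i) | s. \<forall>i. i \<noteq> i0 \<longrightarrow> 0 \<le> s i \<and> s i \<le> a i})"

definition cyl :: "(real^'d) set \<Rightarrow> real^'d \<Rightarrow> real \<Rightarrow> (real^'d) set" where
  "cyl R v h = {x + t *\<^sub>R v | x t. x \<in> R \<and> -h \<le> t \<and> t \<le> h}"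

text \<open>The two connected components of cyl(R,h) minus R.\<close>
definition cyl_C1 :: "(real^'d) set \<Rightarrow> real^'d \<Rightarrow> real \<Rightarrow> (real^'d) set" where
  "cyl_C1 R v h = {x + t *\<^sub>R v | x t. x \<in> R \<and> 0 < t \<and> t \<le> h}"

definition cyl_C2 :: "(real^'d) set \<Rightarrow> real^'d \<Rightarrow> real \<Rightarrow> (real^'d) set" where
  "cyl_C2 R v h = {x + t *\<^sub>R v | x t. x \<in> R \<and> -h \<le> t \<and> t < 0}"

definition boundary_pts :: "nat \<Rightarrow> (real^'d) set \<Rightarrow> (real^'d) set \<Rightarrow> (int^'d) set" where
  "boundary_pts n C K = {z. pt n z \<in> C \<and> (\<exists>w. adj z w \<and> pt n w \<notin> K)}"

definition separates_cyl :: "nat \<Rightarrow> (real^'d) set \<Rightarrow> real^'d \<Rightarrow> real \<Rightarrow> 'd edge set \<Rightarrow> bool" where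
  "separates_cyl n R v h E \<longleftrightarrow>
     (\<forall>(\<gamma>::nat \<Rightarrow> int^'d) m.
        \<gamma> 0 \<in> boundary_pts n (cyl_C1 R v h) (cyl R v h) \<and>
        \<gamma> m \<in> boundary_pts n (cyl_C2 R v h) (cyl R v h) \<and>
        (\<forall>k\<le>m. pt n (\<gamma> k) \<in> cyl R v h) \<and> (\<forall>k<m. adj (\<gamma> k) (\<gamma> (Suc k)))
        \<longrightarrow> (\<exists>k<m. uses_edge E (\<gamma> k) (\<gamma> (Suc k))))"

definition tau :: "nat \<Rightarrow> (real^'d) set \<Rightarrow> real^'d \<Rightarrow> real \<Rightarrow> ('d edge \<Rightarrow> real) \<Rightarrow> ennreal" where
  "tau n R v h t = (INF E \<in> {E. separates_cyl n R v h E}. V t E)"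

definition flow_const :: "real measure \<Rightarrow> real^'d::finite \<Rightarrow> ennreal" where
  "flow_const G v = (THE c. \<forall>R h. hyperrect_normal R v \<and> h > 0 \<longrightarrow>
      ((\<lambda>n. (\<integral>\<^sup>+ t. tau n R v h t \<partial>(cap_measure G))
            / ennreal (measure (hausdorff_measure (real CARD('d) - 1)) R * real n ^ (CARD('d) - 1)))
       \<longlonglongrightarrow> c))"

definition separates_inf :: "nat \<Rightarrow> (real^'d) set \<Rightarrow> 'd edge set \<Rightarrow> bool" where
  "separates_inf n A E \<longleftrightarrow>
     (\<forall>\<gamma>::nat \<Rightarrow> int^'d. pt n (\<gamma> 0) \<in> A \<and> (\<forall>k. adj (\<gamma> k) (\<gamma> (Suc k))) \<and>
        (\<forall>B. bounded B \<longrightarrow> (\<exists>k. pt n (\<gamma> k) \<notin> B))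
        \<longrightarrow> (\<exists>k. uses_edge E (\<gamma> k) (\<gamma> (Suc k))))"

definition phi_inf :: "nat \<Rightarrow> (real^'d) set \<Rightarrow> ('d edge \<Rightarrow> real) \<Rightarrow> ennreal" where
  "phi_inf n A t = (INF E \<in> {E. separates_inf n A E}. V t E)"

definition I_A :: "real measure \<Rightarrow> (real^'d::finite) set \<Rightarrow> ennreal" where
  "I_A G A = (\<integral>\<^sup>+ x. indicator (frontier A) x * flow_const G (normal A x)
                \<partial>(hausdorff_measure (real CARD('d) - 1)))"

end

theory Submission
  imports Defs
begin

text \<open>
  By compactness and the regularity of almost every boundary point, \<open>\<partial>A\<close> is covered, up to a set of small
  \<open>\<H>\<^bsup>d-1\<^esup>\<close>-measure, by finitely many disjoint flat cylinders, each leaning on a supporting hyperplane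
  of \<open>A\<close> whose direction \<open>v\<close> almost minimises \<open>\<nu>\<close> among the normals met in the cylinder. A lattice set separating
  \<open>A\<close> from infinity is obtained by placing minimal cuts of thin cylinders just outside these hyperplanes, and by
  joining them with the edges near the sides of the flat cylinders and near the faces of small cubes covering the
  remaining part of \<open>\<partial>A\<close>. The number of joining edges is a small multiple of \<open>n\<^bsup>d-1\<^esup>\<close>, so Chernoff's bound
  with the exponential moment controls their capacity.

  For the cylinder cuts, \<open>\<tau>\<^sub>N\<close> is bounded by a sum of independent copies of \<open>\<tau>\<^sub>K\<close> at a fixed smaller scale plus
  few gluing edges. This almost subadditivity gives both the existence of \<open>\<nu>\<close> and, again by Chernoff,
  an upper deviation estimate of surface order.
\<close>

section \<open>Hausdorff measure is a Borel measure\<close>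

text \<open>Cuts are handled through vertex sets: the edge boundary of a finite vertex set
  containing the lattice points of \<open>A\<close> separates \<open>A\<close> from infinity, and a
  cut of a cylinder amounts to the set of vertices on its lower side. Joining cuts then means
  assembling vertex sets and tracing each boundary edge of the result to a given cut or to a counted
  family of sites; no topology of separating surfaces enters. The finite family of patches exists
  because a patch of scale \<open>r\<close> holds a fixed fraction of the boundary measure of the
  concentric ball of radius \<open>5 * r\<close>. Both bounds behind this come from contractions:
  orthogonal projection onto the hyperplane from below, nearest-point projection from above.
  Vitali's lemma then captures a fixed share of what is left, and finiteness of the boundary measure
  stops the process. Patches have height at most \<open>\<eta>\<close> times their width, so their
  sides cost an \<open>\<eta>\<close>-fraction of their area. Both \<open>\<eta>\<close> and the
  uncovered measure are chosen after the logarithm of the exponential moment, so that in Chernoff's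
  bound the number of joining edges times this logarithm stays below the linear gain.\<close>

definition hausdorff_gauge :: "real \<Rightarrow> ('a::euclidean_space) set \<Rightarrow> ennreal" where
  "hausdorff_gauge s C = ennreal (haus_alpha s * (diameter C / 2) powr s)"

definition delta_cover :: "real \<Rightarrow> ('a::euclidean_space) set \<Rightarrow> (nat \<Rightarrow> 'a set) \<Rightarrow> bool" where
  "delta_cover \<delta> E C \<longleftrightarrow> E \<subseteq> (\<Union>i. C i) \<and> (\<forall>i. bounded (C i) \<and> diameter (C i) \<le> \<delta>)"

definition hausdorff_pre :: "real \<Rightarrow> real \<Rightarrow> ('a::euclidean_space) set \<Rightarrow> ennreal" where
  "hausdorff_pre s \<delta> E = (INF C \<in> Collect (delta_cover \<delta> E). \<Sum>i. hausdorff_gauge s (C i))"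

lemma hausdorff_outer_eq_SUP: "hausdorff_outer s E = (SUP \<delta>\<in>{0<..}. hausdorff_pre s \<delta> E)"
  unfolding hausdorff_outer_def hausdorff_pre_def delta_cover_def hausdorff_gauge_def ..

lemma hausdorff_pre_le_outer: "0 < \<delta> \<Longrightarrow> hausdorff_pre s \<delta> E \<le> hausdorff_outer s E"
  unfolding hausdorff_outer_eq_SUP by (rule SUP_upper) simp

lemma hausdorff_outer_leI: "(\<And>\<delta>. 0 < \<delta> \<Longrightarrow> hausdorff_pre s \<delta> E \<le> c) \<Longrightarrow> hausdorff_outer s E \<le> c"
  unfolding hausdorff_outer_eq_SUP by (rule SUP_least) simp

lemma hausdorff_pre_le: "delta_cover \<delta> E C \<Longrightarrow> hausdorff_pre s \<delta> E \<le> (\<Sum>i. hausdorff_gauge s (C i))"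
  unfolding hausdorff_pre_def by (rule INF_lower) simp

lemma hausdorff_pre_less:
  assumes "hausdorff_pre s \<delta> E < c"
  obtains C where "delta_cover \<delta> E C" "(\<Sum>i. hausdorff_gauge s (C i)) < c"
  using assms unfolding hausdorff_pre_def INF_less_iff by auto

lemma hausdorff_gauge_empty [simp]: "hausdorff_gauge s {} = 0"
  by (simp add: hausdorff_gauge_def)

lemma haus_alpha_pos: "0 < s \<Longrightarrow> 0 < haus_alpha s"
  by (simp add: haus_alpha_def Gamma_real_pos)

lemma hausdorff_gauge_mono:
  assumes "0 < s" "diameter A \<le> diameter B" "bounded A"
  shows "hausdorff_gauge s A \<le> hausdorff_gauge s B"
  unfolding hausdorff_gauge_def using assms haus_alpha_pos[of s] diameter_ge_0[of A]
  by (intro ennreal_leI mult_left_mono powr_mono2) auto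

lemma hausdorff_pre_antimono: "d1 \<le> d2 \<Longrightarrow> hausdorff_pre s d2 E \<le> hausdorff_pre s d1 E"
  unfolding hausdorff_pre_def delta_cover_def by (rule INF_superset_mono) (auto intro: order_trans)

lemma hausdorff_pre_mono: "E \<subseteq> F \<Longrightarrow> hausdorff_pre s d E \<le> hausdorff_pre s d F"
  unfolding hausdorff_pre_def delta_cover_def by (rule INF_superset_mono) force+

lemma hausdorff_outer_mono: "E \<subseteq> F \<Longrightarrow> hausdorff_outer s E \<le> hausdorff_outer s F"
  by (meson hausdorff_outer_leI hausdorff_pre_le_outer hausdorff_pre_mono order_trans)

lemma hausdorff_outer_empty [simp]: "hausdorff_outer s {} = 0"
proof -
  have "hausdorff_pre s \<delta> ({}::'a set) \<le> 0" if "0 < \<delta>" for \<delta>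
    using hausdorff_pre_le[of \<delta> "{}::'a set" "\<lambda>_. {}" s] that by (simp add: delta_cover_def)
  then have "hausdorff_outer s ({}::'a set) \<le> 0"
    by (rule hausdorff_outer_leI)
  then show ?thesis by simp
qed

text \<open>Covers of \<open>E n\<close> that are optimal up to \<open>e / 2^(n+1)\<close> are
  merged along a pairing of indices; the slacks add up to \<open>e\<close>.\<close>

lemma hausdorff_pre_countably_subadditive:
  "hausdorff_pre s d (\<Union>j::nat. E j) \<le> (\<Sum>j. hausdorff_pre s d (E j))"
proof (rule ennreal_le_epsilon)
  fix e :: real assume e: "0 < e" and fin: "(\<Sum>n. hausdorff_pre s d (E n)) < top"
  then have *: "hausdorff_pre s d (E n) < hausdorff_pre s d (E n) + e * (1/2)^Suc n" for n
    by (auto simp add: less_top dest!: ennreal_suminf_lessD)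
  obtain B where B: "\<And>n. delta_cover d (E n) (B n)"
    and Ble: "\<And>n. (\<Sum>i. hausdorff_gauge s (B n i)) \<le> hausdorff_pre s d (E n) + e * (1/2)^(Suc n)"
  proof -
    have "\<exists>C. delta_cover d (E n) C \<and>
        (\<Sum>i. hausdorff_gauge s (C i)) \<le> hausdorff_pre s d (E n) + e * (1/2)^(Suc n)" for n
      by (rule hausdorff_pre_less[OF *[of n]]) (auto intro: less_imp_le)
    then show thesis using that by metis
  qed
  define C where "C = case_prod B o prod_decode"
  have "delta_cover d (\<Union>j. E j) C"
    unfolding delta_cover_def
  proof (intro conjI allI)
    show "(\<Union>j. E j) \<subseteq> (\<Union>i. C i)"
    proof clarify
      fix x j assume "x \<in> E j"
      then obtain i where "x \<in> B j i" using B[of j] unfolding delta_cover_def by blast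
      then have "x \<in> C (prod_encode (j,i))" by (simp add: C_def)
      then show "x \<in> (\<Union>i. C i)" by blast
    qed
    show "bounded (C i)" "diameter (C i) \<le> d" for i
      using B by (auto simp: C_def delta_cover_def split: prod.split)
  qed
  then have "hausdorff_pre s d (\<Union>j. E j) \<le> (\<Sum>i. hausdorff_gauge s (C i))"
    by (rule hausdorff_pre_le)
  also have "\<dots> = (\<Sum>n. \<Sum>i. hausdorff_gauge s (B n i))"
    using suminf_ennreal_2dimen[of "\<lambda>n. \<Sum>i. hausdorff_gauge s (B n i)" "\<lambda>(n,i). hausdorff_gauge s (B n i)"]
    by (simp add: C_def split_def)
  also have "\<dots> \<le> (\<Sum>n. hausdorff_pre s d (E n) + e * (1/2) ^ Suc n)"
    by (intro suminf_le allI Ble) auto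
  also have "\<dots> = (\<Sum>n. hausdorff_pre s d (E n) + ennreal e * ennreal ((1/2) ^ Suc n))"
    using e by (intro suminf_cong) (simp only: ennreal_mult'[OF less_imp_le[OF e]])
  also have "\<dots> = (\<Sum>n. hausdorff_pre s d (E n)) + (\<Sum>n. ennreal e * ennreal ((1/2) ^ Suc n))"
    by (rule suminf_add[symmetric]) (rule summableI)+
  also have "\<dots> = (\<Sum>n. hausdorff_pre s d (E n)) + e"
    unfolding ennreal_suminf_cmult
    by (subst suminf_ennreal_eq[OF zero_le_power power_half_series]) auto
  finally show "hausdorff_pre s d (\<Union>j. E j) \<le> (\<Sum>n. hausdorff_pre s d (E n)) + e" .
qed

lemma hausdorff_outer_countably_subadditive:
  "hausdorff_outer s (\<Union>j::nat. E j) \<le> (\<Sum>j. hausdorff_outer s (E j))"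
proof (rule hausdorff_outer_leI)
  fix d :: real assume "0 < d"
  then show "hausdorff_pre s d (\<Union>j. E j) \<le> (\<Sum>j. hausdorff_outer s (E j))"
    by (intro order_trans[OF hausdorff_pre_countably_subadditive] suminf_le allI hausdorff_pre_le_outer) auto
qed

lemma hausdorff_outer_subadditive:
  "hausdorff_outer s (A \<union> B) \<le> hausdorff_outer s A + hausdorff_outer s B"
proof -
  have "hausdorff_outer s (\<Union>j. binaryset A B j) \<le> (\<Sum>j. hausdorff_outer s (binaryset A B j))"
    by (rule hausdorff_outer_countably_subadditive)
  also have "\<dots> = hausdorff_outer s A + hausdorff_outer s B"
    by (simp add: suminf_binaryset_eq)
  finally show ?thesis by (simp add: UN_binaryset_eq)
qed

text \<open>A cover by sets of diameter below \<open>r\<close> splits, since no member meets both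
  \<open>A\<close> and \<open>B\<close>; the two suprema over the mesh combine because the
  pre-measures are antitone in the mesh.\<close>

lemma hausdorff_outer_metric:
  fixes A B :: "'a::euclidean_space set"
  assumes s: "0 < s" and r: "0 < r" and sep: "\<And>x y. x \<in> A \<Longrightarrow> y \<in> B \<Longrightarrow> r \<le> dist x y"
  shows "hausdorff_outer s A + hausdorff_outer s B \<le> hausdorff_outer s (A \<union> B)"
proof -
  have split: "hausdorff_pre s d A + hausdorff_pre s d B \<le> hausdorff_pre s d (A \<union> B)"
    if d: "0 < d" "d < r" for d
    unfolding hausdorff_pre_def[of s d "A \<union> B"]
  proof (rule INF_greatest)
    fix C assume "C \<in> Collect (delta_cover d (A \<union> B))"
    then have C: "A \<union> B \<subseteq> (\<Union>i. C i)" "\<And>i. bounded (C i)" "\<And>i. diameter (C i) \<le> d"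
      by (auto simp: delta_cover_def)
    define CA where "CA i = (if C i \<inter> A = {} then {} else C i)" for i
    define CB where "CB i = (if C i \<inter> B = {} then {} else C i)" for i
    have "delta_cover d A CA" "delta_cover d B CB"
      using C d unfolding delta_cover_def CA_def CB_def by auto blast+
    then have "hausdorff_pre s d A + hausdorff_pre s d B
        \<le> (\<Sum>i. hausdorff_gauge s (CA i)) + (\<Sum>i. hausdorff_gauge s (CB i))"
      by (intro add_mono hausdorff_pre_le)
    also have "\<dots> = (\<Sum>i. hausdorff_gauge s (CA i) + hausdorff_gauge s (CB i))"
      by (rule suminf_add) auto
    also have "\<dots> \<le> (\<Sum>i. hausdorff_gauge s (C i))"
    proof (intro suminf_le allI)
      fix i
      have "C i \<inter> A = {} \<or> C i \<inter> B = {}"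
      proof (rule ccontr)
        assume "\<not> ?thesis"
        then obtain x y where xy: "x \<in> C i" "x \<in> A" "y \<in> C i" "y \<in> B" by auto
        then have "dist x y \<le> d"
          using diameter_bounded_bound[OF C(2)[of i], of x y] C(3)[of i] by simp
        then show False using sep[of x y] xy d by simp
      qed
      then show "hausdorff_gauge s (CA i) + hausdorff_gauge s (CB i) \<le> hausdorff_gauge s (C i)"
        by (auto simp: CA_def CB_def)
    qed auto
    finally show "hausdorff_pre s d A + hausdorff_pre s d B \<le> (\<Sum>i. hausdorff_gauge s (C i))" .
  qed
  have "hausdorff_outer s A + hausdorff_outer s B
      = (SUP d\<in>{0<..}. hausdorff_pre s d A + hausdorff_pre s d B)"
    unfolding hausdorff_outer_eq_SUP
  proof (rule SUP_add_directed_ennreal[symmetric])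
    fix i j :: real assume "i \<in> {0<..}" "j \<in> {0<..}"
    then show "\<exists>k\<in>{0<..}. hausdorff_pre s i A + hausdorff_pre s j B \<le> hausdorff_pre s k A + hausdorff_pre s k B"
      by (intro bexI[of _ "min i j"] add_mono hausdorff_pre_antimono) auto
  qed
  also have "\<dots> \<le> hausdorff_outer s (A \<union> B)"
  proof (rule SUP_least)
    fix d :: real assume "d \<in> {0<..}"
    define d' where "d' = min d (r/2)"
    have d': "0 < d'" "d' < r" "d' \<le> d" using \<open>d \<in> {0<..}\<close> r by (auto simp: d'_def)
    have "hausdorff_pre s d A + hausdorff_pre s d B \<le> hausdorff_pre s d' A + hausdorff_pre s d' B"
      by (intro add_mono hausdorff_pre_antimono d')
    also have "\<dots> \<le> hausdorff_pre s d' (A \<union> B)" by (rule split) (use d' in auto)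
    also have "\<dots> \<le> hausdorff_outer s (A \<union> B)" by (rule hausdorff_pre_le_outer) (use d' in auto)
    finally show "hausdorff_pre s d A + hausdorff_pre s d B \<le> hausdorff_outer s (A \<union> B)" .
  qed
  finally show ?thesis .
qed

text \<open>Caratheodory's criterion: the shells of T at distance between 1/(k+1) and 1/k from F that are
  two steps apart are separated, so their outer measures are summable.\<close>

lemma hausdorff_outer_closed_split:
  fixes F T :: "'a::euclidean_space set"
  assumes s: "0 < s" and F: "closed F"
  shows "hausdorff_outer s (T \<inter> F) + hausdorff_outer s (T - F) \<le> hausdorff_outer s T"
proof (cases "F = {} \<or> hausdorff_outer s T = \<infinity>")
  case True then show ?thesis by auto
next
  case False
  let ?H = "hausdorff_outer s :: 'a set \<Rightarrow> ennreal"
  from False have ne: "F \<noteq> {}" and fin: "?H T < \<infinity>" by (auto simp: less_top)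
  define Tk where "Tk k = {x \<in> T. 1 / real (Suc k) \<le> infdist x F}" for k
  define Dk where "Dk k = Tk (Suc k) - Tk k" for k
  have Tk_sub: "Tk k \<subseteq> T" for k by (auto simp: Tk_def)
  \<comment> \<open>The shell containing \<open>x\<close> is found from the least \<open>m\<close>
    with \<open>x\<close> in \<open>Tk m\<close>; closedness of \<open>F\<close> makes such an
    \<open>m\<close> exist.\<close>
  have cover: "T - F \<subseteq> Tk k \<union> (\<Union>j. Dk (j + k))" for k
  proof
    fix x assume x: "x \<in> T - F"
    then have "0 < infdist x F"
      using F ne by (metis DiffD2 in_closed_iff_infdist_zero infdist_nonneg less_eq_real_def)
    then obtain m where "inverse (real (Suc m)) < infdist x F" using reals_Archimedean by blast
    then have ex: "x \<in> Tk m" using x by (auto simp: Tk_def inverse_eq_divide)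
    define p where "p = (LEAST m. x \<in> Tk m)"
    have p: "x \<in> Tk p" "\<And>q. q < p \<Longrightarrow> x \<notin> Tk q"
      unfolding p_def using ex by (auto intro: LeastI dest: not_less_Least)
    show "x \<in> Tk k \<union> (\<Union>j. Dk (j + k))"
    proof (cases "p \<le> k")
      case True
      have "1 / real (Suc k) \<le> 1 / real (Suc p)" using True by (simp add: field_simps)
      then have "x \<in> Tk k" using p(1) by (auto simp: Tk_def)
      then show ?thesis by simp
    next
      case False
      then have "x \<in> Dk (p - 1)" using p by (auto simp: Dk_def)
      moreover have "p - 1 = (p - 1 - k) + k" using False by simp
      ultimately show ?thesis by (metis UN_iff UnI2 UNIV_I)
    qed
  qed
  have sepD: "1 / real (Suc (Suc k)) - 1 / real (Suc l) \<le> dist x y"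
    if "x \<in> Tk (Suc k)" "y \<notin> Tk l" "y \<in> T" for k l x y
  proof -
    have "infdist x F \<le> infdist y F + dist x y" by (rule infdist_triangle)
    then show ?thesis using that by (auto simp: Tk_def)
  qed
  have sumparity: "(\<Sum>i<n. ?H (Dk (2 * i + q))) \<le> ?H (\<Union>i<n. Dk (2 * i + q))" for n q
  proof (induction n)
    case (Suc n)
    show ?case
    proof (cases n)
      case 0 then show ?thesis by (simp add: lessThan_Suc)
    next
      case (Suc m)
      let ?r = "1 / real (Suc (2 * m + q + 1)) - 1 / real (Suc (2 * n + q))"
      have r: "0 < ?r" using Suc by (simp add: frac_less2)
      have "?H (\<Union>i<n. Dk (2 * i + q)) + ?H (Dk (2 * n + q)) \<le> ?H ((\<Union>i<n. Dk (2 * i + q)) \<union> Dk (2 * n + q))"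
      proof (rule hausdorff_outer_metric[OF s r])
        fix x y assume x: "x \<in> (\<Union>i<n. Dk (2 * i + q))" and y: "y \<in> Dk (2 * n + q)"
        then obtain i where i: "i < n" "x \<in> Dk (2 * i + q)" by auto
        have "x \<in> Tk (Suc (2 * i + q))" using i by (simp add: Dk_def)
        moreover have "1 / real (Suc (2 * m + q + 1)) \<le> 1 / real (Suc (Suc (2 * i + q)))"
          using i Suc by (intro divide_left_mono) auto
        ultimately have "x \<in> Tk (Suc (2 * m + q))" by (auto simp: Tk_def)
        moreover have "y \<notin> Tk (2 * n + q)" "y \<in> T" using y by (auto simp: Dk_def Tk_def)
        ultimately show "?r \<le> dist x y" using sepD[of x "2*m+q" y "2*n+q"] by simp
      qed
      then have "(\<Sum>i<Suc n. ?H (Dk (2 * i + q))) \<le> ?H ((\<Union>i<n. Dk (2 * i + q)) \<union> Dk (2 * n + q))"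
        using Suc.IH by (simp add: order_trans[OF add_right_mono])
      also have "(\<Union>i<n. Dk (2 * i + q)) \<union> Dk (2 * n + q) = (\<Union>i<Suc n. Dk (2 * i + q))"
        by (auto simp: less_Suc_eq)
      finally show ?thesis .
    qed
  qed simp
  have Dk_sub: "(\<Union>i<n. Dk (2 * i + q)) \<subseteq> T" for n q using Tk_sub by (auto simp: Dk_def)
  have parity: "(\<Sum>i. ?H (Dk (2 * i + q))) \<le> ?H T" for q
    unfolding suminf_eq_SUP
    by (rule SUP_least) (rule order_trans[OF sumparity hausdorff_outer_mono[OF Dk_sub]])
  let ?S = "\<Sum>i. ?H (Dk i)"
  have "(\<Sum>i<n. ?H (Dk i)) \<le> ?H T + ?H T" for n
  proof -
    have "(\<Sum>i<n. ?H (Dk i)) \<le> (\<Sum>i<2*n. ?H (Dk i))" by (intro sum_mono2) auto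
    also have "\<dots> = (\<Sum>i<n. ?H (Dk (2*i+0))) + (\<Sum>i<n. ?H (Dk (2*i+1)))"
      by (induction n) (auto simp: algebra_simps)
    also have "\<dots> \<le> ?H T + ?H T"
      by (intro add_mono order_trans[OF sum_le_suminf parity]) auto
    finally show ?thesis .
  qed
  then have "?S \<le> ?H T + ?H T" unfolding suminf_eq_SUP by (rule SUP_least)
  also have "\<dots> < \<infinity>" using fin by simp
  finally have finD: "?S < \<infinity>" .
  have "?H (T \<inter> F) + ?H (T - F) \<le> ?H T + (\<Sum>j. ?H (Dk (j + k)))" for k
  proof -
    have "?H (T - F) \<le> ?H (Tk k) + (\<Sum>j. ?H (Dk (j + k)))"
      by (rule order_trans[OF hausdorff_outer_mono[OF cover[of k]]])
        (intro order_trans[OF hausdorff_outer_subadditive] add_left_mono hausdorff_outer_countably_subadditive)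
    then have "?H (T \<inter> F) + ?H (T - F) \<le> ?H (T \<inter> F) + ?H (Tk k) + (\<Sum>j. ?H (Dk (j + k)))"
      by (simp add: add_left_mono ac_simps)
    also have "?H (T \<inter> F) + ?H (Tk k) \<le> ?H (T \<inter> F \<union> Tk k)"
    proof (rule hausdorff_outer_metric[OF s, of "1 / real (Suc k)"])
      fix x y assume "x \<in> T \<inter> F" "y \<in> Tk k"
      then show "1 / real (Suc k) \<le> dist x y"
        using infdist_le[of x F y] by (auto simp: Tk_def dist_commute)
    qed simp
    also have "\<dots> \<le> ?H T" by (intro hausdorff_outer_mono) (use Tk_sub in auto)
    finally show ?thesis by (simp add: add_right_mono)
  qed
  \<comment> \<open>Adding the first \<open>k\<close> shells to both sides completes the tail to the
    whole series \<open>?S\<close>; after the supremum over \<open>k\<close> the finite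
    \<open>?S\<close> cancels, so no limit of tails has to be taken.\<close>
  then have "?H (T \<inter> F) + ?H (T - F) + (\<Sum>i<k. ?H (Dk i)) \<le> ?H T + ?S" for k
    unfolding suminf_offset[of "\<lambda>i. ?H (Dk i)" k, OF summableI] add.assoc[symmetric]
    by (rule add_right_mono)
  then have "(SUP k. ?H (T \<inter> F) + ?H (T - F) + (\<Sum>i<k. ?H (Dk i))) \<le> ?H T + ?S"
    by (rule SUP_least)
  then have "?H (T \<inter> F) + ?H (T - F) + ?S \<le> ?H T + ?S"
    by (subst (asm) ennreal_SUP_add_right[symmetric]) (auto simp: suminf_eq_SUP)
  then show ?thesis using finD by (auto simp: add.commute[of _ ?S] ennreal_add_left_cancel_le)
qed

text \<open>Caratheodory's lemma makes the outer measure countably additive on the sets that split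
  every \<open>T\<close>; these form a sigma-algebra containing the closed sets, hence all Borel
  sets.\<close>

lemma measure_space_hausdorff_outer:
  assumes s: "0 < s"
  shows "measure_space UNIV (sets borel) (hausdorff_outer s :: 'a::euclidean_space set \<Rightarrow> ennreal)"
proof -
  interpret sigma_algebra "UNIV :: 'a set" "Pow UNIV" by (rule sigma_algebra_Pow)
  let ?H = "hausdorff_outer s :: 'a set \<Rightarrow> ennreal"
  let ?L = "lambda_system UNIV (Pow UNIV) ?H"
  have "outer_measure_space (Pow UNIV) ?H"
    unfolding outer_measure_space_def positive_def increasing_def countably_subadditive_def
    by (auto intro: hausdorff_outer_mono hausdorff_outer_countably_subadditive)
  then have ms: "measure_space UNIV ?L ?H" by (rule caratheodory_lemma)
  have "F \<in> ?L" if "closed F" for F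
    unfolding lambda_system_eq
  proof clarsimp
    fix T
    have "T = (T \<inter> F) \<union> (T - F)" by auto
    then have "?H T \<le> ?H (T \<inter> F) + ?H (T - F)" using hausdorff_outer_subadditive by metis
    then show "?H (T \<inter> F) + ?H (T - F) = ?H T"
      using hausdorff_outer_closed_split[OF s that] by (rule antisym[rotated])
  qed
  then have "sigma_sets UNIV (Collect closed) \<subseteq> ?L"
    using ms by (intro sigma_algebra.sigma_sets_subset) (auto simp: measure_space_def)
  then have "sets borel \<subseteq> ?L" by (simp add: borel_eq_closed)
  then show ?thesis using ms by (rule_tac measure_down[OF ms]) (auto intro: sets.sigma_algebra_axioms simp flip: space_borel)
qed

lemma sets_hausdorff_measure [simp, measurable_cong]: "sets (hausdorff_measure s) = sets borel"
  unfolding hausdorff_measure_def using sets.sets_measure_of_eq[of borel] by simp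

lemma space_hausdorff_measure [simp]: "space (hausdorff_measure s) = UNIV"
  unfolding hausdorff_measure_def by (simp add: space_measure_of_conv)

text \<open>\<open>measure_of\<close> yields the zero measure unless its argument is countably
  additive, so this identity rests on the Caratheodory argument.\<close>

lemma emeasure_hausdorff_measure:
  assumes "0 < s" "E \<in> sets borel"
  shows "emeasure (hausdorff_measure s) E = hausdorff_outer s E"
  using measure_space_hausdorff_outer[OF assms(1)] assms(2) unfolding hausdorff_measure_def
  by (intro emeasure_measure_of_sigma) (auto simp: measure_space_def)

text \<open>Mapping the traces of a cover on \<open>E\<close> does not increase diameters. All later
  comparisons of area use this: isometries of rectangles, orthogonal projection onto a hyperplane,
  nearest-point projection onto a convex set.\<close>

lemma hausdorff_outer_contraction:
  fixes f :: "'a::euclidean_space \<Rightarrow> 'b::euclidean_space"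
  assumes s: "0 < s" and f: "\<And>x y. x \<in> E \<Longrightarrow> y \<in> E \<Longrightarrow> dist (f x) (f y) \<le> dist x y"
  shows "hausdorff_outer s (f ` E) \<le> hausdorff_outer s E"
proof (rule hausdorff_outer_leI)
  fix d :: real assume d: "0 < d"
  have "hausdorff_pre s d (f ` E) \<le> hausdorff_pre s d E"
    unfolding hausdorff_pre_def[of s d E]
  proof (rule INF_greatest)
    fix C assume "C \<in> Collect (delta_cover d E)"
    then have C: "E \<subseteq> (\<Union>i. C i)" "\<And>i. bounded (C i)" "\<And>i. diameter (C i) \<le> d"
      by (auto simp: delta_cover_def)
    define B where "B i = f ` (C i \<inter> E)" for i
    have dist: "dist x y \<le> diameter (C i)" if "x \<in> B i" "y \<in> B i" for i x y
    proof -
      obtain x' y' where "x' \<in> C i \<inter> E" "y' \<in> C i \<inter> E" "x = f x'" "y = f y'"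
        using \<open>x \<in> B i\<close> \<open>y \<in> B i\<close> unfolding B_def by blast
      then show ?thesis using f[of x' y'] diameter_bounded_bound[OF C(2)[of i], of x' y'] by simp
    qed
    then have bd: "bounded (B i)" for i
      unfolding bounded_two_points by blast
    have "diameter (B i) \<le> diameter (C i)" for i
      using dist[of _ i] diameter_ge_0[OF C(2)[of i]] by (intro diameter_le) (auto simp: dist_norm)
    then have le: "diameter (B i) \<le> d" "hausdorff_gauge s (B i) \<le> hausdorff_gauge s (C i)" for i
      using C(3)[of i] hausdorff_gauge_mono[OF s _ bd] by (auto intro: order_trans)
    have "f ` E \<subseteq> (\<Union>i. B i)" using C(1) unfolding B_def by blast
    then have "delta_cover d (f ` E) B" using le bd unfolding delta_cover_def by blast
    with le show "hausdorff_pre s d (f ` E) \<le> (\<Sum>i. hausdorff_gauge s (C i))"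
      by (intro order_trans[OF hausdorff_pre_le suminf_le]) auto
  qed
  then show "hausdorff_pre s d (f ` E) \<le> hausdorff_outer s E"
    using hausdorff_pre_le_outer[OF d] order_trans by blast
qed

section \<open>Hausdorff measure of hyperrectangles\<close>

definition onb :: "('d::finite \<Rightarrow> real^'d) \<Rightarrow> bool" where
  "onb b \<longleftrightarrow> (\<forall>i j. inner (b i) (b j) = (if i = j then 1 else 0))"

lemma onb_inner: "onb b \<Longrightarrow> inner (b i) (b j) = (if i = j then 1 else 0)"
  by (simp add: onb_def)

lemma onb_norm: "onb b \<Longrightarrow> norm (b i) = 1"
  by (simp add: onb_def norm_eq_sqrt_inner)

lemma onb_axis: "onb (\<lambda>i. axis i (1::real))"
  by (simp add: onb_def inner_axis_axis)

lemma onb_exists: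
  fixes v :: "real^'d::finite"
  assumes "norm v = 1"
  obtains b where "onb b" "b i0 = v"
proof -
  have "norm (axis i0 (1::real) :: real^'d) = norm v" using assms by simp
  then obtain f where f: "orthogonal_transformation f" "f (axis i0 (1::real)) = v"
    using orthogonal_transformation_exists by blast
  have "onb (\<lambda>i. f (axis i 1))"
    using f(1) by (simp add: onb_def orthogonal_transformation_def inner_axis_axis inner_real_def)
  with f(2) that show thesis by blast
qed

lemma onb_expand:
  fixes b :: "'d::finite \<Rightarrow> real^'d"
  assumes "onb b"
  shows "(\<Sum>i\<in>UNIV. inner x (b i) *\<^sub>R b i) = x"
proof -
  have inj: "inj b" using onb_inner[OF assms] by (metis injI zero_neq_one)
  have orth: "pairwise orthogonal (range b)"
    using onb_inner[OF assms] by (auto simp: pairwise_def orthogonal_def)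
  have nz: "0 \<notin> range b" using onb_norm[OF assms] by (metis imageE norm_zero zero_neq_one)
  have ind: "independent (range b)" by (rule pairwise_orthogonal_independent[OF orth nz])
  have "span (range b) = UNIV"
    using card_ge_dim_independent[of "range b" UNIV] ind card_image[OF inj] by auto
  then have "(\<Sum>c\<in>range b. inner x c *\<^sub>R c) = x"
    using onb_norm[OF assms] by (intro orthonormal_basis_expand orth) auto
  then show ?thesis by (simp add: sum.reindex[OF inj])
qed

lemma onb_sum_inner:
  assumes "onb b"
  shows "inner (\<Sum>i\<in>UNIV. s i *\<^sub>R b i) (b j) = s j"
  by (simp add: inner_sum_left onb_inner[OF assms] if_distrib cong: if_cong)

lemma onb_norm_sum:
  assumes "onb b"
  shows "(norm x)\<^sup>2 = (\<Sum>i\<in>UNIV. (inner x (b i))\<^sup>2)"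
proof -
  have "(norm x)\<^sup>2 = inner x (\<Sum>i\<in>UNIV. inner x (b i) *\<^sub>R b i)"
    using onb_expand[OF assms] by (simp add: power2_norm_eq_inner)
  then show ?thesis by (simp add: inner_sum_right power2_eq_square)
qed

lemma onb_inner_le: "onb b \<Longrightarrow> \<bar>inner x (b i)\<bar> \<le> norm x"
  using Cauchy_Schwarz_ineq2[of x "b i"] by (simp add: onb_norm)

lemma onb_norm_le:
  fixes b :: "'d::finite \<Rightarrow> real^'d"
  assumes "onb b" "\<And>i. \<bar>inner x (b i)\<bar> \<le> r"
  shows "norm x \<le> sqrt (real CARD('d)) * r"
proof -
  have r: "0 \<le> r" using assms(2)[of undefined] by linarith
  have "(norm x)\<^sup>2 \<le> (\<Sum>i\<in>(UNIV::'d set). r\<^sup>2)"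
    unfolding onb_norm_sum[OF assms(1)] using assms(2) by (intro sum_mono) (metis abs_le_square_iff abs_of_nonneg r)
  also have "\<dots> = (sqrt (real CARD('d)) * r)\<^sup>2" by (simp add: power_mult_distrib)
  finally show ?thesis by (rule power2_le_imp_le) (simp add: r)
qed

lemma onb_transpose: "onb b \<Longrightarrow> onb (b \<circ> Transposition.transpose i j)"
  unfolding onb_def comp_def by (metis transpose_involutory)

text \<open>A rectangle with corner \<open>c\<close> in the frame \<open>b\<close> and normal
  \<open>b i0\<close>. Stating it by inequalities on inner products lets membership be checked
  coordinate by coordinate.\<close>

definition frect :: "('d::finite \<Rightarrow> real^'d) \<Rightarrow> 'd \<Rightarrow> real^'d \<Rightarrow> ('d \<Rightarrow> real) \<Rightarrow> (real^'d) set" where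
  "frect b i0 c a = {x. inner (x - c) (b i0) = 0 \<and>
     (\<forall>i. i \<noteq> i0 \<longrightarrow> 0 \<le> inner (x - c) (b i) \<and> inner (x - c) (b i) \<le> a i)}"

lemma closed_frect: "closed (frect b i0 c a)"
proof -
  have "frect b i0 c a = {x. inner (x - c) (b i0) = 0} \<inter>
     (\<Inter>i\<in>-{i0}. {x. 0 \<le> inner (x - c) (b i)} \<inter> {x. inner (x - c) (b i) \<le> a i})"
    by (auto simp: frect_def)
  also have "closed \<dots>"
    by (intro closed_Int closed_INT ballI closed_Collect_eq closed_Collect_le continuous_intros)
  finally show ?thesis .
qed

text \<open>The map \<open>f\<close> carrying the frame \<open>b\<close> at \<open>c\<close> to the
  frame \<open>b'\<close> at \<open>c'\<close> is an isometry, so only the side lengths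
  matter.\<close>

lemma frect_outer_le:
  fixes b b' :: "'d::finite \<Rightarrow> real^'d"
  assumes s: "0 < s" and b: "onb b" and b': "onb b'"
  shows "hausdorff_outer s (frect b' i0 c' a) \<le> hausdorff_outer s (frect b i0 c a)"
proof -
  define f where "f x = c' + (\<Sum>i\<in>UNIV. inner (x - c) (b i) *\<^sub>R b' i)" for x
  have f_coord: "inner (f x - c') (b' j) = inner (x - c) (b j)" for x j
    unfolding f_def using onb_sum_inner[OF b'] by simp
  have dist: "dist (f x) (f y) = dist x y" for x y
  proof -
    have "inner (f x - f y) (b' j) = inner (x - y) (b j)" for j
      using f_coord[of x j] f_coord[of y j] by (simp add: inner_diff_left)
    then have "(norm (f x - f y))\<^sup>2 = (norm (x - y))\<^sup>2"
      by (simp add: onb_norm_sum[OF b, of "x - y"] onb_norm_sum[OF b', of "f x - f y"])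
    then show ?thesis by (simp add: dist_norm)
  qed
  have "frect b' i0 c' a \<subseteq> f ` frect b i0 c a"
  proof
    fix y assume y: "y \<in> frect b' i0 c' a"
    define x where "x = c + (\<Sum>i\<in>UNIV. inner (y - c') (b' i) *\<^sub>R b i)"
    have x_coord: "inner (x - c) (b j) = inner (y - c') (b' j)" for j
      unfolding x_def using onb_sum_inner[OF b] by simp
    have "f x = c' + (y - c')"
      unfolding f_def x_coord by (simp add: onb_expand[OF b'])
    moreover have "x \<in> frect b i0 c a"
      using y by (simp add: frect_def x_coord)
    ultimately show "y \<in> f ` frect b i0 c a" by (simp add: image_iff) (metis)
  qed
  then show ?thesis
    by (rule order_trans[OF hausdorff_outer_mono hausdorff_outer_contraction[OF s]]) (simp add: dist)
qed

lemma frect_outer_eq: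
  "0 < s \<Longrightarrow> onb b \<Longrightarrow> onb b' \<Longrightarrow> hausdorff_outer s (frect b' i0 c' a) = hausdorff_outer s (frect b i0 c a)"
  by (simp add: antisym frect_outer_le)

text \<open>Relabels the frame so that a prescribed index becomes the normal one;
  \<open>hbox_const\<close> is defined with one fixed normal index.\<close>

lemma frect_transpose:
  "frect b i0 c a = frect (b \<circ> Transposition.transpose i0 j0) j0 c (a \<circ> Transposition.transpose i0 j0)"
proof -
  have "(\<forall>i. i \<noteq> i0 \<longrightarrow> P i) \<longleftrightarrow> (\<forall>i. i \<noteq> j0 \<longrightarrow> P (Transposition.transpose i0 j0 i))" for P
    by (metis transpose_apply_second transpose_involutory transpose_apply_first)
  from this[of "\<lambda>i. 0 \<le> inner (_ - c) (b i) \<and> inner (_ - c) (b i) \<le> a i"] show ?thesis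
    by (simp add: frect_def)
qed

section \<open>Finiteness, positivity and product formula for the measure of a rectangle\<close>

lemma hausdorff_pre_finite_cover:
  assumes I: "finite I" and E: "E \<subseteq> (\<Union>i\<in>I. C i)" and \<delta>: "0 \<le> \<delta>"
    and C: "\<And>i. i \<in> I \<Longrightarrow> bounded (C i)" "\<And>i. i \<in> I \<Longrightarrow> diameter (C i) \<le> \<delta>"
  shows "hausdorff_pre s \<delta> E \<le> (\<Sum>i\<in>I. hausdorff_gauge s (C i))"
proof -
  obtain h where h: "bij_betw h {0..<card I} I" using ex_bij_betw_nat_finite[OF I] by blast
  define B where "B k = (if k < card I then C (h k) else {})" for k
  have hI: "h k \<in> I" if "k < card I" for k using h that by (auto simp: bij_betw_def)
  have "E \<subseteq> (\<Union>k. B k)"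
  proof
    fix x assume "x \<in> E"
    then obtain i where "i \<in> I" "x \<in> C i" using E by auto
    moreover then obtain k where "k < card I" "h k = i" using bij_betw_imp_surj_on[OF h] by (metis atLeastLessThan_iff imageE)
    ultimately show "x \<in> (\<Union>k. B k)" by (auto simp: B_def)
  qed
  then have "delta_cover \<delta> E B"
    using C hI \<delta> by (auto simp: delta_cover_def B_def)
  then have "hausdorff_pre s \<delta> E \<le> (\<Sum>k. hausdorff_gauge s (B k))" by (rule hausdorff_pre_le)
  also have "\<dots> = (\<Sum>k\<in>{0..<card I}. hausdorff_gauge s (B k))"
    by (rule suminf_finite) (auto simp: B_def)
  also have "\<dots> = (\<Sum>k\<in>{0..<card I}. hausdorff_gauge s (C (h k)))"
    by (rule sum.cong) (auto simp: B_def)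
  also have "\<dots> = (\<Sum>i\<in>I. hausdorff_gauge s (C i))" by (rule sum.reindex_bij_betw[OF h])
  finally show ?thesis .
qed

abbreviation axes :: "'d::finite \<Rightarrow> real^'d" where "axes \<equiv> \<lambda>i. axis i 1"

lemma frect_axes: "frect axes i0 c a = {x. x $ i0 = c $ i0 \<and> (\<forall>i. i \<noteq> i0 \<longrightarrow> c $ i \<le> x $ i \<and> x $ i \<le> c $ i + a i)}"
  by (auto simp: frect_def inner_axis algebra_simps)

abbreviation codim1 :: "'d::finite itself \<Rightarrow> real" where "codim1 T \<equiv> real CARD('d) - 1"

lemma hausdorff_gauge_codim1:
  assumes d2: "CARD('d::finite) \<ge> 2" and bd: "bounded C"
  shows "hausdorff_gauge (codim1 TYPE('d)) C = ennreal (haus_alpha (codim1 TYPE('d)) * (diameter C / 2) ^ (CARD('d) - 1))"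
\<comment> \<open>\<open>powr\<close> agrees with the natural power for a positive base; at
  \<open>0\<close> both sides vanish because the exponent is at least one.\<close>
proof (cases "diameter C = 0")
  case True then show ?thesis using d2 by (simp add: hausdorff_gauge_def power_0_left)
next
  case False
  then have "0 < diameter C / 2" using diameter_ge_0[OF bd] by simp
  moreover have "codim1 TYPE('d) = real (CARD('d) - 1)" using d2 by simp
  ultimately show ?thesis unfolding hausdorff_gauge_def by (simp only: powr_realpow)
qed

text \<open>A grid of \<open>N^(d-1)\<close> cells of side \<open>L / N\<close> covers the
  rectangle, and its total gauge is bounded independently of \<open>N\<close>.\<close>

lemma frect_outer_finite:
  fixes i0 :: "'d::finite"
  assumes d2: "CARD('d) \<ge> 2" and L: "0 < L" and a: "\<And>i. i \<noteq> i0 \<Longrightarrow> a i \<le> L"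
  shows "hausdorff_outer (codim1 TYPE('d)) (frect axes i0 (0::real^'d) a) < \<infinity>"
proof -
  let ?s = "codim1 TYPE('d)" and ?d = "CARD('d)"
  let ?q = "sqrt (real ?d) * L"
  have "hausdorff_pre ?s \<delta> (frect axes i0 (0::real^'d) a) \<le> ennreal (haus_alpha ?s * (?q / 2) ^ (?d - 1))"
    if \<delta>: "0 < \<delta>" for \<delta>
  proof -
    obtain N0 where N0: "?q / \<delta> < real N0" using reals_Archimedean2 by blast
    define N where "N = Suc N0"
    have N: "0 < N" "?q / real N \<le> \<delta>"
      using N0 \<delta> by (auto simp: N_def field_simps)
    define I where "I = (UNIV - {i0}) \<rightarrow>\<^sub>E {..<N}"
    define C where "C m = frect axes i0 (\<chi> j. if j = i0 then 0 else real (m j) * (L / real N)) (\<lambda>_. L / real N)" for m :: "'d \<Rightarrow> nat"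
    have finI: "finite I" "card I = N ^ (?d - 1)"
      by (auto simp: I_def card_PiE intro!: finite_PiE)
    have nd: "norm (x - y) \<le> ?q / real N" if "x \<in> C m" "y \<in> C m" for x y m
    proof -
      have "\<bar>inner (x - y) (axis i 1)\<bar> \<le> L / real N" for i
      proof (cases "i = i0")
        case True then show ?thesis using that L by (simp add: C_def frect_axes inner_axis)
      next
        case False
        then have "real (m i) * (L / real N) \<le> x $ i" "x $ i \<le> real (m i) * (L / real N) + L / real N"
          "real (m i) * (L / real N) \<le> y $ i" "y $ i \<le> real (m i) * (L / real N) + L / real N"
          using that by (auto simp: C_def frect_axes)
        then show ?thesis by (simp add: inner_axis abs_le_iff)
      qed
      then show ?thesis using onb_norm_le[OF onb_axis, of "x - y" "L / real N"] by simp
    qed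
    have bdC: "bounded (C m)" for m
      unfolding bounded_two_points using nd[of _ m] by (auto simp: dist_norm)
    have diaC: "diameter (C m) \<le> ?q / real N" for m
      using nd[of _ m] L by (intro diameter_le) (auto simp: dist_norm)
    have "frect axes i0 0 a \<subseteq> (\<Union>m\<in>I. C m)"
    proof
      fix x assume x: "x \<in> frect axes i0 (0::real^'d) a"
      \<comment> \<open>The minimum with \<open>N - 1\<close> puts points of the far face into the
        last cell.\<close>
      define m where "m = restrict (\<lambda>i. min (N - 1) (nat \<lfloor>x $ i * real N / L\<rfloor>)) (UNIV - {i0})"
      have "m \<in> I" using N by (auto simp: m_def I_def)
      moreover have "x \<in> C m"
      proof -
        have "real (m i) * (L / real N) \<le> x $ i \<and> x $ i \<le> real (m i) * (L / real N) + L / real N" if i: "i \<noteq> i0" for i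
        proof -
          define q where "q = x $ i * real N / L"
          have xi: "0 \<le> x $ i" "x $ i \<le> L" using x i a[OF i] by (auto simp: frect_axes)
          have q: "0 \<le> q" "q \<le> real N"
            unfolding q_def using xi L N by (auto simp: field_simps)
          have mi: "m i = min (N - 1) (nat \<lfloor>q\<rfloor>)" using i by (simp add: m_def q_def)
          have fl: "real (nat \<lfloor>q\<rfloor>) \<le> q" "q \<le> real (nat \<lfloor>q\<rfloor>) + 1" using q by linarith+
          have m1: "real (m i) \<le> q" "q \<le> real (m i) + 1"
            using fl q N unfolding mi by (simp_all add: min_def of_nat_diff) linarith+
          have xq: "x $ i = q * (L / real N)" using L N by (simp add: q_def)
          have "0 < L / real N" using L N by simp
          then have "real (m i) * (L / real N) \<le> q * (L / real N)" "q * (L / real N) \<le> (real (m i) + 1) * (L / real N)"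
            using m1 mult_right_mono[of "real (m i)" q "L / real N"] mult_right_mono[of q "real (m i) + 1" "L / real N"]
            by (auto simp del: times_divide_eq_right)
          then show ?thesis unfolding xq distrib_right mult_1 by blast
        qed
        then show ?thesis using x by (auto simp: C_def frect_axes)
      qed
      ultimately show "x \<in> (\<Union>m\<in>I. C m)" by blast
    qed
    then have "hausdorff_pre ?s \<delta> (frect axes i0 0 a) \<le> (\<Sum>m\<in>I. hausdorff_gauge ?s (C m))"
      using bdC order_trans[OF diaC N(2)] \<delta> by (intro hausdorff_pre_finite_cover finI) auto
    also have "\<dots> \<le> (\<Sum>m\<in>I. ennreal (haus_alpha ?s * (?q / real N / 2) ^ (?d - 1)))"
    proof (rule sum_mono)
      fix m
      show "hausdorff_gauge ?s (C m) \<le> ennreal (haus_alpha ?s * (?q / real N / 2) ^ (?d - 1))"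
        unfolding hausdorff_gauge_codim1[OF d2 bdC]
        using haus_alpha_pos[of ?s] d2 diaC[of m] diameter_ge_0[OF bdC[of m]]
        by (intro ennreal_leI mult_left_mono power_mono) auto
    qed
    also have "\<dots> = ennreal (real (N ^ (?d - 1)) * (haus_alpha ?s * (?q / real N / 2) ^ (?d - 1)))"
      using finI L haus_alpha_pos[of ?s] d2 by (simp add: ennreal_mult ennreal_of_nat_eq_real_of_nat)
    also have "real (N ^ (?d - 1)) * (haus_alpha ?s * (?q / real N / 2) ^ (?d - 1)) = haus_alpha ?s * (?q / 2) ^ (?d - 1)"
      using N by (simp add: power_divide)
    finally show ?thesis .
  qed
  then have "hausdorff_outer ?s (frect axes i0 (0::real^'d) a) \<le> ennreal (haus_alpha ?s * (?q / 2) ^ (?d - 1))"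
    by (rule hausdorff_outer_leI)
  then show ?thesis by (rule order.strict_trans1) simp
qed

text \<open>Lebesgue measure gives the lower bound: each covering set is enclosed in a box of unit
  height in direction \<open>i0\<close>, and these boxes must fill the unit cube.\<close>

lemma unit_frect_outer_pos:
  fixes i0 :: "'d::finite"
  assumes d2: "CARD('d) \<ge> 2"
  shows "0 < hausdorff_outer (codim1 TYPE('d)) (frect axes i0 (0::real^'d) (\<lambda>_. 1))"
proof -
  let ?s = "codim1 TYPE('d)" and ?d = "CARD('d)"
  let ?E = "frect axes i0 (0::real^'d) (\<lambda>_. 1)"
  \<comment> \<open>Chosen so that \<open>\<kappa> * (2 * diameter)^(d-1)\<close> is the gauge: a
    box has sides twice the diameter while the gauge uses the half diameter, hence the factor
    \<open>4\<close>.\<close>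
  define \<kappa> where "\<kappa> = haus_alpha ?s / 4 ^ (?d - 1)"
  have \<kappa>: "0 < \<kappa>" using haus_alpha_pos[of ?s] d2 by (simp add: \<kappa>_def)
  have "ennreal \<kappa> \<le> hausdorff_pre ?s 1 ?E"
    unfolding hausdorff_pre_def
  proof (rule INF_greatest)
    fix C assume "C \<in> Collect (delta_cover 1 ?E)"
    then have C: "?E \<subseteq> (\<Union>i. C i)" "\<And>i. bounded (C i)" by (auto simp: delta_cover_def)
    define p where "p i = (SOME x. x \<in> C i)" for i
    define S where "S i = cbox (\<chi> j. if j = i0 then 0 else p i $ j - diameter (C i))
        (\<chi> j. if j = i0 then 1 else p i $ j + diameter (C i))" for i
    have "cbox 0 1 \<subseteq> (\<Union>i. S i)"
    proof
      fix x :: "real^'d" assume x: "x \<in> cbox 0 1"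
      define y where "y = (\<chi> j. if j = i0 then 0 else x $ j)"
      have "y \<in> ?E" using x by (auto simp: y_def frect_axes mem_box_cart)
      then obtain i where i: "y \<in> C i" using C(1) by auto
      then have "p i \<in> C i" unfolding p_def by (rule someI)
      then have "norm (y - p i) \<le> diameter (C i)" using i diameter_bounded_bound[OF C(2)] by (simp add: dist_norm)
      then have *: "\<bar>y $ j - p i $ j\<bar> \<le> diameter (C i)" for j
        using component_le_norm_cart[of "y - p i" j] by simp
      have "x \<in> S i"
        unfolding S_def mem_box_cart
      proof (intro allI conjI)
        fix j
        show "(\<chi> j. if j = i0 then 0 else p i $ j - diameter (C i)) $ j \<le> x $ j"
          "x $ j \<le> (\<chi> j. if j = i0 then 1 else p i $ j + diameter (C i)) $ j"
          using x *[of j] by (auto simp: y_def mem_box_cart abs_le_iff split: if_splits)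
      qed
      then show "x \<in> (\<Union>i. S i)" by blast
    qed
    then have "emeasure lborel (cbox 0 (1::real^'d)) \<le> emeasure lborel (\<Union>i. S i)"
      by (rule emeasure_mono) (auto simp: S_def)
    also have "\<dots> \<le> (\<Sum>i. emeasure lborel (S i))"
      by (rule emeasure_subadditive_countably) (auto simp: S_def)
    also have "\<dots> = (\<Sum>i. ennreal ((2 * diameter (C i)) ^ (?d - 1)))"
    proof (rule suminf_cong)
      fix i
      have ne: "S i \<noteq> {}"
        using diameter_ge_0[OF C(2)[of i]] by (auto simp: S_def interval_ne_empty_cart)
      have "measure lborel (S i) = (\<Prod>j\<in>UNIV. if j = i0 then 1 else 2 * diameter (C i))"
        using content_cbox_cart[OF ne[unfolded S_def]] unfolding S_def[symmetric]
        by (auto intro!: prod.cong simp: S_def)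
      also have "\<dots> = (\<Prod>j\<in>UNIV - {i0}. 2 * diameter (C i))"
        by (subst prod.remove[of _ i0]) auto
      also have "\<dots> = (2 * diameter (C i)) ^ (?d - 1)" by simp
      finally show "emeasure lborel (S i) = ennreal ((2 * diameter (C i)) ^ (?d - 1))"
        using emeasure_eq_ennreal_measure[of lborel "S i"] by (simp add: S_def emeasure_lborel_cbox_eq)
    qed
    also have "emeasure lborel (cbox 0 (1::real^'d)) = 1"
      using content_cbox_cart[of "0::real^'d" 1] emeasure_eq_ennreal_measure[of lborel "cbox 0 (1::real^'d)"]
      by (simp add: emeasure_lborel_cbox_eq interval_ne_empty_cart)
    finally have one: "1 \<le> (\<Sum>i. ennreal ((2 * diameter (C i)) ^ (?d - 1)))" .
    have "ennreal \<kappa> * 1 \<le> ennreal \<kappa> * (\<Sum>i. ennreal ((2 * diameter (C i)) ^ (?d - 1)))"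
      by (intro mult_left_mono one) simp
    also have "\<dots> = (\<Sum>i. ennreal \<kappa> * ennreal ((2 * diameter (C i)) ^ (?d - 1)))"
      by (simp add: ennreal_suminf_cmult)
    also have "\<dots> = (\<Sum>i. hausdorff_gauge ?s (C i))"
    proof (rule suminf_cong)
      fix i
      have "\<kappa> * (2 * diameter (C i)) ^ (?d - 1) = haus_alpha ?s * (2 * diameter (C i) / 4) ^ (?d - 1)"
        unfolding \<kappa>_def power_divide by simp
      then show "ennreal \<kappa> * ennreal ((2 * diameter (C i)) ^ (?d - 1)) = hausdorff_gauge ?s (C i)"
        unfolding hausdorff_gauge_codim1[OF d2 C(2)] using \<kappa> by (simp flip: ennreal_mult')
    qed
    finally show "ennreal \<kappa> \<le> (\<Sum>i. hausdorff_gauge ?s (C i))" by simp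
  qed
  also have "\<dots> \<le> hausdorff_outer ?s ?E" by (rule hausdorff_pre_le_outer) simp
  finally show ?thesis using \<kappa> by (metis ennreal_0 ennreal_less_zero_iff less_le_trans ennreal_lessI le_less)
qed

text \<open>Cauchy's functional equation: nonnegativity gives monotonicity, and squeezing
  \<open>n * x\<close> between consecutive integers bounds
  \<open>n * \<bar>f x - x * f 1\<bar>\<close> by \<open>f 1\<close> for every
  \<open>n\<close>.\<close>

lemma additive_nonneg_linear:
  fixes f :: "real \<Rightarrow> real"
  assumes add: "\<And>x y. 0 \<le> x \<Longrightarrow> 0 \<le> y \<Longrightarrow> f (x + y) = f x + f y"
    and nn: "\<And>x. 0 \<le> x \<Longrightarrow> 0 \<le> f x" and x: "0 \<le> x"
  shows "f x = x * f 1"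
proof -
  have mul: "f (real n * y) = real n * f y" if "0 \<le> y" for n y
  proof (induction n)
    case 0 show ?case using add[of 0 0] by simp
  next
    case (Suc n)
    have "f (real (Suc n) * y) = f (real n * y + y)" by (simp add: algebra_simps)
    also have "\<dots> = f (real n * y) + f y" using that by (intro add) auto
    finally show ?case using Suc by (simp add: algebra_simps)
  qed
  have mono: "f u \<le> f w" if "0 \<le> u" "u \<le> w" for u w
    using add[of u "w - u"] nn[of "w - u"] that by simp
  have bound: "real n * \<bar>f x - x * f 1\<bar> \<le> f 1" for n
  proof -
    define k where "k = nat \<lfloor>real n * x\<rfloor>"
    have k: "real k \<le> real n * x" "real n * x \<le> real k + 1"
      using x mult_nonneg_nonneg[of "real n" x] unfolding k_def by linarith+
    have "real k * f 1 \<le> real n * f x"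
      using mul[of 1 k] mul[of x n] mono[of "real k" "real n * x"] k x by simp
    moreover have "real n * f x \<le> (real k + 1) * f 1"
      using mul[of 1 "Suc k"] mul[of x n] mono[of "real n * x" "real (Suc k)"] k x by (simp add: algebra_simps)
    moreover have "real k * f 1 \<le> real n * x * f 1" "real n * x * f 1 \<le> (real k + 1) * f 1"
      using k nn[of 1] by (auto intro: mult_right_mono)
    ultimately have "\<bar>real n * f x - real n * x * f 1\<bar> \<le> f 1" by (simp add: algebra_simps abs_le_iff)
    moreover have "real n * f x - real n * x * f 1 = real n * (f x - x * f 1)" by (simp add: algebra_simps)
    ultimately show ?thesis by (simp add: abs_mult)
  qed
  show ?thesis
  proof (rule ccontr)
    assume "f x \<noteq> x * f 1"
    then have pos: "0 < \<bar>f x - x * f 1\<bar>" by simp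
    then obtain n where "f 1 / \<bar>f x - x * f 1\<bar> < real n" using reals_Archimedean2 by blast
    then show False using bound[of n] pos by (simp add: field_simps)
  qed
qed

text \<open>The measure of a unit cube of dimension \<open>d - 1\<close>, kept as an unevaluated
  positive constant that divides out of ratios of areas. \<open>undefined\<close> serves as one
  fixed choice of normal index.\<close>

definition hbox_const :: "'d::finite itself \<Rightarrow> real" where
  "hbox_const T = enn2real (hausdorff_outer (codim1 TYPE('d)) (frect axes undefined (0::real^'d) (\<lambda>_. 1)))"

lemma hbox_const_pos:
  assumes "CARD('d::finite) \<ge> 2"
  shows "0 < hbox_const TYPE('d)"
  using unit_frect_outer_pos[OF assms, of undefined] frect_outer_finite[OF assms, of 1 undefined "\<lambda>_. 1"]
  unfolding hbox_const_def by (simp add: enn2real_positive_iff)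

text \<open>The measure is additive in one side length, because two boxes glued along a face overlap
  only in that face; linearity follows from Cauchy's equation.\<close>

lemma frect_axes_outer_linear:
  fixes i0 j :: "'d::finite" and a :: "'d \<Rightarrow> real"
  assumes d2: "CARD('d) \<ge> 2" and a: "\<And>i. i \<noteq> i0 \<Longrightarrow> 0 \<le> a i" and j: "j \<noteq> i0" and x: "0 \<le> x"
  shows "enn2real (hausdorff_outer (codim1 TYPE('d)) (frect axes i0 (0::real^'d) (a(j := x))))
    = x * enn2real (hausdorff_outer (codim1 TYPE('d)) (frect axes i0 (0::real^'d) (a(j := 1))))"
proof -
  let ?s = "codim1 TYPE('d)" and ?M = "hausdorff_measure (codim1 TYPE('d)) :: (real^'d) measure"
  have s: "0 < ?s" using d2 by simp
  define \<phi> where "\<phi> t = hausdorff_outer ?s (frect axes i0 (0::real^'d) (a(j := t)))" for t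
  have shift: "emeasure ?M (frect axes i0 c (a(j := t))) = \<phi> t" for c t
    unfolding \<phi>_def emeasure_hausdorff_measure[OF s borel_closed[OF closed_frect]]
    by (rule frect_outer_eq[OF s onb_axis onb_axis])
  have fin: "\<phi> t < \<infinity>" for t
  proof -
    define L where "L = 1 + \<bar>t\<bar> + (\<Sum>i\<in>UNIV. \<bar>a i\<bar>)"
    have "0 \<le> (\<Sum>i\<in>UNIV. \<bar>a i\<bar>)" by (simp add: sum_nonneg)
    then have "0 < L" "\<bar>t\<bar> \<le> L" unfolding L_def by linarith+
    moreover have "a i \<le> L" for i
      using member_le_sum[of i UNIV "\<lambda>i. \<bar>a i\<bar>"] by (auto simp: L_def)
    ultimately show ?thesis unfolding \<phi>_def by (intro frect_outer_finite[OF d2, of L]) (auto simp: abs_le_iff)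
  qed
  \<comment> \<open>A face is null: \<open>n\<close> disjoint translates of it fit into one box of
    finite measure.\<close>
  have zero: "\<phi> 0 = 0"
  proof -
    have "ennreal (real n) * \<phi> 0 \<le> \<phi> 1" for n
    proof -
      define B where "B k = frect axes i0 ((real k / real n) *\<^sub>R axis j 1) (a(j := 0))" for k
      have disj: "disjoint_family_on B {..<n}"
      proof (clarsimp simp: disjoint_family_on_def)
        fix k l assume "k < n" "l < n" "k \<noteq> l"
        have "y $ j = real m / real n" if "y \<in> B m" for y m
          using that j unfolding B_def frect_axes by (auto simp: axis_def)
        moreover have "real k / real n \<noteq> real l / real n" using \<open>k < n\<close> \<open>k \<noteq> l\<close> by simp
        ultimately show "B k \<inter> B l = {}" by (metis disjoint_iff)
      qed
      have "(\<Union>k<n. B k) \<subseteq> frect axes i0 0 (a(j := 1))"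
      proof clarify
        fix y k assume k: "k < n" and y: "y \<in> B k"
        have "0 \<le> real k / real n" "real k / real n \<le> 1" using k by auto
        then show "y \<in> frect axes i0 0 (a(j := 1))"
          using y j unfolding B_def frect_axes by (auto simp: axis_def split: if_splits)
      qed
      then have "emeasure ?M (\<Union>k<n. B k) \<le> \<phi> 1"
        unfolding shift[of 0 1, symmetric] by (rule emeasure_mono) (simp add: closed_frect)
      moreover have "emeasure ?M (\<Union>k<n. B k) = (\<Sum>k<n. emeasure ?M (B k))"
        by (rule sum_emeasure[symmetric]) (use disj in \<open>auto simp: B_def[abs_def] intro: borel_closed closed_frect\<close>)
      ultimately show ?thesis by (simp add: B_def shift ennreal_of_nat_eq_real_of_nat)
    qed
    moreover obtain u v where "\<phi> 0 = ennreal u" "\<phi> 1 = ennreal v" "0 \<le> u" "0 \<le> v"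
      using fin[of 0] fin[of 1] by (metis ennreal_cases infinity_ennreal_def less_irrefl)
    ultimately have uv: "real n * u \<le> v" for n by (metis ennreal_le_iff ennreal_mult of_nat_0_le_iff)
    have "u = 0"
    proof (rule ccontr)
      assume "u \<noteq> 0"
      with \<open>0 \<le> u\<close> obtain n where "v / u < real n" using reals_Archimedean2 by blast
      then show False using uv[of n] \<open>0 \<le> u\<close> \<open>u \<noteq> 0\<close> by (simp add: field_simps)
    qed
    then show ?thesis by (simp add: \<open>\<phi> 0 = ennreal u\<close>)
  qed
  have add: "\<phi> (y + z) = \<phi> y + \<phi> z" if "0 \<le> y" "0 \<le> z" for y z
  proof -
    let ?A = "frect axes i0 (0::real^'d) (a(j := y))" and ?B = "frect axes i0 (y *\<^sub>R axis j 1) (a(j := z))"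
    have U: "?A \<union> ?B = frect axes i0 0 (a(j := y + z))"
    proof (rule set_eqI)
      fix w :: "real^'d"
      have "w \<in> frect axes i0 0 (a(j := t)) \<longleftrightarrow> w $ i0 = 0 \<and> (0 \<le> w $ j \<and> w $ j \<le> t) \<and> (\<forall>i. i \<noteq> i0 \<and> i \<noteq> j \<longrightarrow> 0 \<le> w $ i \<and> w $ i \<le> a i)" for t
        using j by (auto simp: frect_axes)
      moreover have "w \<in> ?B \<longleftrightarrow> w $ i0 = 0 \<and> (y \<le> w $ j \<and> w $ j \<le> y + z) \<and> (\<forall>i. i \<noteq> i0 \<and> i \<noteq> j \<longrightarrow> 0 \<le> w $ i \<and> w $ i \<le> a i)"
        using j unfolding frect_axes by (auto simp: axis_def)
      ultimately show "w \<in> ?A \<union> ?B \<longleftrightarrow> w \<in> frect axes i0 0 (a(j := y + z))" using that by auto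
    qed
    have "?A \<inter> ?B \<subseteq> frect axes i0 (y *\<^sub>R axis j 1) (a(j := 0))"
      using j unfolding frect_axes by (auto simp: axis_def split: if_splits)
    then have "emeasure ?M (?A \<inter> ?B) \<le> \<phi> 0"
      unfolding shift[of "y *\<^sub>R axis j 1" 0, symmetric] by (rule emeasure_mono) (simp add: closed_frect)
    then have "emeasure ?M (?A \<inter> ?B) = 0" by (simp add: zero)
    moreover have "emeasure ?M ?A + emeasure ?M ?B = emeasure ?M (?A \<union> ?B) + emeasure ?M (?A \<inter> ?B)"
      by (rule emeasure_Un_Int) (simp_all add: closed_frect)
    ultimately show ?thesis by (simp add: U shift)
  qed
  have "enn2real (\<phi> x) = x * enn2real (\<phi> 1)"
    by (rule additive_nonneg_linear[of "\<lambda>x. enn2real (\<phi> x)"])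
       (use x add fin in \<open>auto simp: enn2real_plus infinity_ennreal_def\<close>)
  then show ?thesis unfolding \<phi>_def .
qed

text \<open>Starting from the unit cube, the sides are set to their values one at a time, each
  contributing a factor by linearity.\<close>

lemma frect_outer:
  fixes b :: "'d::finite \<Rightarrow> real^'d"
  assumes d2: "CARD('d) \<ge> 2" and b: "onb b" and a: "\<And>i. i \<noteq> i0 \<Longrightarrow> 0 \<le> a i"
  shows "hausdorff_outer (codim1 TYPE('d)) (frect b i0 c a)
    = ennreal (hbox_const TYPE('d) * (\<Prod>i\<in>UNIV - {i0}. a i))"
proof -
  let ?s = "codim1 TYPE('d)"
  have s: "0 < ?s" using d2 by simp
  define j0 where "j0 = (undefined :: 'd)"
  let ?t = "Transposition.transpose i0 j0"
  define a' where "a' = a \<circ> ?t"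
  have a'0: "0 \<le> a' i" if "i \<noteq> j0" for i
    unfolding a'_def using a[of "?t i"] that by (metis comp_apply transpose_apply_first transpose_involutory)
  define F where "F a = enn2real (hausdorff_outer ?s (frect axes j0 (0::real^'d) a))" for a
  have "F (\<lambda>i. if i \<in> J then a' i else 1) = hbox_const TYPE('d) * (\<Prod>i\<in>J. a' i)" if "finite J" "J \<subseteq> UNIV - {j0}" for J
    using that
  proof (induction J)
    case empty then show ?case by (simp add: F_def hbox_const_def j0_def)
  next
    case (insert j J)
    let ?g = "\<lambda>i. if i \<in> J then a' i else 1"
    have g: "(\<lambda>i. if i \<in> insert j J then a' i else 1) = ?g(j := a' j)" "?g = ?g(j := 1)"
      using insert.hyps by auto
    have "F (?g(j := a' j)) = a' j * F (?g(j := 1))"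
      unfolding F_def using insert.prems a'0 by (intro frect_axes_outer_linear[OF d2]) auto
    then show ?case using insert g by (simp add: algebra_simps)
  qed
  from this[of "UNIV - {j0}"] have "F (\<lambda>i. if i \<in> UNIV - {j0} then a' i else 1) = hbox_const TYPE('d) * (\<Prod>i\<in>UNIV - {j0}. a' i)"
    by simp
  moreover have "frect axes j0 (0::real^'d) (\<lambda>i. if i \<in> UNIV - {j0} then a' i else 1) = frect axes j0 0 a'"
    by (auto simp: frect_def)
  moreover have "hausdorff_outer ?s (frect b i0 c a) = hausdorff_outer ?s (frect axes j0 0 a')"
    unfolding frect_transpose[of b i0 c a j0] a'_def
    by (rule frect_outer_eq[OF s onb_axis onb_transpose[OF b]])
  moreover have "hausdorff_outer ?s (frect axes j0 (0::real^'d) a') < \<infinity>"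
  proof (rule frect_outer_finite[OF d2, of "1 + (\<Sum>i\<in>UNIV. \<bar>a' i\<bar>)"])
    show "0 < 1 + (\<Sum>i\<in>UNIV. \<bar>a' i\<bar>)" by (simp add: add_pos_nonneg sum_nonneg)
    show "a' i \<le> 1 + (\<Sum>i\<in>UNIV. \<bar>a' i\<bar>)" for i
      using member_le_sum[of i UNIV "\<lambda>i. \<bar>a' i\<bar>"] by auto
  qed
  moreover have "(\<Prod>i\<in>UNIV - {j0}. a' i) = (\<Prod>i\<in>UNIV - {i0}. a i)"
    unfolding a'_def
    by (rule prod.reindex_bij_witness[of _ ?t ?t]) (auto simp: transpose_eq_iff)
  ultimately show ?thesis unfolding F_def by (metis ennreal_enn2real infinity_ennreal_def)
qed

section \<open>Lattice cuts\<close>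

definition rvec :: "int^'d \<Rightarrow> real^'d" where
  "rvec z = (\<chi> j. real_of_int (z $ j))"

lemma pt_eq_rvec: "pt n z = (1 / real n) *\<^sub>R rvec z"
  by (simp add: pt_def rvec_def vec_eq_iff)

lemma rvec_shift: "rvec (shift z i) = rvec z + axis i 1"
  by (simp add: rvec_def shift_def vec_eq_iff axis_def)

lemma shift_add: "shift (z + w) i = shift z i + w"
  by (simp add: shift_def vec_eq_iff)

lemma shift_eq_iff [simp]: "shift z i = shift z j \<longleftrightarrow> i = j"
proof
  assume "shift z i = shift z j"
  then have "shift z i $ i = shift z j $ i" by simp
  then show "i = j" by (auto simp: shift_def split: if_splits)
qed simp

lemma shift_shift_neq: "z \<noteq> shift (shift z i) j"
proof
  assume "z = shift (shift z i) j"
  then have "z $ i = shift (shift z i) j $ i" by simp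
  then show False by (auto simp: shift_def split: if_splits)
qed

lemma rvec_dist_ge_1:
  assumes "z \<noteq> w" shows "1 \<le> norm (rvec z - rvec w)"
proof -
  obtain j where j: "z $ j \<noteq> w $ j" using assms by (auto simp: vec_eq_iff)
  then have "1 \<le> \<bar>z $ j - w $ j\<bar>" by linarith
  then have "1 \<le> real_of_int \<bar>z $ j - w $ j\<bar>" by linarith
  then have "1 \<le> \<bar>(rvec z - rvec w) $ j\<bar>" by (simp add: rvec_def)
  also have "\<dots> \<le> norm (rvec z - rvec w)" by (rule component_le_norm_cart)
  finally show ?thesis .
qed

text \<open>The box is cut in the rotated frame into half-open cells of side
  \<open>1 / sqrt d\<close>. Distinct lattice points are at distance at least one, so each cell
  holds at most one of them, and the number of cells bounds the count.\<close>

lemma lattice_count: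
  fixes b :: "'d::finite \<Rightarrow> real^'d" and c :: "real^'d"
  assumes b: "onb b" and lu: "\<And>i. l i \<le> u i"
  defines "S \<equiv> {z. \<forall>i. l i \<le> inner (rvec z - c) (b i) \<and> inner (rvec z - c) (b i) \<le> u i}"
  shows "finite S" "real (card S) \<le> (\<Prod>i\<in>UNIV. sqrt (real CARD('d)) * (u i - l i) + 1)"
proof -
  let ?q = "sqrt (real CARD('d))"
  have q: "0 < ?q" by simp
  define g where "g z = (\<lambda>i. \<lfloor>?q * (inner (rvec z - c) (b i) - l i)\<rfloor>)" for z
  define P where "P = PiE UNIV (\<lambda>i. {0..\<lfloor>?q * (u i - l i)\<rfloor>})"
  have inj: "inj_on g S"
  proof (rule inj_onI, rule ccontr)
    fix z w assume zw: "z \<in> S" "w \<in> S" "g z = g w" "z \<noteq> w"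
    have lt: "(inner (rvec z - rvec w) (b i))\<^sup>2 < 1 / real CARD('d)" for i
    proof -
      let ?x = "?q * (inner (rvec z - c) (b i) - l i)" and ?y = "?q * (inner (rvec w - c) (b i) - l i)"
      have "\<lfloor>?x\<rfloor> = \<lfloor>?y\<rfloor>" using zw(3) by (simp add: g_def fun_eq_iff)
      then have "\<bar>?x - ?y\<bar> < 1" by linarith
      moreover have "?x - ?y = ?q * inner (rvec z - rvec w) (b i)"
        by (simp add: inner_diff_left algebra_simps)
      ultimately have "\<bar>?q * inner (rvec z - rvec w) (b i)\<bar>\<^sup>2 < 1\<^sup>2"
        by (intro power_strict_mono) auto
      then have "real CARD('d) * (inner (rvec z - rvec w) (b i))\<^sup>2 < 1"
        by (simp add: power_mult_distrib)
      then show ?thesis by (simp add: field_simps)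
    qed
    have "(norm (rvec z - rvec w))\<^sup>2 < (\<Sum>i\<in>(UNIV::'d set). 1 / real CARD('d))"
      unfolding onb_norm_sum[OF b] by (rule sum_strict_mono) (use lt in auto)
    then have "(norm (rvec z - rvec w))\<^sup>2 < 1" by simp
    moreover have "1\<^sup>2 \<le> (norm (rvec z - rvec w))\<^sup>2"
      by (rule power_mono[OF rvec_dist_ge_1[OF zw(4)]]) simp
    ultimately show False by simp
  qed
  have sub: "g ` S \<subseteq> P"
    unfolding g_def P_def S_def using q by (auto simp: floor_mono mult_left_mono)
  have finP: "finite P" unfolding P_def by (rule finite_PiE) auto
  show "finite S" using finite_imageD[OF finite_subset[OF sub finP] inj] .
  have "card S \<le> card P" using card_image[OF inj] card_mono[OF finP sub] by simp
  moreover have "card P = (\<Prod>i\<in>UNIV. nat (\<lfloor>?q * (u i - l i)\<rfloor> + 1))"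
    unfolding P_def by (simp add: card_PiE)
  moreover have "real (\<Prod>i\<in>UNIV. nat (\<lfloor>?q * (u i - l i)\<rfloor> + 1)) \<le> (\<Prod>i\<in>UNIV. ?q * (u i - l i) + 1)"
    unfolding of_nat_prod
  proof (rule prod_mono)
    fix i
    have "0 \<le> ?q * (u i - l i)" using lu[of i] by simp
    then show "0 \<le> real (nat (\<lfloor>?q * (u i - l i)\<rfloor> + 1)) \<and> real (nat (\<lfloor>?q * (u i - l i)\<rfloor> + 1)) \<le> ?q * (u i - l i) + 1"
      by linarith
  qed
  ultimately show "real (card S) \<le> (\<Prod>i\<in>UNIV. ?q * (u i - l i) + 1)"
    by (metis (no_types, lifting) of_nat_le_iff order_trans)
qed

lemma lattice_count_pt:
  fixes b :: "'d::finite \<Rightarrow> real^'d" and c :: "real^'d"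
  assumes b: "onb b" and lu: "\<And>i. l i \<le> u i" and n: "n \<ge> 1"
  defines "S \<equiv> {z. \<forall>i. l i \<le> inner (pt n z - c) (b i) \<and> inner (pt n z - c) (b i) \<le> u i}"
  shows "finite S" "real (card S) \<le> (\<Prod>i\<in>UNIV. sqrt (real CARD('d)) * (real n * (u i - l i)) + 1)"
proof -
  have *: "real n * inner (pt n z - c) (b i) = inner (rvec z - real n *\<^sub>R c) (b i)" for z i
    using n by (simp add: pt_eq_rvec inner_diff_left algebra_simps)
  have eq: "S = {z. \<forall>i. real n * l i \<le> inner (rvec z - real n *\<^sub>R c) (b i) \<and> inner (rvec z - real n *\<^sub>R c) (b i) \<le> real n * u i}"
    unfolding S_def using n by (simp flip: * )
  have lu': "real n * l i \<le> real n * u i" for i using lu[of i] by (simp add: mult_left_mono)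
  show "finite S" unfolding eq by (rule lattice_count(1)[OF b lu'])
  show "real (card S) \<le> (\<Prod>i\<in>UNIV. sqrt (real CARD('d)) * (real n * (u i - l i)) + 1)"
    using lattice_count(2)[OF b lu', where c="real n *\<^sub>R c"] unfolding eq by (simp add: right_diff_distrib)
qed

lemma uses_edge_sym: "uses_edge E z w \<longleftrightarrow> uses_edge E w z"
  by (auto simp: uses_edge_def)

lemma uses_edge_shift: "uses_edge E z (shift z i) \<longleftrightarrow> (z, i) \<in> E"
  using shift_shift_neq by (auto simp: uses_edge_def)

lemma adj_cases:
  assumes "adj z w" obtains i where "w = shift z i" | i where "z = shift w i"
  using assms by (auto simp: uses_edge_def)

lemma adj_rvec: "adj z w \<Longrightarrow> norm (rvec w - rvec z) = 1"
  by (erule adj_cases) (simp_all add: rvec_shift)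

lemma adj_rvec_inner: "adj z w \<Longrightarrow> norm v = 1 \<Longrightarrow> \<bar>inner (rvec w - c) v - inner (rvec z - c) v\<bar> \<le> 1"
  using Cauchy_Schwarz_ineq2[of "rvec w - rvec z" v] adj_rvec[of z w] by (simp add: inner_diff_left)

definition touching :: "(int^'d) set \<Rightarrow> 'd edge set" where
  "touching S = {(z, i). z \<in> S \<or> shift z i \<in> S}"

lemma touching_bound:
  fixes S :: "(int^'d::finite) set"
  assumes "finite S"
  shows "finite (touching S)" "card (touching S) \<le> 2 * CARD('d) * card S"
proof -
  define unshift :: "int^'d \<Rightarrow> 'd \<Rightarrow> int^'d" where "unshift z i = (\<chi> j. if j = i then z $ j - 1 else z $ j)" for z i
  have us: "shift w i = z \<Longrightarrow> w = unshift z i" for w z i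
    unfolding shift_def unshift_def vec_eq_iff by (simp, metis add_diff_cancel_right')
  have sub: "touching S \<subseteq> (S \<times> UNIV) \<union> (\<lambda>(z, i). (unshift z i, i)) ` (S \<times> UNIV)"
  proof
    fix e assume "e \<in> touching S"
    then obtain z i where e: "e = (z, i)" "z \<in> S \<or> shift z i \<in> S" by (auto simp: touching_def)
    show "e \<in> (S \<times> UNIV) \<union> (\<lambda>(z, i). (unshift z i, i)) ` (S \<times> UNIV)"
    proof (cases "z \<in> S")
      case False
      then have "shift z i \<in> S" using e by simp
      then have "(unshift (shift z i) i, i) \<in> (\<lambda>(z, i). (unshift z i, i)) ` (S \<times> UNIV)" by force
      then show ?thesis using us[OF refl, of z i] e by simp
    qed (use e in simp)
  qed
  have fin: "finite ((S \<times> (UNIV::'d set)) \<union> (\<lambda>(z, i). (unshift z i, i)) ` (S \<times> UNIV))" using assms by simp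
  show "finite (touching S)" by (rule finite_subset[OF sub fin])
  have "card (touching S) \<le> card ((S \<times> (UNIV::'d set)) \<union> (\<lambda>(z, i). (unshift z i, i)) ` (S \<times> UNIV))"
    by (rule card_mono[OF fin sub])
  also have "\<dots> \<le> card (S \<times> (UNIV::'d set)) + card ((\<lambda>(z, i). (unshift z i, i)) ` (S \<times> (UNIV::'d set)))"
    by (rule card_Un_le)
  also have "\<dots> \<le> card (S \<times> (UNIV::'d set)) + card (S \<times> (UNIV::'d set))"
    using assms by (intro add_left_mono card_image_le) simp
  finally show "card (touching S) \<le> 2 * CARD('d) * card S" by (simp add: card_cartesian_product algebra_simps)
qed

lemma V_finite: "finite E \<Longrightarrow> V t E = (\<Sum>e\<in>E. ennreal (t e))"
  by (simp add: V_def)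

lemma V_mono: "E \<subseteq> F \<Longrightarrow> V t E \<le> V t F"
  unfolding V_def by (rule infsum_mono_neutral) (auto simp: nonneg_summable_on_complete)

section \<open>Edge boundaries of vertex sets and cuts of cylinders\<close>

definition inner_edges :: "(int^'d) set \<Rightarrow> 'd edge set" where
  "inner_edges D = {(z, i). z \<in> D \<and> shift z i \<in> D}"

definition bd_edges :: "(int^'d) set \<Rightarrow> (int^'d) set \<Rightarrow> 'd edge set" where
  "bd_edges U D = {(z, i). z \<in> D \<and> shift z i \<in> D \<and> (z \<in> U \<longleftrightarrow> shift z i \<notin> U)}"

lemma bd_edges_sub_inner: "bd_edges U D \<subseteq> inner_edges D"
  by (auto simp: bd_edges_def inner_edges_def)

lemma finite_inner_edges: "finite (D :: (int^'d::finite) set) \<Longrightarrow> finite (inner_edges D)"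
  by (rule finite_subset[of _ "D \<times> UNIV"]) (auto simp: inner_edges_def)

text \<open>A discrete intermediate value argument: membership in \<open>U\<close> differs at the
  two ends, so it flips at some step.\<close>

lemma path_crosses_bd_edges:
  fixes \<gamma> :: "nat \<Rightarrow> int^'d"
  assumes D: "\<And>k. k \<le> m \<Longrightarrow> \<gamma> k \<in> D" and adj: "\<And>k. k < m \<Longrightarrow> adj (\<gamma> k) (\<gamma> (Suc k))"
    and ends: "(\<gamma> 0 \<in> U) \<noteq> (\<gamma> m \<in> U)"
  shows "\<exists>k<m. uses_edge (bd_edges U D) (\<gamma> k) (\<gamma> (Suc k))"
proof -
  have "\<exists>k<m. (\<gamma> k \<in> U) \<noteq> (\<gamma> (Suc k) \<in> U)"
  proof (rule ccontr)
    assume "\<not> ?thesis"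
    then have "k \<le> m \<Longrightarrow> (\<gamma> k \<in> U) = (\<gamma> 0 \<in> U)" for k by (induction k) auto
    from this[of m] show False using ends by simp
  qed
  then obtain k where k: "k < m" "(\<gamma> k \<in> U) \<noteq> (\<gamma> (Suc k) \<in> U)" by blast
  have "uses_edge (bd_edges U D) (\<gamma> k) (\<gamma> (Suc k))"
    using adj[OF k(1)] D[of k] D[of "Suc k"] k by (auto simp: uses_edge_def bd_edges_def)
  then show ?thesis using k by blast
qed

text \<open>Inclusion has to be checked only for steps that leave \<open>U\<close>; either
  orientation of an edge reduces to such a step.\<close>

lemma bd_edges_sub:
  assumes "\<And>z w. z \<in> D \<Longrightarrow> w \<in> D \<Longrightarrow> adj z w \<Longrightarrow> z \<in> U \<Longrightarrow> w \<notin> U \<Longrightarrow> uses_edge E z w"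
  shows "bd_edges U D \<subseteq> E"
proof
  fix e assume "e \<in> bd_edges U D"
  then obtain z i where e: "e = (z, i)" "z \<in> D" "shift z i \<in> D" "z \<in> U \<longleftrightarrow> shift z i \<notin> U"
    by (auto simp: bd_edges_def)
  have adj: "adj z (shift z i)" "adj (shift z i) z" by (simp_all add: uses_edge_shift uses_edge_sym[of _ "shift z i"])
  show "e \<in> E"
  proof (cases "z \<in> U")
    case True then show ?thesis using assms[of z "shift z i"] e adj by (simp add: uses_edge_shift)
  next
    case False then show ?thesis using assms[of "shift z i" z] e adj uses_edge_shift[of E z i] uses_edge_sym[of E z "shift z i"] by simp
  qed
qed

abbreviation cyl_pts :: "nat \<Rightarrow> (real^'d) set \<Rightarrow> real^'d \<Rightarrow> real \<Rightarrow> (int^'d) set" where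
  "cyl_pts n R v h \<equiv> {z. pt n z \<in> cyl R v h}"

text \<open>A cut of the cylinder is recorded by the set of vertices on its lower side.\<close>

definition colorings :: "nat \<Rightarrow> (real^'d) set \<Rightarrow> real^'d \<Rightarrow> real \<Rightarrow> (int^'d) set set" where
  "colorings n R v h = {U. U \<subseteq> cyl_pts n R v h \<and>
     boundary_pts n (cyl_C1 R v h) (cyl R v h) \<inter> U = {} \<and>
     boundary_pts n (cyl_C2 R v h) (cyl R v h) \<subseteq> U}"

lemma coloring_separates:
  assumes "U \<in> colorings n R v h"
  shows "separates_cyl n R v h (bd_edges U (cyl_pts n R v h))"
  unfolding separates_cyl_def
proof (intro allI impI, elim conjE)
  fix \<gamma> :: "nat \<Rightarrow> int^'a" and m
  assume *: "\<gamma> 0 \<in> boundary_pts n (cyl_C1 R v h) (cyl R v h)" "\<gamma> m \<in> boundary_pts n (cyl_C2 R v h) (cyl R v h)"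
    "\<forall>k\<le>m. pt n (\<gamma> k) \<in> cyl R v h" "\<forall>k<m. adj (\<gamma> k) (\<gamma> (Suc k))"
  have "\<gamma> 0 \<notin> U" "\<gamma> m \<in> U" using assms *(1,2) by (auto simp: colorings_def)
  then show "\<exists>k<m. uses_edge (bd_edges U (cyl_pts n R v h)) (\<gamma> k) (\<gamma> (Suc k))"
    using *(3,4) by (intro path_crosses_bd_edges) auto
qed

text \<open>\<open>U\<close> consists of the vertices of the cylinder that cannot be reached from
  its upper boundary without using \<open>E\<close>; a boundary edge of \<open>U\<close> outside
  \<open>E\<close> would extend a path into \<open>U\<close>.\<close>

lemma separates_coloring:
  assumes sep: "separates_cyl n R v h E"
  obtains U where "U \<in> colorings n R v h" "bd_edges U (cyl_pts n R v h) \<subseteq> E"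
proof -
  let ?D = "cyl_pts n R v h"
  let ?B1 = "boundary_pts n (cyl_C1 R v h) (cyl R v h)" and ?B2 = "boundary_pts n (cyl_C2 R v h) (cyl R v h)"
  define path where "path \<gamma> m z \<longleftrightarrow> \<gamma> 0 \<in> ?B1 \<and> \<gamma> m = z \<and> (\<forall>k\<le>m. \<gamma> k \<in> ?D) \<and>
      (\<forall>k<m. adj (\<gamma> k) (\<gamma> (Suc k)) \<and> \<not> uses_edge E (\<gamma> k) (\<gamma> (Suc k)))" for \<gamma> m z
  define U where "U = {z \<in> ?D. \<not> (\<exists>\<gamma> m. path \<gamma> m z)}"
  have B1D: "?B1 \<subseteq> ?D" by (auto simp: boundary_pts_def cyl_C1_def cyl_def) (metis less_imp_le neg_le_0_iff_le order_trans)
  have B2D: "?B2 \<subseteq> ?D" by (auto simp: boundary_pts_def cyl_C2_def cyl_def) (metis less_imp_le neg_le_0_iff_le order_trans)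
  have "U \<in> colorings n R v h"
    unfolding colorings_def
  proof (intro CollectI conjI)
    show "U \<subseteq> ?D" by (auto simp: U_def)
    show "?B1 \<inter> U = {}"
    proof -
      have "path (\<lambda>_. z) 0 z" if "z \<in> ?B1" for z using that B1D by (auto simp: path_def)
      then show ?thesis unfolding U_def by blast
    qed
    show "?B2 \<subseteq> U"
    proof
      fix z assume z: "z \<in> ?B2"
      have False if "path \<gamma> m z" for \<gamma> m
        using sep[unfolded separates_cyl_def, rule_format, of \<gamma> m] that z by (auto simp: path_def)
      then show "z \<in> U" using z B2D by (auto simp: U_def)
    qed
  qed
  moreover have "bd_edges U ?D \<subseteq> E"
  proof (rule bd_edges_sub)
    fix z w assume zw: "z \<in> ?D" "w \<in> ?D" "adj z w" "z \<in> U" "w \<notin> U"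
    then obtain \<gamma> m where p: "path \<gamma> m w" by (auto simp: U_def)
    define \<gamma>' where "\<gamma>' k = (if k \<le> m then \<gamma> k else z)" for k
    show "uses_edge E z w"
    proof (rule ccontr)
      assume n: "\<not> uses_edge E z w"
      have "path \<gamma>' (Suc m) z"
        unfolding path_def
      proof (intro conjI allI impI)
        show "\<gamma>' 0 \<in> ?B1" using p by (auto simp: path_def \<gamma>'_def)
        show "\<gamma>' (Suc m) = z" by (simp add: \<gamma>'_def)
        show "\<gamma>' k \<in> ?D" for k using p zw by (auto simp: path_def \<gamma>'_def)
        fix k assume k: "k < Suc m"
        show "adj (\<gamma>' k) (\<gamma>' (Suc k))"
          using p k zw(3) uses_edge_sym[of _ z w] by (cases "k = m") (auto simp: path_def \<gamma>'_def)
        show "\<not> uses_edge E (\<gamma>' k) (\<gamma>' (Suc k))"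
          using p k n uses_edge_sym[of _ z w] by (cases "k = m") (auto simp: path_def \<gamma>'_def)
      qed
      then show False using zw(4) by (auto simp: U_def)
    qed
  qed
  ultimately show thesis by (rule that)
qed

text \<open>Replaces arbitrary edge sets by vertex sets inside the cylinder. For a hyperrectangle
  these are finitely many, which later gives attainment and measurability of
  \<open>tau\<close>.\<close>

lemma tau_eq_INF_colorings:
  "tau n R v h t = (INF U \<in> colorings n R v h. V t (bd_edges U (cyl_pts n R v h)))"
  unfolding tau_def
proof (rule antisym)
  show "(INF E \<in> {E. separates_cyl n R v h E}. V t E) \<le> (INF U \<in> colorings n R v h. V t (bd_edges U (cyl_pts n R v h)))"
    by (rule INF_greatest) (auto intro!: INF_lower coloring_separates)
  show "(INF U \<in> colorings n R v h. V t (bd_edges U (cyl_pts n R v h))) \<le> (INF E \<in> {E. separates_cyl n R v h E}. V t E)"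
  proof (rule INF_greatest)
    fix E assume "E \<in> {E. separates_cyl n R v h E}"
    then obtain U where "U \<in> colorings n R v h" "bd_edges U (cyl_pts n R v h) \<subseteq> E"
      by (auto elim: separates_coloring)
    then show "(INF U \<in> colorings n R v h. V t (bd_edges U (cyl_pts n R v h))) \<le> V t E"
      by (intro INF_lower2[of U]) (auto intro: V_mono)
  qed
qed

lemma tau_le: "U \<in> colorings n R v h \<Longrightarrow> tau n R v h t \<le> V t (bd_edges U (cyl_pts n R v h))"
  unfolding tau_eq_INF_colorings by (rule INF_lower)

text \<open>A path leaving every bounded set must leave the finite set \<open>U\<close>.\<close>

lemma phi_inf_le:
  fixes U :: "(int^'d::finite) set"
  assumes U: "finite U" and A: "\<And>z. pt n z \<in> A \<Longrightarrow> z \<in> U"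
  shows "phi_inf n A t \<le> V t (bd_edges U UNIV)"
proof -
  have "separates_inf n A (bd_edges U UNIV)"
    unfolding separates_inf_def
  proof (intro allI impI, elim conjE)
    fix \<gamma> :: "nat \<Rightarrow> int^'d"
    assume *: "pt n (\<gamma> 0) \<in> A" "\<forall>k. adj (\<gamma> k) (\<gamma> (Suc k))" "\<forall>B. bounded B \<longrightarrow> (\<exists>k. pt n (\<gamma> k) \<notin> B)"
    have "bounded (pt n ` U)" using U by (simp add: finite_imp_bounded)
    then obtain m where "pt n (\<gamma> m) \<notin> pt n ` U" using *(3) by blast
    then have "\<gamma> m \<notin> U" by blast
    then show "\<exists>k. uses_edge (bd_edges U UNIV) (\<gamma> k) (\<gamma> (Suc k))"
      using path_crosses_bd_edges[of m \<gamma> UNIV U] A[OF *(1)] *(2) by auto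
  qed
  then show ?thesis unfolding phi_inf_def by (intro INF_lower) simp
qed

text \<open>The range of heights is a parameter, so that the cylinder and its upper and lower halves
  are instances.\<close>

definition fcyl :: "('d::finite \<Rightarrow> real^'d) \<Rightarrow> 'd \<Rightarrow> real^'d \<Rightarrow> ('d \<Rightarrow> real) \<Rightarrow> real set \<Rightarrow> (real^'d) set" where
  "fcyl b i0 c a T = {x. inner (x - c) (b i0) \<in> T \<and>
     (\<forall>i. i \<noteq> i0 \<longrightarrow> 0 \<le> inner (x - c) (b i) \<and> inner (x - c) (b i) \<le> a i)}"

lemma fcyl_eq:
  assumes b: "onb b"
  shows "fcyl b i0 c a T = {x + t *\<^sub>R b i0 | x t. x \<in> frect b i0 c a \<and> t \<in> T}"
proof (intro set_eqI iffI)
  fix y assume y: "y \<in> fcyl b i0 c a T"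
  define t where "t = inner (y - c) (b i0)"
  have "inner (y - t *\<^sub>R b i0 - c) (b i) = inner (y - c) (b i) - (if i = i0 then t else 0)" for i
    by (simp add: inner_diff_left onb_inner[OF b])
  then have "y - t *\<^sub>R b i0 \<in> frect b i0 c a" "t \<in> T"
    using y by (auto simp: fcyl_def frect_def t_def)
  then show "y \<in> {x + t *\<^sub>R b i0 | x t. x \<in> frect b i0 c a \<and> t \<in> T}"
    by (intro CollectI exI[of _ "y - t *\<^sub>R b i0"] exI[of _ t]) simp
next
  fix y assume "y \<in> {x + t *\<^sub>R b i0 | x t. x \<in> frect b i0 c a \<and> t \<in> T}"
  then obtain x t where *: "y = x + t *\<^sub>R b i0" "x \<in> frect b i0 c a" "t \<in> T" by blast
  have "inner (y - c) (b i) = inner (x - c) (b i) + (if i = i0 then t else 0)" for i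
    unfolding *(1) by (simp add: inner_diff_left inner_add_left onb_inner[OF b])
  then show "y \<in> fcyl b i0 c a T" using * by (auto simp: fcyl_def frect_def)
qed

lemma cyl_frect: "onb b \<Longrightarrow> cyl (frect b i0 c a) (b i0) h = fcyl b i0 c a {-h..h}"
  and cyl_C1_frect: "onb b \<Longrightarrow> cyl_C1 (frect b i0 c a) (b i0) h = fcyl b i0 c a {0<..h}"
  and cyl_C2_frect: "onb b \<Longrightarrow> cyl_C2 (frect b i0 c a) (b i0) h = fcyl b i0 c a {-h..<0}"
  unfolding cyl_def cyl_C1_def cyl_C2_def by (simp_all add: fcyl_eq)

lemma hyperrect_normal_iff:
  "hyperrect_normal R v \<longleftrightarrow> (\<exists>b i0 c a. onb b \<and> b i0 = v \<and> (\<forall>i. i \<noteq> i0 \<longrightarrow> 0 < a i) \<and> R = frect b i0 c a)"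
proof -
  have *: "{c + (\<Sum>i\<in>UNIV - {i0}. s i *\<^sub>R b i) | s. \<forall>i. i \<noteq> i0 \<longrightarrow> 0 \<le> s i \<and> s i \<le> a i} = frect b i0 c a"
    if b: "onb b" for b :: "'a \<Rightarrow> real^'a" and i0 c a
  proof (intro set_eqI iffI)
    fix y assume "y \<in> {c + (\<Sum>i\<in>UNIV - {i0}. s i *\<^sub>R b i) | s. \<forall>i. i \<noteq> i0 \<longrightarrow> 0 \<le> s i \<and> s i \<le> a i}"
    then obtain s where s: "y = c + (\<Sum>i\<in>UNIV - {i0}. s i *\<^sub>R b i)" "\<forall>i. i \<noteq> i0 \<longrightarrow> 0 \<le> s i \<and> s i \<le> a i" by blast
    define s' where "s' = s(i0 := 0)"
    have "(\<Sum>i\<in>UNIV. s' i *\<^sub>R b i) = (\<Sum>i\<in>UNIV - {i0}. s i *\<^sub>R b i)"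
      by (subst sum.remove[of _ i0]) (auto simp: s'_def)
    then have "y - c = (\<Sum>i\<in>UNIV. s' i *\<^sub>R b i)" using s(1) by simp
    then have "inner (y - c) (b j) = s' j" for j by (simp add: onb_sum_inner[OF b])
    then show "y \<in> frect b i0 c a" using s(2) by (auto simp: frect_def s'_def)
  next
    fix y assume y: "y \<in> frect b i0 c a"
    have "y - c = (\<Sum>i\<in>UNIV. inner (y - c) (b i) *\<^sub>R b i)" by (simp add: onb_expand[OF b])
    also have "\<dots> = (\<Sum>i\<in>UNIV - {i0}. inner (y - c) (b i) *\<^sub>R b i)"
      using y by (subst sum.remove[of _ i0]) (auto simp: frect_def)
    finally have "y = c + (\<Sum>i\<in>UNIV - {i0}. inner (y - c) (b i) *\<^sub>R b i)" by (simp add: algebra_simps)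
    then show "y \<in> {c + (\<Sum>i\<in>UNIV - {i0}. s i *\<^sub>R b i) | s. \<forall>i. i \<noteq> i0 \<longrightarrow> 0 \<le> s i \<and> s i \<le> a i}"
      using y by (intro CollectI exI[of _ "\<lambda>i. inner (y - c) (b i)"]) (auto simp: frect_def)
  qed
  show ?thesis
    unfolding hyperrect_normal_def onb_def[symmetric] by (metis (no_types, lifting) * )
qed

lemma finite_fcyl_pts:
  fixes b :: "'d::finite \<Rightarrow> real^'d"
  assumes "onb b" "n \<ge> 1"
  shows "finite {z. pt n z \<in> fcyl b i0 c a {l..u}}"
proof -
  define L where "L i = (if i = i0 then l else 0)" for i
  define W where "W i = (if i = i0 then max l u else max 0 (a i))" for i
  have "finite {z. \<forall>i. L i \<le> inner (pt n z - c) (b i) \<and> inner (pt n z - c) (b i) \<le> W i}"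
    by (rule lattice_count_pt(1)[OF assms(1) _ assms(2)]) (auto simp: L_def W_def)
  then show ?thesis by (rule rev_finite_subset) (auto simp: fcyl_def L_def W_def)
qed

lemma finite_cyl_pts:
  assumes "hyperrect_normal R v" "n \<ge> 1"
  shows "finite (cyl_pts n R (v :: real^'d::finite) h)"
proof -
  obtain b i0 c a where "onb b" "b i0 = v" "R = frect b i0 c a" using assms(1) unfolding hyperrect_normal_iff by blast
  then show ?thesis using finite_fcyl_pts[of b n i0 c a "-h" h] assms(2) cyl_frect[of b i0 c a h] by simp
qed

lemma colorings_nonempty:
  assumes "hyperrect_normal R (v :: real^'d::finite)"
  shows "colorings n R v h \<noteq> {}"
proof -
  obtain b i0 c a where b: "onb b" "b i0 = v" "R = frect b i0 c a" using assms(1) unfolding hyperrect_normal_iff by blast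
  have "boundary_pts n (cyl_C2 R v h) (cyl R v h) \<in> colorings n R v h"
    unfolding colorings_def boundary_pts_def b(3) b(2)[symmetric] cyl_frect[OF b(1)] cyl_C1_frect[OF b(1)] cyl_C2_frect[OF b(1)]
    by (auto simp: fcyl_def)
  then show ?thesis by blast
qed

lemma tau_attained:
  assumes "hyperrect_normal R (v :: real^'d::finite)" "n \<ge> 1"
  obtains U where "U \<in> colorings n R v h" "tau n R v h t = V t (bd_edges U (cyl_pts n R v h))"
proof -
  have "finite (colorings n R v h)"
    by (rule finite_subset[of _ "Pow (cyl_pts n R v h)"]) (auto simp: colorings_def finite_cyl_pts[OF assms])
  then have "finite ((\<lambda>U. V t (bd_edges U (cyl_pts n R v h))) ` colorings n R v h)" by simp
  moreover have "(\<lambda>U. V t (bd_edges U (cyl_pts n R v h))) ` colorings n R v h \<noteq> {}"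
    using colorings_nonempty[OF assms(1)] by simp
  ultimately have "tau n R v h t \<in> (\<lambda>U. V t (bd_edges U (cyl_pts n R v h))) ` colorings n R v h"
    unfolding tau_eq_INF_colorings using Min_in Min_Inf by metis
  then show thesis using that by blast
qed

section \<open>Capacities and exponential moments\<close>

definition depends_on :: "('a \<Rightarrow> 'b) set \<Rightarrow> (('a \<Rightarrow> 'b) \<Rightarrow> 'c) \<Rightarrow> 'a set \<Rightarrow> bool" where
  "depends_on \<Omega> f F \<longleftrightarrow> (\<forall>t\<in>\<Omega>. \<forall>t'\<in>\<Omega>. (\<forall>e\<in>F. t e = t' e) \<longrightarrow> f t = f t')"

definition translate :: "int^'d \<Rightarrow> ('d edge \<Rightarrow> real) \<Rightarrow> ('d edge \<Rightarrow> real)" where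
  "translate z t = (\<lambda>e. t (fst e + z, snd e))"

definition move_edges :: "int^'d \<Rightarrow> 'd edge set \<Rightarrow> 'd edge set" where
  "move_edges z F = (\<lambda>e. (fst e + z, snd e)) ` F"

lemma tau_depends_on: "depends_on UNIV (tau n R v h) (inner_edges (cyl_pts n R v h))"
  unfolding depends_on_def
proof (intro ballI impI)
  fix t t' :: "'a edge \<Rightarrow> real" assume eq: "\<forall>e\<in>inner_edges (cyl_pts n R v h). t e = t' e"
  have "V t (bd_edges U (cyl_pts n R v h)) = V t' (bd_edges U (cyl_pts n R v h))" for U
    unfolding V_def by (rule infsum_cong) (use eq bd_edges_sub_inner in \<open>metis subsetD\<close>)
  then show "tau n R v h t = tau n R v h t'" unfolding tau_eq_INF_colorings by simp
qed

lemma tau_le_V_inner: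
  assumes "hyperrect_normal R (v :: real^'d::finite)"
  shows "tau n R v h t \<le> V t (inner_edges (cyl_pts n R v h))"
proof -
  obtain U where "U \<in> colorings n R v h" using colorings_nonempty[OF assms] by blast
  then show ?thesis using order_trans[OF tau_le V_mono[OF bd_edges_sub_inner]] by blast
qed

text \<open>Second-order Taylor expansion, with \<open>exp \<xi>\<close> and
  \<open>w\<^sup>2\<close> each bounded by a multiple of \<open>exp (\<theta>0 * w / 2)\<close>. It
  turns one exponential moment at \<open>\<theta>0\<close> into a first-order expansion near
  \<open>0\<close>.\<close>

lemma exp_le_quadratic:
  fixes w \<theta> \<theta>0 :: real
  assumes "0 \<le> w" "0 < \<theta>" "2 * \<theta> \<le> \<theta>0"
  shows "exp (\<theta> * w) \<le> 1 + \<theta> * w + \<theta>\<^sup>2 * (4 / \<theta>0\<^sup>2) * exp (\<theta>0 * w)"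
proof -
  have \<theta>0: "0 < \<theta>0" using assms by simp
  obtain \<xi> where \<xi>: "\<bar>\<xi>\<bar> \<le> \<bar>\<theta> * w\<bar>" "exp (\<theta> * w) = (\<Sum>m<2. (\<theta> * w) ^ m / fact m) + (exp \<xi> / fact 2) * (\<theta> * w) ^ 2"
    using Maclaurin_exp_le[of "\<theta> * w" 2] by blast
  have "exp \<xi> \<le> exp (\<theta>0 / 2 * w)"
  proof -
    have "\<xi> \<le> \<theta> * w" using \<xi>(1) assms by simp
    also have "\<dots> \<le> \<theta>0 / 2 * w" using assms by (intro mult_right_mono) auto
    finally show ?thesis by simp
  qed
  moreover have "w\<^sup>2 \<le> 8 / \<theta>0\<^sup>2 * exp (\<theta>0 / 2 * w)"
  proof -
    have "(\<theta>0 / 2 * w)\<^sup>2 / 2 \<le> exp (\<theta>0 / 2 * w)"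
    proof -
      have "0 \<le> \<theta>0 / 2 * w" using assms \<theta>0 by simp
      then show ?thesis using exp_lower_Taylor_quadratic[of "\<theta>0 / 2 * w"] by linarith
    qed
    then show ?thesis using \<theta>0 by (simp add: field_simps power2_eq_square)
  qed
  ultimately have "exp \<xi> * w\<^sup>2 \<le> exp (\<theta>0 / 2 * w) * (8 / \<theta>0\<^sup>2 * exp (\<theta>0 / 2 * w))"
    by (intro mult_mono) auto
  also have "\<dots> = 8 / \<theta>0\<^sup>2 * exp (\<theta>0 * w)"
    by (simp add: mult.left_commute flip: exp_add)
  finally have "(exp \<xi> * w\<^sup>2) * (\<theta>\<^sup>2 / 2) \<le> (8 / \<theta>0\<^sup>2 * exp (\<theta>0 * w)) * (\<theta>\<^sup>2 / 2)"
    by (intro mult_right_mono) auto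
  moreover have "exp (\<theta> * w) = 1 + \<theta> * w + (exp \<xi> * w\<^sup>2) * (\<theta>\<^sup>2 / 2)"
    using \<xi>(2) by (simp add: numeral_2_eq_2 power_mult_distrib)
  ultimately show ?thesis by (simp add: algebra_simps)
qed

lemma emeasure_le_nn_integral_const:
  assumes "S \<in> sets M" "\<And>x. x \<in> S \<Longrightarrow> K \<le> f x"
  shows "K * emeasure M S \<le> (\<integral>\<^sup>+ x. f x \<partial>M)"
proof -
  have "K * emeasure M S = (\<integral>\<^sup>+ x. K * indicator S x \<partial>M)" using assms(1) by (simp add: nn_integral_cmult_indicator)
  also have "\<dots> \<le> (\<integral>\<^sup>+ x. f x \<partial>M)" by (rule nn_integral_mono) (auto simp: assms(2) indicator_def)
  finally show ?thesis .
qed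

section \<open>The law of the capacities and Chernoff bounds\<close>

locale capacity_law =
  fixes G :: "real measure" and \<theta>0 :: real
  assumes prob_G: "prob_space G" and sets_G: "sets G = sets borel"
    and \<theta>0_pos: "0 < \<theta>0" and exp_moment: "(\<integral>\<^sup>+ x. ennreal (exp (\<theta>0 * x)) \<partial>G) < \<infinity>"
begin

lemma space_G [simp]: "space G = UNIV"
  using sets_eq_imp_space_eq[OF sets_G] by simp

lemma space_cap [simp]: "space (cap_measure G) = UNIV"
  by (simp add: cap_measure_def space_PiM)

lemma prob_space_cap: "prob_space (cap_measure G)"
  unfolding cap_measure_def by (intro prob_space_PiM prob_G)

lemma coord_measurable [measurable]: "(\<lambda>t. t e) \<in> borel_measurable (cap_measure G)"
proof -
  have "(\<lambda>t. t e) \<in> measurable (PiM UNIV (\<lambda>_. G)) G" by (rule measurable_component_singleton) simp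
  then show ?thesis unfolding cap_measure_def using measurable_cong_sets[OF refl sets_G] by blast
qed

lemma nn_integral_coord:
  assumes "f \<in> borel_measurable borel"
  shows "(\<integral>\<^sup>+ t. f (t e) \<partial>(cap_measure G :: ('d::finite edge \<Rightarrow> real) measure)) = (\<integral>\<^sup>+ x. f x \<partial>G)"
proof -
  have D: "distr (cap_measure G) G (\<lambda>t. t e) = G"
    unfolding cap_measure_def using distr_PiM_component[of UNIV "\<lambda>_. G" e] prob_G by simp
  have m: "(\<lambda>t. t e) \<in> measurable (cap_measure G) G"
    unfolding cap_measure_def by (rule measurable_component_singleton) simp
  have "f \<in> borel_measurable G" using assms measurable_cong_sets[OF sets_G refl] by blast
  then have "(\<integral>\<^sup>+ x. f x \<partial>distr (cap_measure G) G (\<lambda>t. t e)) = (\<integral>\<^sup>+ t. f (t e) \<partial>cap_measure G)"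
    by (intro nn_integral_distr[OF m]) simp
  then show ?thesis by (simp add: D)
qed

lemma V_measurable [measurable]: "finite E \<Longrightarrow> (\<lambda>t. V t E) \<in> borel_measurable (cap_measure G)"
  by (simp add: V_finite)

lemma tau_measurable:
  assumes "hyperrect_normal R (v :: real^'d::finite)" "n \<ge> 1"
  shows "tau n R v h \<in> borel_measurable (cap_measure G)"
proof -
  have fin: "finite (cyl_pts n R v h)" by (rule finite_cyl_pts[OF assms])
  have "countable (colorings n R v h)"
    by (rule countable_finite, rule finite_subset[of _ "Pow (cyl_pts n R v h)"]) (auto simp: colorings_def fin)
  moreover have "finite (bd_edges U (cyl_pts n R v h))" for U
    by (rule finite_subset[OF bd_edges_sub_inner finite_inner_edges[OF fin]])
  ultimately have "(\<lambda>t. INF U \<in> colorings n R v h. V t (bd_edges U (cyl_pts n R v h))) \<in> borel_measurable (cap_measure G)"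
    by (intro borel_measurable_INF V_measurable) auto
  then show ?thesis unfolding tau_eq_INF_colorings[abs_def] .
qed

lemma distr_translate: "distr (cap_measure G) (cap_measure G) (translate z) = cap_measure G"
proof -
  have "distr (Pi\<^sub>M UNIV (\<lambda>_. G)) (\<Pi>\<^sub>M i\<in>UNIV. G) (\<lambda>\<omega>. \<lambda>e\<in>UNIV. \<omega> (fst e + z, snd e)) = (\<Pi>\<^sub>M i\<in>UNIV. G)"
    by (rule distr_PiM_reindex[of UNIV "\<lambda>_. G" "\<lambda>e. (fst e + z, snd e)" UNIV])
       (auto simp: prob_G inj_on_def)
  then show ?thesis by (simp add: cap_measure_def translate_def[abs_def] restrict_UNIV)
qed

lemma translate_measurable [measurable]: "translate z \<in> measurable (cap_measure G) (cap_measure G)"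
  unfolding cap_measure_def translate_def[abs_def]
  by (rule measurable_PiM_single') (auto intro: measurable_component_singleton)

lemma nn_integral_translate:
  assumes "f \<in> borel_measurable (cap_measure G)"
  shows "(\<integral>\<^sup>+ t. f (translate z t) \<partial>cap_measure G) = (\<integral>\<^sup>+ t. f t \<partial>cap_measure G)"
  using nn_integral_distr[OF translate_measurable, of f z] assms by (simp add: distr_translate)

lemma nn_integral_prod_disjoint:
  fixes g :: "'m \<Rightarrow> ('d::finite edge \<Rightarrow> real) \<Rightarrow> ennreal"
  assumes M: "finite M" and g: "\<And>m. m \<in> M \<Longrightarrow> g m \<in> borel_measurable (cap_measure G)"
    and dep: "\<And>m. m \<in> M \<Longrightarrow> depends_on UNIV (g m) (F m)" and disj: "disjoint_family_on F M"
  shows "(\<integral>\<^sup>+ t. (\<Prod>m\<in>M. g m t) \<partial>cap_measure G) = (\<Prod>m\<in>M. \<integral>\<^sup>+ t. g m t \<partial>cap_measure G)"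
proof -
  let ?P = "cap_measure G :: ('d edge \<Rightarrow> real) measure"
  interpret prob_space ?P by (rule prob_space_cap)
  have rv: "random_variable G (\<lambda>t. t e)" for e
    unfolding cap_measure_def by (rule measurable_component_singleton) simp
  have "distr ?P G (\<lambda>t. t e) = G" for e
    unfolding cap_measure_def using distr_PiM_component[of UNIV "\<lambda>_. G" e] prob_G by simp
  then have "distr ?P (Pi\<^sub>M UNIV (\<lambda>_. G)) (\<lambda>x. \<lambda>e\<in>UNIV. x e) = Pi\<^sub>M UNIV (\<lambda>e. distr ?P G (\<lambda>t. t e))"
    by (simp add: restrict_UNIV cap_measure_def distr_id[unfolded id_def])
  then have "indep_vars (\<lambda>_. G) (\<lambda>e t. t e) UNIV"
    by (subst indep_vars_iff_distr_eq_PiM) (auto simp: rv)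
  then have ind: "indep_vars (\<lambda>m. PiM (F m) (\<lambda>_. G)) (\<lambda>m t. restrict (\<lambda>e. t e) (F m)) M"
    by (rule indep_vars_restrict) (auto simp: disj)
  \<comment> \<open>Filling with \<open>0\<close> outside \<open>F m\<close> turns a configuration
    on \<open>F m\<close> into a full one, so that \<open>g m\<close> becomes a function of the
    restricted coordinates alone.\<close>
  define ext where "ext m u = (\<lambda>e. if e \<in> F m then u e else (0::real))" for m u
  have ext: "ext m \<in> measurable (PiM (F m) (\<lambda>_. G)) ?P" for m
    unfolding cap_measure_def ext_def
  proof (rule measurable_PiM_single')
    fix e
    show "(\<lambda>u. if e \<in> F m then u e else 0) \<in> measurable (PiM (F m) (\<lambda>_. G)) G"
      by (cases "e \<in> F m") (auto intro: measurable_component_singleton)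
  qed auto
  have "indep_vars (\<lambda>_. borel) (\<lambda>m t. g m (ext m (restrict (\<lambda>e. t e) (F m)))) M"
    by (rule indep_vars_compose2[OF ind]) (rule measurable_compose[OF ext g])
  moreover have eq: "g m (ext m (restrict (\<lambda>e. t e) (F m))) = g m t" if "m \<in> M" for m t
    using dep[OF that] unfolding depends_on_def by (auto simp: ext_def)
  ultimately have "indep_vars (\<lambda>_. borel) g M"
    by (subst indep_vars_cong[OF refl _ refl, of M g "\<lambda>m t. g m (ext m (restrict (\<lambda>e. t e) (F m)))"]) auto
  then show ?thesis by (intro indep_vars_nn_integral[OF M]) auto
qed

text \<open>\<open>V\<close> reads a capacity through \<open>ennreal\<close>, which sends negative
  values to \<open>0\<close>; hence the exponential moment of the positive part.\<close>

definition mgf :: real where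
  "mgf = enn2real (\<integral>\<^sup>+ x. ennreal (exp (\<theta>0 * max 0 x)) \<partial>G)"

lemma mgf_finite: "(\<integral>\<^sup>+ x. ennreal (exp (\<theta>0 * max 0 x)) \<partial>G) = ennreal mgf"
proof -
  have "(\<integral>\<^sup>+ x. ennreal (exp (\<theta>0 * max 0 x)) \<partial>G) \<le> (\<integral>\<^sup>+ x. 1 + ennreal (exp (\<theta>0 * x)) \<partial>G)"
  proof (rule nn_integral_mono)
    fix x
    have "exp (\<theta>0 * max 0 x) \<le> 1 + exp (\<theta>0 * x)" by (cases "0 \<le> x") (auto simp: max_def)
    then show "ennreal (exp (\<theta>0 * max 0 x)) \<le> 1 + ennreal (exp (\<theta>0 * x))"
      by (metis ennreal_1 ennreal_leI ennreal_plus exp_ge_zero zero_le_one)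
  qed
  also have "\<dots> = (\<integral>\<^sup>+ x. 1 \<partial>G) + (\<integral>\<^sup>+ x. ennreal (exp (\<theta>0 * x)) \<partial>G)"
    by (rule nn_integral_add) (simp_all add: measurable_cong_sets[OF sets_G refl])
  also have "\<dots> < \<infinity>" using exp_moment prob_space.emeasure_space_1[OF prob_G] by simp
  finally show ?thesis unfolding mgf_def by (simp add: less_top)
qed

lemma mgf_ge_1: "1 \<le> mgf"
proof -
  have "ennreal 1 \<le> (\<integral>\<^sup>+ x. 1 \<partial>G)" using prob_space.emeasure_space_1[OF prob_G] by simp
  also have "\<dots> \<le> (\<integral>\<^sup>+ x. ennreal (exp (\<theta>0 * max 0 x)) \<partial>G)"
    by (rule nn_integral_mono) (use \<theta>0_pos in \<open>simp flip: ennreal_1 add: ennreal_leI\<close>)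
  finally have "ennreal 1 \<le> ennreal mgf" by (simp only: mgf_finite)
  then show ?thesis by (simp add: mgf_def ennreal_le_iff)
qed

lemma V_real: "finite E \<Longrightarrow> V t E = ennreal (\<Sum>e\<in>E. max 0 (t e))"
proof -
  assume "finite E"
  have "ennreal (t e) = ennreal (max 0 (t e))" for e by (simp add: max_def ennreal_neg)
  then have "(\<Sum>e\<in>E. ennreal (t e)) = (\<Sum>e\<in>E. ennreal (max 0 (t e)))" by (rule sum.cong[OF refl])
  also have "\<dots> = ennreal (\<Sum>e\<in>E. max 0 (t e))" by (rule sum_ennreal) simp
  finally show ?thesis using \<open>finite E\<close> by (simp only: V_finite)
qed

lemma exp_V_integral:
  assumes "finite (E :: 'd::finite edge set)"
  shows "(\<integral>\<^sup>+ t. ennreal (exp (\<theta>0 * enn2real (V t E))) \<partial>cap_measure G) = ennreal (mgf ^ card E)"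
proof -
  have nn: "0 \<le> (\<Sum>e\<in>E. max 0 (t e))" for t :: "'d edge \<Rightarrow> real" by (simp add: sum_nonneg)
  have "(\<integral>\<^sup>+ t. ennreal (exp (\<theta>0 * enn2real (V t E))) \<partial>cap_measure G)
      = (\<integral>\<^sup>+ t. (\<Prod>e\<in>E. ennreal (exp (\<theta>0 * max 0 (t e)))) \<partial>cap_measure G)"
    using assms by (intro nn_integral_cong) (simp add: V_real nn sum_distrib_left exp_sum prod_ennreal)
  also have "\<dots> = (\<Prod>e\<in>E. \<integral>\<^sup>+ t. ennreal (exp (\<theta>0 * max 0 (t e))) \<partial>(cap_measure G :: ('d edge \<Rightarrow> real) measure))"
    using assms by (intro nn_integral_prod_disjoint[where F="\<lambda>e. {e}"]) (auto simp: depends_on_def disjoint_family_on_def)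
  also have "\<dots> = (\<Prod>e\<in>E. ennreal mgf)"
    by (intro prod.cong refl) (subst nn_integral_coord[where f="\<lambda>x. ennreal (exp (\<theta>0 * max 0 x))"], auto simp: mgf_finite)
  also have "\<dots> = ennreal (mgf ^ card E)" using mgf_ge_1 by (simp add: ennreal_power)
  finally show ?thesis .
qed

text \<open>Markov's inequality at the fixed exponent \<open>\<theta>0\<close>. It is applied to
  edge sets so small that \<open>card E * ln mgf\<close> is at most half of
  \<open>\<theta>0 * a\<close>.\<close>

lemma V_chernoff:
  assumes E: "finite (E :: 'd::finite edge set)" and a: "0 \<le> a"
  shows "emeasure (cap_measure G) {t. ennreal a \<le> V t E} \<le> ennreal (exp (- \<theta>0 * a) * mgf ^ card E)"
proof -
  let ?S = "{t. ennreal a \<le> V t E}"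
  have S: "?S \<in> sets (cap_measure G)"
    using measurable_sets[OF V_measurable[OF E], of "{ennreal a..}"] by (simp add: vimage_def)
  have "ennreal (exp (\<theta>0 * a)) * emeasure (cap_measure G) ?S \<le> (\<integral>\<^sup>+ t. ennreal (exp (\<theta>0 * enn2real (V t E))) \<partial>cap_measure G)"
  proof (rule emeasure_le_nn_integral_const[OF S])
    fix t assume "t \<in> ?S"
    then have "a \<le> enn2real (V t E)"
      using a by (simp add: V_real[OF E] sum_nonneg)
    then show "ennreal (exp (\<theta>0 * a)) \<le> ennreal (exp (\<theta>0 * enn2real (V t E)))"
      using \<theta>0_pos by (intro ennreal_leI) simp
  qed
  then have le: "ennreal (exp (\<theta>0 * a)) * emeasure (cap_measure G) ?S \<le> ennreal (mgf ^ card E)"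
    by (simp only: exp_V_integral[OF E])
  have "emeasure (cap_measure G) ?S = ennreal (exp (- \<theta>0 * a)) * (ennreal (exp (\<theta>0 * a)) * emeasure (cap_measure G) ?S)"
    by (simp add: mult.assoc[symmetric] ennreal_mult'[symmetric] exp_add[symmetric])
  also have "\<dots> \<le> ennreal (exp (- \<theta>0 * a)) * ennreal (mgf ^ card E)"
    by (rule mult_left_mono[OF le]) simp
  finally show ?thesis by (simp add: ennreal_mult')
qed

text \<open>An upper bound for the expected capacity rather than its value, from
  \<open>\<theta>0 * x \<le> exp (\<theta>0 * max 0 x)\<close>.\<close>

definition mean :: real where "mean = mgf / \<theta>0"

lemma mean_nonneg: "0 \<le> mean" using mgf_ge_1 \<theta>0_pos by (simp add: mean_def)

lemma V_mean_le:
  assumes E: "finite (E :: 'd::finite edge set)"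
  shows "(\<integral>\<^sup>+ t. V t E \<partial>cap_measure G) \<le> ennreal (real (card E) * mean)"
proof -
  have le: "(\<integral>\<^sup>+ x. ennreal x \<partial>G) \<le> ennreal mean"
  proof -
    have "(\<integral>\<^sup>+ x. ennreal x \<partial>G) \<le> (\<integral>\<^sup>+ x. ennreal (1 / \<theta>0) * ennreal (exp (\<theta>0 * max 0 x)) \<partial>G)"
    proof (rule nn_integral_mono)
      fix x
      have "\<theta>0 * x \<le> exp (\<theta>0 * max 0 x)"
        using exp_ge_add_one_self[of "\<theta>0 * max 0 x"] \<theta>0_pos mult_left_mono[of x "max 0 x" \<theta>0] by linarith
      then have "x \<le> 1 / \<theta>0 * exp (\<theta>0 * max 0 x)" using \<theta>0_pos by (simp add: field_simps)
      then show "ennreal x \<le> ennreal (1 / \<theta>0) * ennreal (exp (\<theta>0 * max 0 x))"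
        using \<theta>0_pos by (simp add: ennreal_leI flip: ennreal_mult')
    qed
    also have "\<dots> = ennreal (1 / \<theta>0) * (\<integral>\<^sup>+ x. ennreal (exp (\<theta>0 * max 0 x)) \<partial>G)"
      by (rule nn_integral_cmult) (simp add: measurable_cong_sets[OF sets_G refl])
    also have "\<dots> = ennreal mean" using \<theta>0_pos by (simp add: mgf_finite mean_def flip: ennreal_mult')
    finally show ?thesis .
  qed
  have "(\<integral>\<^sup>+ t. V t E \<partial>cap_measure G) = (\<Sum>e\<in>E. \<integral>\<^sup>+ t. ennreal (t e) \<partial>(cap_measure G :: ('d edge \<Rightarrow> real) measure))"
    using E by (simp add: V_finite nn_integral_sum)
  also have "\<dots> \<le> (\<Sum>e\<in>E. ennreal mean)"
    by (rule sum_mono) (simp add: nn_integral_coord le)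
  also have "\<dots> = ennreal (real (card E) * mean)"
    using mean_nonneg by (simp add: ennreal_mult ennreal_of_nat_eq_real_of_nat)
  finally show ?thesis .
qed

text \<open>One \<open>\<theta>\<close> serves all numbers and positions of blocks. The quadratic
  expansion bounds the moment of a block by \<open>1 + \<theta> * m + \<theta>\<^sup>2 * c\<close>,
  where \<open>m\<close> is its mean, and this is below
  \<open>exp (\<theta> * (m + \<epsilon>))\<close> once
  \<open>\<theta> * c \<le> \<epsilon>\<close>; independence of disjoint blocks multiplies the
  moments.\<close>

lemma block_chernoff:
  fixes X :: "('d::finite edge \<Rightarrow> real) \<Rightarrow> ennreal"
  assumes X: "X \<in> borel_measurable (cap_measure G)" and dep: "depends_on UNIV X F" and F: "finite F"
    and XV: "\<And>t. X t \<le> V t F" and \<epsilon>: "0 < \<epsilon>"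
  shows "\<exists>\<theta>>0. \<forall>(M :: 'm set) z a. finite M \<longrightarrow> disjoint_family_on (\<lambda>m. move_edges (z m) F) M \<longrightarrow> 0 \<le> a \<longrightarrow>
      emeasure (cap_measure G) {t. ennreal a \<le> (\<Sum>m\<in>M. X (translate (z m) t))}
      \<le> ennreal (exp (\<theta> * (real (card M) * (enn2real (\<integral>\<^sup>+ t. X t \<partial>cap_measure G) + \<epsilon>) - a)))"
proof -
  let ?P = "cap_measure G :: ('d edge \<Rightarrow> real) measure"
  interpret prob_space ?P by (rule prob_space_cap)
  define w where "w t = enn2real (X t)" for t
  have Xfin: "X t < \<infinity>" for t using XV[of t] by (simp add: V_real[OF F] order.strict_trans1)
  then have Xw: "X t = ennreal (w t)" for t unfolding w_def by (simp add: less_top)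
  have w0: "0 \<le> w t" for t by (simp add: w_def)
  have wm [measurable]: "w \<in> borel_measurable ?P" unfolding w_def using X by measurable
  define m where "m = enn2real (\<integral>\<^sup>+ t. X t \<partial>?P)"
  have "(\<integral>\<^sup>+ t. X t \<partial>?P) < \<infinity>"
    using order_trans[OF nn_integral_mono[of ?P X "\<lambda>t. V t F"] V_mean_le[OF F]] XV by (simp add: order.strict_trans1)
  then have Em: "(\<integral>\<^sup>+ t. ennreal (w t) \<partial>?P) = ennreal m" unfolding m_def Xw[symmetric] by (simp add: less_top)
  have m0: "0 \<le> m" by (simp add: m_def)
  define c where "c = 4 / \<theta>0\<^sup>2 * mgf ^ card F"
  have c: "0 < c" using \<theta>0_pos mgf_ge_1 by (simp add: c_def)
  \<comment> \<open>The first bound permits the quadratic expansion, the second makes its error at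
    most \<open>\<theta> * \<epsilon>\<close>.\<close>
  define \<theta> where "\<theta> = min (\<theta>0 / 2) (\<epsilon> / c)"
  have \<theta>: "0 < \<theta>" "2 * \<theta> \<le> \<theta>0" "\<theta> * c \<le> \<epsilon>"
  proof -
    show "0 < \<theta>" "2 * \<theta> \<le> \<theta>0" using \<theta>0_pos c \<epsilon> by (auto simp: \<theta>_def)
    have "\<theta> * c \<le> \<epsilon> / c * c" using c by (intro mult_right_mono) (auto simp: \<theta>_def)
    then show "\<theta> * c \<le> \<epsilon>" using c by simp
  qed
  define f where "f t = ennreal (exp (\<theta> * w t))" for t
  have fm [measurable]: "f \<in> borel_measurable ?P" unfolding f_def by measurable
  have If: "(\<integral>\<^sup>+ t. f t \<partial>?P) \<le> ennreal (exp (\<theta> * (m + \<epsilon>)))"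
  proof -
    have "(\<integral>\<^sup>+ t. f t \<partial>?P) \<le> (\<integral>\<^sup>+ t. 1 + (ennreal \<theta> * ennreal (w t) + ennreal (\<theta>\<^sup>2 * (4 / \<theta>0\<^sup>2)) * ennreal (exp (\<theta>0 * enn2real (V t F)))) \<partial>?P)"
    proof (rule nn_integral_mono)
      fix t
      have "w t \<le> enn2real (V t F)"
        unfolding w_def using XV[of t] by (intro enn2real_mono) (simp_all add: V_real[OF F])
      then have "exp (\<theta>0 * w t) \<le> exp (\<theta>0 * enn2real (V t F))" using \<theta>0_pos by simp
      then have "\<theta>\<^sup>2 * (4 / \<theta>0\<^sup>2) * exp (\<theta>0 * w t) \<le> \<theta>\<^sup>2 * (4 / \<theta>0\<^sup>2) * exp (\<theta>0 * enn2real (V t F))"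
        by (intro mult_left_mono) auto
      then have "exp (\<theta> * w t) \<le> 1 + (\<theta> * w t + \<theta>\<^sup>2 * (4 / \<theta>0\<^sup>2) * exp (\<theta>0 * enn2real (V t F)))"
        using exp_le_quadratic[OF w0 \<theta>(1,2), of t] by linarith
      then show "f t \<le> 1 + (ennreal \<theta> * ennreal (w t) + ennreal (\<theta>\<^sup>2 * (4 / \<theta>0\<^sup>2)) * ennreal (exp (\<theta>0 * enn2real (V t F))))"
        unfolding f_def using \<theta> w0[of t]
        by (simp add: ennreal_leI flip: ennreal_mult' ennreal_plus ennreal_1)
    qed
    also have "\<dots> = 1 + (ennreal \<theta> * (\<integral>\<^sup>+ t. ennreal (w t) \<partial>?P) + ennreal (\<theta>\<^sup>2 * (4 / \<theta>0\<^sup>2)) * (\<integral>\<^sup>+ t. ennreal (exp (\<theta>0 * enn2real (V t F))) \<partial>?P))"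
      using F by (simp add: nn_integral_add nn_integral_cmult emeasure_space_1[simplified])
    also have "\<dots> = ennreal (1 + (\<theta> * m + \<theta>\<^sup>2 * c))"
    proof -
      have "ennreal \<theta> * ennreal m = ennreal (\<theta> * m)" using \<theta> by (simp add: ennreal_mult')
      moreover have "ennreal (\<theta>\<^sup>2 * (4 / \<theta>0\<^sup>2)) * ennreal (mgf ^ card F) = ennreal (\<theta>\<^sup>2 * c)"
        unfolding c_def by (subst ennreal_mult'[symmetric]) (auto simp: mult.assoc)
      ultimately show ?thesis
        unfolding Em exp_V_integral[OF F] using \<theta> m0 c by (simp add: ennreal_plus)
    qed
    also have "\<dots> \<le> ennreal (exp (\<theta> * (m + \<epsilon>)))"
    proof (rule ennreal_leI)
      have "1 + (\<theta> * m + \<theta>\<^sup>2 * c) \<le> 1 + \<theta> * (m + \<epsilon>)"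
        using \<theta>(3) mult_left_mono[OF \<theta>(3), of \<theta>] \<theta>(1) by (simp add: algebra_simps power2_eq_square)
      also have "\<dots> \<le> exp (\<theta> * (m + \<epsilon>))" by (rule exp_ge_add_one_self)
      finally show "1 + (\<theta> * m + \<theta>\<^sup>2 * c) \<le> exp (\<theta> * (m + \<epsilon>))" .
    qed
    finally show ?thesis .
  qed
  have main: "emeasure ?P {t. ennreal a \<le> (\<Sum>k\<in>M. X (translate (z k) t))} \<le> ennreal (exp (\<theta> * (real (card M) * (m + \<epsilon>) - a)))"
    if M: "finite M" and disj: "disjoint_family_on (\<lambda>k. move_edges (z k) F) M" and a: "0 \<le> a" for M :: "'m set" and z a
  proof -
    let ?S = "{t. ennreal a \<le> (\<Sum>k\<in>M. X (translate (z k) t))}"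
    have "(\<lambda>t. \<Sum>k\<in>M. X (translate (z k) t)) \<in> borel_measurable ?P"
      by (intro borel_measurable_sum measurable_compose[OF translate_measurable X])
    then have S: "?S \<in> sets ?P"
      using measurable_sets[of _ ?P borel "{ennreal a..}"] by (fastforce simp: vimage_def)
    have "ennreal (exp (\<theta> * a)) * emeasure ?P ?S \<le> (\<integral>\<^sup>+ t. (\<Prod>k\<in>M. f (translate (z k) t)) \<partial>?P)"
    proof (rule emeasure_le_nn_integral_const[OF S])
      fix t assume "t \<in> ?S"
      then have "a \<le> (\<Sum>k\<in>M. w (translate (z k) t))"
        using w0 by (simp add: Xw sum_nonneg)
      then have "\<theta> * a \<le> (\<Sum>k\<in>M. \<theta> * w (translate (z k) t))"
        using \<theta>(1) by (simp add: sum_distrib_left[symmetric])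
      then show "ennreal (exp (\<theta> * a)) \<le> (\<Prod>k\<in>M. f (translate (z k) t))"
        using M by (simp add: f_def prod_ennreal exp_sum[symmetric] ennreal_leI)
    qed
    also have "\<dots> = (\<Prod>k\<in>M. \<integral>\<^sup>+ t. f (translate (z k) t) \<partial>?P)"
    proof (rule nn_integral_prod_disjoint[OF M _ _ disj])
      show "(\<lambda>t. f (translate (z k) t)) \<in> borel_measurable ?P" for k
        by (rule measurable_compose[OF translate_measurable fm])
      show "depends_on UNIV (\<lambda>t. f (translate (z k) t)) (move_edges (z k) F)" for k
        unfolding depends_on_def
      proof (intro ballI impI)
        fix t t' :: "'d edge \<Rightarrow> real" assume "\<forall>e\<in>move_edges (z k) F. t e = t' e"
        then have "\<forall>e\<in>F. translate (z k) t e = translate (z k) t' e" by (simp add: move_edges_def translate_def)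
        then have "X (translate (z k) t) = X (translate (z k) t')" using dep unfolding depends_on_def by blast
        then show "f (translate (z k) t) = f (translate (z k) t')" by (simp add: f_def w_def)
      qed
    qed
    also have "\<dots> = (\<integral>\<^sup>+ t. f t \<partial>?P) ^ card M" by (simp add: nn_integral_translate)
    also have "\<dots> \<le> ennreal (exp (\<theta> * (m + \<epsilon>))) ^ card M" by (rule power_mono[OF If]) simp
    also have "\<dots> = ennreal (exp (real (card M) * (\<theta> * (m + \<epsilon>))))" by (simp add: ennreal_power exp_of_nat_mult)
    finally have le: "ennreal (exp (\<theta> * a)) * emeasure ?P ?S \<le> ennreal (exp (real (card M) * (\<theta> * (m + \<epsilon>))))" .
    have "emeasure ?P ?S = ennreal (exp (- \<theta> * a)) * (ennreal (exp (\<theta> * a)) * emeasure ?P ?S)"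
      by (simp add: mult.assoc[symmetric] ennreal_mult'[symmetric] exp_add[symmetric])
    also have "\<dots> \<le> ennreal (exp (- \<theta> * a)) * ennreal (exp (real (card M) * (\<theta> * (m + \<epsilon>))))"
      by (rule mult_left_mono[OF le]) simp
    also have "\<dots> = ennreal (exp (\<theta> * (real (card M) * (m + \<epsilon>) - a)))"
      by (simp add: ennreal_mult'[symmetric] exp_add[symmetric] algebra_simps)
    finally show ?thesis .
  qed
  show ?thesis by (intro exI[of _ \<theta>] conjI allI impI \<theta>(1)) (use main in \<open>simp add: m_def\<close>)
qed

end

section \<open>Tiling a cylinder by lattice translates\<close>

text \<open>The cylinder after multiplication by the scale. In these coordinates the lattice has
  mesh one at every scale, so a block of scale \<open>K\<close> can be placed inside a cylinder of
  scale \<open>N\<close> by an integer translation.\<close>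

definition lbox :: "('d::finite \<Rightarrow> real^'d) \<Rightarrow> 'd \<Rightarrow> real^'d \<Rightarrow> ('d \<Rightarrow> real) \<Rightarrow> real \<Rightarrow> (int^'d) set" where
  "lbox b i0 C \<alpha> H = {z. \<bar>inner (rvec z - C) (b i0)\<bar> \<le> H \<and>
     (\<forall>i. i \<noteq> i0 \<longrightarrow> 0 \<le> inner (rvec z - C) (b i) \<and> inner (rvec z - C) (b i) \<le> \<alpha> i)}"

text \<open>The condition of \<open>colorings\<close> in these coordinates; boundary sites at height
  exactly \<open>0\<close> are free.\<close>

definition lcol :: "('d::finite \<Rightarrow> real^'d) \<Rightarrow> 'd \<Rightarrow> real^'d \<Rightarrow> ('d \<Rightarrow> real) \<Rightarrow> real \<Rightarrow> (int^'d) set \<Rightarrow> bool" where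
  "lcol b i0 C \<alpha> H U \<longleftrightarrow> U \<subseteq> lbox b i0 C \<alpha> H \<and>
     (\<forall>z w. z \<in> lbox b i0 C \<alpha> H \<longrightarrow> adj z w \<longrightarrow> w \<notin> lbox b i0 C \<alpha> H \<longrightarrow>
        (0 < inner (rvec z - C) (b i0) \<longrightarrow> z \<notin> U) \<and> (inner (rvec z - C) (b i0) < 0 \<longrightarrow> z \<in> U))"

lemma pt_inner_scale: "n \<ge> 1 \<Longrightarrow> inner (rvec z - real n *\<^sub>R c) v = real n * inner (pt n z - c) v"
  by (simp add: pt_eq_rvec inner_diff_left algebra_simps)

lemma cyl_pts_frect:
  assumes "onb b" "n \<ge> 1"
  shows "cyl_pts n (frect b i0 c a) (b i0) h = lbox b i0 (real n *\<^sub>R c) (\<lambda>i. real n * a i) (real n * h)"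
  using assms(2) unfolding cyl_frect[OF assms(1)]
  by (auto simp: lbox_def fcyl_def pt_inner_scale abs_le_iff zero_le_mult_iff abs_mult)

lemma colorings_frect:
  assumes "onb b" "n \<ge> 1"
  shows "U \<in> colorings n (frect b i0 c a) (b i0) h \<longleftrightarrow> lcol b i0 (real n *\<^sub>R c) (\<lambda>i. real n * a i) (real n * h) U"
proof -
  let ?D = "lbox b i0 (real n *\<^sub>R c) (\<lambda>i. real n * a i) (real n * h)"
  let ?R = "frect b i0 c a"
  note D = cyl_pts_frect[OF assms, of i0 c a h]
  have Dm: "pt n z \<in> cyl ?R (b i0) h \<longleftrightarrow> z \<in> ?D" for z using D by blast
  have 1: "pt n z \<in> cyl_C1 ?R (b i0) h \<longleftrightarrow> z \<in> ?D \<and> 0 < inner (rvec z - real n *\<^sub>R c) (b i0)" for z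
    using assms(2) unfolding Dm[symmetric] cyl_frect[OF assms(1)] cyl_C1_frect[OF assms(1)]
    by (auto simp: fcyl_def pt_inner_scale zero_less_mult_iff)
  have 2: "pt n z \<in> cyl_C2 ?R (b i0) h \<longleftrightarrow> z \<in> ?D \<and> inner (rvec z - real n *\<^sub>R c) (b i0) < 0" for z
    using assms(2) unfolding Dm[symmetric] cyl_frect[OF assms(1)] cyl_C2_frect[OF assms(1)]
    by (auto simp: fcyl_def pt_inner_scale mult_less_0_iff)
  show ?thesis unfolding colorings_def lcol_def boundary_pts_def Dm 1 2 by auto
qed

lemma prod_if_two:
  fixes x y :: "'d::finite" and f g h :: real
  assumes "y \<noteq> x"
  shows "(\<Prod>k\<in>UNIV. if k = x then f else if k = y then g else h) = f * g * h ^ (CARD('d) - 2)"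
proof -
  have "(\<Prod>k\<in>UNIV. if k = x then f else if k = y then g else h) = f * (\<Prod>k\<in>UNIV - {x}. if k = x then f else if k = y then g else h)"
    by (subst prod.remove[of _ x]) auto
  also have "(\<Prod>k\<in>UNIV - {x}. if k = x then f else if k = y then g else h) = g * (\<Prod>k\<in>UNIV - {x} - {y}. if k = x then f else if k = y then g else h)"
    using assms by (subst prod.remove[of _ y]) auto
  also have "(\<Prod>k\<in>UNIV - {x} - {y}. if k = x then f else if k = y then g else h) = (\<Prod>k\<in>UNIV - {x} - {y}. h)"
    by (rule prod.cong) auto
  also have "\<dots> = h ^ (CARD('d) - 2)" using assms by (simp add: card_Diff_insert numeral_2_eq_2)
  finally show ?thesis by simp
qed

lemma other_index:
  assumes "CARD('d::finite) \<ge> 2"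
  shows "\<exists>k. k \<noteq> (i :: 'd)"
proof (rule ccontr)
  assume "\<not> ?thesis"
  then have "UNIV = {i}" by auto
  then have "CARD('d) = 1" by (metis card_1_singleton_iff One_nat_def)
  with assms show False by simp
qed

text \<open>Unprimed data describe the small block, primed data the large cylinder; their frames
  need to share only the normal direction. The bound on \<open>H\<close> leaves room for heights up
  to \<open>\<rho> + 1\<close>, one lattice step and a rounding error \<open>\<rho>\<close>; the
  bound on \<open>H'\<close> lets a rounded block fit inside together with its neighbours.\<close>

locale tile_setup =
  fixes b b' :: "'d::finite \<Rightarrow> real^'d" and i0 i0' :: 'd and C C' :: "real^'d"
    and \<alpha> \<alpha>' :: "'d \<Rightarrow> real" and H H' \<rho> :: real
  assumes b: "onb b" and b': "onb b'" and bb: "b' i0' = b i0"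
    and \<alpha>: "\<And>i. i \<noteq> i0 \<Longrightarrow> 0 < \<alpha> i" and \<alpha>': "\<And>j. j \<noteq> i0' \<Longrightarrow> 0 < \<alpha>' j"
    and \<rho>: "\<rho> = sqrt (real CARD('d))" and H: "2 * \<rho> + 2 \<le> H" and H': "H + \<rho> + 1 \<le> H'"
    and d2: "CARD('d) \<ge> 2"
begin

abbreviation "D \<equiv> lbox b i0 C \<alpha> H"
abbreviation "D' \<equiv> lbox b' i0' C' \<alpha>' H'"

text \<open>The period of the tiling: each of two adjacent blocks may shift by \<open>\<rho>\<close>
  through rounding, and the extra \<open>1\<close> keeps them disjoint.\<close>

definition p :: "'d \<Rightarrow> real" where "p i = \<alpha> i + 2 * \<rho> + 1"

definition s :: "int^'d \<Rightarrow> 'd \<Rightarrow> real" where "s z i = inner (rvec z - C') (b i)"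

lemma \<rho>_ge: "1 \<le> \<rho>" using d2 by (simp add: \<rho>)

lemma p_pos: "i \<noteq> i0 \<Longrightarrow> 0 < p i" using \<alpha>[of i] \<rho>_ge by (simp add: p_def)

definition corner :: "('d \<Rightarrow> int) \<Rightarrow> real^'d" where
  "corner m = C' + (\<Sum>i\<in>UNIV. (if i = i0 then 0 else of_int (m i) * p i) *\<^sub>R b i)"

lemma corner_inner: "inner (corner m - C') (b i) = (if i = i0 then 0 else of_int (m i) * p i)"
  unfolding corner_def using onb_sum_inner[OF b] by simp

text \<open>Tiles are moved by integer vectors, so that all cells carry the same law; rounding costs at most the
  distance \<open>\<rho>\<close>, which is absorbed by leaving gaps between the tiles.\<close>

definition zz :: "('d \<Rightarrow> int) \<Rightarrow> int^'d" where
  "zz m = (\<chi> j. \<lfloor>(corner m - C) $ j\<rfloor>)"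

definition \<delta> :: "('d \<Rightarrow> int) \<Rightarrow> 'd \<Rightarrow> real" where
  "\<delta> m i = inner (corner m - C - rvec (zz m)) (b i)"

lemma \<delta>_le: "\<bar>\<delta> m i\<bar> \<le> \<rho>"
proof -
  have "\<bar>inner (corner m - C - rvec (zz m)) (axis j 1)\<bar> \<le> 1" for j
    by (simp add: inner_axis rvec_def zz_def) linarith
  then have "norm (corner m - C - rvec (zz m)) \<le> \<rho>"
    using onb_norm_le[OF onb_axis, of "corner m - C - rvec (zz m)" 1] by (simp add: \<rho>)
  then show ?thesis unfolding \<delta>_def using onb_inner_le[OF b] order_trans by blast
qed

lemma cell_coord: "inner (rvec (z - zz m) - C) (b i) = s z i - (if i = i0 then 0 else of_int (m i) * p i) + \<delta> m i"
proof -
  have "rvec (z - zz m) = rvec z - rvec (zz m)" by (simp add: rvec_def vec_eq_iff)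
  then have "rvec (z - zz m) - C = (rvec z - C') - (corner m - C') + (corner m - C - rvec (zz m))" by simp
  then have "inner (rvec (z - zz m) - C) (b i) = s z i - inner (corner m - C') (b i) + \<delta> m i"
    unfolding s_def \<delta>_def by (simp only: inner_add_left inner_diff_left[of "rvec z - C'" "corner m - C'"])
  then show ?thesis by (simp only: corner_inner)
qed

lemma cell_bounds:
  assumes "z - zz m \<in> D"
  shows "\<bar>s z i0\<bar> \<le> H + \<rho>"
    and "i \<noteq> i0 \<Longrightarrow> of_int (m i) * p i - \<rho> \<le> s z i" "i \<noteq> i0 \<Longrightarrow> s z i \<le> of_int (m i) * p i + \<alpha> i + \<rho>"
proof -
  have *: "\<bar>inner (rvec (z - zz m) - C) (b i0)\<bar> \<le> H"
    "\<And>i. i \<noteq> i0 \<Longrightarrow> 0 \<le> inner (rvec (z - zz m) - C) (b i) \<and> inner (rvec (z - zz m) - C) (b i) \<le> \<alpha> i"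
    using assms unfolding lbox_def by auto
  show "\<bar>s z i0\<bar> \<le> H + \<rho>" using *(1) \<delta>_le[of m i0] unfolding cell_coord by simp
  show "i \<noteq> i0 \<Longrightarrow> of_int (m i) * p i - \<rho> \<le> s z i" "i \<noteq> i0 \<Longrightarrow> s z i \<le> of_int (m i) * p i + \<alpha> i + \<rho>"
    using *(2)[of i] \<delta>_le[of m i] unfolding cell_coord by auto
qed

lemma cell_unique:
  assumes "z - zz m \<in> D" "z - zz m' \<in> D" "m i0 = m' i0"
  shows "m = m'"
proof
  fix i
  show "m i = m' i"
  proof (cases "i = i0")
    case False
    have "False" if lt: "k < l" and k: "s z i \<le> of_int k * p i + \<alpha> i + \<rho>" and l: "of_int l * p i - \<rho> \<le> s z i" for k l :: int
    proof -
      have "of_int (k + 1) * p i \<le> of_int l * p i"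
        using lt p_pos[OF False] by (intro mult_right_mono) auto
      then show False using k l by (simp add: p_def algebra_simps)
    qed
    from this[of "m i" "m' i"] this[of "m' i" "m i"] show ?thesis
      using cell_bounds(2,3)[OF assms(1) False] cell_bounds(2,3)[OF assms(2) False] by force
  qed (use assms in simp)
qed

text \<open>Cells that stay over the base of the large cylinder even when enlarged by
  \<open>\<rho> + 1\<close>, which accounts for rounding and one lattice step. Fixing
  \<open>m i0 = 0\<close> makes the index of a cell unique.\<close>

definition M :: "('d \<Rightarrow> int) set" where
  "M = {m. m i0 = 0 \<and> (\<forall>x. (\<forall>i. i \<noteq> i0 \<longrightarrow> of_int (m i) * p i - \<rho> - 1 \<le> inner (x - C') (b i) \<and>
            inner (x - C') (b i) \<le> of_int (m i) * p i + \<alpha> i + \<rho> + 1) \<longrightarrow>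
          (\<forall>j. j \<noteq> i0' \<longrightarrow> 0 \<le> inner (x - C') (b' j) \<and> inner (x - C') (b' j) \<le> \<alpha>' j))}"

lemma M_unique: "m \<in> M \<Longrightarrow> m' \<in> M \<Longrightarrow> z - zz m \<in> D \<Longrightarrow> z - zz m' \<in> D \<Longrightarrow> m = m'"
  by (rule cell_unique) (auto simp: M_def)

lemma s_i0: "s z i0 = inner (rvec z - C') (b' i0')" by (simp add: s_def bb)

lemma s_adj: "adj z w \<Longrightarrow> \<bar>s w i - s z i\<bar> \<le> 1"
  unfolding s_def by (rule adj_rvec_inner) (simp_all add: onb_norm[OF b])

lemma cell_adj_in_D':
  assumes m: "m \<in> M" and z: "z - zz m \<in> D" and zw: "adj z w"
  shows "w \<in> D'"
proof -
  have "of_int (m i) * p i - \<rho> - 1 \<le> inner (rvec w - C') (b i) \<and> inner (rvec w - C') (b i) \<le> of_int (m i) * p i + \<alpha> i + \<rho> + 1"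
    if "i \<noteq> i0" for i
    using cell_bounds(2,3)[OF z that] s_adj[OF zw, of i] by (simp add: s_def abs_le_iff)
  then have "\<forall>j. j \<noteq> i0' \<longrightarrow> 0 \<le> inner (rvec w - C') (b' j) \<and> inner (rvec w - C') (b' j) \<le> \<alpha>' j"
    using m unfolding M_def by blast
  moreover have "\<bar>s w i0\<bar> \<le> H'" using cell_bounds(1)[OF z] s_adj[OF zw, of i0] H' by simp
  ultimately show ?thesis by (simp add: lbox_def s_i0)
qed

text \<open>Before rounding, the tiles are disjoint rectangles inside the base of the large
  cylinder, so comparing areas bounds the number of blocks with the sharp constant, whatever the
  angle between the frames.\<close>

lemma packing:
  assumes F: "finite F" "F \<subseteq> M"
  shows "real (card F) * (\<Prod>i\<in>UNIV - {i0}. \<alpha> i) \<le> (\<Prod>j\<in>UNIV - {i0'}. \<alpha>' j)"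
proof -
  let ?s = "codim1 TYPE('d)" and ?\<mu> = "hausdorff_measure (codim1 TYPE('d)) :: (real^'d) measure"
  have spos: "0 < ?s" using d2 by simp
  define T where "T m = frect b i0 (corner m) \<alpha>" for m
  have Tb: "T m \<in> sets borel" for m by (simp add: T_def closed_frect)
  have coord: "inner (x - C') (b i) = inner (x - corner m) (b i) + (if i = i0 then 0 else of_int (m i) * p i)" for x m i
    using corner_inner[of m i] by (simp add: inner_diff_left)
  have Tm: "x \<in> T m \<longleftrightarrow> inner (x - C') (b i0) = 0 \<and> (\<forall>i. i \<noteq> i0 \<longrightarrow> of_int (m i) * p i \<le> inner (x - C') (b i)
      \<and> inner (x - C') (b i) \<le> of_int (m i) * p i + \<alpha> i)" for x m
    unfolding T_def frect_def by (auto simp: coord[of x _ m])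
  have disj: "disjoint_family_on T F"
  proof (unfold disjoint_family_on_def, intro ballI impI)
    fix m m' assume mm: "m \<in> F" "m' \<in> F" "m \<noteq> m'"
    then obtain i where i: "m i \<noteq> m' i" by auto
    moreover have "m i0 = 0" "m' i0 = 0" using mm F(2) unfolding M_def by blast+
    ultimately have i0: "i \<noteq> i0" by auto
    have "False" if lt: "k < l" and "y \<le> of_int k * p i + \<alpha> i" "of_int l * p i \<le> y" for k l :: int and y
    proof -
      have "of_int (k + 1) * p i \<le> of_int l * p i"
        using lt p_pos[OF i0] by (intro mult_right_mono) auto
      then show False using that \<rho>_ge by (simp add: p_def algebra_simps)
    qed
    from this[of "m i" "m' i"] this[of "m' i" "m i"] i show "T m \<inter> T m' = {}"
      unfolding Tm disjoint_iff using i0 by (meson linorder_neqE)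
  qed
  have sub: "(\<Union>m\<in>F. T m) \<subseteq> frect b' i0' C' \<alpha>'"
  proof clarify
    fix x m assume m: "m \<in> F" and x: "x \<in> T m"
    have "\<forall>i. i \<noteq> i0 \<longrightarrow> of_int (m i) * p i - \<rho> - 1 \<le> inner (x - C') (b i) \<and> inner (x - C') (b i) \<le> of_int (m i) * p i + \<alpha> i + \<rho> + 1"
      using x \<rho>_ge unfolding Tm by force
    then have "\<forall>j. j \<noteq> i0' \<longrightarrow> 0 \<le> inner (x - C') (b' j) \<and> inner (x - C') (b' j) \<le> \<alpha>' j"
      using m F unfolding M_def by blast
    then show "x \<in> frect b' i0' C' \<alpha>'" using x unfolding Tm by (simp add: frect_def bb)
  qed
  let ?c = "hbox_const TYPE('d)"
  have pos: "0 \<le> (\<Prod>i\<in>UNIV - {i0}. \<alpha> i)" "0 \<le> (\<Prod>j\<in>UNIV - {i0'}. \<alpha>' j)"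
    using \<alpha> \<alpha>' by (auto intro!: prod_nonneg dest: less_imp_le)
  have eT: "emeasure ?\<mu> (T m) = ennreal (?c * (\<Prod>i\<in>UNIV - {i0}. \<alpha> i))" for m
    using Tb[of m] \<alpha> by (simp add: emeasure_hausdorff_measure[OF spos] T_def frect_outer[OF d2 b] less_imp_le)
  have "(\<Sum>m\<in>F. emeasure ?\<mu> (T m)) = emeasure ?\<mu> (\<Union>m\<in>F. T m)"
    by (rule sum_emeasure) (use Tb disj F in auto)
  also have "\<dots> \<le> emeasure ?\<mu> (frect b' i0' C' \<alpha>')"
    by (rule emeasure_mono[OF sub]) (simp add: closed_frect)
  also have "\<dots> = ennreal (?c * (\<Prod>j\<in>UNIV - {i0'}. \<alpha>' j))"
    using \<alpha>' by (subst emeasure_hausdorff_measure[OF spos]) (simp_all add: closed_frect frect_outer[OF d2 b'] less_imp_le)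
  finally have "ennreal (real (card F) * (?c * (\<Prod>i\<in>UNIV - {i0}. \<alpha> i))) \<le> ennreal (?c * (\<Prod>j\<in>UNIV - {i0'}. \<alpha>' j))"
    using hbox_const_pos[OF d2] pos by (simp add: eT ennreal_mult' ennreal_of_nat_eq_real_of_nat)
  then have "?c * (real (card F) * (\<Prod>i\<in>UNIV - {i0}. \<alpha> i)) \<le> ?c * (\<Prod>j\<in>UNIV - {i0'}. \<alpha>' j)"
    using hbox_const_pos[OF d2] pos by (simp add: ennreal_le_iff mult.left_commute)
  then show ?thesis using hbox_const_pos[OF d2] by simp
qed

lemma finite_M: "finite M"
proof -
  let ?a = "\<Prod>i\<in>UNIV - {i0}. \<alpha> i" and ?a' = "\<Prod>j\<in>UNIV - {i0'}. \<alpha>' j"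
  have a: "0 < ?a" using \<alpha> by (intro prod_pos) auto
  have "card F \<le> nat \<lceil>?a' / ?a\<rceil>" if "F \<subseteq> M" "finite F" for F
  proof -
    have "real (card F) \<le> ?a' / ?a" using packing[OF that(2,1)] a by (simp add: field_simps)
    then show ?thesis by linarith
  qed
  then show ?thesis by (rule finite_if_finite_subsets_card_bdd[THEN conjunct1, rotated]) auto
qed

text \<open>Sites near the middle hyperplane that lie deep inside no cell of \<open>M\<close>. The
  margin \<open>\<rho> + 1\<close> allows for rounding and one step: a site near that hyperplane
  that respects it has all its neighbours in the same block.\<close>

definition Gap :: "(int^'d) set" where
  "Gap = {z \<in> D'. \<bar>s z i0\<bar> \<le> \<rho> + 1 \<and> (\<forall>m\<in>M. \<exists>i. i \<noteq> i0 \<and>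
     \<not> (of_int (m i) * p i + \<rho> + 1 \<le> s z i \<and> s z i \<le> of_int (m i) * p i + \<alpha> i - \<rho> - 1))}"

definition glue :: "(('d \<Rightarrow> int) \<Rightarrow> (int^'d) set) \<Rightarrow> (int^'d) set" where
  "glue W = {z \<in> D'. (\<exists>m\<in>M. z - zz m \<in> D \<and> z - zz m \<in> W m) \<or> (\<forall>m\<in>M. z - zz m \<notin> D) \<and> s z i0 \<le> 0}"

lemma adj_translate: "adj (z - x) (w - x) \<longleftrightarrow> adj z w"
proof -
  have "w - x = shift (z - x) i \<longleftrightarrow> w = shift z i" for z w i
    using shift_add[of "z - x" x i] by (metis add_diff_cancel diff_add_cancel)
  then show ?thesis by (simp add: uses_edge_def)
qed

text \<open>The blocks of \<open>M\<close> keep away from the outer boundary of the large cylinder,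
  so only the flat half-space is seen there.\<close>

lemma lcol_glue: "lcol b' i0' C' \<alpha>' H' (glue W)"
proof -
  have "z - zz m \<notin> D" if "z \<in> D'" "adj z w" "w \<notin> D'" "m \<in> M" for z w m
    using cell_adj_in_D'[OF that(4) _ that(2)] that(3) by blast
  then show ?thesis unfolding lcol_def glue_def s_i0 by fastforce
qed

text \<open>An edge inside one block comes from the cut of that block. For any other step from
  \<open>z\<close> in \<open>glue W\<close> to \<open>w\<close> outside, the boundary conditions of
  the blocks force \<open>z\<close> low and \<open>w\<close> high, so the edge is near the middle
  hyperplane and \<open>z\<close> belongs to \<open>Gap\<close>.\<close>

lemma bd_edges_glue:
  assumes W: "\<And>m. m \<in> M \<Longrightarrow> lcol b i0 C \<alpha> H (W m)"
  shows "bd_edges (glue W) D' \<subseteq> (\<Union>m\<in>M. move_edges (zz m) (bd_edges (W m) D)) \<union> touching Gap"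
proof (rule bd_edges_sub)
  fix z w assume zw: "z \<in> D'" "w \<in> D'" "adj z w" "z \<in> glue W" "w \<notin> glue W"
  let ?E = "(\<Union>m\<in>M. move_edges (zz m) (bd_edges (W m) D)) \<union> touching Gap"
  show "uses_edge ?E z w"
  proof (cases "\<exists>m\<in>M. z - zz m \<in> D \<and> w - zz m \<in> D")
    case True
    then obtain m where m: "m \<in> M" "z - zz m \<in> D" "w - zz m \<in> D" by blast
    have "z - zz m \<in> W m" using zw(4) m M_unique unfolding glue_def by blast
    moreover have "w - zz m \<notin> W m" using zw(2,5) m unfolding glue_def by blast
    ultimately have edge: "uses_edge (bd_edges (W m) D) (z - zz m) (w - zz m)"
      using zw(3) m unfolding adj_translate[of z "zz m" w, symmetric] by (auto simp: uses_edge_def bd_edges_def)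
    have mv: "(y, i) \<in> move_edges (zz m) (bd_edges (W m) D)" if "(y - zz m, i) \<in> bd_edges (W m) D" for y i
      unfolding move_edges_def by (rule image_eqI[OF _ that]) simp
    have sh: "x - zz m = shift (y - zz m) i \<Longrightarrow> x = shift y i" for x y i
      using shift_add[of "y - zz m" "zz m" i] by (metis diff_add_cancel)
    from edge obtain i where "(z - zz m, i) \<in> bd_edges (W m) D \<and> w - zz m = shift (z - zz m) i \<or>
        (w - zz m, i) \<in> bd_edges (W m) D \<and> z - zz m = shift (w - zz m) i"
      unfolding uses_edge_def by blast
    then have "(z, i) \<in> move_edges (zz m) (bd_edges (W m) D) \<and> w = shift z i \<or>
        (w, i) \<in> move_edges (zz m) (bd_edges (W m) D) \<and> z = shift w i"
      using mv sh by blast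
    then show ?thesis using m(1) unfolding uses_edge_def by blast
  next
    case False
    have wz: "adj w z" using zw(3) uses_edge_sym by blast
    have z_low: "s z i0 \<le> \<rho>"
    proof (cases "\<exists>m\<in>M. z - zz m \<in> D \<and> z - zz m \<in> W m")
      case True
      then obtain m where m: "m \<in> M" "z - zz m \<in> D" "z - zz m \<in> W m" by blast
      then have "w - zz m \<notin> D" using False by blast
      then have "\<not> 0 < inner (rvec (z - zz m) - C) (b i0)"
        using W[OF m(1)] m adj_translate[of z "zz m" w] zw(3) unfolding lcol_def by blast
      then show ?thesis using \<delta>_le[of m i0] unfolding cell_coord by simp
    next
      case False then show ?thesis using zw(4) \<rho>_ge unfolding glue_def by auto
    qed
    have w_high: "- \<rho> \<le> s w i0"
    proof (cases "\<exists>m\<in>M. w - zz m \<in> D")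
      case True
      then obtain m where m: "m \<in> M" "w - zz m \<in> D" by blast
      then have "w - zz m \<notin> W m" using zw(2,5) unfolding glue_def by blast
      moreover have "z - zz m \<notin> D" using False m by blast
      ultimately have "\<not> inner (rvec (w - zz m) - C) (b i0) < 0"
        using W[OF m(1)] m adj_translate[of w "zz m" z] wz unfolding lcol_def by blast
      then show ?thesis using \<delta>_le[of m i0] unfolding cell_coord by simp
    next
      case False then show ?thesis using zw(2,5) \<rho>_ge unfolding glue_def by auto
    qed
    have zs: "\<bar>s z i0\<bar> \<le> \<rho> + 1" using z_low w_high s_adj[OF zw(3), of i0] by (simp add: abs_le_iff)
    have "z \<in> Gap"
    proof (rule ccontr)
      assume "z \<notin> Gap"
      then obtain m where m: "m \<in> M" and in_m: "\<And>i. i \<noteq> i0 \<Longrightarrow> of_int (m i) * p i + \<rho> + 1 \<le> s z i \<and> s z i \<le> of_int (m i) * p i + \<alpha> i - \<rho> - 1"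
        using zw(1) zs unfolding Gap_def by blast
      have "y - zz m \<in> D" if y: "\<And>i. \<bar>s y i - s z i\<bar> \<le> 1" for y
        unfolding lbox_def mem_Collect_eq cell_coord
      proof (intro conjI allI impI)
        show "\<bar>s y i0 - (if i0 = i0 then 0 else of_int (m i0) * p i0) + \<delta> m i0\<bar> \<le> H"
          using zs y[of i0] \<delta>_le[of m i0] H by simp
        fix i assume i: "i \<noteq> i0"
        show "0 \<le> s y i - (if i = i0 then 0 else of_int (m i) * p i) + \<delta> m i"
          "s y i - (if i = i0 then 0 else of_int (m i) * p i) + \<delta> m i \<le> \<alpha> i"
          using i in_m[OF i] y[of i] \<delta>_le[of m i] by (auto simp: abs_le_iff)
      qed
      from this[of z] this[of w] s_adj[OF zw(3)] show False using False m by auto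
    qed
    then show ?thesis using zw(3) unfolding uses_edge_def touching_def by auto
  qed
qed

lemma finite_Gap: "finite Gap"
proof -
  have "finite {z. \<forall>i. (if i = i0' then - H' else 0) \<le> inner (rvec z - C') (b' i) \<and> inner (rvec z - C') (b' i) \<le> (if i = i0' then H' else \<alpha>' i)}"
    by (rule lattice_count(1)[OF b']) (use H H' \<rho>_ge \<alpha>' in \<open>auto intro: less_imp_le\<close>)
  then show ?thesis by (rule rev_finite_subset) (auto simp: Gap_def lbox_def abs_le_iff)
qed

section \<open>Counting the gap sites\<close>

definition \<Lambda> :: real where "\<Lambda> = (\<Sum>i\<in>UNIV - {i0}. p i + \<rho> + 1)"

lemma \<Lambda>_nonneg: "0 \<le> \<Lambda>"
  unfolding \<Lambda>_def using p_pos \<rho>_ge by (intro sum_nonneg) (simp add: less_imp_le add_nonneg_nonneg)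

definition boxcnt :: "('d \<Rightarrow> real^'d) \<Rightarrow> ('d \<Rightarrow> real) \<Rightarrow> ('d \<Rightarrow> real) \<Rightarrow> (int^'d) set" where
  "boxcnt e l u = {z. \<forall>i. l i \<le> inner (rvec z - C') (e i) \<and> inner (rvec z - C') (e i) \<le> u i}"

text \<open>An enlarged cell outside \<open>M\<close> has a point \<open>x\<close> off the base.
  Expanding \<open>x - z\<close> in the frame \<open>b\<close> bounds the displacement along each
  \<open>b' j\<close> by \<open>\<Lambda>\<close>, so \<open>z\<close> is close to a side of the
  base.\<close>

lemma boundary_tile:
  assumes z: "z \<in> D'" and m: "m \<notin> M" "m i0 = 0"
    and fl: "\<And>i. i \<noteq> i0 \<Longrightarrow> of_int (m i) * p i \<le> s z i \<and> s z i \<le> of_int (m i) * p i + p i"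
  shows "\<exists>j. j \<noteq> i0' \<and> (inner (rvec z - C') (b' j) \<le> \<Lambda> \<or> \<alpha>' j - \<Lambda> \<le> inner (rvec z - C') (b' j))"
proof -
  obtain x j where x: "\<And>i. i \<noteq> i0 \<Longrightarrow> of_int (m i) * p i - \<rho> - 1 \<le> inner (x - C') (b i) \<and>
      inner (x - C') (b i) \<le> of_int (m i) * p i + \<alpha> i + \<rho> + 1"
    and j: "j \<noteq> i0'" "\<not> (0 \<le> inner (x - C') (b' j) \<and> inner (x - C') (b' j) \<le> \<alpha>' j)"
    using m unfolding M_def by blast
  have "inner (x - rvec z) (b' j) = (\<Sum>i\<in>UNIV. inner (x - rvec z) (b i) * inner (b i) (b' j))"
  proof -
    have "inner (\<Sum>i\<in>UNIV. inner (x - rvec z) (b i) *\<^sub>R b i) (b' j) = (\<Sum>i\<in>UNIV. inner (x - rvec z) (b i) * inner (b i) (b' j))"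
      by (simp add: inner_sum_left)
    then show ?thesis by (simp only: onb_expand[OF b])
  qed
  also have "\<dots> = (\<Sum>i\<in>UNIV - {i0}. inner (x - rvec z) (b i) * inner (b i) (b' j))"
    using j(1) bb onb_inner[OF b', of i0' j] by (subst sum.remove[of _ i0]) auto
  finally have "\<bar>inner (x - rvec z) (b' j)\<bar> \<le> (\<Sum>i\<in>UNIV - {i0}. \<bar>inner (x - rvec z) (b i) * inner (b i) (b' j)\<bar>)"
    by (simp add: sum_abs)
  also have "\<dots> \<le> \<Lambda>"
    unfolding \<Lambda>_def
  proof (rule sum_mono)
    fix i assume "i \<in> UNIV - {i0}"
    then have i: "i \<noteq> i0" by simp
    have "inner (x - rvec z) (b i) = inner (x - C') (b i) - s z i" by (simp add: s_def inner_diff_left)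
    then have "\<bar>inner (x - rvec z) (b i)\<bar> \<le> p i + \<rho> + 1"
      using x[OF i] fl[OF i] \<rho>_ge by (auto simp: abs_le_iff p_def)
    moreover have "\<bar>inner (b i) (b' j)\<bar> \<le> 1" using onb_inner_le[OF b', of "b i" j] onb_norm[OF b, of i] by simp
    ultimately have "\<bar>inner (x - rvec z) (b i)\<bar> * \<bar>inner (b i) (b' j)\<bar> \<le> (p i + \<rho> + 1) * 1"
      by (intro mult_mono) auto
    then show "\<bar>inner (x - rvec z) (b i) * inner (b i) (b' j)\<bar> \<le> p i + \<rho> + 1" by (simp add: abs_mult)
  qed
  finally have "\<bar>inner (x - rvec z) (b' j)\<bar> \<le> \<Lambda>" .
  then have "\<bar>inner (x - C') (b' j) - inner (rvec z - C') (b' j)\<bar> \<le> \<Lambda>" by (simp add: inner_diff_left)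
  then show ?thesis using j by (intro exI[of _ j]) (auto simp: abs_le_iff)
qed

text \<open>Rounding down assigns a period cell to each gap site. If the cell is in
  \<open>M\<close>, the site is near one of its walls: since \<open>\<alpha> - \<rho> - 1\<close>
  equals \<open>p - (3 * \<rho> + 2)\<close>, a strip of width \<open>3 * \<rho> + 2\<close>
  suffices on either side. Otherwise the site is near a side of the large base.\<close>

lemma Gap_cover:
  "Gap \<subseteq> (\<Union>m\<in>M. \<Union>i\<in>UNIV - {i0}.
        boxcnt b (\<lambda>k. if k = i0 then - (\<rho> + 1) else of_int (m k) * p k)
                 (\<lambda>k. if k = i0 then \<rho> + 1 else if k = i then of_int (m k) * p k + (3 * \<rho> + 2) else of_int (m k) * p k + p k)
      \<union> boxcnt b (\<lambda>k. if k = i0 then - (\<rho> + 1) else if k = i then of_int (m k) * p k + p k - (3 * \<rho> + 2) else of_int (m k) * p k)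
                 (\<lambda>k. if k = i0 then \<rho> + 1 else of_int (m k) * p k + p k))
    \<union> (\<Union>j\<in>UNIV - {i0'}.
        boxcnt b' (\<lambda>k. if k = i0' then - (\<rho> + 1) else 0) (\<lambda>k. if k = i0' then \<rho> + 1 else if k = j then \<Lambda> else \<alpha>' k)
      \<union> boxcnt b' (\<lambda>k. if k = i0' then - (\<rho> + 1) else if k = j then \<alpha>' k - \<Lambda> else 0) (\<lambda>k. if k = i0' then \<rho> + 1 else \<alpha>' k))"
proof
  fix z assume z: "z \<in> Gap"
  define m where "m i = (if i = i0 then 0 else \<lfloor>s z i / p i\<rfloor>)" for i
  have fl: "of_int (m i) * p i \<le> s z i \<and> s z i \<le> of_int (m i) * p i + p i" if i: "i \<noteq> i0" for i
  proof -
    have "of_int \<lfloor>s z i / p i\<rfloor> \<le> s z i / p i" "s z i / p i \<le> of_int \<lfloor>s z i / p i\<rfloor> + 1" by linarith+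
    then have "of_int \<lfloor>s z i / p i\<rfloor> * p i \<le> s z i" "s z i \<le> (of_int \<lfloor>s z i / p i\<rfloor> + 1) * p i"
      using p_pos[OF i] by (simp_all only: pos_le_divide_eq pos_divide_le_eq)
    then show ?thesis using i by (simp add: m_def algebra_simps)
  qed
  have zD: "z \<in> D'" and zi0: "\<bar>s z i0\<bar> \<le> \<rho> + 1" using z by (auto simp: Gap_def)
  show "z \<in> (\<Union>m\<in>M. \<Union>i\<in>UNIV - {i0}.
        boxcnt b (\<lambda>k. if k = i0 then - (\<rho> + 1) else of_int (m k) * p k)
                 (\<lambda>k. if k = i0 then \<rho> + 1 else if k = i then of_int (m k) * p k + (3 * \<rho> + 2) else of_int (m k) * p k + p k)
      \<union> boxcnt b (\<lambda>k. if k = i0 then - (\<rho> + 1) else if k = i then of_int (m k) * p k + p k - (3 * \<rho> + 2) else of_int (m k) * p k)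
                 (\<lambda>k. if k = i0 then \<rho> + 1 else of_int (m k) * p k + p k))
    \<union> (\<Union>j\<in>UNIV - {i0'}.
        boxcnt b' (\<lambda>k. if k = i0' then - (\<rho> + 1) else 0) (\<lambda>k. if k = i0' then \<rho> + 1 else if k = j then \<Lambda> else \<alpha>' k)
      \<union> boxcnt b' (\<lambda>k. if k = i0' then - (\<rho> + 1) else if k = j then \<alpha>' k - \<Lambda> else 0) (\<lambda>k. if k = i0' then \<rho> + 1 else \<alpha>' k))"
    (is "z \<in> ?A \<union> ?B")
  proof (cases "m \<in> M")
    case True
    then obtain i where i: "i \<noteq> i0" "\<not> (of_int (m i) * p i + \<rho> + 1 \<le> s z i \<and> s z i \<le> of_int (m i) * p i + \<alpha> i - \<rho> - 1)"
      using z unfolding Gap_def by blast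
    then consider "s z i \<le> of_int (m i) * p i + (3 * \<rho> + 2)" | "of_int (m i) * p i + p i - (3 * \<rho> + 2) \<le> s z i"
      using \<rho>_ge by (force simp: p_def)
    then have "z \<in> boxcnt b (\<lambda>k. if k = i0 then - (\<rho> + 1) else of_int (m k) * p k)
                 (\<lambda>k. if k = i0 then \<rho> + 1 else if k = i then of_int (m k) * p k + (3 * \<rho> + 2) else of_int (m k) * p k + p k)
      \<union> boxcnt b (\<lambda>k. if k = i0 then - (\<rho> + 1) else if k = i then of_int (m k) * p k + p k - (3 * \<rho> + 2) else of_int (m k) * p k)
                 (\<lambda>k. if k = i0 then \<rho> + 1 else of_int (m k) * p k + p k)"
      by cases (use fl zi0 in \<open>auto simp: boxcnt_def s_def[symmetric] abs_le_iff\<close>)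
    then have "z \<in> ?A" using True i by blast
    then show ?thesis by blast
  next
    case False
    have "m i0 = 0" by (simp add: m_def)
    from boundary_tile[OF zD False this fl] obtain j where j: "j \<noteq> i0'" "inner (rvec z - C') (b' j) \<le> \<Lambda> \<or> \<alpha>' j - \<Lambda> \<le> inner (rvec z - C') (b' j)"
      by blast
    have "z \<in> boxcnt b' (\<lambda>k. if k = i0' then - (\<rho> + 1) else 0) (\<lambda>k. if k = i0' then \<rho> + 1 else if k = j then \<Lambda> else \<alpha>' k)
      \<union> boxcnt b' (\<lambda>k. if k = i0' then - (\<rho> + 1) else if k = j then \<alpha>' k - \<Lambda> else 0) (\<lambda>k. if k = i0' then \<rho> + 1 else \<alpha>' k)"
      using j zD zi0[unfolded s_i0] by (auto simp: boxcnt_def lbox_def abs_le_iff)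
    then have "z \<in> ?B" using j by blast
    then show ?thesis by blast
  qed
qed

lemma boxcnt_card:
  assumes e: "onb e" and lu: "\<And>k. l k \<le> u k"
    and len: "\<And>k. \<rho> * (u k - l k) + 1 \<le> B k"
  shows "real (card (boxcnt e l u)) \<le> (\<Prod>k\<in>UNIV. B k)"
proof -
  have "real (card (boxcnt e l u)) \<le> (\<Prod>k\<in>UNIV. \<rho> * (u k - l k) + 1)"
    unfolding boxcnt_def \<rho> using lattice_count(2)[OF e lu] .
  also have "\<dots> \<le> (\<Prod>k\<in>UNIV. B k)"
    using len lu \<rho>_ge by (intro prod_mono) (simp add: add_nonneg_nonneg)
  finally show ?thesis .
qed

text \<open>Each strip is short in the normal direction and across a wall, which leaves
  \<open>d - 2\<close> long directions: of the order of the block for the walls of cells, of the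
  order of the cylinder along the sides of the base.\<close>

lemma Gap_card:
  assumes P: "\<And>k. k \<noteq> i0 \<Longrightarrow> \<rho> * p k + 1 \<le> P" and P': "\<And>k. k \<noteq> i0' \<Longrightarrow> \<rho> * \<alpha>' k + 1 \<le> P'"
    and \<Lambda>: "\<rho> * \<Lambda> + 1 \<le> L" and c: "\<rho> * (3 * \<rho> + 2) + 1 \<le> c"
  shows "real (card Gap) \<le> 2 * real CARD('d) * c ^ 2 * (real (card M) * P ^ (CARD('d) - 2)) + 2 * real CARD('d) * c * L * P' ^ (CARD('d) - 2)"
proof -
  let ?d = "CARD('d)"
  have "\<rho> * (2 * (\<rho> + 1)) \<le> \<rho> * (3 * \<rho> + 2)" using \<rho>_ge by (intro mult_left_mono) auto
  then have c1: "\<rho> * (2 * (\<rho> + 1)) + 1 \<le> c" using c by linarith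
  let ?A1 = "\<lambda>m i. boxcnt b (\<lambda>k. if k = i0 then - (\<rho> + 1) else of_int (m k) * p k)
                 (\<lambda>k. if k = i0 then \<rho> + 1 else if k = i then of_int (m k) * p k + (3 * \<rho> + 2) else of_int (m k) * p k + p k)"
  let ?A2 = "\<lambda>m i. boxcnt b (\<lambda>k. if k = i0 then - (\<rho> + 1) else if k = i then of_int (m k) * p k + p k - (3 * \<rho> + 2) else of_int (m k) * p k)
                 (\<lambda>k. if k = i0 then \<rho> + 1 else of_int (m k) * p k + p k)"
  let ?B1 = "\<lambda>j. boxcnt b' (\<lambda>k. if k = i0' then - (\<rho> + 1) else 0) (\<lambda>k. if k = i0' then \<rho> + 1 else if k = j then \<Lambda> else \<alpha>' k)"
  let ?B2 = "\<lambda>j. boxcnt b' (\<lambda>k. if k = i0' then - (\<rho> + 1) else if k = j then \<alpha>' k - \<Lambda> else 0) (\<lambda>k. if k = i0' then \<rho> + 1 else \<alpha>' k)"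
  have A1: "real (card (?A1 m i)) \<le> c ^ 2 * P ^ (?d - 2)" if i: "i \<noteq> i0" for m i
  proof -
    have "real (card (?A1 m i)) \<le> (\<Prod>k\<in>UNIV. if k = i0 then c else if k = i then c else P)"
      using i P c c1 p_pos \<rho>_ge by (intro boxcnt_card b) (auto simp: less_imp_le)
    then show ?thesis unfolding prod_if_two[OF i] by (simp add: power2_eq_square)
  qed
  have A2: "real (card (?A2 m i)) \<le> c ^ 2 * P ^ (?d - 2)" if i: "i \<noteq> i0" for m i
  proof -
    have "real (card (?A2 m i)) \<le> (\<Prod>k\<in>UNIV. if k = i0 then c else if k = i then c else P)"
      using i P c c1 p_pos \<rho>_ge by (intro boxcnt_card b) (auto simp: less_imp_le)
    then show ?thesis unfolding prod_if_two[OF i] by (simp add: power2_eq_square)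
  qed
  have B1: "real (card (?B1 j)) \<le> c * L * P' ^ (?d - 2)" if j: "j \<noteq> i0'" for j
  proof -
    have "real (card (?B1 j)) \<le> (\<Prod>k\<in>UNIV. if k = i0' then c else if k = j then L else P')"
      using j P' c c1 \<alpha>' \<rho>_ge \<Lambda> \<Lambda>_nonneg by (intro boxcnt_card b') (auto simp: less_imp_le)
    then show ?thesis unfolding prod_if_two[OF j] .
  qed
  have B2: "real (card (?B2 j)) \<le> c * L * P' ^ (?d - 2)" if j: "j \<noteq> i0'" for j
  proof -
    have "real (card (?B2 j)) \<le> (\<Prod>k\<in>UNIV. if k = i0' then c else if k = j then L else P')"
      using j P' c c1 \<alpha>' \<rho>_ge \<Lambda> \<Lambda>_nonneg by (intro boxcnt_card b') (auto simp: less_imp_le)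
    then show ?thesis unfolding prod_if_two[OF j] .
  qed
  have finb: "finite (boxcnt e l u)" if "onb e" "\<And>k. l k \<le> u k" for e l u
    unfolding boxcnt_def by (rule lattice_count(1)[OF that])
  have fin: "finite ((\<Union>m\<in>M. \<Union>i\<in>UNIV - {i0}. ?A1 m i \<union> ?A2 m i) \<union> (\<Union>j\<in>UNIV - {i0'}. ?B1 j \<union> ?B2 j))"
    using p_pos \<rho>_ge \<alpha>' \<Lambda>_nonneg by (intro finite_UnI finite_UN_I finite_M finb b b') (auto simp: less_imp_le)
  have "card Gap \<le> card ((\<Union>m\<in>M. \<Union>i\<in>UNIV - {i0}. ?A1 m i \<union> ?A2 m i) \<union> (\<Union>j\<in>UNIV - {i0'}. ?B1 j \<union> ?B2 j))"
    by (rule card_mono[OF fin Gap_cover])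
  also have "\<dots> \<le> card (\<Union>m\<in>M. \<Union>i\<in>UNIV - {i0}. ?A1 m i \<union> ?A2 m i) + card (\<Union>j\<in>UNIV - {i0'}. ?B1 j \<union> ?B2 j)"
    by (rule card_Un_le)
  also have "\<dots> \<le> (\<Sum>m\<in>M. \<Sum>i\<in>UNIV - {i0}. card (?A1 m i) + card (?A2 m i)) + (\<Sum>j\<in>UNIV - {i0'}. card (?B1 j) + card (?B2 j))"
    by (intro add_mono order_trans[OF card_UN_le] sum_mono card_Un_le finite_M) auto
  finally have "real (card Gap) \<le> (\<Sum>m\<in>M. \<Sum>i\<in>UNIV - {i0}. real (card (?A1 m i)) + real (card (?A2 m i))) + (\<Sum>j\<in>UNIV - {i0'}. real (card (?B1 j)) + real (card (?B2 j)))"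
    by (simp flip: of_nat_add of_nat_sum)
  also have "\<dots> \<le> (\<Sum>m\<in>M. \<Sum>i\<in>UNIV - {i0}. c ^ 2 * P ^ (?d - 2) + c ^ 2 * P ^ (?d - 2)) + (\<Sum>j\<in>UNIV - {i0'}. c * L * P' ^ (?d - 2) + c * L * P' ^ (?d - 2))"
    by (intro add_mono sum_mono A1 A2 B1 B2) auto
  also have "\<dots> = real (card M) * (real (?d - 1) * (2 * (c ^ 2 * P ^ (?d - 2)))) + real (?d - 1) * (2 * (c * L * P' ^ (?d - 2)))"
    by simp
  also have "\<dots> \<le> real (card M) * (real ?d * (2 * (c ^ 2 * P ^ (?d - 2)))) + real ?d * (2 * (c * L * P' ^ (?d - 2)))"
  proof -
    obtain k where k: "k \<noteq> i0" using other_index[OF d2] by blast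
    obtain k' where k': "k' \<noteq> i0'" using other_index[OF d2] by blast
    have "0 \<le> \<rho> * p k" "0 \<le> \<rho> * \<alpha>' k'" "0 \<le> \<rho> * \<Lambda>" "0 \<le> \<rho> * (3 * \<rho> + 2)"
      using \<rho>_ge p_pos[OF k] \<alpha>'[OF k'] \<Lambda>_nonneg by (auto intro!: mult_nonneg_nonneg simp: less_imp_le)
    then have "0 \<le> P" "0 \<le> P'" "0 \<le> L" "0 \<le> c"
      using P[OF k] P'[OF k'] \<Lambda> c by linarith+
    then show ?thesis by (intro add_mono mult_left_mono mult_right_mono) auto
  qed
  finally show ?thesis by (simp add: mult.assoc mult.left_commute)
qed

end

section \<open>The flow constant and its upper deviations\<close>

lemma V_Un_le: "finite E \<Longrightarrow> finite F \<Longrightarrow> V t (E \<union> F) \<le> V t E + V t F"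
  using sum.union_inter[of E F "\<lambda>e. ennreal (t e)"] by (simp add: V_finite) (metis le_iff_add)

lemma V_UN_le:
  assumes "finite M" "\<And>m. m \<in> M \<Longrightarrow> finite (E m)"
  shows "V t (\<Union>m\<in>M. E m) \<le> (\<Sum>m\<in>M. V t (E m))"
  using assms
proof (induction M)
  case empty then show ?case by (simp add: V_finite)
next
  case (insert m M)
  have "V t (\<Union>k\<in>insert m M. E k) \<le> V t (E m) + V t (\<Union>k\<in>M. E k)"
    using insert V_Un_le[of "E m" "\<Union>k\<in>M. E k" t] by simp
  also have "\<dots> \<le> V t (E m) + (\<Sum>k\<in>M. V t (E k))" using insert by (intro add_left_mono) auto
  finally show ?case using insert by simp
qed

lemma V_translate: "finite F \<Longrightarrow> V (translate z t) F = V t (move_edges z F)"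
proof -
  assume F: "finite F"
  have "inj_on (\<lambda>e. (fst e + z, snd e)) F" by (auto simp: inj_on_def prod_eq_iff)
  then show ?thesis using F by (simp add: V_finite move_edges_def sum.reindex translate_def)
qed

lemma (in tile_setup) disjoint_cells: "disjoint_family_on (\<lambda>m. move_edges (zz m) (inner_edges D)) M"
proof (unfold disjoint_family_on_def, intro ballI impI)
  fix m m' assume mm: "m \<in> M" "m' \<in> M" "m \<noteq> m'"
  have "fst e - zz k \<in> D" if "e \<in> move_edges (zz k) (inner_edges D)" for e k
    using that by (auto simp: move_edges_def inner_edges_def)
  then show "move_edges (zz m) (inner_edges D) \<inter> move_edges (zz m') (inner_edges D) = {}"
    using M_unique[OF mm(1,2)] mm(3) by blast
qed

text \<open>The pointwise form of subadditivity: scale \<open>K\<close> blocks tile the scale \<open>N\<close> cylinder, and the edges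
  needed to glue them are negligible when \<open>1 \<lless> K \<lless> N\<close>.\<close>

lemma tiling:
  fixes b b' :: "'d::finite \<Rightarrow> real^'d" and c c' :: "real^'d"
  assumes d2: "CARD('d) \<ge> 2" and ons: "onb b" "onb b'" "b' i0' = b i0"
    and a: "\<And>i. i \<noteq> i0 \<Longrightarrow> 0 < a i" and a': "\<And>j. j \<noteq> i0' \<Longrightarrow> 0 < a' j" and h: "0 < h" "0 < h'"
  defines "R \<equiv> frect b i0 c a" and "R' \<equiv> frect b' i0' c' a'" and "v \<equiv> b i0"
  obtains C1 C2 where "0 \<le> C1" "0 \<le> C2"
    "\<And>K N. 1 \<le> K \<Longrightarrow> 1 \<le> N \<Longrightarrow> 2 * sqrt (real CARD('d)) + 2 \<le> real K * h \<Longrightarrow>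
       real K * h + sqrt (real CARD('d)) + 1 \<le> real N * h' \<Longrightarrow>
       \<exists>(M :: ('d \<Rightarrow> int) set) zz B. finite M \<and> finite B \<and>
         disjoint_family_on (\<lambda>m. move_edges (zz m) (inner_edges (cyl_pts K R v h))) M \<and>
         real (card M) * (real K ^ (CARD('d) - 1) * (\<Prod>i\<in>UNIV - {i0}. a i)) \<le> real N ^ (CARD('d) - 1) * (\<Prod>j\<in>UNIV - {i0'}. a' j) \<and>
         real (card B) \<le> C1 * (real (card M) * real K ^ (CARD('d) - 2)) + C2 * real K * real N ^ (CARD('d) - 2) \<and>
         (\<forall>t. tau N R' v h' t \<le> (\<Sum>m\<in>M. tau K R v h (translate (zz m) t)) + V t B)"
proof -
  let ?d = "CARD('d)"
  define \<rho> where "\<rho> = sqrt (real ?d)"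
  have \<rho>1: "1 \<le> \<rho>" using d2 by (simp add: \<rho>_def)
  define A where "A = (\<Sum>i\<in>UNIV. \<bar>a i\<bar>)"
  define A' where "A' = (\<Sum>i\<in>UNIV. \<bar>a' i\<bar>)"
  have aA: "a i \<le> A" for i unfolding A_def using member_le_sum[of i UNIV "\<lambda>i. \<bar>a i\<bar>"] by auto
  have aA': "a' i \<le> A'" for i unfolding A'_def using member_le_sum[of i UNIV "\<lambda>i. \<bar>a' i\<bar>"] by auto
  have A0: "0 \<le> A" "0 \<le> A'" by (simp_all add: A_def A'_def sum_nonneg)
  \<comment> \<open>\<open>c0\<close>, \<open>P0\<close>, \<open>P0'\<close> and \<open>L0\<close>
    are the bounds required by \<open>Gap_card\<close> after division by \<open>1\<close>,
    \<open>K\<close>, \<open>N\<close> and \<open>K\<close>; lower-order terms are absorbed using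
    \<open>1 \<le> K\<close> and \<open>1 \<le> N\<close>.\<close>
  define c0 where "c0 = \<rho> * (3 * \<rho> + 2) + 1"
  define P0 where "P0 = \<rho> * (A + 2 * \<rho> + 1) + 1"
  define P0' where "P0' = \<rho> * A' + 1"
  define \<Lambda>0 where "\<Lambda>0 = real ?d * (A + 3 * \<rho> + 2)"
  define L0 where "L0 = \<rho> * \<Lambda>0 + 1"
  have pos: "0 \<le> c0" "0 \<le> P0" "0 \<le> P0'" "0 \<le> \<Lambda>0" "0 \<le> L0"
    using \<rho>1 A0 by (auto simp: c0_def P0_def P0'_def \<Lambda>0_def L0_def)
  define C1 where "C1 = 2 * real ?d * (2 * real ?d * c0 ^ 2 * P0 ^ (?d - 2))"
  define C2 where "C2 = 2 * real ?d * (2 * real ?d * c0 * L0 * P0' ^ (?d - 2))"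
  show thesis
  proof (rule that[of C1 C2])
    show "0 \<le> C1" "0 \<le> C2" using pos by (simp_all add: C1_def C2_def)
    fix K N :: nat
    assume K: "1 \<le> K" and N: "1 \<le> N" and Kh: "2 * sqrt (real ?d) + 2 \<le> real K * h"
      and Nh: "real K * h + sqrt (real ?d) + 1 \<le> real N * h'"
    interpret tile_setup b b' i0 i0' "real K *\<^sub>R c" "real N *\<^sub>R c'" "\<lambda>i. real K * a i" "\<lambda>j. real N * a' j" "real K * h" "real N * h'" \<rho>
      using K N Kh Nh a a' ons d2 by unfold_locales (auto simp: \<rho>_def)
    have D: "cyl_pts K R v h = D" unfolding R_def v_def by (rule cyl_pts_frect[OF ons(1) K])
    have D': "cyl_pts N R' v h' = D'" unfolding R'_def v_def ons(3)[symmetric] by (rule cyl_pts_frect[OF ons(2) N])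
    have hyp: "hyperrect_normal R v" unfolding hyperrect_normal_iff R_def v_def using a ons by blast
    have finD: "finite D" using finite_cyl_pts[OF hyp K, of h] unfolding D .
    define B where "B = touching Gap"
    have "real (card B) \<le> real (2 * ?d * card Gap)"
      unfolding of_nat_le_iff B_def by (rule touching_bound(2)[OF finite_Gap])
    then have finB: "finite B" "real (card B) \<le> 2 * real ?d * real (card Gap)"
      using touching_bound(1)[OF finite_Gap] unfolding B_def by simp_all
    have cK: "u \<le> real K * u" if "0 \<le> u" for u using K that by (simp add: mult_le_cancel_right1)
    have cN: "u \<le> real N * u" if "0 \<le> u" for u using N that by (simp add: mult_le_cancel_right1)
    have p_le: "p k \<le> real K * (A + 2 * \<rho> + 1)" for k
    proof -
      have "p k = real K * a k + (2 * \<rho> + 1)" by (simp add: p_def)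
      also have "\<dots> \<le> real K * A + real K * (2 * \<rho> + 1)"
        using aA[of k] \<rho>1 by (intro add_mono mult_left_mono cK) auto
      finally show ?thesis by (simp add: algebra_simps)
    qed
    have GapB: "real (card Gap) \<le> 2 * real ?d * c0 ^ 2 * (real (card M) * (real K * P0) ^ (?d - 2)) + 2 * real ?d * c0 * (real K * L0) * (real N * P0') ^ (?d - 2)"
    proof (rule Gap_card)
      fix k
      show "\<rho> * p k + 1 \<le> real K * P0"
      proof -
        have "\<rho> * p k \<le> \<rho> * (real K * (A + 2 * \<rho> + 1))" using p_le[of k] \<rho>1 by (intro mult_left_mono) auto
        moreover have "1 \<le> real K" using K by simp
        ultimately show ?thesis unfolding P0_def by (simp add: algebra_simps)
      qed
      show "\<rho> * (real N * a' k) + 1 \<le> real N * P0'"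
      proof -
        have "\<rho> * (real N * a' k) \<le> \<rho> * (real N * A')" using aA'[of k] \<rho>1 by (intro mult_left_mono) auto
        moreover have "1 \<le> real N" using N by simp
        ultimately show ?thesis unfolding P0'_def by (simp add: algebra_simps)
      qed
      show "\<rho> * \<Lambda> + 1 \<le> real K * L0"
      proof -
        have "\<Lambda> \<le> (\<Sum>i\<in>UNIV - {i0}. real K * (A + 3 * \<rho> + 2))"
          unfolding \<Lambda>_def
        proof (rule sum_mono)
          fix i
          have "\<rho> + 1 \<le> real K * (\<rho> + 1)" using \<rho>1 by (intro cK) auto
          then show "p i + \<rho> + 1 \<le> real K * (A + 3 * \<rho> + 2)" using p_le[of i] by (simp add: algebra_simps)
        qed
        also have "\<dots> \<le> (\<Sum>i\<in>(UNIV :: 'd set). real K * (A + 3 * \<rho> + 2))"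
          using A0 \<rho>1 by (intro sum_mono2) auto
        also have "\<dots> = real K * \<Lambda>0" by (simp add: \<Lambda>0_def)
        finally have "\<rho> * \<Lambda> \<le> \<rho> * (real K * \<Lambda>0)" using \<rho>1 by (intro mult_left_mono) auto
        moreover have "1 \<le> real K" using K by simp
        ultimately show ?thesis unfolding L0_def by (simp add: algebra_simps)
      qed
      show "\<rho> * (3 * \<rho> + 2) + 1 \<le> c0" by (simp add: c0_def)
    qed
    have "real (card B) \<le> 2 * real ?d * (2 * real ?d * c0 ^ 2 * (real (card M) * (real K * P0) ^ (?d - 2)) + 2 * real ?d * c0 * (real K * L0) * (real N * P0') ^ (?d - 2))"
      by (rule order_trans[OF finB(2) mult_left_mono[OF GapB]]) simp
    also have "\<dots> = C1 * (real (card M) * real K ^ (?d - 2)) + C2 * real K * real N ^ (?d - 2)"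
      by (simp add: C1_def C2_def power_mult_distrib algebra_simps)
    finally have cardB: "real (card B) \<le> C1 * (real (card M) * real K ^ (?d - 2)) + C2 * real K * real N ^ (?d - 2)" .
    have pack: "real (card M) * (real K ^ (?d - 1) * (\<Prod>i\<in>UNIV - {i0}. a i)) \<le> real N ^ (?d - 1) * (\<Prod>j\<in>UNIV - {i0'}. a' j)"
      using packing[OF finite_M order_refl] by (simp add: prod.distrib)
    have "tau N R' v h' t \<le> (\<Sum>m\<in>M. tau K R v h (translate (zz m) t)) + V t B" for t
    proof -
      \<comment> \<open>Each block uses its own optimal cut, read in the configuration shifted to
        it.\<close>
      have "\<exists>U. lcol b i0 (real K *\<^sub>R c) (\<lambda>i. real K * a i) (real K * h) U \<and> tau K R v h (translate (zz m) t) = V (translate (zz m) t) (bd_edges U D)" for m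
        using tau_attained[OF hyp K, of h "translate (zz m) t"] colorings_frect[OF ons(1) K, of _ i0 c a h]
        unfolding D R_def[symmetric] v_def[symmetric] by metis
      then obtain W where W: "\<And>m. lcol b i0 (real K *\<^sub>R c) (\<lambda>i. real K * a i) (real K * h) (W m)"
        "\<And>m. tau K R v h (translate (zz m) t) = V (translate (zz m) t) (bd_edges (W m) D)" by metis
      have finW: "finite (bd_edges (W m) D)" for m
        by (rule finite_subset[OF bd_edges_sub_inner finite_inner_edges[OF finD]])
      have "glue W \<in> colorings N R' v h'"
        using lcol_glue[of W] colorings_frect[OF ons(2) N, of "glue W" i0' c' a' h'] unfolding R'_def v_def ons(3) by blast
      then have "tau N R' v h' t \<le> V t (bd_edges (glue W) D')" using tau_le D' by metis
      also have "\<dots> \<le> V t ((\<Union>m\<in>M. move_edges (zz m) (bd_edges (W m) D)) \<union> B)"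
        unfolding B_def by (intro V_mono bd_edges_glue W)
      also have "\<dots> \<le> V t (\<Union>m\<in>M. move_edges (zz m) (bd_edges (W m) D)) + V t B"
        using finB finite_M finW by (intro V_Un_le) (auto simp: move_edges_def)
      also have "\<dots> \<le> (\<Sum>m\<in>M. V t (move_edges (zz m) (bd_edges (W m) D))) + V t B"
        using finite_M finW by (intro add_right_mono V_UN_le) (auto simp: move_edges_def)
      also have "\<dots> = (\<Sum>m\<in>M. tau K R v h (translate (zz m) t)) + V t B"
        by (simp add: W(2) V_translate[OF finW])
      finally show ?thesis .
    qed
    then show "\<exists>(M :: ('d \<Rightarrow> int) set) zz B. finite M \<and> finite B \<and>
         disjoint_family_on (\<lambda>m. move_edges (zz m) (inner_edges (cyl_pts K R v h))) M \<and>
         real (card M) * (real K ^ (?d - 1) * (\<Prod>i\<in>UNIV - {i0}. a i)) \<le> real N ^ (?d - 1) * (\<Prod>j\<in>UNIV - {i0'}. a' j) \<and>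
         real (card B) \<le> C1 * (real (card M) * real K ^ (?d - 2)) + C2 * real K * real N ^ (?d - 2) \<and>
         (\<forall>t. tau N R' v h' t \<le> (\<Sum>m\<in>M. tau K R v h (translate (zz m) t)) + V t B)"
      unfolding D using finite_M finB(1) disjoint_cells pack cardB by blast
  qed
qed

text \<open>Fekete's argument: the limit is the infimum of \<open>f x K + C1 / K\<close>, obtained
  by sending first \<open>N\<close> and then \<open>K\<close> to infinity. Comparing two members of
  \<open>X\<close> in both directions forces a common limit, which is how independence of the
  rectangle and the height arises.\<close>

lemma almost_subadditive_limit:
  fixes f :: "'x \<Rightarrow> nat \<Rightarrow> real"
  assumes nn: "\<And>x n. x \<in> X \<Longrightarrow> 0 \<le> f x n"
    and sub: "\<And>x y. x \<in> X \<Longrightarrow> y \<in> X \<Longrightarrow> \<exists>C1\<ge>0. \<exists>C2\<ge>0. \<exists>K0. \<forall>K\<ge>K0. \<exists>N0. \<forall>N\<ge>N0.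
        f y N \<le> f x K + C1 / real K + C2 * real K / real N"
  shows "\<exists>L\<ge>0. \<forall>x\<in>X. f x \<longlonglongrightarrow> L"
proof -
  have lim0: "(\<lambda>N. C / real N) \<longlonglongrightarrow> 0" for C :: real
    by (rule lim_const_over_n)
  have ex: "\<exists>L\<ge>0. f x \<longlonglongrightarrow> L" if x: "x \<in> X" for x
  proof -
    obtain C1 C2 K0 where C: "0 \<le> C1" "0 \<le> C2"
      and le: "\<And>K. K \<ge> K0 \<Longrightarrow> \<exists>N0. \<forall>N\<ge>N0. f x N \<le> f x K + C1 / real K + C2 * real K / real N"
      using sub[OF x x] by blast
    \<comment> \<open>The correction \<open>C1 / K\<close> is kept inside the infimum, because the
      hypothesis bounds later values only by the corrected terms.\<close>
    define S where "S = (\<lambda>K. f x K + C1 / real K) ` {K0..}"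
    define L where "L = Inf S"
    have S0: "y \<in> S \<Longrightarrow> 0 \<le> y" for y using nn[OF x] C by (auto simp: S_def)
    have ne: "S \<noteq> {}" by (simp add: S_def)
    have bb: "bdd_below S" using S0 by (meson bdd_belowI)
    have L0: "0 \<le> L" unfolding L_def by (rule cInf_greatest[OF ne S0])
    have "f x \<longlonglongrightarrow> L"
    proof (rule LIMSEQ_I)
      fix e :: real assume e: "0 < e"
      have "Inf S < L + e / 2" using e by (simp add: L_def)
      then obtain y where "y \<in> S" "y < L + e / 2" using cInf_lessD[OF ne] by blast
      then obtain K where K: "K \<ge> K0" "f x K + C1 / real K < L + e / 2" by (auto simp: S_def)
      obtain N0 where N0: "\<And>N. N \<ge> N0 \<Longrightarrow> f x N \<le> f x K + C1 / real K + C2 * real K / real N" using le[OF K(1)] by blast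
      obtain N1 where N1: "\<And>N. N \<ge> N1 \<Longrightarrow> norm (C2 * real K / real N - 0) < e / 2" using LIMSEQ_D[OF lim0, of "e/2"] e by (metis half_gt_zero)
      obtain N2 where N2: "\<And>N. N \<ge> N2 \<Longrightarrow> norm (C1 / real N - 0) < e" using LIMSEQ_D[OF lim0 e] by metis
      show "\<exists>no. \<forall>n\<ge>no. norm (f x n - L) < e"
      proof (intro exI allI impI)
        fix n assume n: "max (max N0 N1) (max N2 K0) \<le> n"
        have "\<bar>C2 * real K / real n\<bar> < e / 2" using N1[of n] n by simp
        then have "C2 * real K / real n < e / 2" by linarith
        then have "f x n < L + e" using N0[of n] K n by linarith
        moreover have "L \<le> f x n + C1 / real n" unfolding L_def using n by (intro cInf_lower bb) (auto simp: S_def)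
        moreover have "\<bar>C1 / real n\<bar> < e" using N2[of n] n by simp
        then have "C1 / real n < e" by linarith
        ultimately show "norm (f x n - L) < e" unfolding real_norm_def by linarith
      qed
    qed
    with L0 show ?thesis by blast
  qed
  have le: "Ly \<le> Lx" if x: "x \<in> X" "f x \<longlonglongrightarrow> Lx" and y: "y \<in> X" "f y \<longlonglongrightarrow> Ly" for x y Lx Ly
  proof -
    obtain C1 C2 K0 where le: "\<And>K. K \<ge> K0 \<Longrightarrow> \<exists>N0. \<forall>N\<ge>N0. f y N \<le> f x K + C1 / real K + C2 * real K / real N"
      using sub[OF x(1) y(1)] by blast
    have "Ly \<le> f x K + C1 / real K" if K: "K \<ge> K0" for K
    proof -
      have "(\<lambda>N. f x K + C1 / real K + C2 * real K / real N) \<longlonglongrightarrow> f x K + C1 / real K + 0"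
        by (intro tendsto_intros lim0)
      then show ?thesis using LIMSEQ_le[OF y(2)] le[OF K] by fastforce
    qed
    moreover have "(\<lambda>K. f x K + C1 / real K) \<longlonglongrightarrow> Lx + 0" by (intro tendsto_add x(2) lim0)
    ultimately show "Ly \<le> Lx" using LIMSEQ_le_const[of "\<lambda>K. f x K + C1 / real K" Lx Ly] by auto
  qed
  show ?thesis
  proof (cases "X = {}")
    case False
    then obtain x where x: "x \<in> X" by blast
    obtain L where L: "L \<ge> 0" "f x \<longlonglongrightarrow> L" using ex[OF x] by blast
    have "f y \<longlonglongrightarrow> L" if y: "y \<in> X" for y
      using ex[OF y] le[OF x L(2) y] le[OF y _ x L(2)] by (metis antisym)
    then show ?thesis using L by blast
  qed auto
qed

lemma measure_frect:
  fixes b :: "'d::finite \<Rightarrow> real^'d"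
  assumes d2: "CARD('d) \<ge> 2" and b: "onb b" and a: "\<And>i. i \<noteq> i0 \<Longrightarrow> 0 \<le> a i"
  shows "emeasure (hausdorff_measure (codim1 TYPE('d))) (frect b i0 c a) = ennreal (hbox_const TYPE('d) * (\<Prod>i\<in>UNIV - {i0}. a i))"
    and "measure (hausdorff_measure (codim1 TYPE('d))) (frect b i0 c a) = hbox_const TYPE('d) * (\<Prod>i\<in>UNIV - {i0}. a i)"
proof -
  have "0 < codim1 TYPE('d)" using d2 by simp
  then show e: "emeasure (hausdorff_measure (codim1 TYPE('d))) (frect b i0 c a) = ennreal (hbox_const TYPE('d) * (\<Prod>i\<in>UNIV - {i0}. a i))"
    using frect_outer[OF d2 b a] by (simp add: emeasure_hausdorff_measure closed_frect)
  have "0 \<le> hbox_const TYPE('d) * (\<Prod>i\<in>UNIV - {i0}. a i)"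
    using hbox_const_pos[OF d2] a by (intro mult_nonneg_nonneg prod_nonneg) (auto simp: less_imp_le)
  then show "measure (hausdorff_measure (codim1 TYPE('d))) (frect b i0 c a) = hbox_const TYPE('d) * (\<Prod>i\<in>UNIV - {i0}. a i)"
    unfolding measure_def e by simp
qed

abbreviation rect_area :: "(real^'d::finite) set \<Rightarrow> real" where
  "rect_area R \<equiv> measure (hausdorff_measure (codim1 TYPE('d))) R"

lemma tiling_hyperrect:
  fixes v :: "real^'d::finite"
  assumes d2: "CARD('d) \<ge> 2" and R: "hyperrect_normal R v" "0 < h" and R': "hyperrect_normal R' v" "0 < h'"
  shows "\<exists>C1\<ge>0. \<exists>C2\<ge>0. \<forall>K N. 1 \<le> K \<longrightarrow> 1 \<le> N \<longrightarrow> 2 * sqrt (real CARD('d)) + 2 \<le> real K * h \<longrightarrow>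
       real K * h + sqrt (real CARD('d)) + 1 \<le> real N * h' \<longrightarrow>
       (\<exists>(M :: ('d \<Rightarrow> int) set) zz B. finite M \<and> finite B \<and>
         disjoint_family_on (\<lambda>m. move_edges (zz m) (inner_edges (cyl_pts K R v h))) M \<and>
         real (card M) * (real K ^ (CARD('d) - 1) * rect_area R) \<le> real N ^ (CARD('d) - 1) * rect_area R' \<and>
         real (card B) \<le> C1 * (real (card M) * real K ^ (CARD('d) - 2)) + C2 * real K * real N ^ (CARD('d) - 2) \<and>
         (\<forall>t. tau N R' v h' t \<le> (\<Sum>m\<in>M. tau K R v h (translate (zz m) t)) + V t B))"
proof -
  obtain b i0 c a where b: "onb b" "b i0 = v" "\<And>i. i \<noteq> i0 \<Longrightarrow> 0 < a i" "R = frect b i0 c a"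
    using R(1) unfolding hyperrect_normal_iff by blast
  obtain b' i0' c' a' where b': "onb b'" "b' i0' = v" "\<And>i. i \<noteq> i0' \<Longrightarrow> 0 < a' i" "R' = frect b' i0' c' a'"
    using R'(1) unfolding hyperrect_normal_iff by blast
  have bb: "b' i0' = b i0" using b b' by simp
  have area: "rect_area R = hbox_const TYPE('d) * (\<Prod>i\<in>UNIV - {i0}. a i)"
    "rect_area R' = hbox_const TYPE('d) * (\<Prod>i\<in>UNIV - {i0'}. a' i)"
    unfolding b(4) b'(4) using b(3) b'(3) by (auto intro!: measure_frect d2 b b' less_imp_le)
  show ?thesis
  proof (rule tiling[where c=c and c'=c' and a=a and a'=a' and ?i0.0=i0 and i0'=i0', OF d2 b(1) b'(1) bb b(3) b'(3) R(2) R'(2)])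
    fix C1 C2 :: real assume C: "0 \<le> C1" "0 \<le> C2" and tile:
    "\<And>K N. 1 \<le> K \<Longrightarrow> 1 \<le> N \<Longrightarrow> 2 * sqrt (real CARD('d)) + 2 \<le> real K * h \<Longrightarrow>
       real K * h + sqrt (real CARD('d)) + 1 \<le> real N * h' \<Longrightarrow>
       \<exists>(M :: ('d \<Rightarrow> int) set) zz B. finite M \<and> finite B \<and>
         disjoint_family_on (\<lambda>m. move_edges (zz m) (inner_edges (cyl_pts K (frect b i0 c a) (b i0) h))) M \<and>
         real (card M) * (real K ^ (CARD('d) - 1) * (\<Prod>i\<in>UNIV - {i0}. a i)) \<le> real N ^ (CARD('d) - 1) * (\<Prod>j\<in>UNIV - {i0'}. a' j) \<and>
         real (card B) \<le> C1 * (real (card M) * real K ^ (CARD('d) - 2)) + C2 * real K * real N ^ (CARD('d) - 2) \<and>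
         (\<forall>t. tau N (frect b' i0' c' a') (b i0) h' t \<le> (\<Sum>m\<in>M. tau K (frect b i0 c a) (b i0) h (translate (zz m) t)) + V t B)"
    have ineq: "real m * (x * rect_area R) \<le> y * rect_area R' \<longleftrightarrow>
        real m * (x * (\<Prod>i\<in>UNIV - {i0}. a i)) \<le> y * (\<Prod>j\<in>UNIV - {i0'}. a' j)" for m x y
    proof -
      have "real m * (x * rect_area R) = hbox_const TYPE('d) * (real m * (x * (\<Prod>i\<in>UNIV - {i0}. a i)))"
        "y * rect_area R' = hbox_const TYPE('d) * (y * (\<Prod>j\<in>UNIV - {i0'}. a' j))"
        unfolding area by (simp_all add: mult_ac)
      then show ?thesis by (simp only: mult_le_cancel_left_pos[OF hbox_const_pos[OF d2]])
    qed
    show ?thesis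
      unfolding ineq unfolding b(4) b'(4) b(2)[symmetric] using C tile by blast
  qed
qed

section \<open>Expected cuts, existence of the flow constant, deviations of a single cut\<close>

context capacity_law
begin

definition mtau :: "nat \<Rightarrow> (real^'d::finite) set \<Rightarrow> real^'d \<Rightarrow> real \<Rightarrow> real" where
  "mtau n R v h = enn2real (\<integral>\<^sup>+ t. tau n R v h t \<partial>cap_measure G)"

lemma mtau_eq:
  assumes "hyperrect_normal R (v :: real^'d::finite)" "n \<ge> 1"
  shows "(\<integral>\<^sup>+ t. tau n R v h t \<partial>cap_measure G) = ennreal (mtau n R v h)"
proof -
  have "(\<integral>\<^sup>+ t. tau n R v h t \<partial>cap_measure G) \<le> (\<integral>\<^sup>+ t. V t (inner_edges (cyl_pts n R v h)) \<partial>cap_measure G)"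
    by (rule nn_integral_mono) (rule tau_le_V_inner[OF assms(1)])
  also have "\<dots> \<le> ennreal (real (card (inner_edges (cyl_pts n R v h))) * mean)"
    by (rule V_mean_le[OF finite_inner_edges[OF finite_cyl_pts[OF assms]]])
  finally have "(\<integral>\<^sup>+ t. tau n R v h t \<partial>cap_measure G) < \<infinity>" by (rule order.strict_trans1) simp
  then show ?thesis unfolding mtau_def by (simp add: less_top)
qed

lemma mtau_nonneg: "0 \<le> mtau n R v h" by (simp add: mtau_def)

lemma rect_area_pos:
  fixes v :: "real^'d::finite"
  assumes d2: "CARD('d) \<ge> 2" and R: "hyperrect_normal R v"
  shows "0 < rect_area R"
proof -
  obtain b i0 c a where b: "onb b" "b i0 = v" "\<And>i. i \<noteq> i0 \<Longrightarrow> 0 < a i" "R = frect b i0 c a"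
    using R(1) unfolding hyperrect_normal_iff by blast
  have "rect_area R = hbox_const TYPE('d) * (\<Prod>i\<in>UNIV - {i0}. a i)"
    unfolding b(4) using b(3) by (auto intro!: measure_frect d2 b less_imp_le)
  moreover have "0 < (\<Prod>i\<in>UNIV - {i0}. a i)" using b(3) by (intro prod_pos) auto
  ultimately show ?thesis using hbox_const_pos[OF d2] by simp
qed

text \<open>The tiling in expectation. All blocks have the same law, and the packing bound leaves a
  gluing cost of relative order \<open>1 / K\<close> for the cell walls and \<open>K / N\<close> for
  the sides of the large cylinder.\<close>

lemma mtau_ratio_sub:
  fixes v :: "real^'d::finite"
  assumes d2: "CARD('d) \<ge> 2" and R: "hyperrect_normal R v" "0 < h" and R': "hyperrect_normal R' v" "0 < h'"
  shows "\<exists>C1\<ge>0. \<exists>C2\<ge>0. \<exists>K0. \<forall>K\<ge>K0. \<exists>N0. \<forall>N\<ge>N0.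
     mtau N R' v h' / (rect_area R' * real N ^ (CARD('d) - 1))
     \<le> mtau K R v h / (rect_area R * real K ^ (CARD('d) - 1)) + C1 / real K + C2 * real K / real N"
proof -
  let ?d = "CARD('d)"
  define A where "A = rect_area R"
  define A' where "A' = rect_area R'"
  have A: "0 < A" "0 < A'" unfolding A_def A'_def using rect_area_pos[OF d2] R R' by auto
  obtain C1 C2 where C: "0 \<le> C1" "0 \<le> C2" and tile:
    "\<And>K N. 1 \<le> K \<Longrightarrow> 1 \<le> N \<Longrightarrow> 2 * sqrt (real ?d) + 2 \<le> real K * h \<Longrightarrow>
       real K * h + sqrt (real ?d) + 1 \<le> real N * h' \<Longrightarrow>
       \<exists>(M :: ('d \<Rightarrow> int) set) zz B. finite M \<and> finite B \<and>
         disjoint_family_on (\<lambda>m. move_edges (zz m) (inner_edges (cyl_pts K R v h))) M \<and>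
         real (card M) * (real K ^ (?d - 1) * A) \<le> real N ^ (?d - 1) * A' \<and>
         real (card B) \<le> C1 * (real (card M) * real K ^ (?d - 2)) + C2 * real K * real N ^ (?d - 2) \<and>
         (\<forall>t. tau N R' v h' t \<le> (\<Sum>m\<in>M. tau K R v h (translate (zz m) t)) + V t B)"
    unfolding A_def A'_def using tiling_hyperrect[OF d2 R R'] by blast
  define K0 where "K0 = max 1 (nat \<lceil>(2 * sqrt (real ?d) + 2) / h\<rceil>)"
  have "mtau N R' v h' / (rect_area R' * real N ^ (?d - 1))
      \<le> mtau K R v h / (rect_area R * real K ^ (?d - 1)) + (mean * C1 / A) / real K + (mean * C2 / A') * real K / real N"
    if K: "K \<ge> K0" and N: "N \<ge> max 1 (nat \<lceil>(real K * h + sqrt (real ?d) + 1) / h'\<rceil>)" for K N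
  proof -
    have K1: "1 \<le> K" "2 * sqrt (real ?d) + 2 \<le> real K * h"
    proof -
      show "1 \<le> K" using K by (simp add: K0_def)
      have "nat \<lceil>(2 * sqrt (real ?d) + 2) / h\<rceil> \<le> K" using K by (simp add: K0_def)
      then have "(2 * sqrt (real ?d) + 2) / h \<le> real K" by linarith
      then show "2 * sqrt (real ?d) + 2 \<le> real K * h" using R(2) by (simp add: field_simps)
    qed
    have N1: "1 \<le> N" "real K * h + sqrt (real ?d) + 1 \<le> real N * h'"
    proof -
      show "1 \<le> N" using N by simp
      have "nat \<lceil>(real K * h + sqrt (real ?d) + 1) / h'\<rceil> \<le> N" using N by simp
      then have "(real K * h + sqrt (real ?d) + 1) / h' \<le> real N" by linarith
      then show "real K * h + sqrt (real ?d) + 1 \<le> real N * h'" using R'(2) by (simp add: field_simps)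
    qed
    obtain M :: "('d \<Rightarrow> int) set" and zz B where M: "finite M" "finite B"
      "real (card M) * (real K ^ (?d - 1) * A) \<le> real N ^ (?d - 1) * A'"
      "real (card B) \<le> C1 * (real (card M) * real K ^ (?d - 2)) + C2 * real K * real N ^ (?d - 2)"
      "\<And>t. tau N R' v h' t \<le> (\<Sum>m\<in>M. tau K R v h (translate (zz m) t)) + V t B"
      using tile[OF K1(1) N1(1) K1(2) N1(2)] by blast
    have tm: "tau K R v h \<in> borel_measurable (cap_measure G)" by (rule tau_measurable[OF R(1) K1(1)])
    have "ennreal (mtau N R' v h') \<le> (\<integral>\<^sup>+ t. (\<Sum>m\<in>M. tau K R v h (translate (zz m) t)) + V t B \<partial>cap_measure G)"
      unfolding mtau_eq[OF R'(1) N1(1), symmetric] by (rule nn_integral_mono) (rule M(5))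
    also have "\<dots> = (\<Sum>m\<in>M. \<integral>\<^sup>+ t. tau K R v h (translate (zz m) t) \<partial>cap_measure G) + (\<integral>\<^sup>+ t. V t B \<partial>cap_measure G)"
      using M(2) measurable_compose[OF translate_measurable tm]
      by (subst nn_integral_add) (auto simp: nn_integral_sum intro!: borel_measurable_sum)
    also have "\<dots> \<le> (\<Sum>m\<in>M. ennreal (mtau K R v h)) + ennreal (real (card B) * mean)"
      by (intro add_mono sum_mono V_mean_le M) (simp add: nn_integral_translate[OF tm] mtau_eq[OF R(1) K1(1)])
    also have "\<dots> = ennreal (real (card M) * mtau K R v h + real (card B) * mean)"
      using mean_nonneg mtau_nonneg[of K R v h] by (simp add: ennreal_plus ennreal_mult ennreal_of_nat_eq_real_of_nat)
    finally have le: "mtau N R' v h' \<le> real (card M) * mtau K R v h + real (card B) * mean"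
      using mean_nonneg mtau_nonneg[of K R v h] by (subst (asm) ennreal_le_iff) auto
    let ?k = "real K ^ (?d - 1)" and ?n = "real N ^ (?d - 1)"
    have k: "0 < ?k" "0 < ?n" using K1 N1 by simp_all
    have Mle: "real (card M) \<le> ?n * A' / (?k * A)" using M(3) k A by (simp add: field_simps)
    have dd: "?d - 1 = Suc (?d - 2)" using d2 by simp
    have kk: "?k = real K * real K ^ (?d - 2)" "?n = real N * real N ^ (?d - 2)" unfolding dd by simp_all
    have "real (card B) \<le> C1 * (?n * A' / (?k * A) * real K ^ (?d - 2)) + C2 * real K * real N ^ (?d - 2)"
      using Mle C by (intro order_trans[OF M(4)] add_right_mono mult_left_mono mult_right_mono) auto
    also have "\<dots> = ?n * A' * (C1 / (A * real K) + C2 * real K / (A' * real N))"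
      using K1 N1 A unfolding kk by (simp add: field_simps)
    finally have Bmean: "real (card B) * mean \<le> ?n * A' * (C1 / (A * real K) + C2 * real K / (A' * real N)) * mean"
      by (rule mult_right_mono[OF _ mean_nonneg])
    have "real (card M) * mtau K R v h \<le> ?n * A' / (?k * A) * mtau K R v h"
      using Mle by (rule mult_right_mono) (simp add: mtau_def)
    with le Bmean have "mtau N R' v h' \<le> ?n * A' / (?k * A) * mtau K R v h + ?n * A' * (C1 / (A * real K) + C2 * real K / (A' * real N)) * mean"
      by linarith
    then have "mtau N R' v h' / (A' * ?n) \<le> (?n * A' / (?k * A) * mtau K R v h + ?n * A' * (C1 / (A * real K) + C2 * real K / (A' * real N)) * mean) / (A' * ?n)"
      using A k by (intro divide_right_mono) auto
    also have "\<dots> = mtau K R v h / (A * ?k) + (mean * C1 / A) / real K + (mean * C2 / A') * real K / real N"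
      using A k K1 N1 by (simp add: add_divide_distrib distrib_left distrib_right) (simp add: field_simps)
    finally show ?thesis unfolding A_def A'_def .
  qed
  moreover have "0 \<le> mean * C1 / A" "0 \<le> mean * C2 / A'"
    using mean_nonneg C A by auto
  ultimately show ?thesis by blast
qed

definition nu :: "real^'d::finite \<Rightarrow> real" where "nu v = enn2real (flow_const G v)"

text \<open>\<open>flow_const\<close> is a definite description, so it has content only once the
  limit exists and is the same for all rectangles and heights; a unit rectangle built from
  \<open>v\<close> secures uniqueness.\<close>

lemma flow_const_limit:
  fixes v :: "real^'d::finite" and h :: real
  assumes d2: "CARD('d) \<ge> 2" and v: "norm v = 1"
  shows "flow_const G v = ennreal (nu v)"
    and "hyperrect_normal R v \<Longrightarrow> 0 < h \<Longrightarrow>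
      (\<lambda>n. mtau n R v h / (rect_area R * real n ^ (CARD('d) - 1))) \<longlonglongrightarrow> nu v"
proof -
  let ?d = "CARD('d)"
  define X :: "((real^'d) set \<times> real) set" where "X = {(R, h). hyperrect_normal R v \<and> 0 < h}"
  define f where "f x n = mtau n (fst x) v (snd x) / (rect_area (fst x) * real n ^ (?d - 1))" for x n
  have "\<exists>L\<ge>0. \<forall>x\<in>X. f x \<longlonglongrightarrow> L"
  proof (rule almost_subadditive_limit)
    show "0 \<le> f x n" for x n unfolding f_def mtau_def by simp
    fix x y assume "x \<in> X" "y \<in> X"
    then show "\<exists>C1\<ge>0. \<exists>C2\<ge>0. \<exists>K0. \<forall>K\<ge>K0. \<exists>N0. \<forall>N\<ge>N0. f y N \<le> f x K + C1 / real K + C2 * real K / real N"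
      unfolding f_def X_def by (intro mtau_ratio_sub[OF d2]) auto
  qed
  then obtain L where L: "0 \<le> L" "\<And>x. x \<in> X \<Longrightarrow> f x \<longlonglongrightarrow> L" by blast
  obtain b where b: "onb b" "b undefined = v" using onb_exists[OF v] .
  have ex: "hyperrect_normal (frect b undefined 0 (\<lambda>_. 1)) v" unfolding hyperrect_normal_iff using b by (metis zero_less_one)
  let ?lim = "\<lambda>c. \<forall>R h. hyperrect_normal R v \<and> h > 0 \<longrightarrow>
      ((\<lambda>n. (\<integral>\<^sup>+ t. tau n R v h t \<partial>(cap_measure G)) / ennreal (rect_area R * real n ^ (?d - 1))) \<longlonglongrightarrow> c)"
  have "?lim (ennreal L)"
  proof (intro allI impI)
    fix R and h :: real assume R: "hyperrect_normal R v \<and> 0 < h"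
    then have "(\<lambda>n. mtau n R v h / (rect_area R * real n ^ (?d - 1))) \<longlonglongrightarrow> L"
      using L(2)[of "(R, h)"] by (simp add: X_def f_def[abs_def])
    then have "(\<lambda>n. ennreal (mtau n R v h / (rect_area R * real n ^ (?d - 1)))) \<longlonglongrightarrow> ennreal L"
      by (rule tendsto_ennrealI)
    moreover have "\<forall>\<^sub>F n in sequentially. ennreal (mtau n R v h / (rect_area R * real n ^ (?d - 1))) =
        (\<integral>\<^sup>+ t. tau n R v h t \<partial>(cap_measure G)) / ennreal (rect_area R * real n ^ (?d - 1))"
      using eventually_ge_at_top[of 1]
    proof eventually_elim
      case (elim n)
      then have "0 < rect_area R * real n ^ (?d - 1)" using rect_area_pos[OF d2, of R v] R by simp
      then show ?case
        using mtau_eq[of R v n h] R elim divide_ennreal[OF mtau_nonneg, of "rect_area R * real n ^ (?d - 1)" n R v h] by simp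
    qed
    ultimately show "(\<lambda>n. (\<integral>\<^sup>+ t. tau n R v h t \<partial>(cap_measure G)) / ennreal (rect_area R * real n ^ (?d - 1))) \<longlonglongrightarrow> ennreal L"
      by (rule Lim_transform_eventually)
  qed
  moreover have "c = ennreal L" if "?lim c" for c
  proof -
    let ?R = "frect b undefined 0 (\<lambda>_. 1)"
    let ?f = "\<lambda>n. (\<integral>\<^sup>+ t. tau n ?R v 1 t \<partial>(cap_measure G)) / ennreal (rect_area ?R * real n ^ (?d - 1))"
    have "?f \<longlonglongrightarrow> c" using that ex zero_less_one by blast
    moreover have "?f \<longlonglongrightarrow> ennreal L" using \<open>?lim (ennreal L)\<close> ex zero_less_one by blast
    ultimately show ?thesis by (rule LIMSEQ_unique)
  qed
  ultimately have "flow_const G v = ennreal L" unfolding flow_const_def by (rule the_equality)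
  moreover then have "nu v = L" using L(1) by (simp add: nu_def)
  ultimately show "flow_const G v = ennreal (nu v)"
    "hyperrect_normal R v \<Longrightarrow> 0 < h \<Longrightarrow> (\<lambda>n. mtau n R v h / (rect_area R * real n ^ (?d - 1))) \<longlonglongrightarrow> nu v"
    using L(2)[of "(R, h)"] by (auto simp: X_def f_def[abs_def])
qed

lemma nu_nonneg: "0 \<le> nu v" by (simp add: nu_def)

text \<open>A scale \<open>K\<close> is fixed at which the mean per unit area is below
  \<open>nu v + \<epsilon> / 4\<close>. Reaching \<open>nu v + \<epsilon>\<close> then requires the
  blocks to reach \<open>nu v + 3 * \<epsilon> / 4\<close> or the gluing edges to reach
  \<open>\<epsilon> / 4\<close> per unit area, and both have probabilities of surface order.\<close>

lemma tau_upper_deviation: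
  fixes v :: "real^'d::finite"
  assumes d2: "CARD('d) \<ge> 2" and R: "hyperrect_normal R v" and h: "0 < h" and \<epsilon>: "0 < \<epsilon>"
  shows "\<exists>c>0. \<exists>n0. \<forall>n\<ge>n0. emeasure (cap_measure G) {t. ennreal ((nu v + \<epsilon>) * rect_area R * real n ^ (CARD('d) - 1)) \<le> tau n R v h t}
      \<le> ennreal (2 * exp (- c * real n ^ (CARD('d) - 1)))"
proof -
  let ?d = "CARD('d)"
  obtain b i0 where "onb b" "b i0 = v" using R unfolding hyperrect_normal_iff by blast
  then have v: "norm v = 1" using onb_norm by blast
  define u where "u = rect_area R"
  have u: "0 < u" unfolding u_def by (rule rect_area_pos[OF d2 R])
  obtain C1 C2 where C: "0 \<le> C1" "0 \<le> C2" and tile: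
    "\<And>K N. 1 \<le> K \<Longrightarrow> 1 \<le> N \<Longrightarrow> 2 * sqrt (real ?d) + 2 \<le> real K * h \<Longrightarrow>
       real K * h + sqrt (real ?d) + 1 \<le> real N * h \<Longrightarrow>
       \<exists>(M :: ('d \<Rightarrow> int) set) zz B. finite M \<and> finite B \<and>
         disjoint_family_on (\<lambda>m. move_edges (zz m) (inner_edges (cyl_pts K R v h))) M \<and>
         real (card M) * (real K ^ (?d - 1) * u) \<le> real N ^ (?d - 1) * u \<and>
         real (card B) \<le> C1 * (real (card M) * real K ^ (?d - 2)) + C2 * real K * real N ^ (?d - 2) \<and>
         (\<forall>t. tau N R v h t \<le> (\<Sum>m\<in>M. tau K R v h (translate (zz m) t)) + V t B)"
    unfolding u_def using tiling_hyperrect[OF d2 R h R h] by blast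
  define l where "l = ln mgf"
  have l: "0 \<le> l" "exp l = mgf" using mgf_ge_1 by (simp_all add: l_def)
  \<comment> \<open>The cell walls and the outer sides each contribute at most \<open>\<eta>\<close>
    to \<open>card B * l\<close> per \<open>N^(d-1)\<close>; together they use half of the Chernoff
    gain \<open>\<theta>0 * u * \<epsilon> / 4\<close>.\<close>
  define \<eta> where "\<eta> = \<theta>0 * u * \<epsilon> / 16"
  have \<eta>: "0 < \<eta>" using \<theta>0_pos u \<epsilon> by (simp add: \<eta>_def)
  have "\<forall>\<^sub>F K in sequentially. mtau K R v h / (u * real K ^ (?d - 1)) < nu v + \<epsilon> / 4"
    using order_tendstoD(2)[OF flow_const_limit(2)[OF d2 v R h], of "nu v + \<epsilon> / 4"] \<epsilon> by (simp add: u_def)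
  moreover have "\<forall>\<^sub>F K in sequentially. C1 * l / real K < \<eta>"
    using order_tendstoD(2)[OF lim_const_over_n \<eta>] .
  moreover have "\<forall>\<^sub>F K in sequentially. (2 * sqrt (real ?d) + 2) / real K < h"
    using order_tendstoD(2)[OF lim_const_over_n h] .
  ultimately have "\<forall>\<^sub>F K in sequentially. mtau K R v h / (u * real K ^ (?d - 1)) < nu v + \<epsilon> / 4 \<and> C1 * l / real K < \<eta> \<and> (2 * sqrt (real ?d) + 2) / real K < h \<and> 1 \<le> K"
    using eventually_ge_at_top[of 1] by eventually_elim auto
  then obtain K where K: "mtau K R v h / (u * real K ^ (?d - 1)) < nu v + \<epsilon> / 4" "C1 * l / real K < \<eta>"
      "(2 * sqrt (real ?d) + 2) / real K < h" "1 \<le> K"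
    using eventually_happens'[OF sequentially_bot] by blast
  have Kh: "2 * sqrt (real ?d) + 2 \<le> real K * h" using K(3,4) by (simp add: field_simps)
  let ?k = "real K ^ (?d - 1)"
  have k: "0 < ?k" using K(4) by simp
  \<comment> \<open>This slack per block costs \<open>\<epsilon> / 4\<close> per unit area and
    leaves another \<open>\<epsilon> / 4\<close> below the threshold \<open>T1\<close>.\<close>
  define \<epsilon>' where "\<epsilon>' = u * \<epsilon> * ?k / 4"
  have \<epsilon>': "0 < \<epsilon>'" using u \<epsilon> k by (simp add: \<epsilon>'_def)
  let ?F = "inner_edges (cyl_pts K R v h)"
  obtain \<theta> where \<theta>: "0 < \<theta>" and chern: "\<And>(M :: ('d \<Rightarrow> int) set) z a. finite M \<Longrightarrow> disjoint_family_on (\<lambda>m. move_edges (z m) ?F) M \<Longrightarrow> 0 \<le> a \<Longrightarrow>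
      emeasure (cap_measure G) {t. ennreal a \<le> (\<Sum>m\<in>M. tau K R v h (translate (z m) t))}
      \<le> ennreal (exp (\<theta> * (real (card M) * (mtau K R v h + \<epsilon>') - a)))"
    unfolding mtau_def
    using block_chernoff[where X="tau K R v h" and F="?F" and 'm="'d \<Rightarrow> int", OF tau_measurable[OF R K(4)] tau_depends_on finite_inner_edges[OF finite_cyl_pts[OF R K(4)]] tau_le_V_inner[OF R] \<epsilon>'] by blast
  define c1 where "c1 = min (\<theta> * u * \<epsilon> / 4) (\<theta>0 * u * \<epsilon> / 8)"
  have c1: "0 < c1" using \<theta> \<theta>0_pos u \<epsilon> by (simp add: c1_def)
  have "\<forall>\<^sub>F N in sequentially. C2 * real K * l / real N < \<eta>"
    using order_tendstoD(2)[OF lim_const_over_n \<eta>] .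
  moreover have "\<forall>\<^sub>F N in sequentially. (real K * h + sqrt (real ?d) + 1) / real N < h"
    using order_tendstoD(2)[OF lim_const_over_n h] .
  ultimately have "\<forall>\<^sub>F N in sequentially. C2 * real K * l / real N < \<eta> \<and> (real K * h + sqrt (real ?d) + 1) / real N < h \<and> 1 \<le> N"
    using eventually_ge_at_top[of 1] by eventually_elim auto
  then obtain n0 where n0: "\<And>N. N \<ge> n0 \<Longrightarrow> C2 * real K * l / real N < \<eta> \<and> (real K * h + sqrt (real ?d) + 1) / real N < h \<and> 1 \<le> N"
    unfolding eventually_sequentially by blast
  have "emeasure (cap_measure G) {t. ennreal ((nu v + \<epsilon>) * u * real N ^ (?d - 1)) \<le> tau N R v h t}
      \<le> ennreal (2 * exp (- c1 * real N ^ (?d - 1)))" if "N \<ge> n0" for N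
  proof -
    have N: "C2 * real K * l / real N < \<eta>" "(real K * h + sqrt (real ?d) + 1) / real N < h" "1 \<le> N" using n0[OF that] by auto
    have Nh: "real K * h + sqrt (real ?d) + 1 \<le> real N * h" using N(2,3) by (simp add: field_simps)
    let ?n = "real N ^ (?d - 1)"
    have n: "0 < ?n" using N(3) by simp
    obtain M :: "('d \<Rightarrow> int) set" and zz B where M: "finite M" "finite B"
      "disjoint_family_on (\<lambda>m. move_edges (zz m) ?F) M"
      "real (card M) * (?k * u) \<le> ?n * u"
      "real (card B) \<le> C1 * (real (card M) * real K ^ (?d - 2)) + C2 * real K * real N ^ (?d - 2)"
      "\<And>t. tau N R v h t \<le> (\<Sum>m\<in>M. tau K R v h (translate (zz m) t)) + V t B"
      using tile[OF K(4) N(3) Kh Nh] by blast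
    have cM: "real (card M) \<le> ?n / ?k" using M(4) u k by (simp add: field_simps)
    define T1 where "T1 = u * (nu v + 3 * \<epsilon> / 4) * ?n"
    define T2 where "T2 = u * \<epsilon> / 4 * ?n"
    have T: "(nu v + \<epsilon>) * u * ?n = T1 + T2" "0 \<le> T1" "0 \<le> T2"
      using u \<epsilon> n nu_nonneg[of v] by (auto simp: T1_def T2_def algebra_simps)
    let ?S1 = "{t. ennreal T1 \<le> (\<Sum>m\<in>M. tau K R v h (translate (zz m) t))}" and ?S2 = "{t. ennreal T2 \<le> V t B}"
    have tm: "tau K R v h \<in> borel_measurable (cap_measure G)" by (rule tau_measurable[OF R K(4)])
    have "(\<lambda>t. \<Sum>m\<in>M. tau K R v h (translate (zz m) t)) \<in> borel_measurable (cap_measure G)"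
      by (intro borel_measurable_sum measurable_compose[OF translate_measurable tm])
    then have S1: "?S1 \<in> sets (cap_measure G)"
      using measurable_sets[of _ "cap_measure G" borel "{ennreal T1..}"] by (fastforce simp: vimage_def)
    have S2: "?S2 \<in> sets (cap_measure G)"
      using measurable_sets[OF V_measurable[OF M(2)], of "{ennreal T2..}"] by (simp add: vimage_def)
    have "{t. ennreal ((nu v + \<epsilon>) * u * ?n) \<le> tau N R v h t} \<subseteq> ?S1 \<union> ?S2"
    proof
      fix t assume "t \<in> {t. ennreal ((nu v + \<epsilon>) * u * ?n) \<le> tau N R v h t}"
      then have "ennreal T1 + ennreal T2 \<le> tau N R v h t" unfolding T(1) ennreal_plus[OF T(2,3)] by simp
      then have "ennreal T1 + ennreal T2 \<le> (\<Sum>m\<in>M. tau K R v h (translate (zz m) t)) + V t B"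
        using M(6)[of t] by (rule order_trans)
      then show "t \<in> ?S1 \<union> ?S2" using add_strict_mono[of "\<Sum>m\<in>M. tau K R v h (translate (zz m) t)" "ennreal T1" "V t B" "ennreal T2"]
        by (auto simp: not_le[symmetric])
    qed
    then have "emeasure (cap_measure G) {t. ennreal ((nu v + \<epsilon>) * u * ?n) \<le> tau N R v h t} \<le> emeasure (cap_measure G) (?S1 \<union> ?S2)"
      by (rule emeasure_mono) (use S1 S2 in auto)
    also have "\<dots> \<le> emeasure (cap_measure G) ?S1 + emeasure (cap_measure G) ?S2"
      by (rule emeasure_subadditive[OF S1 S2])
    also have "\<dots> \<le> ennreal (exp (- c1 * ?n)) + ennreal (exp (- c1 * ?n))"
    proof (rule add_mono)
      have "real (card M) * (mtau K R v h + \<epsilon>') \<le> ?n / ?k * (mtau K R v h + \<epsilon>')"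
        using cM \<epsilon>' by (intro mult_right_mono) (auto simp: mtau_def)
      also have "\<dots> = ?n * u * (mtau K R v h / (u * ?k)) + ?n * (u * \<epsilon> / 4)"
      proof -
        have "n / k * (x + u * \<epsilon> * k / 4) = n * u * (x / (u * k)) + n * (u * \<epsilon> / 4)" if "0 < k" for n k x :: real
          using that u by (simp add: field_simps)
        from this[OF k] show ?thesis unfolding \<epsilon>'_def .
      qed
      also have "\<dots> \<le> ?n * u * (nu v + \<epsilon> / 4) + ?n * (u * \<epsilon> / 4)"
        using K(1) n u by (intro add_right_mono mult_left_mono) auto
      finally have "real (card M) * (mtau K R v h + \<epsilon>') - T1 \<le> - (u * \<epsilon> / 4 * ?n)"
        unfolding T1_def by (simp add: algebra_simps)
      then have "\<theta> * (real (card M) * (mtau K R v h + \<epsilon>') - T1) \<le> \<theta> * (- (u * \<epsilon> / 4 * ?n))"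
        using \<theta> by (intro mult_left_mono) auto
      also have "\<dots> = - (\<theta> * u * \<epsilon> / 4) * ?n" by simp
      also have "\<dots> \<le> - c1 * ?n" using n by (intro mult_right_mono) (auto simp: c1_def)
      finally show "emeasure (cap_measure G) ?S1 \<le> ennreal (exp (- c1 * ?n))"
        using chern[OF M(1,3) T(2)] by (meson ennreal_leI exp_le_cancel_iff order_trans)
      have dd: "?d - 1 = Suc (?d - 2)" using d2 by simp
      have kk: "?k = real K * real K ^ (?d - 2)" "?n = real N * real N ^ (?d - 2)" unfolding dd by simp_all
      have "real (card B) \<le> C1 * (?n / ?k * real K ^ (?d - 2)) + C2 * real K * real N ^ (?d - 2)"
        using cM C by (intro order_trans[OF M(5)] add_right_mono mult_left_mono mult_right_mono) auto
      also have "\<dots> = ?n * (C1 / real K + C2 * real K / real N)"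
        using K(4) N(3) unfolding kk by (simp add: field_simps)
      finally have "real (card B) * l \<le> ?n * (C1 / real K + C2 * real K / real N) * l"
        by (rule mult_right_mono[OF _ l(1)])
      also have "\<dots> = ?n * (C1 * l / real K + C2 * real K * l / real N)" by (simp add: algebra_simps)
      also have "\<dots> \<le> ?n * (\<eta> + \<eta>)" using K(2) N(1) n by (intro mult_left_mono add_mono) auto
      finally have Bl: "real (card B) * l \<le> \<theta>0 * u * \<epsilon> / 8 * ?n" by (simp add: \<eta>_def algebra_simps)
      have "exp (- \<theta>0 * T2) * mgf ^ card B = exp (- \<theta>0 * T2 + real (card B) * l)"
        by (simp only: exp_add exp_of_nat_mult l(2))
      also have "\<dots> \<le> exp (- c1 * ?n)"
      proof -
        have "- \<theta>0 * T2 + real (card B) * l \<le> - (\<theta>0 * u * \<epsilon> / 8) * ?n" using Bl unfolding T2_def by (simp add: algebra_simps)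
        also have "\<dots> \<le> - c1 * ?n" using n by (intro mult_right_mono) (auto simp: c1_def)
        finally show ?thesis by simp
      qed
      finally show "emeasure (cap_measure G) ?S2 \<le> ennreal (exp (- c1 * ?n))"
        using V_chernoff[OF M(2) T(3)] by (meson ennreal_leI order_trans)
    qed
    also have "\<dots> = ennreal (2 * exp (- c1 * ?n))" by (simp flip: ennreal_plus)
    finally show ?thesis .
  qed
  then show ?thesis using c1 unfolding u_def by blast
qed

end

section \<open>Flat patches of a convex boundary\<close>

lemma outer_normal_exists:
  fixes A :: "(real^'d::finite) set"
  assumes A: "convex A" "closed A" and x: "x \<in> frontier A"
  obtains w where "is_outer_normal A x w"
proof -
  have xA: "x \<in> A" using x A(2) frontier_subset_closed by blast
  have "\<exists>a. a \<noteq> 0 \<and> (\<forall>y\<in>A. inner a x \<le> inner a y)"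
  \<comment> \<open>A convex set with empty interior lies in a hyperplane, whose normal vector
    supports it at every point.\<close>
  proof (cases "interior A = {}")
    case True
    then obtain a c where "a \<noteq> 0" "A \<subseteq> {y. inner a y = c}" using empty_interior_subset_hyperplane[OF A(1)] by blast
    then have "inner a y = c" if "y \<in> A" for y using that by blast
    then show ?thesis using xA \<open>a \<noteq> 0\<close> by (intro exI[of _ a]) simp
  next
    case False
    have "x \<notin> rel_interior A"
      using x rel_interior_nonempty_interior[OF False] by (simp add: frontier_def)
    then show ?thesis using supporting_hyperplane_rel_boundary[OF A(1) xA] by metis
  qed
  then obtain a where a: "a \<noteq> 0" "\<And>y. y \<in> A \<Longrightarrow> inner a x \<le> inner a y" by blast
  have "is_outer_normal A x (- (a /\<^sub>R norm a))"
    unfolding is_outer_normal_def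
  proof (intro conjI ballI)
    show "norm (- (a /\<^sub>R norm a)) = 1" using a(1) by simp
    fix y assume "y \<in> A"
    then have "0 \<le> inner a (y - x)" using a(2) by (simp add: inner_diff_right)
    then have "0 \<le> inner (y - x) a" by (simp add: inner_commute)
    then show "inner (y - x) (- (a /\<^sub>R norm a)) \<le> 0" by simp
  qed
  then show thesis by (rule that)
qed

lemma normal_is_outer: "has_normal A x \<Longrightarrow> is_outer_normal A x (normal A x)"
  unfolding has_normal_def normal_def by (rule theI')

text \<open>Outer normals pass to limits and the unit sphere is compact, so normals at points
  tending to \<open>x\<close> accumulate only at the unique normal of \<open>x\<close>.\<close>

lemma normals_near:
  fixes A :: "(real^'d::finite) set"
  assumes x: "has_normal A x" and \<delta>: "0 < \<delta>"
  obtains r where "0 < r" "\<And>y w. y \<in> A \<Longrightarrow> dist y x < r \<Longrightarrow> is_outer_normal A y w \<Longrightarrow> norm (w - normal A x) < \<delta>"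
proof (rule ccontr)
  assume neg: "\<not> thesis"
  note obt = that
  have no: "\<exists>y w. y \<in> A \<and> dist y x < r \<and> is_outer_normal A y w \<and> \<delta> \<le> norm (w - normal A x)" if r: "0 < r" for r
  proof (rule ccontr)
    assume "\<not> ?thesis"
    then have "norm (w - normal A x) < \<delta>" if "y \<in> A" "dist y x < r" "is_outer_normal A y w" for y w
      using that by (meson not_le)
    then show False using obt[OF r] neg by blast
  qed
  have "\<forall>n. \<exists>y w. y \<in> A \<and> dist y x < 1 / real (Suc n) \<and> is_outer_normal A y w \<and> \<delta> \<le> norm (w - normal A x)"
    using no by simp
  then obtain y w where yw: "\<And>n. y n \<in> A" "\<And>n. dist (y n) x < 1 / real (Suc n)" "\<And>n. is_outer_normal A (y n) (w n)" "\<And>n. \<delta> \<le> norm (w n - normal A x)"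
    by metis
  have "w n \<in> sphere 0 1" for n using yw(3)[of n] by (simp add: is_outer_normal_def)
  then obtain l f where l: "l \<in> sphere 0 1" "strict_mono f" "(w \<circ> f) \<longlonglongrightarrow> l"
    using seq_compactE[OF compact_imp_seq_compact[OF compact_sphere]] by metis
  have lim: "(\<lambda>n. 1 / real (Suc n)) \<longlonglongrightarrow> 0" by (rule LIMSEQ_Suc[OF lim_1_over_n])
  have "(\<lambda>n. dist (y n) x) \<longlonglongrightarrow> 0"
    by (rule tendsto_sandwich[OF _ _ tendsto_const lim]) (use yw(2) in \<open>auto intro!: always_eventually less_imp_le\<close>)
  then have "y \<longlonglongrightarrow> x" by (simp add: tendsto_dist_iff[of y])
  then have yf: "(y \<circ> f) \<longlonglongrightarrow> x" using l(2) LIMSEQ_subseq_LIMSEQ by blast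
  have "is_outer_normal A x l"
    unfolding is_outer_normal_def
  proof (intro conjI ballI)
    show "norm l = 1" using l(1) by simp
    fix z assume z: "z \<in> A"
    have "(\<lambda>n. inner (z - (y \<circ> f) n) ((w \<circ> f) n)) \<longlonglongrightarrow> inner (z - x) l"
      by (intro tendsto_intros yf l(3))
    moreover have "inner (z - (y \<circ> f) n) ((w \<circ> f) n) \<le> 0" for n
      using yw(3)[of "f n"] z by (simp add: is_outer_normal_def)
    ultimately show "inner (z - x) l \<le> 0" using LIMSEQ_le_const2 by blast
  qed
  then have "l = normal A x" using x normal_is_outer[OF x] unfolding has_normal_def by blast
  moreover have "\<delta> \<le> norm (l - normal A x)"
  proof -
    have "(\<lambda>n. norm ((w \<circ> f) n - normal A x)) \<longlonglongrightarrow> norm (l - normal A x)" by (intro tendsto_intros l(3))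
    then show ?thesis by (rule LIMSEQ_le_const) (use yw(4) in auto)
  qed
  ultimately show False using \<delta> by simp
qed

text \<open>Unlike \<open>frect\<close>, centred at \<open>c\<close> in the lateral directions;
  \<open>l = u = 0\<close> gives a rectangle of half side \<open>\<rho>\<close>.\<close>

definition slab :: "('d::finite \<Rightarrow> real^'d) \<Rightarrow> 'd \<Rightarrow> real^'d \<Rightarrow> real \<Rightarrow> real \<Rightarrow> real \<Rightarrow> (real^'d) set" where
  "slab b i0 c \<rho> l u = {x. (\<forall>i. i \<noteq> i0 \<longrightarrow> \<bar>inner (x - c) (b i)\<bar> \<le> \<rho>) \<and> l \<le> inner (x - c) (b i0) \<and> inner (x - c) (b i0) \<le> u}"

lemma closed_slab: "closed (slab b i0 c \<rho> l u)"
proof -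
  have "slab b i0 c \<rho> l u = (\<Inter>i\<in>-{i0}. {x. \<bar>inner (x - c) (b i)\<bar> \<le> \<rho>}) \<inter> {x. l \<le> inner (x - c) (b i0)} \<inter> {x. inner (x - c) (b i0) \<le> u}"
    by (auto simp: slab_def)
  also have "closed \<dots>"
    by (intro closed_Int closed_INT ballI closed_Collect_le continuous_intros)
  finally show ?thesis .
qed

lemma slab_norm:
  fixes b :: "'d::finite \<Rightarrow> real^'d"
  assumes "onb b" "x \<in> slab b i0 c \<rho> l u" "\<rho> \<le> m" "- m \<le> l" "u \<le> m"
  shows "norm (x - c) \<le> sqrt (real CARD('d)) * m"
proof (rule onb_norm_le[OF assms(1)])
  fix i show "\<bar>inner (x - c) (b i)\<bar> \<le> m"
    using assms(2-) by (cases "i = i0") (auto simp: slab_def abs_le_iff intro: order_trans)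
qed

lemma slab_base_frect: "onb b \<Longrightarrow> slab b i0 c \<rho> 0 0 = frect b i0 (c - \<rho> *\<^sub>R (\<Sum>i\<in>UNIV - {i0}. b i)) (\<lambda>_. 2 * \<rho>)"
proof -
  assume b: "onb b"
  have "inner (\<Sum>i\<in>UNIV - {i0}. b i) (b j) = (if j = i0 then 0 else 1)" for j
    by (auto simp: inner_sum_left onb_inner[OF b])
  then have "inner (x - (c - \<rho> *\<^sub>R (\<Sum>i\<in>UNIV - {i0}. b i))) (b j) = inner (x - c) (b j) + (if j = i0 then 0 else \<rho>)" for x j
    by (simp add: inner_diff_left)
  then show ?thesis by (auto simp: slab_def frect_def abs_le_iff)
qed

lemma slab_base_outer:
  fixes b :: "'d::finite \<Rightarrow> real^'d"
  assumes d2: "CARD('d) \<ge> 2" and b: "onb b" and \<rho>: "0 \<le> \<rho>"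
  shows "hausdorff_outer (codim1 TYPE('d)) (slab b i0 c \<rho> 0 0) = ennreal (hbox_const TYPE('d) * (2 * \<rho>) ^ (CARD('d) - 1))"
  unfolding slab_base_frect[OF b] using \<rho> by (subst frect_outer[OF d2 b]) simp_all

text \<open>The components are a frame, the index of its normal vector, the centre, the lateral half
  side and the half height.\<close>

type_synonym 'd patch = "('d \<Rightarrow> real^'d) \<times> 'd \<times> (real^'d) \<times> real \<times> real"

fun pcyl :: "'d::finite patch \<Rightarrow> (real^'d) set" where
  "pcyl (b, i0, c, \<rho>, h) = slab b i0 c \<rho> (-h) h"

fun prad :: "'d::finite patch \<Rightarrow> real" where
  "prad (b, i0, c, \<rho>, h) = \<rho>"

text \<open>The last clause of \<open>good_patch\<close>, rather than closeness of the directions, is what makes the argument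
  independent of any continuity of \<open>\<nu>\<close>.\<close>

fun good_patch :: "(real^'d::finite) set \<Rightarrow> (real^'d \<Rightarrow> real) \<Rightarrow> real \<Rightarrow> real \<Rightarrow> 'd patch \<Rightarrow> bool" where
  "good_patch A \<nu> \<eta> \<epsilon> (b, i0, c, \<rho>, h) \<longleftrightarrow> onb b \<and> 0 < \<rho> \<and> 0 < h \<and> h \<le> \<eta> * \<rho> \<and>
     (\<forall>x\<in>A. inner (x - c) (b i0) \<le> 0) \<and> slab b i0 c (\<rho> + h) (-h) (-h) \<subseteq> interior A \<and>
     (\<forall>z\<in>frontier A \<inter> slab b i0 c \<rho> (-h) h. has_normal A z \<longrightarrow> \<nu> (b i0) \<le> \<nu> (normal A z) + \<epsilon>)"

text \<open>If the half side \<open>\<rho>\<close> is this ratio times \<open>r\<close>, a box of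
  half side \<open>2 * \<rho>\<close> stays within \<open>r / 2\<close> of its centre, which leaves
  room for the offset between the centre and \<open>x\<close>.\<close>

definition patch_ratio :: "'d::finite itself \<Rightarrow> real" where
  "patch_ratio T = 1 / (4 * sqrt (real CARD('d)))"

lemma patch_ratio_pos: "0 < patch_ratio TYPE('d::finite)" by (simp add: patch_ratio_def)

text \<open>The patch leans on the supporting hyperplane at a point \<open>y\<close> near
  \<open>x\<close> whose normal almost minimises \<open>\<nu>\<close>, and it is centred at the
  projection of \<open>x\<close>. Normals near \<open>x\<close> are close to each other, so
  \<open>A\<close> is almost flat there, and even the bottom of a cylinder much thinner than
  \<open>r\<close> lies inside \<open>A\<close>.\<close>

lemma patch_exists:
  fixes A :: "(real^'d::finite) set"
  assumes A: "convex A" "compact A" and x: "x \<in> frontier A" "has_normal A x"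
    and \<nu>: "\<And>w. 0 \<le> \<nu> w" and \<eta>: "0 < \<eta>" and \<epsilon>: "0 < \<epsilon>"
  obtains r0 where "0 < r0" "\<And>r. 0 < r \<Longrightarrow> r < r0 \<Longrightarrow>
     \<exists>P. good_patch A \<nu> \<eta> \<epsilon> P \<and> pcyl P \<subseteq> cball x r \<and> prad P = patch_ratio TYPE('d) * r"
proof -
  let ?d = "CARD('d)"
  let ?\<kappa> = "patch_ratio TYPE('d)"
  have \<kappa>: "0 < ?\<kappa>" "sqrt (real ?d) * ?\<kappa> = 1 / 4" "?\<kappa> \<le> 1 / 4"
    by (auto simp: patch_ratio_def field_simps)
  have clA: "closed A" using A(2) by (rule compact_imp_closed)
  have fA: "frontier A \<subseteq> A" using clA by (rule frontier_subset_closed)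
  define \<eta>' where "\<eta>' = min \<eta> 1"
  have \<eta>': "0 < \<eta>'" "\<eta>' \<le> \<eta>" "\<eta>' \<le> 1" using \<eta> by (auto simp: \<eta>'_def)
  \<comment> \<open>Makes \<open>8 * \<delta> * r\<close> equal to \<open>h / 2\<close>, so that the
    flatness error is smaller than the depth \<open>h\<close>.\<close>
  define \<delta> where "\<delta> = \<eta>' * ?\<kappa> / 16"
  have \<delta>: "0 < \<delta>" using \<eta>' \<kappa> by (simp add: \<delta>_def)
  have "\<eta>' * ?\<kappa> \<le> 1 * (1 / 4)" using \<eta>' \<kappa> by (intro mult_mono) auto
  then have \<delta>16: "\<delta> \<le> 1 / 64" by (simp add: \<delta>_def)
  obtain R where R: "0 < R" and near: "\<And>y w. y \<in> A \<Longrightarrow> dist y x < R \<Longrightarrow> is_outer_normal A y w \<Longrightarrow> norm (w - normal A x) < \<delta>"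
    using normals_near[OF x(2) \<delta>] by blast
  have close: "norm (w1 - w2) \<le> 2 * \<delta>" if "y1 \<in> A" "dist y1 x < R" "is_outer_normal A y1 w1" "y2 \<in> A" "dist y2 x < R" "is_outer_normal A y2 w2" for y1 y2 w1 w2
    using near[OF that(1-3)] near[OF that(4-6)] norm_triangle_ineq4[of "w1 - normal A x" "w2 - normal A x"] by simp
  \<comment> \<open>\<open>y\<close> lies below the supporting hyperplane at \<open>z\<close>;
    exchanging the normal at \<open>z\<close> for the one at \<open>y\<close> costs at most the
    distance of the points times the distance of the normals.\<close>
  have flat: "- (4 * \<delta> * s) \<le> inner (z - y) wy" if "y \<in> A" "dist y x < R" "is_outer_normal A y wy" "z \<in> A" "dist z x < R" "is_outer_normal A z wz" "dist y x \<le> s" "dist z x \<le> s" for y z wy wz s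
  proof -
    have 1: "0 \<le> inner (z - y) wz" using that(1,6) unfolding is_outer_normal_def by (metis inner_minus_left minus_diff_eq neg_le_0_iff_le minus_minus)
    have "norm (z - y) \<le> 2 * s" using that(7,8) dist_triangle2[of z y x] by (simp add: dist_norm)
    then have "norm (z - y) * norm (wy - wz) \<le> (2 * s) * (2 * \<delta>)"
      using close[OF that(1-6)] \<delta> order_trans[OF zero_le_dist that(7)] by (intro mult_mono) auto
    also have "\<dots> = 4 * \<delta> * s" by simp
    finally have "\<bar>inner (z - y) (wy - wz)\<bar> \<le> 4 * \<delta> * s" using Cauchy_Schwarz_ineq2[of "z - y" "wy - wz"] by simp
    then show ?thesis using 1 by (simp add: inner_diff_right abs_le_iff)
  qed
  show thesis
  proof (rule that[of "R / 2"])
    show "0 < R / 2" using R by simp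
    fix r assume r: "0 < r" "r < R / 2"
    \<comment> \<open>The infimum is taken over the whole ball, since every frontier point of the
      future cylinder lies in it.\<close>
    define S where "S = (\<lambda>z. \<nu> (normal A z)) ` {z \<in> frontier A \<inter> cball x r. has_normal A z}"
    have "x \<in> {z \<in> frontier A \<inter> cball x r. has_normal A z}" using x r by simp
    then have "S \<noteq> {}" unfolding S_def by blast
    moreover have bb: "bdd_below S" using \<nu> by (auto simp: S_def intro!: bdd_belowI[of _ 0])
    moreover have "Inf S < Inf S + \<epsilon>" using \<epsilon> by simp
    ultimately obtain q where "q \<in> S" "q < Inf S + \<epsilon>" using cInf_lessD by metis
    then obtain y where y: "y \<in> frontier A" "dist y x \<le> r" "has_normal A y" "\<nu> (normal A y) < Inf S + \<epsilon>"
      by (auto simp: S_def dist_commute)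
    have min: "\<nu> (normal A y) \<le> \<nu> (normal A z) + \<epsilon>" if "z \<in> frontier A" "z \<in> cball x r" "has_normal A z" for z
    proof -
      have "Inf S \<le> \<nu> (normal A z)" using that by (intro cInf_lower bb) (auto simp: S_def)
      then show ?thesis using y(4) by simp
    qed
    define w where "w = normal A y"
    have w: "is_outer_normal A y w" unfolding w_def by (rule normal_is_outer[OF y(3)])
    have w1: "norm w = 1" using w by (simp add: is_outer_normal_def)
    have yA: "y \<in> A" and yR: "dist y x < R" using y fA r by auto
    have xA: "x \<in> A" using x fA by blast
    define i0 where "i0 = (undefined :: 'd)"
    obtain b where b: "onb b" "b i0 = w" using onb_exists[OF w1] .
    define c where "c = x - inner (x - y) w *\<^sub>R w"
    have ww: "inner w w = 1" using w1 by (simp add: norm_eq_sqrt_inner)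
    have cy: "inner (z - c) w = inner (z - y) w" for z
      by (simp add: c_def inner_diff_left inner_add_left ww)
    have xc: "norm (x - c) \<le> 4 * \<delta> * r"
    proof -
      have "inner (x - y) w \<le> 0" using w xA by (simp add: is_outer_normal_def)
      moreover have "- (4 * \<delta> * r) \<le> inner (x - y) w"
        using flat[OF yA yR w xA _ normal_is_outer[OF x(2)] y(2)] r R by simp
      ultimately have "\<bar>inner (x - y) w\<bar> \<le> 4 * \<delta> * r" by simp
      then show ?thesis by (simp add: c_def w1)
    qed
    define \<rho> where "\<rho> = ?\<kappa> * r"
    define h where "h = \<eta>' * \<rho>"
    have \<rho>: "0 < \<rho>" "sqrt (real ?d) * \<rho> = r / 4" using \<kappa>(1,2) r by (simp_all add: \<rho>_def mult.assoc[symmetric])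
    have h: "0 < h" "h \<le> \<eta> * \<rho>" "h \<le> \<rho>"
      using \<eta>' \<rho> by (auto simp: h_def intro: mult_right_mono)
    have \<delta>r: "4 * \<delta> * r \<le> r / 4" using \<delta>16 r mult_right_mono[OF \<delta>16, of "4 * r"] by simp
    have near_x: "dist p x \<le> r" if "norm (p - c) \<le> r / 2" for p
    proof -
      have "norm (p - x) \<le> norm (p - c) + norm (x - c)" using norm_triangle_ineq4[of "p - c" "x - c"] by simp
      then show ?thesis using that xc \<delta>r r unfolding dist_norm by linarith
    qed
    have cyl: "slab b i0 c \<rho> (-h) h \<subseteq> cball x r"
    proof
      fix p assume p: "p \<in> slab b i0 c \<rho> (-h) h"
      have "norm (p - c) \<le> sqrt (real ?d) * \<rho>" using h by (intro slab_norm[OF b(1) p]) auto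
      then have "dist p x \<le> r" using \<rho>(2) r by (intro near_x) simp
      then show "p \<in> cball x r" by (simp add: dist_commute)
    qed
    \<comment> \<open>A bottom point \<open>p\<close> that is not interior is reached from its
      closest point \<open>z\<close> along an outer normal, which is nearly \<open>w\<close>. Then
      \<open>p\<close> is no deeper than \<open>z\<close>, and flatness at \<open>z\<close>
      contradicts the depth \<open>h\<close>.\<close>
    have bottom: "slab b i0 c (\<rho> + h) (-h) (-h) \<subseteq> interior A"
    proof (rule subsetI, rule ccontr)
      fix p assume p: "p \<in> slab b i0 c (\<rho> + h) (-h) (-h)" and pn: "p \<notin> interior A"
      have "norm (p - c) \<le> sqrt (real ?d) * (2 * \<rho>)" using h p by (intro slab_norm[OF b(1) p]) auto
      also have "\<dots> = r / 2" using \<rho>(2) by simp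
      finally have px: "dist p x \<le> r" by (rule near_x)
      define z where "z = closest_point A p"
      have zA: "z \<in> A" unfolding z_def using clA xA by (intro closest_point_in_set) auto
      have "dist p z \<le> dist p x" unfolding z_def by (rule closest_point_le[OF clA xA])
      then have zx: "dist z x \<le> 2 * r" using px dist_triangle3[of z x p] by simp
      have "\<exists>wz. is_outer_normal A z wz \<and> p = z + dist p z *\<^sub>R wz"
      proof (cases "p \<in> A")
        case True
        then have "z = p" unfolding z_def by (rule closest_point_self)
        moreover have "p \<in> frontier A" using True pn clA by (simp add: frontier_def)
        ultimately obtain wz where "is_outer_normal A z wz" using outer_normal_exists[OF A(1) clA] by metis
        then show ?thesis using \<open>z = p\<close> by auto
      next
        case False
        then have pz: "p \<noteq> z" using zA by auto
        have "is_outer_normal A z ((p - z) /\<^sub>R norm (p - z))"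
          unfolding is_outer_normal_def
        proof (intro conjI ballI)
          show "norm ((p - z) /\<^sub>R norm (p - z)) = 1" using pz by simp
          fix u assume "u \<in> A"
          then have "inner (p - z) (u - z) \<le> 0" unfolding z_def by (rule closest_point_dot[OF A(1) clA])
          then show "inner (u - z) ((p - z) /\<^sub>R norm (p - z)) \<le> 0" by (simp add: inner_commute mult_nonneg_nonpos)
        qed
        moreover have "p = z + dist p z *\<^sub>R ((p - z) /\<^sub>R norm (p - z))" using pz by (simp add: dist_norm)
        ultimately show ?thesis by blast
      qed
      then obtain wz where wz: "is_outer_normal A z wz" "p = z + dist p z *\<^sub>R wz" by blast
      have zR: "dist z x < R" using zx r by simp
      have "- (4 * \<delta> * (2 * r)) \<le> inner (z - y) w"
        using y(2) r by (intro flat[OF yA yR w zA zR wz(1) _ zx]) simp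
      moreover have "0 \<le> inner (p - z) w"
      proof -
        have "norm (wz - w) \<le> 2 * \<delta>" by (rule close[OF zA zR wz(1) yA yR w])
        then have "\<bar>inner (wz - w) w\<bar> \<le> 1" using Cauchy_Schwarz_ineq2[of "wz - w" w] w1 \<delta>16 by simp
        then have "0 \<le> inner wz w" by (simp add: inner_diff_left ww abs_le_iff)
        moreover have "inner (p - z) w = dist p z * inner wz w" by (subst wz(2)) simp
        ultimately show ?thesis by simp
      qed
      ultimately have "- (8 * \<delta> * r) \<le> inner (p - y) w" by (simp add: inner_diff_left)
      then have "- (8 * \<delta> * r) \<le> - h" using p b(2) cy[of p] by (simp add: slab_def)
      moreover have "8 * \<delta> * r = h / 2" by (simp add: \<delta>_def h_def \<rho>_def)
      ultimately show False using h by simp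
    qed
    have "good_patch A \<nu> \<eta> \<epsilon> (b, i0, c, \<rho>, h)"
      using b \<rho>(1) h bottom cyl w min unfolding w_def[symmetric]
      by (auto simp: cy is_outer_normal_def)
    then show "\<exists>P. good_patch A \<nu> \<eta> \<epsilon> P \<and> pcyl P \<subseteq> cball x r \<and> prad P = ?\<kappa> * r"
      using cyl by (intro exI[of _ "(b, i0, c, \<rho>, h)"]) (simp add: \<rho>_def)
  qed
qed

text \<open>Orthogonal projection onto the supporting hyperplane is a contraction and maps this part
  of the frontier onto a set containing the base: the segment from an interior point at the bottom
  to a point of the hyperplane, which is not interior, must meet the frontier.\<close>

lemma good_patch_area:
  fixes A :: "(real^'d::finite) set"
  assumes d2: "CARD('d) \<ge> 2" and P: "good_patch A \<nu> \<eta> \<epsilon> P"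
  shows "ennreal (hbox_const TYPE('d) * (2 * prad P) ^ (CARD('d) - 1)) \<le> hausdorff_outer (codim1 TYPE('d)) (frontier A \<inter> pcyl P)"
proof -
  obtain b i0 c \<rho> h where Pe: "P = (b, i0, c, \<rho>, h)" by (metis prod_cases5)
  have b: "onb b" and \<rho>: "0 < \<rho>" and h: "0 < h" and below: "\<And>x. x \<in> A \<Longrightarrow> inner (x - c) (b i0) \<le> 0"
    and bot: "slab b i0 c (\<rho> + h) (-h) (-h) \<subseteq> interior A" using P unfolding Pe by auto
  let ?w = "b i0"
  have ww: "inner ?w ?w = 1" by (simp add: onb_inner[OF b])
  define f where "f z = z - inner (z - c) ?w *\<^sub>R ?w" for z
  have dist: "dist (f z) (f y) \<le> dist z y" for z y
  proof -
    have "f z - f y = (z - y) - inner (z - y) ?w *\<^sub>R ?w" by (simp add: f_def inner_diff_left algebra_simps)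
    moreover have "(norm (u - inner u ?w *\<^sub>R ?w))\<^sup>2 = (norm u)\<^sup>2 - (inner u ?w)\<^sup>2" for u
      unfolding power2_norm_eq_inner inner_diff_left inner_diff_right inner_scaleR_left inner_scaleR_right ww inner_commute[of ?w u]
      by (simp add: power2_eq_square)
    ultimately have "(norm (f z - f y))\<^sup>2 = (norm (z - y))\<^sup>2 - (inner (z - y) ?w)\<^sup>2" by simp
    then have "(norm (f z - f y))\<^sup>2 \<le> (norm (z - y))\<^sup>2" by simp
    then show ?thesis by (simp add: dist_norm)
  qed
  have "slab b i0 c \<rho> 0 0 \<subseteq> f ` (frontier A \<inter> pcyl P)"
  proof
    fix u assume u: "u \<in> slab b i0 c \<rho> 0 0"
    have coord: "inner (u - t *\<^sub>R ?w - c) (b i) = inner (u - c) (b i) - (if i = i0 then t else 0)" for t i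
      by (simp add: inner_diff_left onb_inner[OF b])
    have u0: "inner (u - c) ?w = 0" using u by (simp add: slab_def)
    have "u - h *\<^sub>R ?w \<in> interior A"
      using u h by (intro subsetD[OF bot]) (auto simp: slab_def coord intro: order_trans)
    then have inA: "u - h *\<^sub>R ?w \<in> A" using interior_subset by blast
    have "\<exists>t. 0 \<le> t \<and> t \<le> h \<and> u - t *\<^sub>R ?w \<in> frontier A"
    proof (cases "u \<in> A")
      case True
      have "u \<notin> interior A"
      proof
        assume "u \<in> interior A"
        then obtain e where e: "0 < e" "cball u e \<subseteq> A" by (auto simp: mem_interior_cball)
        have "u + e *\<^sub>R ?w \<in> A" using e onb_norm[OF b, of i0] by (intro subsetD[OF e(2)]) (simp add: dist_norm)
        then have "inner (u + e *\<^sub>R ?w - c) ?w \<le> 0" by (rule below)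
        moreover have "inner (u + e *\<^sub>R ?w - c) ?w = inner (u - c) ?w + e" by (simp add: inner_diff_left inner_add_left ww)
        ultimately show False using u0 e by simp
      qed
      then have "u \<in> frontier A" using True closure_subset by (auto simp: frontier_def)
      then show ?thesis using h by (intro exI[of _ 0]) simp
    next
      case False
      let ?S = "closed_segment (u - h *\<^sub>R ?w) u"
      have "?S \<inter> frontier A \<noteq> {}"
        using inA False by (intro connected_Int_frontier) auto
      then obtain z where z: "z \<in> ?S" "z \<in> frontier A" by blast
      then obtain s where s: "0 \<le> s" "s \<le> 1" "z = (1 - s) *\<^sub>R (u - h *\<^sub>R ?w) + s *\<^sub>R u" by (auto simp: closed_segment_def)
      then have "z = u - ((1 - s) * h) *\<^sub>R ?w" by (simp add: algebra_simps)
      then show ?thesis using z(2) s h by (intro exI[of _ "(1 - s) * h"]) (auto simp: mult_left_le_one_le)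
    qed
    then obtain t where t: "0 \<le> t" "t \<le> h" "u - t *\<^sub>R ?w \<in> frontier A" by blast
    have "f (u - t *\<^sub>R ?w) = u" unfolding f_def using coord[of t i0] u0 by simp
    moreover have "u - t *\<^sub>R ?w \<in> pcyl P" using u t unfolding Pe by (auto simp: slab_def coord)
    ultimately show "u \<in> f ` (frontier A \<inter> pcyl P)" using t(3) by (metis IntI image_eqI)
  qed
  then have "hausdorff_outer (codim1 TYPE('d)) (slab b i0 c \<rho> 0 0) \<le> hausdorff_outer (codim1 TYPE('d)) (frontier A \<inter> pcyl P)"
    using d2 dist by (intro order_trans[OF hausdorff_outer_mono hausdorff_outer_contraction]) auto
  then show ?thesis using slab_base_outer[OF d2 b, of \<rho> i0 c] \<rho> by (simp add: Pe)
qed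

text \<open>The areas of the \<open>2 * d\<close> faces of a cube of side \<open>4 * \<rho>\<close>,
  with \<open>\<rho>^(d-1)\<close> factored out.\<close>

definition ahlfors :: "'d::finite itself \<Rightarrow> real" where
  "ahlfors T = 2 * real CARD('d) * (hbox_const TYPE('d) * 4 ^ (CARD('d) - 1))"

text \<open>The boundary of a convex set inside a cube is the image of the boundary of the cube under a nearest point
  projection, which is a contraction.\<close>

lemma convex_frontier_upper:
  fixes A :: "(real^'d::finite) set"
  assumes d2: "CARD('d) \<ge> 2" and A: "convex A" "compact A" and \<rho>: "0 < \<rho>"
  shows "hausdorff_outer (codim1 TYPE('d)) (frontier A \<inter> cball x \<rho>) \<le> ennreal (ahlfors TYPE('d) * \<rho> ^ (CARD('d) - 1))"
proof (cases "frontier A \<inter> cball x \<rho> = {}")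
  case True then show ?thesis by simp
next
  case False
  let ?d = "CARD('d)" and ?s = "codim1 TYPE('d)"
  have s: "0 < ?s" using d2 by simp
  have clA: "closed A" using A(2) by (rule compact_imp_closed)
  \<comment> \<open>Half side \<open>2 * \<rho>\<close> puts the ball strictly inside the
    cube.\<close>
  define p where "p = (\<chi> j. x $ j - 2 * \<rho>)"
  define q where "q = (\<chi> j. x $ j + 2 * \<rho>)"
  define Q where "Q = cbox p q"
  define C where "C = A \<inter> Q"
  have inQ: "z \<in> box p q" if "z \<in> cball x \<rho>" for z
  proof -
    have "\<bar>z $ j - x $ j\<bar> \<le> \<rho>" for j
      using component_le_norm_cart[of "z - x" j] that by (simp add: dist_norm norm_minus_commute)
    then have "x $ j - 2 * \<rho> < z $ j \<and> z $ j < x $ j + 2 * \<rho>" for j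
      using \<rho> abs_le_D1[of "z $ j - x $ j" \<rho>] abs_le_D2[of "z $ j - x $ j" \<rho>] by fastforce
    then show ?thesis unfolding mem_box_cart p_def q_def by simp
  qed
  have CC: "convex C" "closed C" unfolding C_def Q_def using A clA by (auto intro: convex_Int closed_Int)
  define face where "face i t = frect axes i (\<chi> j. if j = i then t else x $ j - 2 * \<rho>) (\<lambda>_. 4 * \<rho>)" for i t
  define W where "W = (\<Union>i\<in>UNIV. face i (x $ i - 2 * \<rho>) \<union> face i (x $ i + 2 * \<rho>))"
  have sub: "frontier A \<inter> cball x \<rho> \<subseteq> closest_point C ` W"
  proof
    fix z assume z: "z \<in> frontier A \<inter> cball x \<rho>"
    then have zA: "z \<in> A" using clA frontier_subset_closed by blast
    have zb: "z \<in> box p q" using z inQ by blast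
    then have zC: "z \<in> C" using zA box_subset_cbox unfolding C_def Q_def by blast
    obtain w where w: "is_outer_normal A z w" using outer_normal_exists[OF A(1) clA] z by blast
    have w1: "norm w = 1" using w by (simp add: is_outer_normal_def)
    have "bounded Q" by (simp add: Q_def)
    then obtain B where B: "\<And>y. y \<in> Q \<Longrightarrow> norm y \<le> B" unfolding bounded_iff by blast
    \<comment> \<open>Far enough for the normal ray from \<open>z\<close> to leave the cube;
      \<open>y\<close> is a point where it meets a face.\<close>
    define T where "T = B + norm z + 1"
    have "0 \<le> B" using B[of z] zC order_trans[OF norm_ge_zero] unfolding C_def by blast
    then have T0: "0 \<le> T" by (simp add: T_def)
    have "norm (T *\<^sub>R w) \<le> norm (z + T *\<^sub>R w) + norm z" using norm_triangle_ineq4[of "z + T *\<^sub>R w" z] by simp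
    then have out: "z + T *\<^sub>R w \<notin> Q" using B[of "z + T *\<^sub>R w"] w1 T0 by (auto simp: T_def)
    let ?S = "closed_segment z (z + T *\<^sub>R w)"
    have "?S \<inter> frontier Q \<noteq> {}"
      using zC out by (intro connected_Int_frontier) (auto simp: C_def)
    then obtain y where y: "y \<in> ?S" "y \<in> frontier Q" by blast
    then obtain t0 where t0: "0 \<le> t0" "y = (1 - t0) *\<^sub>R z + t0 *\<^sub>R (z + T *\<^sub>R w)" by (auto simp: closed_segment_def)
    define t where "t = t0 * T"
    have yt: "y = z + t *\<^sub>R w" "0 \<le> t" using t0 T0 by (auto simp: t_def algebra_simps)
    have yW: "y \<in> W"
    proof -
      have "y \<in> cbox p q - box p q" using y(2) unfolding Q_def frontier_def by simp
      then have yb: "\<And>j. p $ j \<le> y $ j \<and> y $ j \<le> q $ j" and "\<exists>i. \<not> (p $ i < y $ i \<and> y $ i < q $ i)"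
        by (auto simp: mem_box_cart)
      then obtain i where "y $ i = p $ i \<or> y $ i = q $ i" by (metis less_eq_real_def)
      moreover have "x $ j - 2 * \<rho> \<le> y $ j" "y $ j \<le> x $ j - 2 * \<rho> + 4 * \<rho>" for j
        using yb[of j] by (simp_all add: p_def q_def)
      ultimately have "y \<in> face i (x $ i - 2 * \<rho>) \<union> face i (x $ i + 2 * \<rho>)"
        unfolding face_def frect_axes by (auto simp: p_def q_def)
      then show ?thesis unfolding W_def by blast
    qed
    \<comment> \<open>\<open>w\<close> supports \<open>C\<close> at \<open>z\<close> and
      \<open>y\<close> lies on the ray from \<open>z\<close> in direction \<open>w\<close>, so no
      point of \<open>C\<close> is closer to \<open>y\<close>.\<close>
    have "z = closest_point C y"
    proof (rule closest_point_unique[OF CC zC], rule ballI)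
      fix u assume "u \<in> C"
      then have "inner (u - z) w \<le> 0" using w by (simp add: C_def is_outer_normal_def)
      moreover have "inner (y - u) w = t - inner (u - z) w"
        using w1 by (simp add: yt(1) inner_diff_left inner_add_left norm_eq_sqrt_inner)
      moreover have "inner (y - u) w \<le> norm (y - u)" using norm_cauchy_schwarz[of "y - u" w] w1 by simp
      ultimately have "t \<le> norm (y - u)" by simp
      then show "dist y z \<le> dist y u" using yt w1 by (simp add: dist_norm)
    qed
    then show "z \<in> closest_point C ` W" using yW by blast
  qed
  have ne: "C \<noteq> {}"
    using False inQ clA frontier_subset_closed[OF clA] box_subset_cbox[of p q] unfolding C_def Q_def by blast
  have "hausdorff_outer ?s (frontier A \<inter> cball x \<rho>) \<le> hausdorff_outer ?s W"
    by (rule order_trans[OF hausdorff_outer_mono[OF sub] hausdorff_outer_contraction[OF s]]) (rule closest_point_lipschitz[OF CC ne])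
  also have "\<dots> = emeasure (hausdorff_measure ?s) W"
    by (rule emeasure_hausdorff_measure[symmetric, OF s]) (auto simp: W_def face_def closed_frect)
  also have "\<dots> \<le> (\<Sum>i\<in>(UNIV::'d set). emeasure (hausdorff_measure ?s) (face i (x $ i - 2 * \<rho>) \<union> face i (x $ i + 2 * \<rho>)))"
    unfolding W_def by (rule emeasure_subadditive_finite) (auto simp: face_def closed_frect)
  also have "\<dots> \<le> (\<Sum>i\<in>(UNIV::'d set). ennreal (2 * (hbox_const TYPE('d) * (4 * \<rho>) ^ (?d - 1))))"
  proof (rule sum_mono)
    fix i :: 'd
    have e: "emeasure (hausdorff_measure ?s) (face i t) = ennreal (hbox_const TYPE('d) * (4 * \<rho>) ^ (?d - 1))" for t
      unfolding face_def using \<rho> by (subst measure_frect(1)[OF d2 onb_axis]) auto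
    have "emeasure (hausdorff_measure ?s) (face i (x $ i - 2 * \<rho>) \<union> face i (x $ i + 2 * \<rho>))
        \<le> emeasure (hausdorff_measure ?s) (face i (x $ i - 2 * \<rho>)) + emeasure (hausdorff_measure ?s) (face i (x $ i + 2 * \<rho>))"
      by (rule emeasure_subadditive) (auto simp: face_def closed_frect)
    also have "\<dots> = ennreal (2 * (hbox_const TYPE('d) * (4 * \<rho>) ^ (?d - 1)))"
      unfolding e using hbox_const_pos[OF d2] \<rho> by (subst ennreal_plus[symmetric]) auto
    finally show "emeasure (hausdorff_measure ?s) (face i (x $ i - 2 * \<rho>) \<union> face i (x $ i + 2 * \<rho>)) \<le> ennreal (2 * (hbox_const TYPE('d) * (4 * \<rho>) ^ (?d - 1)))" .
  qed
  also have "\<dots> = ennreal (ahlfors TYPE('d) * \<rho> ^ (?d - 1))"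
  proof -
    let ?k = "2 * (hbox_const TYPE('d) * (4 * \<rho>) ^ (?d - 1))"
    have k: "0 \<le> ?k" using hbox_const_pos[OF d2] \<rho> by simp
    have "(\<Sum>i\<in>(UNIV::'d set). ennreal ?k) = ennreal (\<Sum>i\<in>(UNIV::'d set). ?k)" by (rule sum_ennreal[OF k])
    also have "(\<Sum>i\<in>(UNIV::'d set). ?k) = ahlfors TYPE('d) * \<rho> ^ (?d - 1)" by (simp add: ahlfors_def power_mult_distrib)
    finally show ?thesis .
  qed
  finally show ?thesis .
qed

section \<open>Exhausting the boundary by patches\<close>

lemma closed_pcyl: "closed (pcyl P)"
  by (cases P) (simp add: closed_slab)

lemma frontier_finite_measure:
  fixes A :: "(real^'d::finite) set"
  assumes d2: "CARD('d) \<ge> 2" and A: "convex A" "compact A"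
  shows "hausdorff_outer (codim1 TYPE('d)) (frontier A) < \<infinity>"
proof -
  obtain B where B: "0 < B" "\<And>x. x \<in> A \<Longrightarrow> norm x \<le> B" using compact_imp_bounded[OF A(2)] bounded_pos by metis
  have "frontier A \<subseteq> A" using A(2) by (simp add: compact_imp_closed frontier_subset_closed)
  then have "frontier A \<inter> cball 0 B = frontier A" using B(2) by auto
  then have "hausdorff_outer (codim1 TYPE('d)) (frontier A) \<le> ennreal (ahlfors TYPE('d) * B ^ (CARD('d) - 1))"
    using convex_frontier_upper[OF d2 A B(1), of 0] by simp
  then show ?thesis by (rule order.strict_trans1) simp
qed

text \<open>Vitali's lemma yields disjoint balls in the open set whose fivefold enlargements cover
  the boundary there up to a null set. Each ball contains a patch, and the two area bounds compare
  the patch with the enlarged ball, so a fixed fraction of the measure is captured.\<close>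

lemma patch_extension:
  fixes A :: "(real^'d::finite) set"
  assumes d2: "CARD('d) \<ge> 2" and A: "convex A" "compact A"
    and normal: "AE x in hausdorff_measure (codim1 TYPE('d)). x \<in> frontier A \<longrightarrow> has_normal A x"
    and \<nu>: "\<And>w. 0 \<le> \<nu> w" and \<eta>: "0 < \<eta>" and \<epsilon>: "0 < \<epsilon>"
    and \<Omega>: "open \<Omega>" and e: "ennreal e < hausdorff_outer (codim1 TYPE('d)) (frontier A \<inter> \<Omega>)" "0 < e"
  shows "\<exists>\<P>. finite \<P> \<and> (\<forall>P\<in>\<P>. good_patch A \<nu> \<eta> \<epsilon> P \<and> pcyl P \<subseteq> \<Omega>) \<and>
      pairwise (\<lambda>P Q. disjnt (pcyl P) (pcyl Q)) \<P> \<and>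
      ennreal (e * (hbox_const TYPE('d) * (2 * patch_ratio TYPE('d)) ^ (CARD('d) - 1)) / (ahlfors TYPE('d) * 5 ^ (CARD('d) - 1)))
        \<le> emeasure (hausdorff_measure (codim1 TYPE('d))) (frontier A \<inter> (\<Union>P\<in>\<P>. pcyl P))"
proof -
  let ?d = "CARD('d)" and ?s = "codim1 TYPE('d)"
  let ?\<mu> = "hausdorff_measure ?s :: (real^'d) measure"
  let ?c = "hbox_const TYPE('d)" and ?\<kappa> = "patch_ratio TYPE('d)" and ?a = "ahlfors TYPE('d)"
  have s: "0 < ?s" using d2 by simp
  have c: "0 < ?c" by (rule hbox_const_pos[OF d2])
  have a: "0 < ?a" using c d2 by (simp add: ahlfors_def)
  have \<kappa>: "0 < ?\<kappa>" by (rule patch_ratio_pos)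
  have fr: "frontier A \<in> sets borel" by simp
  define S where "S = {x \<in> frontier A \<inter> \<Omega>. has_normal A x}"
  define I where "I = {i. fst i \<in> S \<and> 0 < snd i \<and> snd i \<le> 1 \<and> cball (fst i) (snd i) \<subseteq> \<Omega> \<and>
     (\<exists>P. good_patch A \<nu> \<eta> \<epsilon> P \<and> pcyl P \<subseteq> cball (fst i) (snd i) \<and> prad P = ?\<kappa> * snd i)}"
  have cov: "S \<subseteq> (\<Union>i\<in>I. cball (fst i) (snd i))"
  proof
    fix x assume x: "x \<in> S"
    then have xf: "x \<in> frontier A" "has_normal A x" "x \<in> \<Omega>" by (auto simp: S_def)
    obtain r1 where r1: "0 < r1" "cball x r1 \<subseteq> \<Omega>" using \<Omega> xf(3) open_contains_cball by blast
    obtain r0 where r0: "0 < r0" "\<And>r. 0 < r \<Longrightarrow> r < r0 \<Longrightarrow> \<exists>P. good_patch A \<nu> \<eta> \<epsilon> P \<and> pcyl P \<subseteq> cball x r \<and> prad P = ?\<kappa> * r"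
      using patch_exists[where \<nu>=\<nu>, OF A xf(1,2) \<nu> \<eta> \<epsilon>] by blast
    define r where "r = min (min r1 1) (r0 / 2)"
    have r: "0 < r" "r \<le> r1" "r \<le> 1" "r < r0" using r1(1) r0(1) by (auto simp: r_def)
    have "cball x r \<subseteq> \<Omega>" using r1(2) r(2) by (meson order_trans subset_cball)
    then have "(x, r) \<in> I" unfolding I_def mem_Collect_eq fst_conv snd_conv using x r r0(2)[OF r(1,4)] by blast
    then show "x \<in> (\<Union>i\<in>I. cball (fst i) (snd i))" using r(1) by (intro UN_I[of "(x, r)"]) auto
  qed
  have Ir: "0 < snd i \<and> snd i \<le> 1" if "i \<in> I" for i using that unfolding I_def by blast
  obtain C where C: "countable C" "C \<subseteq> I"
      "pairwise (\<lambda>i j. disjnt (cball (fst i) (snd i)) (cball (fst j) (snd j))) C"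
      "S \<subseteq> (\<Union>i\<in>C. cball (fst i) (5 * snd i))"
    using Vitali_covering_lemma_cballs[where S=S and K=I and a=fst and r=snd and B=1, OF cov Ir] by blast
  define T where "T i = frontier A \<inter> cball (fst i) (5 * snd i)" for i :: "(real^'d) \<times> real"
  have Tb: "T i \<in> sets borel" for i by (simp add: T_def)
  have TC: "(\<Union>i\<in>F. T i) \<in> sets borel" if "countable F" for F by (rule sets.countable_UN'[OF that]) (use Tb in blast)
  \<comment> \<open>The points without a unique normal are missed by the balls, but they form a null
    set.\<close>
  have big: "ennreal e < emeasure ?\<mu> (\<Union>i\<in>C. T i)"
  proof -
    obtain N where N: "{x \<in> space ?\<mu>. \<not> (x \<in> frontier A \<longrightarrow> has_normal A x)} \<subseteq> N" "emeasure ?\<mu> N = 0" "N \<in> sets ?\<mu>"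
      using AE_E[OF normal] by blast
    have "frontier A \<inter> \<Omega> \<subseteq> (\<Union>i\<in>C. T i) \<union> N" using C(4) N(1) unfolding S_def T_def by fastforce
    then have "hausdorff_outer ?s (frontier A \<inter> \<Omega>) \<le> hausdorff_outer ?s ((\<Union>i\<in>C. T i) \<union> N)" by (rule hausdorff_outer_mono)
    also have "\<dots> = emeasure ?\<mu> ((\<Union>i\<in>C. T i) \<union> N)"
      using N(3) TC[OF C(1)] by (intro emeasure_hausdorff_measure[symmetric] s sets.Un) simp_all
    also have "\<dots> = emeasure ?\<mu> (\<Union>i\<in>C. T i)"
      using N TC[OF C(1)] by (intro emeasure_Un_null_set) (auto simp: null_sets_def)
    finally show ?thesis using e(1) by (rule less_le_trans[rotated])
  qed
  \<comment> \<open>Continuity from below reduces the countable family to a finite one; the strict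
    inequality for \<open>e\<close> leaves the room.\<close>
  have "\<exists>C'. finite C' \<and> C' \<subseteq> C \<and> ennreal e < emeasure ?\<mu> (\<Union>i\<in>C'. T i)"
  proof (cases "C = {}")
    case True then show ?thesis using big by auto
  next
    case False
    define f where "f = from_nat_into C"
    have rf: "range f = C" unfolding f_def using range_from_nat_into[OF False C(1)] .
    have "(SUP n. emeasure ?\<mu> (\<Union>k\<le>n. T (f k))) = emeasure ?\<mu> (\<Union>n. \<Union>k\<le>n. T (f k))"
    proof (rule SUP_emeasure_incseq)
      have "(\<Union>k\<le>n. T (f k)) \<in> sets borel" for n by (rule sets.finite_UN) (simp_all only: Tb finite_atMost)
      then show "range (\<lambda>n. \<Union>k\<le>n. T (f k)) \<subseteq> sets ?\<mu>" by auto
      show "incseq (\<lambda>n. \<Union>k\<le>n. T (f k))" unfolding incseq_def by (intro allI impI UN_mono) auto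
    qed
    also have "(\<Union>n. \<Union>k\<le>n. T (f k)) = (\<Union>i\<in>C. T i)" using rf by (auto, force)
    finally have "ennreal e < (SUP n. emeasure ?\<mu> (\<Union>k\<le>n. T (f k)))" using big by simp
    then obtain n where "ennreal e < emeasure ?\<mu> (\<Union>k\<le>n. T (f k))" unfolding less_SUP_iff by blast
    then show ?thesis using rf by (intro exI[of _ "f ` {..n}"]) auto
  qed
  then obtain C' where C': "finite C'" "C' \<subseteq> C" "ennreal e < emeasure ?\<mu> (\<Union>i\<in>C'. T i)" by blast
  have "\<forall>i\<in>C'. \<exists>P. good_patch A \<nu> \<eta> \<epsilon> P \<and> pcyl P \<subseteq> cball (fst i) (snd i) \<and> prad P = ?\<kappa> * snd i"
    using C'(2) C(2) unfolding I_def by blast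
  then obtain P where P: "\<And>i. i \<in> C' \<Longrightarrow> good_patch A \<nu> \<eta> \<epsilon> (P i)" "\<And>i. i \<in> C' \<Longrightarrow> pcyl (P i) \<subseteq> cball (fst i) (snd i)"
    "\<And>i. i \<in> C' \<Longrightarrow> prad (P i) = ?\<kappa> * snd i" by metis
  have disj: "disjnt (pcyl (P i)) (pcyl (P j))" if "i \<in> C'" "j \<in> C'" "i \<noteq> j" for i j
    using C(3) C'(2) P(2) that unfolding pairwise_def disjnt_def by blast
  \<comment> \<open>The ratio of the area bounds for the enlarged ball and for the patch; the radius
    cancels.\<close>
  define k where "k = ?a * 5 ^ (?d - 1) / (?c * (2 * ?\<kappa>) ^ (?d - 1))"
  have k: "0 < k" using a c \<kappa> by (simp add: k_def)
  have one: "emeasure ?\<mu> (T i) \<le> ennreal k * emeasure ?\<mu> (frontier A \<inter> pcyl (P i))" if i: "i \<in> C'" for i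
  proof -
    have r: "0 < snd i" using i C' C(2) Ir by blast
    have "emeasure ?\<mu> (T i) \<le> ennreal (?a * (5 * snd i) ^ (?d - 1))"
      unfolding emeasure_hausdorff_measure[OF s Tb] unfolding T_def using r by (intro convex_frontier_upper[OF d2 A]) simp
    also have "?a * (5 * snd i) ^ (?d - 1) = k * (?c * (2 * prad (P i)) ^ (?d - 1))"
      using c \<kappa> by (simp add: P(3)[OF i] k_def power_mult_distrib)
    also have "ennreal \<dots> = ennreal k * ennreal (?c * (2 * prad (P i)) ^ (?d - 1))"
      using k by (simp add: ennreal_mult')
    also have "\<dots> \<le> ennreal k * hausdorff_outer ?s (frontier A \<inter> pcyl (P i))"
      by (intro mult_left_mono good_patch_area[OF d2 P(1)[OF i]]) simp
    also have "hausdorff_outer ?s (frontier A \<inter> pcyl (P i)) = emeasure ?\<mu> (frontier A \<inter> pcyl (P i))"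
      by (rule emeasure_hausdorff_measure[symmetric, OF s]) (simp add: closed_pcyl)
    finally show ?thesis .
  qed
  have "ennreal e \<le> (\<Sum>i\<in>C'. emeasure ?\<mu> (T i))"
    using C'(1,3) Tb by (intro order_trans[OF less_imp_le emeasure_subadditive_finite]) auto
  also have "\<dots> \<le> (\<Sum>i\<in>C'. ennreal k * emeasure ?\<mu> (frontier A \<inter> pcyl (P i)))" by (rule sum_mono[OF one])
  also have "\<dots> = ennreal k * (\<Sum>i\<in>C'. emeasure ?\<mu> (frontier A \<inter> pcyl (P i)))" by (simp add: sum_distrib_left)
  also have "(\<Sum>i\<in>C'. emeasure ?\<mu> (frontier A \<inter> pcyl (P i))) = emeasure ?\<mu> (\<Union>i\<in>C'. frontier A \<inter> pcyl (P i))"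
  proof (rule sum_emeasure)
    show "(\<lambda>i. frontier A \<inter> pcyl (P i)) ` C' \<subseteq> sets ?\<mu>" by (auto simp: closed_pcyl)
    show "disjoint_family_on (\<lambda>i. frontier A \<inter> pcyl (P i)) C'"
      unfolding disjoint_family_on_def using disj unfolding disjnt_def by blast
  qed (rule C'(1))
  also have "(\<Union>i\<in>C'. frontier A \<inter> pcyl (P i)) = frontier A \<inter> (\<Union>Q\<in>P ` C'. pcyl Q)" by auto
  finally have "ennreal (1 / k) * ennreal e \<le> ennreal (1 / k) * (ennreal k * emeasure ?\<mu> (frontier A \<inter> (\<Union>Q\<in>P ` C'. pcyl Q)))"
    by (rule mult_left_mono) simp
  also have "\<dots> = emeasure ?\<mu> (frontier A \<inter> (\<Union>Q\<in>P ` C'. pcyl Q))"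
    using k by (simp add: mult.assoc[symmetric] ennreal_mult'[symmetric])
  finally have "ennreal (e / k) \<le> emeasure ?\<mu> (frontier A \<inter> (\<Union>Q\<in>P ` C'. pcyl Q))"
    using k by (simp add: ennreal_mult'[symmetric])
  moreover have "pcyl (P i) \<subseteq> \<Omega>" if "i \<in> C'" for i
    using P(2)[OF that] that C'(2) C(2) unfolding I_def by blast
  moreover have "pairwise (\<lambda>P Q. disjnt (pcyl P) (pcyl Q)) (P ` C')"
    using disj unfolding pairwise_def by blast
  ultimately show ?thesis
    using C'(1) P(1) by (intro exI[of _ "P ` C'"] conjI) (auto simp: k_def simp del: good_patch.simps pcyl.simps)
qed

text \<open>As long as more than \<open>e\<close> is uncovered, an extension in the open complement
  of the closed patches adds at least \<open>g\<close>, which the finite measure of the boundary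
  permits only finitely often.\<close>

lemma patch_exhaustion:
  fixes A :: "(real^'d::finite) set"
  assumes d2: "CARD('d) \<ge> 2" and A: "convex A" "compact A"
    and normal: "AE x in hausdorff_measure (codim1 TYPE('d)). x \<in> frontier A \<longrightarrow> has_normal A x"
    and \<nu>: "\<And>w. 0 \<le> \<nu> w" and \<eta>: "0 < \<eta>" and \<epsilon>: "0 < \<epsilon>" and e: "0 < e"
  obtains \<P> where "finite \<P>" "\<And>P. P \<in> \<P> \<Longrightarrow> good_patch A \<nu> \<eta> \<epsilon> P"
    "pairwise (\<lambda>P Q. disjnt (pcyl P) (pcyl Q)) \<P>"
    "hausdorff_outer (codim1 TYPE('d)) (frontier A - (\<Union>P\<in>\<P>. pcyl P)) \<le> ennreal e"
proof (rule ccontr)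
  assume neg: "\<not> thesis"
  note obt = that
  let ?d = "CARD('d)" and ?s = "codim1 TYPE('d)"
  let ?\<mu> = "hausdorff_measure ?s :: (real^'d) measure"
  have s: "0 < ?s" using d2 by simp
  define g where "g = e * (hbox_const TYPE('d) * (2 * patch_ratio TYPE('d)) ^ (?d - 1)) / (ahlfors TYPE('d) * 5 ^ (?d - 1))"
  have "0 < ahlfors TYPE('d)" using hbox_const_pos[OF d2] by (simp add: ahlfors_def)
  then have g: "0 < g" using e hbox_const_pos[OF d2] patch_ratio_pos[where 'd='d] by (simp add: g_def)
  define ok where "ok \<P> \<longleftrightarrow> finite \<P> \<and> (\<forall>P\<in>\<P>. good_patch A \<nu> \<eta> \<epsilon> P) \<and> pairwise (\<lambda>P Q. disjnt (pcyl P) (pcyl Q)) \<P>" for \<P> :: "'d patch set"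
  define cap where "cap \<P> = emeasure ?\<mu> (frontier A \<inter> (\<Union>P\<in>\<P>. pcyl P))" for \<P>
  have step: "\<exists>\<P>'. ok \<P>' \<and> cap \<P> + ennreal g \<le> cap \<P>'" if ok: "ok \<P>" for \<P>
  proof -
    let ?W = "- (\<Union>P\<in>\<P>. pcyl P)"
    have fin: "finite \<P>" using ok by (simp add: ok_def)
    have opW: "open ?W" by (intro open_Compl closed_UN fin ballI closed_pcyl)
    have "\<not> hausdorff_outer ?s (frontier A - (\<Union>P\<in>\<P>. pcyl P)) \<le> ennreal e"
      using obt[of \<P>] neg ok unfolding ok_def by blast
    then have gt: "ennreal e < hausdorff_outer ?s (frontier A \<inter> ?W)" unfolding Diff_eq not_le .
    obtain \<Q> where Q: "finite \<Q>" "\<forall>P\<in>\<Q>. good_patch A \<nu> \<eta> \<epsilon> P \<and> pcyl P \<subseteq> ?W"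
      "pairwise (\<lambda>P Q. disjnt (pcyl P) (pcyl Q)) \<Q>" "ennreal g \<le> cap \<Q>"
      using patch_extension[where \<nu>=\<nu>, OF d2 A normal \<nu> \<eta> \<epsilon> opW gt e] unfolding g_def cap_def by blast
    have cross: "disjnt (pcyl P) (pcyl Q)" if "P \<in> \<P>" "Q \<in> \<Q>" for P Q
      using Q(2) that unfolding disjnt_def by blast
    have "disjnt (pcyl P) (pcyl Q)" if "P \<in> \<P> \<union> \<Q>" "Q \<in> \<P> \<union> \<Q>" "P \<noteq> Q" for P Q
      using that ok Q(3) cross[of P Q] cross[of Q P] unfolding ok_def by (auto dest: pairwiseD simp: disjnt_sym)
    then have "ok (\<P> \<union> \<Q>)" using ok Q(1,2) unfolding ok_def by (simp add: pairwise_def) blast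
    have mb: "frontier A \<inter> (\<Union>P\<in>F. pcyl P) \<in> sets ?\<mu>" if "finite F" for F
      unfolding sets_hausdorff_measure by (intro borel_closed closed_Int frontier_closed closed_UN that ballI closed_pcyl)
    have "cap \<P> + ennreal g \<le> cap (\<P> \<union> \<Q>)"
    proof -
      have "cap \<P> + cap \<Q> = emeasure ?\<mu> ((frontier A \<inter> (\<Union>P\<in>\<P>. pcyl P)) \<union> (frontier A \<inter> (\<Union>P\<in>\<Q>. pcyl P)))"
        unfolding cap_def
      proof (intro plus_emeasure mb fin Q(1))
        show "frontier A \<inter> (\<Union>P\<in>\<P>. pcyl P) \<inter> (frontier A \<inter> (\<Union>P\<in>\<Q>. pcyl P)) = {}"
          using cross unfolding disjnt_def by blast
      qed
      also have "\<dots> = cap (\<P> \<union> \<Q>)" unfolding cap_def by (simp add: Int_Un_distrib)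
      finally show ?thesis using Q(4) by (metis add_left_mono)
    qed
    with \<open>ok (\<P> \<union> \<Q>)\<close> show ?thesis by blast
  qed
  have "\<exists>\<P>. ok \<P> \<and> ennreal (real n * g) \<le> cap \<P>" for n
  proof (induction n)
    case 0 show ?case by (intro exI[of _ "{}"]) (simp add: ok_def)
  next
    case (Suc n)
    then obtain \<P> where P: "ok \<P>" "ennreal (real n * g) \<le> cap \<P>" by blast
    obtain \<P>' where P': "ok \<P>'" "cap \<P> + ennreal g \<le> cap \<P>'" using step[OF P(1)] by blast
    have "ennreal (real (Suc n) * g) = ennreal (real n * g) + ennreal g"
      using g by (simp add: distrib_right ennreal_plus)
    also have "\<dots> \<le> cap \<P> + ennreal g" by (intro add_right_mono P)
    finally show ?case using P' by (meson order_trans)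
  qed
  moreover have "cap \<P> \<le> hausdorff_outer ?s (frontier A)" for \<P>
    unfolding cap_def emeasure_hausdorff_measure[OF s, of "frontier A", symmetric, simplified] by (intro emeasure_mono) auto
  ultimately have le: "ennreal (real n * g) \<le> hausdorff_outer ?s (frontier A)" for n by (meson order_trans)
  obtain m where m: "0 \<le> m" "hausdorff_outer ?s (frontier A) = ennreal m"
    using frontier_finite_measure[OF d2 A] by (cases "hausdorff_outer ?s (frontier A)") auto
  obtain n where "m / g < real n" using reals_Archimedean2 by blast
  then show False using le[of n] g m by (simp add: ennreal_le_iff field_simps)
qed

text \<open>Each set of a near-optimal cover is placed in an open cube of half side slightly above
  its diameter, and compactness selects finitely many. The factor \<open>2^(d-1)\<close> over
  \<open>haus_alpha\<close> undoes the gauge, and the \<open>+ 1\<close> pays for the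
  enlargements.\<close>

lemma hausdorff_cube_cover:
  fixes K :: "(real^'d::finite) set"
  assumes d2: "CARD('d) \<ge> 2" and K: "compact K" and e: "hausdorff_outer (codim1 TYPE('d)) K < ennreal e" "0 < e"
  obtains I :: "nat set" and p l where "finite I" "\<And>i. i \<in> I \<Longrightarrow> 0 < l i"
    "K \<subseteq> (\<Union>i\<in>I. {y. \<forall>j. \<bar>(y - p i) $ j\<bar> < l i})"
    "(\<Sum>i\<in>I. l i ^ (CARD('d) - 1)) \<le> (2 ^ (CARD('d) - 1) / haus_alpha (codim1 TYPE('d)) + 1) * e"
proof -
  let ?d = "CARD('d)" and ?s = "codim1 TYPE('d)"
  let ?\<alpha> = "haus_alpha ?s"
  have \<alpha>: "0 < ?\<alpha>" using d2 by (intro haus_alpha_pos) simp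
  have "hausdorff_pre ?s 1 K < ennreal e" using hausdorff_pre_le_outer[of 1 ?s K] e by (simp add: order.strict_trans1)
  then obtain C where C: "delta_cover 1 K C" "(\<Sum>i. hausdorff_gauge ?s (C i)) < ennreal e" using hausdorff_pre_less by blast
  have bd: "bounded (C i)" for i using C(1) by (simp add: delta_cover_def)
  \<comment> \<open>Strict enlargement lets an open cube contain the covering set, also when its
    diameter is \<open>0\<close>.\<close>
  have "\<exists>l. diameter (C i) < l \<and> l ^ (?d - 1) < diameter (C i) ^ (?d - 1) + e * (1/2) ^ Suc i" for i
  proof -
    have "isCont (\<lambda>l. l ^ (?d - 1)) (diameter (C i))" by (intro continuous_intros)
    then have "\<forall>\<^sub>F l in at_right (diameter (C i)). l ^ (?d - 1) < diameter (C i) ^ (?d - 1) + e * (1/2) ^ Suc i"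
      using e(2) unfolding continuous_at by (intro order_tendstoD(2)[OF tendsto_within_subset]) auto
    moreover have "\<forall>\<^sub>F l in at_right (diameter (C i)). diameter (C i) < l" by (rule eventually_at_right_less)
    ultimately have "\<forall>\<^sub>F l in at_right (diameter (C i)). diameter (C i) < l \<and> l ^ (?d - 1) < diameter (C i) ^ (?d - 1) + e * (1/2) ^ Suc i"
      by eventually_elim simp
    then show ?thesis by (rule eventually_happens'[rotated]) simp
  qed
  then obtain l where l: "\<And>i. diameter (C i) < l i" "\<And>i. l i ^ (?d - 1) < diameter (C i) ^ (?d - 1) + e * (1/2) ^ Suc i" by metis
  define p where "p i = (SOME y. y \<in> C i)" for i
  define Q where "Q i = {y. \<forall>j. \<bar>(y - p i) $ j\<bar> < l i}" for i
  have openQ: "open (Q i)" for i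
  proof -
    have "Q i = (\<Inter>j\<in>UNIV. {y. \<bar>(y - p i) $ j\<bar> < l i})" by (auto simp: Q_def)
    also have "open \<dots>" by (intro open_INT ballI open_Collect_less continuous_intros finite)
    finally show ?thesis .
  qed
  have "C i \<subseteq> Q i" for i
  proof
    fix y assume y: "y \<in> C i"
    then have "p i \<in> C i" unfolding p_def by (rule someI)
    then have "norm (y - p i) \<le> diameter (C i)" using y diameter_bounded_bound[OF bd] by (simp add: dist_norm)
    then show "y \<in> Q i" unfolding Q_def using component_le_norm_cart[of "y - p i"] l(1)[of i] by (smt (verit) mem_Collect_eq)
  qed
  then have "K \<subseteq> (\<Union>i\<in>UNIV. Q i)" using C(1) unfolding delta_cover_def by blast
  then obtain I where I: "finite I" "K \<subseteq> (\<Union>i\<in>I. Q i)"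
    using compactE_image[OF K, of UNIV Q] openQ by metis
  have "(\<Sum>i\<in>I. ennreal (?\<alpha> * (diameter (C i) / 2) ^ (?d - 1))) \<le> (\<Sum>i. hausdorff_gauge ?s (C i))"
    unfolding hausdorff_gauge_codim1[OF d2 bd, symmetric] using I(1) by (intro sum_le_suminf) auto
  then have "(\<Sum>i\<in>I. ennreal (?\<alpha> * (diameter (C i) / 2) ^ (?d - 1))) < ennreal e" using C(2) by (rule order.strict_trans1)
  then have "ennreal (\<Sum>i\<in>I. ?\<alpha> * (diameter (C i) / 2) ^ (?d - 1)) < ennreal e"
    using \<alpha> diameter_ge_0[OF bd] by (subst (asm) sum_ennreal) auto
  then have s1: "(\<Sum>i\<in>I. ?\<alpha> * (diameter (C i) / 2) ^ (?d - 1)) < e"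
    using \<alpha> diameter_ge_0[OF bd] by (subst (asm) ennreal_less_iff) (auto intro!: sum_nonneg)
  have "(\<Sum>i\<in>I. diameter (C i) ^ (?d - 1)) = 2 ^ (?d - 1) / ?\<alpha> * (\<Sum>i\<in>I. ?\<alpha> * (diameter (C i) / 2) ^ (?d - 1))"
    using \<alpha> by (simp add: sum_distrib_left power_divide)
  also have "\<dots> \<le> 2 ^ (?d - 1) / ?\<alpha> * e" using s1 \<alpha> by (intro mult_left_mono) auto
  finally have s2: "(\<Sum>i\<in>I. diameter (C i) ^ (?d - 1)) \<le> 2 ^ (?d - 1) / ?\<alpha> * e" .
  have "(\<Sum>i\<in>I. (1/2::real) ^ Suc i) \<le> (\<Sum>i. (1/2) ^ Suc i)"
    using I(1) power_half_series sums_summable by (intro sum_le_suminf) auto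
  also have "\<dots> = 1" using power_half_series by (rule sums_unique[symmetric])
  finally have s3: "(\<Sum>i\<in>I. (1/2::real) ^ Suc i) \<le> 1" .
  have "(\<Sum>i\<in>I. l i ^ (?d - 1)) \<le> (\<Sum>i\<in>I. diameter (C i) ^ (?d - 1) + e * (1/2) ^ Suc i)"
    by (intro sum_mono less_imp_le l(2))
  also have "\<dots> = (\<Sum>i\<in>I. diameter (C i) ^ (?d - 1)) + e * (\<Sum>i\<in>I. (1/2) ^ Suc i)"
    by (simp add: sum.distrib sum_distrib_left)
  also have "\<dots> \<le> 2 ^ (?d - 1) / ?\<alpha> * e + e * 1" using e(2) by (intro add_mono s2 mult_left_mono s3) auto
  finally have sum: "(\<Sum>i\<in>I. l i ^ (?d - 1)) \<le> (2 ^ (?d - 1) / ?\<alpha> + 1) * e" by (simp add: algebra_simps)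
  have "0 < l i" for i using l(1)[of i] diameter_ge_0[OF bd[of i]] by simp
  then show thesis using that[of I l p] I sum unfolding Q_def by blast
qed

section \<open>Cuts over a patch\<close>

lemma finite_pt_bounded:
  fixes S :: "(real^'d::finite) set"
  assumes "bounded S" "n \<ge> 1"
  shows "finite {z. pt n z \<in> S}"
proof -
  obtain B where B: "\<And>x. x \<in> S \<Longrightarrow> norm x \<le> B" "0 < B" using assms(1) bounded_pos by metis
  have "finite {z. \<forall>i. - B \<le> inner (pt n z - 0) (axis i 1) \<and> inner (pt n z - 0) (axis i 1) \<le> B}"
    by (rule lattice_count_pt(1)[OF onb_axis _ assms(2)]) (use B in simp)
  moreover have "{z. pt n z \<in> S} \<subseteq> {z. \<forall>i. - B \<le> inner (pt n z - 0) (axis i 1) \<and> inner (pt n z - 0) (axis i 1) \<le> B}"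
  proof (intro subsetI CollectI allI)
    fix z i assume "z \<in> {z. pt n z \<in> S}"
    then have "\<bar>inner (pt n z - 0) (axis i 1)\<bar> \<le> B"
      using onb_inner_le[OF onb_axis, of "pt n z" i] B(1)[of "pt n z"] by simp
    then show "- B \<le> inner (pt n z - 0) (axis i 1) \<and> inner (pt n z - 0) (axis i 1) \<le> B" by (intro conjI) linarith+
  qed
  ultimately show ?thesis by (rule rev_finite_subset)
qed

lemma pt_adj_norm: "adj z w \<Longrightarrow> n \<ge> 1 \<Longrightarrow> norm (pt n w - pt n z) = 1 / real n"
proof -
  assume "adj z w" "n \<ge> 1"
  moreover have "pt n w - pt n z = (1 / real n) *\<^sub>R (rvec w - rvec z)" by (simp add: pt_eq_rvec scaleR_diff_right)
  ultimately show ?thesis by (simp add: adj_rvec)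
qed

lemma pt_adj_inner:
  assumes "adj z w" "n \<ge> 1" "norm v = 1"
  shows "\<bar>inner (pt n w - c) v - inner (pt n z - c) v\<bar> \<le> 1 / real n"
proof -
  have "inner (pt n w - c) v - inner (pt n z - c) v = inner (pt n w - pt n z) v" by (simp add: inner_diff_left)
  then show ?thesis using Cauchy_Schwarz_ineq2[of "pt n w - pt n z" v] pt_adj_norm[OF assms(1,2)] assms(3) by simp
qed

lemma hyperrect_slab:
  assumes "onb b" "0 < \<rho>"
  shows "hyperrect_normal (slab b i0 c \<rho> 0 0) (b i0)"
proof -
  show ?thesis unfolding hyperrect_normal_iff slab_base_frect[OF assms(1)] using assms
    by (intro exI[of _ b] exI[of _ i0] exI[of _ "c - \<rho> *\<^sub>R (\<Sum>i\<in>UNIV - {i0}. b i)"] exI[of _ "\<lambda>_. 2 * \<rho>"]) simp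
qed

lemma fcyl_slab:
  assumes b: "onb b"
  shows "fcyl b i0 (c - \<rho> *\<^sub>R (\<Sum>i\<in>UNIV - {i0}. b i)) (\<lambda>_. 2 * \<rho>) T =
    {x. (\<forall>i. i \<noteq> i0 \<longrightarrow> \<bar>inner (x - c) (b i)\<bar> \<le> \<rho>) \<and> inner (x - c) (b i0) \<in> T}"
proof -
  have "inner (\<Sum>i\<in>UNIV - {i0}. b i) (b j) = (if j = i0 then 0 else 1)" for j
    by (auto simp: inner_sum_left onb_inner[OF b])
  then have "inner (x - (c - \<rho> *\<^sub>R (\<Sum>i\<in>UNIV - {i0}. b i))) (b j) = inner (x - c) (b j) + (if j = i0 then 0 else \<rho>)" for x j
    by (simp add: inner_diff_left)
  then show ?thesis by (auto simp: fcyl_def abs_le_iff)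
qed

lemma cyl_slab: "onb b \<Longrightarrow> cyl (slab b i0 c \<rho> 0 0) (b i0) h = slab b i0 c \<rho> (-h) h"
  by (auto simp: slab_base_frect cyl_frect fcyl_slab) (auto simp: slab_def)

lemma colorings_slab:
  assumes b: "onb b" and U: "U \<in> colorings n (slab b i0 c \<rho> 0 0) (b i0) h"
  shows "U \<subseteq> {z. pt n z \<in> slab b i0 c \<rho> (-h) h}"
    and "pt n z \<in> slab b i0 c \<rho> (-h) h \<Longrightarrow> adj z w \<Longrightarrow> pt n w \<notin> slab b i0 c \<rho> (-h) h \<Longrightarrow> 0 < inner (pt n z - c) (b i0) \<Longrightarrow> z \<notin> U"
    and "pt n z \<in> slab b i0 c \<rho> (-h) h \<Longrightarrow> adj z w \<Longrightarrow> pt n w \<notin> slab b i0 c \<rho> (-h) h \<Longrightarrow> inner (pt n z - c) (b i0) < 0 \<Longrightarrow> z \<in> U"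
proof -
  have C1: "cyl_C1 (slab b i0 c \<rho> 0 0) (b i0) h = {x \<in> slab b i0 c \<rho> (-h) h. 0 < inner (x - c) (b i0)}"
    unfolding slab_base_frect[OF b] cyl_C1_frect[OF b] fcyl_slab[OF b] by (auto simp: slab_def)
  have C2: "cyl_C2 (slab b i0 c \<rho> 0 0) (b i0) h = {x \<in> slab b i0 c \<rho> (-h) h. inner (x - c) (b i0) < 0}"
    unfolding slab_base_frect[OF b] cyl_C2_frect[OF b] fcyl_slab[OF b] by (auto simp: slab_def)
  note * = U[unfolded colorings_def cyl_slab[OF b] C1 C2 boundary_pts_def]
  show "U \<subseteq> {z. pt n z \<in> slab b i0 c \<rho> (-h) h}" using * by blast
  show "pt n z \<in> slab b i0 c \<rho> (-h) h \<Longrightarrow> adj z w \<Longrightarrow> pt n w \<notin> slab b i0 c \<rho> (-h) h \<Longrightarrow> 0 < inner (pt n z - c) (b i0) \<Longrightarrow> z \<notin> U"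
    using * by blast
  show "pt n z \<in> slab b i0 c \<rho> (-h) h \<Longrightarrow> adj z w \<Longrightarrow> pt n w \<notin> slab b i0 c \<rho> (-h) h \<Longrightarrow> inner (pt n z - c) (b i0) < 0 \<Longrightarrow> z \<in> U"
    using * by blast
qed

section \<open>Counting sites in collars and shells\<close>

lemma thin_box_count:
  fixes b :: "'d::finite \<Rightarrow> real^'d" and c :: "real^'d"
  assumes b: "onb b" and n: "n \<ge> 1" and lu: "\<And>k. l k \<le> u k"
    and B: "\<And>k. sqrt (real CARD('d)) * (real n * (u k - l k)) + 1 \<le> B k"
  defines "S \<equiv> {z. \<forall>k. l k \<le> inner (pt n z - c) (b k) \<and> inner (pt n z - c) (b k) \<le> u k}"
  shows "finite S" "real (card S) \<le> (\<Prod>k\<in>UNIV. B k)"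
proof -
  show "finite S" unfolding S_def by (rule lattice_count_pt(1)[OF b lu n])
  have "real (card S) \<le> (\<Prod>k\<in>UNIV. sqrt (real CARD('d)) * (real n * (u k - l k)) + 1)"
    unfolding S_def by (rule lattice_count_pt(2)[OF b lu n])
  also have "\<dots> \<le> (\<Prod>k\<in>UNIV. B k)" using B lu by (intro prod_mono) (simp add: add_nonneg_nonneg)
  finally show "real (card S) \<le> (\<Prod>k\<in>UNIV. B k)" .
qed

text \<open>The factor \<open>4 * sqrt d + 1\<close>, once per direction, absorbs the
  \<open>+ 1\<close> of the lattice count and side lengths up to four times the reference length in
  that direction.\<close>

definition lat_const :: "'d::finite itself \<Rightarrow> real" where
  "lat_const T = (4 * sqrt (real CARD('d)) + 1) ^ CARD('d)"

lemma lat_const_pos: "0 < lat_const TYPE('d::finite)"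
  by (simp add: lat_const_def add_nonneg_pos)

text \<open>Sites through which the boundary of a patch block can pass other than at the cut of the
  lid: the side walls, and the rim of the lid left outside the cylinder of half side
  \<open>\<rho>\<close>.\<close>

definition collar :: "('d::finite \<Rightarrow> real^'d) \<Rightarrow> 'd \<Rightarrow> real^'d \<Rightarrow> real \<Rightarrow> real \<Rightarrow> nat \<Rightarrow> (int^'d) set" where
  "collar b i0 c \<rho> h n =
    {z. pt n z \<in> slab b i0 c (\<rho> + h) (-h) (2 * h) \<and> (\<exists>i. i \<noteq> i0 \<and> \<rho> + h - 1 / real n \<le> \<bar>inner (pt n z - c) (b i)\<bar>)} \<union>
    {z. pt n z \<in> slab b i0 c (\<rho> + h) (2 * h - 1 / real n) (2 * h) \<and> (\<exists>i. i \<noteq> i0 \<and> \<rho> - 1 / real n \<le> \<bar>inner (pt n z - c) (b i)\<bar>)}"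

text \<open>Wall pieces have height \<open>3 * h\<close> and thickness \<open>1 / n\<close>, rim
  pieces have width about \<open>h\<close> and height \<open>1 / n\<close>. Either way there are of
  order \<open>n * h * (n * \<rho>)^(d-2)\<close> sites, a fraction \<open>h / \<rho>\<close> of the
  base.\<close>

lemma collar_card:
  fixes b :: "'d::finite \<Rightarrow> real^'d"
  assumes d2: "CARD('d) \<ge> 2" and b: "onb b" and h: "0 < h" "h \<le> \<rho>" and n: "n \<ge> 1" "1 \<le> real n * h"
  shows "finite (collar b i0 c \<rho> h n)"
    and "real (card (collar b i0 c \<rho> h n)) \<le> 4 * real CARD('d) * lat_const TYPE('d) * (real n * h * (real n * \<rho>) ^ (CARD('d) - 2))"
proof -
  let ?d = "CARD('d)" and ?q = "sqrt (real CARD('d))"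
  define Q where "Q = 4 * ?q + 1"
  have q: "1 \<le> ?q" using d2 by simp
  have nr: "real n * h \<le> real n * \<rho>" using h by (intro mult_left_mono) auto
  have n1: "0 < 1 / real n" "real n * (1 / real n) = 1" "1 / real n \<le> h" using n h by (auto simp: field_simps)
  \<comment> \<open>The second argument selects one of the two parallel walls, the third the lateral wall or the rim of the lid.\<close>
  define lo where "lo i p m k = (if k = i0 then (if m then - h else 2 * h - 1 / real n) else if k = i then
      (if p then (if m then \<rho> + h - 1 / real n else \<rho> - 1 / real n) else - (\<rho> + h)) else - (\<rho> + h))" for i p m k
  define up where "up i p m k = (if k = i0 then 2 * h else if k = i then
      (if p then \<rho> + h else (if m then - (\<rho> + h - 1 / real n) else - (\<rho> - 1 / real n))) else \<rho> + h)" for i p m k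
  define bx where "bx i p m = {z. \<forall>k. lo i p m k \<le> inner (pt n z - c) (b k) \<and> inner (pt n z - c) (b k) \<le> up i p m k}" for i p m
  have lu: "lo i p m k \<le> up i p m k" for i p m k unfolding lo_def up_def using h n1 by (smt (verit))
  have bx: "finite (bx i p m)" "real (card (bx i p m)) \<le> lat_const TYPE('d) * (real n * h * (real n * \<rho>) ^ (?d - 2))" if i: "i \<noteq> i0" for i p m
  proof -
    show "finite (bx i p m)" unfolding bx_def by (rule lattice_count_pt(1)[OF b lu n(1)])
    define Bf where "Bf k = (if k = i0 then (if m then Q * (real n * h) else Q) else if k = i then (if m then Q else Q * (real n * h)) else Q * (real n * \<rho>))" for k
    have len: "?q * (real n * (up i p m k - lo i p m k)) + 1 \<le> Bf k" for k
    proof -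
      have nh: "?q \<le> ?q * (real n * h)" using n(2) q by (simp add: mult_le_cancel_left1)
      have QE: "Q * y = 4 * (?q * y) + y" for y by (simp add: Q_def algebra_simps)
      have A: "?q * (real n * (3 * h)) + 1 \<le> Q * (real n * h)"
      proof -
        have "?q * (real n * (3 * h)) = 3 * (?q * (real n * h))" by simp
        then show ?thesis unfolding QE using n(2) q nh by linarith
      qed
      have B: "?q * (real n * (1 / real n)) + 1 \<le> Q" unfolding n1(2) using q by (simp add: Q_def)
      have C: "?q * (real n * (h + 1 / real n)) + 1 \<le> Q * (real n * h)"
      proof -
        have "real n * (h + 1 / real n) = real n * h + 1" using n by (simp add: field_simps)
        then have "?q * (real n * (h + 1 / real n)) = ?q * (real n * h) + ?q" by (simp only: distrib_left mult_1_right)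
        then show ?thesis unfolding QE using n(2) q nh by linarith
      qed
      have D: "?q * (real n * (2 * (\<rho> + h))) + 1 \<le> Q * (real n * \<rho>)"
      proof -
        have "?q * (real n * h) \<le> ?q * (real n * \<rho>)" by (rule mult_left_mono[OF nr]) (use q in simp)
        moreover have "?q * (real n * (2 * (\<rho> + h))) = 2 * (?q * (real n * \<rho>)) + 2 * (?q * (real n * h))" by (simp add: algebra_simps)
        ultimately show ?thesis unfolding QE using n(2) nr by linarith
      qed
      have e1: "2 * h - (- h) = 3 * h" "2 * h - (2 * h - 1 / real n) = 1 / real n" "\<rho> + h - (\<rho> + h - 1 / real n) = 1 / real n"
        "\<rho> + h - (\<rho> - 1 / real n) = h + 1 / real n" "- (\<rho> + h - 1 / real n) - (- (\<rho> + h)) = 1 / real n"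
        "- (\<rho> - 1 / real n) - (- (\<rho> + h)) = h + 1 / real n" "\<rho> + h - (- (\<rho> + h)) = 2 * (\<rho> + h)" by simp_all
      show ?thesis
        unfolding lo_def up_def Bf_def
        by (cases "k = i0"; cases "k = i"; cases p; cases m) (simp_all only: e1 A B C D simp_thms if_True if_False)
    qed
    have "real (card (bx i p m)) \<le> (\<Prod>k\<in>UNIV. Bf k)"
      unfolding bx_def by (rule thin_box_count(2)[OF b n(1) lu len])
    also have "\<dots> = (if m then Q * (real n * h) else Q) * (if m then Q else Q * (real n * h)) * (Q * (real n * \<rho>)) ^ (?d - 2)"
      unfolding Bf_def by (rule prod_if_two[OF i])
    also have "\<dots> = Q * Q * Q ^ (?d - 2) * (real n * h * (real n * \<rho>) ^ (?d - 2))"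
      by (simp add: power_mult_distrib)
    also have "Q * Q * Q ^ (?d - 2) = lat_const TYPE('d)"
    proof -
      have "Q * Q * Q ^ (?d - 2) = Q ^ Suc (Suc (?d - 2))" by simp
      also have "Suc (Suc (?d - 2)) = ?d" using d2 by simp
      finally show ?thesis by (simp add: lat_const_def Q_def)
    qed
    finally show "real (card (bx i p m)) \<le> lat_const TYPE('d) * (real n * h * (real n * \<rho>) ^ (?d - 2))" .
  qed
  let ?W = "\<Union>i\<in>UNIV - {i0}. \<Union>p\<in>UNIV. \<Union>m\<in>UNIV. bx i p m"
  have sub: "collar b i0 c \<rho> h n \<subseteq> ?W"
  proof
    fix z assume "z \<in> collar b i0 c \<rho> h n"
    then obtain i m where i: "i \<noteq> i0" and sl: "pt n z \<in> slab b i0 c (\<rho> + h) (if m then - h else 2 * h - 1 / real n) (2 * h)"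
      and th: "(if m then \<rho> + h - 1 / real n else \<rho> - 1 / real n) \<le> \<bar>inner (pt n z - c) (b i)\<bar>"
      unfolding collar_def by (smt (verit, del_insts) Un_iff mem_Collect_eq)
    define p where "p \<longleftrightarrow> 0 \<le> inner (pt n z - c) (b i)"
    have "\<bar>inner (pt n z - c) (b k)\<bar> \<le> \<rho> + h" if "k \<noteq> i0" for k using sl that by (simp add: slab_def)
    then have "inner (pt n z - c) (b k) \<le> \<rho> + h" "- (\<rho> + h) \<le> inner (pt n z - c) (b k)" if "k \<noteq> i0" for k
      using that abs_le_D1 abs_le_D2 by fastforce+
    then have "z \<in> bx i p m"
      unfolding bx_def lo_def up_def using sl th i by (auto simp: slab_def p_def split: if_splits)
    then show "z \<in> ?W" using i by blast
  qed
  have finW: "finite ?W" using bx(1) by (intro finite_UN_I) auto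
  show "finite (collar b i0 c \<rho> h n)" by (rule finite_subset[OF sub finW])
  have "card (collar b i0 c \<rho> h n) \<le> card ?W" by (rule card_mono[OF finW sub])
  also have "\<dots> \<le> (\<Sum>i\<in>UNIV - {i0}. \<Sum>p\<in>UNIV. \<Sum>m\<in>UNIV. card (bx i p m))"
    by (intro order_trans[OF card_UN_le] sum_mono) auto
  finally have "real (card (collar b i0 c \<rho> h n)) \<le> (\<Sum>i\<in>UNIV - {i0}. \<Sum>p\<in>UNIV. \<Sum>m\<in>UNIV. real (card (bx i p m)))"
    by (simp flip: of_nat_sum)
  also have "\<dots> \<le> (\<Sum>i\<in>UNIV - {i0}. \<Sum>p\<in>(UNIV::bool set). \<Sum>m\<in>(UNIV::bool set). lat_const TYPE('d) * (real n * h * (real n * \<rho>) ^ (?d - 2)))"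
    by (intro sum_mono bx(2)) auto
  also have "\<dots> = 4 * real (?d - 1) * (lat_const TYPE('d) * (real n * h * (real n * \<rho>) ^ (?d - 2)))" by simp
  also have "\<dots> \<le> 4 * real ?d * (lat_const TYPE('d) * (real n * h * (real n * \<rho>) ^ (?d - 2)))"
    using lat_const_pos[where 'd='d] h by (intro mult_right_mono) auto
  finally show "real (card (collar b i0 c \<rho> h n)) \<le> 4 * real ?d * lat_const TYPE('d) * (real n * h * (real n * \<rho>) ^ (?d - 2))"
    by (simp add: mult.assoc)
qed

definition shell :: "real^'d \<Rightarrow> real \<Rightarrow> nat \<Rightarrow> (int^'d::finite) set" where
  "shell p l n = {z. (\<forall>j. \<bar>(pt n z - p) $ j\<bar> \<le> l) \<and> (\<exists>j. l - 1 / real n \<le> \<bar>(pt n z - p) $ j\<bar>)}"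

text \<open>The layer is covered by \<open>2 * d\<close> boxes of thickness \<open>1 / n\<close>,
  one for each face of the cube.\<close>

lemma shell_card:
  fixes p :: "real^'d::finite"
  assumes d2: "CARD('d) \<ge> 2" and l: "0 < l" and n: "n \<ge> 1" "1 \<le> real n * l"
  shows "finite (shell p l n)"
    and "real (card (shell p l n)) \<le> 2 * real CARD('d) * lat_const TYPE('d) * (real n * l) ^ (CARD('d) - 1)"
proof -
  let ?d = "CARD('d)" and ?q = "sqrt (real CARD('d))"
  define Q where "Q = 4 * ?q + 1"
  have q: "1 \<le> ?q" using d2 by simp
  have n1: "0 < 1 / real n" "1 / real n \<le> l" using n l by (auto simp: field_simps)
  define lo where "lo i s k = (if k = i \<and> s then l - 1 / real n else - l)" for i k :: 'd and s
  define up where "up i s k = (if k = i \<and> \<not> s then - (l - 1 / real n) else l)" for i k :: 'd and s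
  define bx where "bx i s = {z. \<forall>k. lo i s k \<le> inner (pt n z - p) (axis k 1) \<and> inner (pt n z - p) (axis k 1) \<le> up i s k}" for i s
  have lu: "lo i s k \<le> up i s k" for i s k unfolding lo_def up_def using l n1 by (smt (verit))
  have bx: "finite (bx i s)" "real (card (bx i s)) \<le> lat_const TYPE('d) * (real n * l) ^ (?d - 1)" for i s
  proof -
    show "finite (bx i s)" unfolding bx_def by (rule lattice_count_pt(1)[OF onb_axis lu n(1)])
    have len: "?q * (real n * (up i s k - lo i s k)) + 1 \<le> (if k = i then Q else Q * (real n * l))" for k
    proof (cases "k = i")
      case True
      then have "real n * (up i s k - lo i s k) = 1" using n by (simp add: lo_def up_def)
      then show ?thesis using True q by (simp add: Q_def)
    next
      case False
      have "?q \<le> ?q * (real n * l)" using n(2) q by (simp add: mult_le_cancel_left1)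
      moreover have "?q * (real n * (up i s k - lo i s k)) = 2 * (?q * (real n * l))" using False by (simp add: lo_def up_def)
      moreover have "Q * (real n * l) = 4 * (?q * (real n * l)) + real n * l" by (simp add: Q_def algebra_simps)
      ultimately have "?q * (real n * (up i s k - lo i s k)) + 1 \<le> Q * (real n * l)" using n(2) q by linarith
      then show ?thesis using False by simp
    qed
    have "real (card (bx i s)) \<le> (\<Prod>k\<in>UNIV. if k = i then Q else Q * (real n * l))"
      unfolding bx_def by (rule thin_box_count(2)[OF onb_axis n(1) lu len])
    also have "\<dots> = Q * (\<Prod>k\<in>UNIV - {i}. if k = i then Q else Q * (real n * l))" by (subst prod.remove[of _ i]) auto
    also have "(\<Prod>k\<in>UNIV - {i}. if k = i then Q else Q * (real n * l)) = (\<Prod>k\<in>UNIV - {i}. Q * (real n * l))"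
      by (rule prod.cong) auto
    also have "Q * (\<Prod>k\<in>UNIV - {i}. Q * (real n * l)) = (Q * Q ^ (?d - 1)) * (real n * l) ^ (?d - 1)"
      by (simp add: power_mult_distrib)
    also have "Q * Q ^ (?d - 1) = lat_const TYPE('d)"
      using d2 by (simp add: lat_const_def Q_def flip: power_Suc)
    finally show "real (card (bx i s)) \<le> lat_const TYPE('d) * (real n * l) ^ (?d - 1)" .
  qed
  let ?W = "\<Union>i\<in>UNIV. \<Union>s\<in>UNIV. bx i s"
  have sub: "shell p l n \<subseteq> ?W"
  proof
    fix z assume z: "z \<in> shell p l n"
    then obtain i where i: "l - 1 / real n \<le> \<bar>(pt n z - p) $ i\<bar>" by (auto simp: shell_def)
    define s where "s \<longleftrightarrow> 0 \<le> (pt n z - p) $ i"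
    have ab: "(pt n z - p) $ k \<le> l" "- l \<le> (pt n z - p) $ k" for k
      using z abs_le_D1[of "(pt n z - p) $ k" l] abs_le_D2[of "(pt n z - p) $ k" l] unfolding shell_def by fastforce+
    have in_ax: "inner (pt n z - p) (axis k 1) = (pt n z - p) $ k" for k by (simp add: inner_axis)
    have "z \<in> bx i s"
      unfolding bx_def lo_def up_def in_ax mem_Collect_eq
    proof (intro allI conjI)
      fix k
      show "(if k = i \<and> s then l - 1 / real n else - l) \<le> (pt n z - p) $ k" using i ab[of k] by (auto simp only: s_def abs_of_nonneg split: if_splits)
      show "(pt n z - p) $ k \<le> (if k = i \<and> \<not> s then - (l - 1 / real n) else l)" using i ab[of k] unfolding s_def by (simp del: vector_minus_component) linarith
    qed
    then show "z \<in> ?W" by blast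
  qed
  have finW: "finite ?W" using bx(1) by (intro finite_UN_I) auto
  show "finite (shell p l n)" by (rule finite_subset[OF sub finW])
  have "card (shell p l n) \<le> card ?W" by (rule card_mono[OF finW sub])
  also have "\<dots> \<le> (\<Sum>i\<in>UNIV. \<Sum>s\<in>UNIV. card (bx i s))"
    by (intro order_trans[OF card_UN_le] sum_mono) auto
  finally have "real (card (shell p l n)) \<le> (\<Sum>i\<in>UNIV. \<Sum>s\<in>UNIV. real (card (bx i s)))"
    by (simp flip: of_nat_sum)
  also have "\<dots> \<le> (\<Sum>i\<in>(UNIV::'d set). \<Sum>s\<in>(UNIV::bool set). lat_const TYPE('d) * (real n * l) ^ (?d - 1))"
    by (intro sum_mono bx(2))
  also have "\<dots> = 2 * real ?d * lat_const TYPE('d) * (real n * l) ^ (?d - 1)" by simp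
  finally show "real (card (shell p l n)) \<le> 2 * real ?d * lat_const TYPE('d) * (real n * l) ^ (?d - 1)" .
qed

text \<open>The cut over a patch: the block below the lid at height \<open>2h\<close>, with the lid replaced by a cut of the
  cylinder of height \<open>[h, 3h]\<close>, which lies outside \<open>A\<close>.\<close>

definition patch_block :: "('d::finite \<Rightarrow> real^'d) \<Rightarrow> 'd \<Rightarrow> real^'d \<Rightarrow> real \<Rightarrow> real \<Rightarrow> nat \<Rightarrow> (int^'d) set \<Rightarrow> (int^'d) set" where
  "patch_block b i0 c \<rho> h n U = {z. pt n z \<in> slab b i0 c (\<rho> + h) (-h) (2 * h) \<and>
      pt n z \<notin> slab b i0 (c + (2 * h) *\<^sub>R b i0) \<rho> (-h) h} \<union> U"

text \<open>A step leaving the block through the bottom lands in \<open>A\<close>; through a side or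
  the rim it starts in \<open>collar\<close>. Within the cylinder it belongs to the cut. Where it
  enters or leaves the cylinder, the boundary condition of \<open>U\<close> compares the height with
  \<open>2 * h\<close> and reduces the step to the previous cases.\<close>

lemma patch_block_boundary:
  assumes b: "onb b" and h: "0 < h" "0 < \<rho>" and n: "n \<ge> 1" "1 / real n < h"
    and U: "U \<in> colorings n (slab b i0 (c + (2 * h) *\<^sub>R b i0) \<rho> 0 0) (b i0) h"
    and bottom: "\<And>x. (\<And>i. i \<noteq> i0 \<Longrightarrow> \<bar>inner (x - c) (b i)\<bar> \<le> \<rho> + h) \<Longrightarrow> - h - 1 / real n \<le> inner (x - c) (b i0) \<Longrightarrow> inner (x - c) (b i0) \<le> - h \<Longrightarrow> x \<in> A"
    and z: "z \<in> patch_block b i0 c \<rho> h n U" and w: "w \<notin> patch_block b i0 c \<rho> h n U" "pt n w \<notin> A" and zw: "adj z w"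
  shows "uses_edge (bd_edges U {z. pt n z \<in> slab b i0 (c + (2 * h) *\<^sub>R b i0) \<rho> (-h) h}) z w \<or> z \<in> collar b i0 c \<rho> h n"
proof -
  let ?c' = "c + (2 * h) *\<^sub>R b i0"
  define s where "s x i = inner (pt n x - c) (b i)" for x i
  have c': "inner (pt n x - ?c') (b i) = s x i - (if i = i0 then 2 * h else 0)" for x i
    unfolding s_def by (simp add: inner_diff_left inner_add_left onb_inner[OF b])
  define D where "D x \<longleftrightarrow> (\<forall>i. i \<noteq> i0 \<longrightarrow> \<bar>s x i\<bar> \<le> \<rho>) \<and> h \<le> s x i0 \<and> s x i0 \<le> 3 * h" for x
  define L where "L x \<longleftrightarrow> (\<forall>i. i \<noteq> i0 \<longrightarrow> \<bar>s x i\<bar> \<le> \<rho> + h) \<and> - h \<le> s x i0 \<and> s x i0 \<le> 2 * h" for x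
  have Dm: "pt n x \<in> slab b i0 ?c' \<rho> (-h) h \<longleftrightarrow> D x" for x unfolding slab_def D_def mem_Collect_eq c' by auto
  have Lm: "pt n x \<in> slab b i0 c (\<rho> + h) (-h) (2 * h) \<longleftrightarrow> L x" for x unfolding slab_def L_def s_def by simp
  note US = colorings_slab[OF b U, unfolded Dm c', simplified]
  have blk: "x \<in> patch_block b i0 c \<rho> h n U \<longleftrightarrow> L x \<and> \<not> D x \<or> x \<in> U" for x
    unfolding patch_block_def Lm Dm by auto
  have UD: "x \<in> U \<Longrightarrow> D x" for x using US(1) by blast
  have near: "\<bar>s w i - s z i\<bar> \<le> 1 / real n" for i
    unfolding s_def by (rule pt_adj_inner[OF zw n(1)]) (rule onb_norm[OF b])
  have wz: "adj w z" using zw uses_edge_sym by blast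
  have exit: "z \<in> collar b i0 c \<rho> h n" if Lz: "L z" and Lw: "\<not> L w" and nb: "\<not> (D z \<and> D w)"
  proof (cases "\<exists>i. i \<noteq> i0 \<and> \<rho> + h < \<bar>s w i\<bar>")
    case True
    then obtain i where i: "i \<noteq> i0" "\<rho> + h < \<bar>s w i\<bar>" by blast
    then have "\<rho> + h - 1 / real n \<le> \<bar>s z i\<bar>" using near[of i] by linarith
    then show ?thesis using Lz i(1) unfolding collar_def Lm s_def by blast
  next
    case False
    then have lat: "\<And>i. i \<noteq> i0 \<Longrightarrow> \<bar>s w i\<bar> \<le> \<rho> + h" by force
    have "\<not> s w i0 < - h"
    proof
      assume lt: "s w i0 < - h"
      have "pt n w \<in> A"
      proof (rule bottom)
        show "\<bar>inner (pt n w - c) (b i)\<bar> \<le> \<rho> + h" if "i \<noteq> i0" for i using lat[OF that] unfolding s_def .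
        show "- h - 1 / real n \<le> inner (pt n w - c) (b i0)" using Lz near[of i0] unfolding L_def s_def by linarith
        show "inner (pt n w - c) (b i0) \<le> - h" using lt unfolding s_def by simp
      qed
      then show False using w(2) by simp
    qed
    then have top: "2 * h < s w i0" using Lw lat unfolding L_def by force
    then have zt: "2 * h - 1 / real n \<le> s z i0" "s z i0 \<le> 2 * h" using near[of i0] Lz unfolding L_def by linarith+
    have "\<exists>i. i \<noteq> i0 \<and> \<rho> - 1 / real n \<le> \<bar>s z i\<bar>"
    proof (rule ccontr)
      assume "\<not> ?thesis"
      then have in1: "\<bar>s z i\<bar> < \<rho> - 1 / real n" if "i \<noteq> i0" for i using that by force
      have "0 < 1 / real n" using n by simp
      then have "\<bar>s z i\<bar> \<le> \<rho>" "\<bar>s w i\<bar> \<le> \<rho>" if "i \<noteq> i0" for i using in1[OF that] near[of i] by linarith+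
      then have "D z \<and> D w" unfolding D_def using zt top near[of i0] n(2) h by (intro conjI allI impI) auto
      then show False using nb by simp
    qed
    moreover have "pt n z \<in> slab b i0 c (\<rho> + h) (2 * h - 1 / real n) (2 * h)"
      using Lz zt unfolding slab_def L_def s_def by simp
    ultimately show ?thesis unfolding collar_def s_def by blast
  qed
  show ?thesis
  proof (cases "D z \<and> D w")
    case True
    then have "z \<in> U" "w \<notin> U" using z w(1) unfolding blk by auto
    then have "uses_edge (bd_edges U {z. pt n z \<in> slab b i0 ?c' \<rho> (-h) h}) z w"
      using zw True unfolding uses_edge_def bd_edges_def Dm by auto
    then show ?thesis by blast
  next
    case nb: False
    have "z \<in> collar b i0 c \<rho> h n"
    proof (cases "D z")
      case True
      then have nDw: "\<not> D w" using nb by blast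
      have "z \<in> U" using z True unfolding blk by blast
      then have "s z i0 \<le> 2 * h" using US(2)[of z w] True zw nDw by force
      then have "L z" using True h unfolding D_def L_def by force
      moreover have "\<not> L w" using w(1) nDw unfolding blk by blast
      ultimately show ?thesis using nb by (rule exit)
    next
      case False
      then have Lz: "L z" using z UD unfolding blk by blast
      show ?thesis
      proof (cases "D w")
        case True
        have "w \<notin> U" using w(1) unfolding blk by blast
        then have "2 * h \<le> s w i0" using US(3)[of w z] True wz False by force
        then have zt: "2 * h - 1 / real n \<le> s z i0" "s z i0 \<le> 2 * h" using near[of i0] Lz unfolding L_def by linarith+
        then obtain i where i: "i \<noteq> i0" "\<rho> < \<bar>s z i\<bar>" using False h n(2) unfolding D_def by force
        have "0 < 1 / real n" using n by simp
        then have "\<rho> - 1 / real n \<le> \<bar>s z i\<bar>" using i by linarith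
        moreover have "pt n z \<in> slab b i0 c (\<rho> + h) (2 * h - 1 / real n) (2 * h)"
          using Lz zt unfolding slab_def L_def s_def by simp
        ultimately show ?thesis using i(1) unfolding collar_def s_def by blast
      next
        case False
        then have "\<not> L w" using w(1) unfolding blk by blast
        then show ?thesis using Lz nb by (intro exit)
      qed
    qed
    then show ?thesis by blast
  qed
qed

section \<open>Gluing the cuts\<close>

fun pbase :: "'d::finite patch \<Rightarrow> (real^'d) set" where
  "pbase (b, i0, c, \<rho>, h) = slab b i0 (c + (2 * h) *\<^sub>R b i0) \<rho> 0 0"

fun pdir :: "'d::finite patch \<Rightarrow> real^'d" where
  "pdir (b, i0, c, \<rho>, h) = b i0"

fun pheight :: "'d::finite patch \<Rightarrow> real" where
  "pheight (b, i0, c, \<rho>, h) = h"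

text \<open>Open and laterally wider than \<open>pcyl\<close> by \<open>h\<close>: these sets and
  the open cubes form an open cover of the frontier, to which a Lebesgue number applies.\<close>

fun popen :: "'d::finite patch \<Rightarrow> (real^'d) set" where
  "popen (b, i0, c, \<rho>, h) = {x. (\<forall>i. i \<noteq> i0 \<longrightarrow> \<bar>inner (x - c) (b i)\<bar> < \<rho> + h) \<and> - h < inner (x - c) (b i0) \<and> inner (x - c) (b i0) < h}"

fun pcollar :: "'d::finite patch \<Rightarrow> nat \<Rightarrow> (int^'d) set" where
  "pcollar (b, i0, c, \<rho>, h) n = collar b i0 c \<rho> h n"

fun pblock :: "'d::finite patch \<Rightarrow> nat \<Rightarrow> (int^'d) set \<Rightarrow> (int^'d) set" where
  "pblock (b, i0, c, \<rho>, h) n U = patch_block b i0 c \<rho> h n U"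

lemma good_patch_simple:
  assumes "good_patch A \<nu> \<eta> \<epsilon> P"
  shows "hyperrect_normal (pbase P) (pdir P)" "0 < pheight P" "0 < prad P" "norm (pdir P) = 1"
    "pheight P \<le> \<eta> * prad P"
proof -
  obtain b i0 c \<rho> h where Pe: "P = (b, i0, c, \<rho>, h)" by (metis prod_cases5)
  show "hyperrect_normal (pbase P) (pdir P)" "0 < pheight P" "0 < prad P" "norm (pdir P) = 1" "pheight P \<le> \<eta> * prad P"
    using assms unfolding Pe by (auto intro: hyperrect_slab onb_norm)
qed

lemma pbase_area:
  fixes P :: "'d::finite patch"
  assumes d2: "CARD('d) \<ge> 2" and P: "good_patch A \<nu> \<eta> \<epsilon> P"
  shows "rect_area (pbase P) = hbox_const TYPE('d) * (2 * prad P) ^ (CARD('d) - 1)"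
proof -
  obtain b i0 c \<rho> h where Pe: "P = (b, i0, c, \<rho>, h)" by (metis prod_cases5)
  have b: "onb b" "0 < \<rho>" using P unfolding Pe by auto
  have s: "0 < codim1 TYPE('d)" using d2 by simp
  have "0 \<le> hbox_const TYPE('d) * (2 * \<rho>) ^ (CARD('d) - 1)" using hbox_const_pos[OF d2] b(2) by simp
  then show ?thesis
    using slab_base_outer[OF d2 b(1), of \<rho> i0 "c + (2 * h) *\<^sub>R b i0"] b(2)
    unfolding Pe measure_def by (simp add: emeasure_hausdorff_measure[OF s] closed_slab)
qed

lemma open_popen: "open (popen P)"
proof -
  obtain b i0 c \<rho> h where Pe: "P = (b, i0, c, \<rho>, h)" by (metis prod_cases5)
  have "popen P = (\<Inter>i\<in>-{i0}. {x. \<bar>inner (x - c) (b i)\<bar> < \<rho> + h}) \<inter> {x. - h < inner (x - c) (b i0)} \<inter> {x. inner (x - c) (b i0) < h}"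
    unfolding Pe by auto
  also have "open \<dots>" by (intro open_Int open_INT ballI open_Collect_less continuous_intros finite)
  finally show ?thesis .
qed

text \<open>Frontier points are strictly above the bottom face, which is interior to
  \<open>A\<close>, and strictly below height \<open>h\<close>, since \<open>A\<close> lies below
  height \<open>0\<close>.\<close>

lemma frontier_pcyl_popen:
  assumes "closed A" and P: "good_patch A \<nu> \<eta> \<epsilon> P"
  shows "frontier A \<inter> pcyl P \<subseteq> popen P"
proof
  obtain b i0 c \<rho> h where Pe: "P = (b, i0, c, \<rho>, h)" by (metis prod_cases5)
  have h: "0 < h" and below: "\<And>x. x \<in> A \<Longrightarrow> inner (x - c) (b i0) \<le> 0" and bot: "slab b i0 c (\<rho> + h) (-h) (-h) \<subseteq> interior A"
    using P unfolding Pe by auto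
  fix x assume x: "x \<in> frontier A \<inter> pcyl P"
  then have "x \<in> A" using assms(1) frontier_subset_closed by blast
  then have le: "inner (x - c) (b i0) \<le> 0" by (rule below)
  have sl: "x \<in> slab b i0 c \<rho> (-h) h" using x unfolding Pe by simp
  have "inner (x - c) (b i0) \<noteq> - h"
  proof
    assume "inner (x - c) (b i0) = - h"
    then have "x \<in> slab b i0 c (\<rho> + h) (-h) (-h)" using sl h unfolding slab_def by force
    then show False using bot x by (auto simp: frontier_def)
  qed
  then have "- h < inner (x - c) (b i0)" using sl unfolding slab_def by force
  moreover have "\<bar>inner (x - c) (b i)\<bar> < \<rho> + h" if "i \<noteq> i0" for i using sl h that unfolding slab_def by force
  ultimately show "x \<in> popen P" using le h unfolding Pe by simp
qed

text \<open>The compact bottom face has a uniform neighbourhood inside \<open>interior A\<close>;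
  once \<open>1 / n\<close> is below its width, a step through the bottom ends in \<open>A\<close>,
  as \<open>patch_block_boundary\<close> requires.\<close>

lemma pblock_boundary:
  fixes A :: "(real^'d::finite) set"
  assumes P: "good_patch A \<nu> \<eta> \<epsilon> P"
  shows "\<exists>N. \<forall>n\<ge>N. (\<forall>U z w. U \<in> colorings n (pbase P) (pdir P) (pheight P) \<longrightarrow>
      z \<in> pblock P n U \<longrightarrow> w \<notin> pblock P n U \<longrightarrow> pt n w \<notin> A \<longrightarrow> adj z w \<longrightarrow>
      uses_edge (bd_edges U (cyl_pts n (pbase P) (pdir P) (pheight P))) z w \<or> z \<in> pcollar P n) \<and> 1 \<le> n \<and> 1 \<le> real n * pheight P"
proof -
  obtain b i0 c \<rho> h where Pe: "P = (b, i0, c, \<rho>, h)" by (metis prod_cases5)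
  have b: "onb b" and \<rho>: "0 < \<rho>" and h: "0 < h" and bot: "slab b i0 c (\<rho> + h) (-h) (-h) \<subseteq> interior A"
    using P unfolding Pe by auto
  let ?K = "slab b i0 c (\<rho> + h) (-h) (-h)"
  have "bounded ?K"
  proof -
    have "norm (x - c) \<le> sqrt (real CARD('d)) * (\<rho> + h)" if "x \<in> ?K" for x
      using \<rho> h by (intro slab_norm[OF b that]) auto
    then have "?K \<subseteq> cball c (sqrt (real CARD('d)) * (\<rho> + h))" by (auto simp: dist_norm norm_minus_commute)
    then show ?thesis by (rule bounded_subset[OF bounded_cball])
  qed
  then have "compact ?K" using closed_slab compact_eq_bounded_closed by blast
  then obtain e where e: "0 < e" "(\<Union>x\<in>?K. ball x e) \<subseteq> interior A"
    using compact_subset_open_imp_ball_epsilon_subset[OF _ open_interior bot] by blast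
  obtain N where N: "inverse (real (Suc N)) < min h e" using reals_Archimedean h e by (metis min_less_iff_conj)
  have small: "1 / real n < h" "1 / real n < e" "1 \<le> n" if "Suc N \<le> n" for n
  proof -
    have "1 / real n \<le> inverse (real (Suc N))" using that by (simp add: inverse_eq_divide frac_le)
    then show "1 / real n < h" "1 / real n < e" "1 \<le> n" using N that by auto
  qed
  show ?thesis
  proof (intro exI[of _ "Suc N"] allI impI conjI)
    fix n assume n: "Suc N \<le> n"
    show "1 \<le> n" using small[OF n] by simp
    show "1 \<le> real n * pheight P" using small[OF n] unfolding Pe by (simp add: field_simps)
    fix U z w assume U: "U \<in> colorings n (pbase P) (pdir P) (pheight P)" and z: "z \<in> pblock P n U"
      and w: "w \<notin> pblock P n U" "pt n w \<notin> A" and zw: "adj z w"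
    have bottom: "x \<in> A" if lat: "\<And>i. i \<noteq> i0 \<Longrightarrow> \<bar>inner (x - c) (b i)\<bar> \<le> \<rho> + h"
      and lo: "- h - 1 / real n \<le> inner (x - c) (b i0)" and up: "inner (x - c) (b i0) \<le> - h" for x
    proof -
      define t where "t = - h - inner (x - c) (b i0)"
      have t: "0 \<le> t" "t < e" using lo up small[OF n] by (auto simp: t_def)
      have "inner (x + t *\<^sub>R b i0 - c) (b i) = inner (x - c) (b i) + (if i = i0 then t else 0)" for i
        by (simp add: inner_diff_left inner_add_left onb_inner[OF b])
      then have "x + t *\<^sub>R b i0 \<in> ?K" unfolding slab_def using lat by (simp add: t_def)
      moreover have "x \<in> ball (x + t *\<^sub>R b i0) e" using t by (simp add: dist_norm onb_norm[OF b])
      ultimately show ?thesis using e(2) interior_subset by blast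
    qed
    show "uses_edge (bd_edges U (cyl_pts n (pbase P) (pdir P) (pheight P))) z w \<or> z \<in> pcollar P n"
      using patch_block_boundary[OF b h \<rho> small(3,1)[OF n] _ bottom _ _ w(2) zw] U z w(1)
      unfolding Pe by (simp add: cyl_slab[OF b])
  qed
qed

text \<open>The factor \<open>2 * d\<close> of \<open>touching_bound\<close> times the factor
  \<open>4 * d * lat_const\<close> of the site counts.\<close>

definition glue_const :: "'d::finite itself \<Rightarrow> real" where
  "glue_const T = 8 * (real CARD('d))\<^sup>2 * lat_const TYPE('d)"

text \<open>The vertex set consists of \<open>A\<close>, all patch blocks and all cubes. An edge
  leaving it from \<open>A\<close> crosses the frontier, and for \<open>1 / n\<close> below a
  Lebesgue number both its ends lie in one patch or one cube of the cover. So every boundary edge is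
  in a patch cut or touches a collar or a shell.\<close>

lemma phi_inf_bound:
  fixes A :: "(real^'d::finite) set" and I :: "nat set"
  assumes d2: "CARD('d) \<ge> 2" and A: "compact A" and \<eta>: "\<eta> \<le> 1"
    and \<P>: "finite \<P>" "\<And>P. P \<in> \<P> \<Longrightarrow> good_patch A \<nu> \<eta> \<epsilon> P"
    and I: "finite I" "\<And>i. i \<in> I \<Longrightarrow> 0 < l i"
    and cover: "frontier A \<subseteq> (\<Union>P\<in>\<P>. popen P) \<union> (\<Union>i\<in>I. {y. \<forall>j. \<bar>(y - p i) $ j\<bar> < l i})"
  shows "\<exists>n0. \<forall>n\<ge>n0. \<exists>B. finite B \<and>
      real (card B) \<le> glue_const TYPE('d) * ((\<Sum>P\<in>\<P>. \<eta> * prad P ^ (CARD('d) - 1)) + (\<Sum>i\<in>I. l i ^ (CARD('d) - 1))) * real n ^ (CARD('d) - 1) \<and>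
      (\<forall>t. phi_inf n A t \<le> (\<Sum>P\<in>\<P>. tau n (pbase P) (pdir P) (pheight P) t) + V t B)"
proof -
  let ?d = "CARD('d)"
  have clA: "closed A" using A by (rule compact_imp_closed)
  define cube where "cube i = {y. \<forall>j. \<bar>(y - p i) $ j\<bar> < l i}" for i
  have open_cube: "open (cube i)" for i
  proof -
    have "cube i = (\<Inter>j\<in>UNIV. {y. \<bar>(y - p i) $ j\<bar> < l i})" by (auto simp: cube_def)
    also have "open \<dots>" by (intro open_INT ballI open_Collect_less continuous_intros finite)
    finally show ?thesis .
  qed
  have bounded_cube: "bounded (cube i)" for i
  proof -
    have "norm (y - p i) \<le> sqrt (real ?d) * l i" if "y \<in> cube i" for y
      using that by (intro onb_norm_le[OF onb_axis]) (auto simp: cube_def inner_axis less_imp_le)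
    then have "cube i \<subseteq> cball (p i) (sqrt (real ?d) * l i)" by (auto simp: dist_norm norm_minus_commute)
    then show ?thesis by (rule bounded_subset[OF bounded_cball])
  qed
  have "compact (frontier A)" using A by (rule compact_frontier)
  moreover have "frontier A \<subseteq> \<Union>(popen ` \<P> \<union> cube ` I)"
    using cover unfolding Union_Un_distrib cube_def .
  moreover have "open S" if "S \<in> popen ` \<P> \<union> cube ` I" for S
    using that open_popen open_cube by blast
  ultimately have "\<exists>\<zeta>>0. \<forall>x\<in>frontier A. \<exists>S\<in>popen ` \<P> \<union> cube ` I. ball x \<zeta> \<subseteq> S"
  proof (rule Heine_Borel_lemma)
    fix \<zeta> :: real assume z: "0 < \<zeta>" "\<And>x. x \<in> frontier A \<Longrightarrow> \<exists>S\<in>popen ` \<P> \<union> cube ` I. ball x \<zeta> \<subseteq> S"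
    show "\<exists>\<zeta>>0. \<forall>x\<in>frontier A. \<exists>S\<in>popen ` \<P> \<union> cube ` I. ball x \<zeta> \<subseteq> S"
      by (intro exI[of _ \<zeta>] conjI ballI z)
  qed
  then obtain \<zeta> where \<zeta>: "0 < \<zeta>" "\<And>x. x \<in> frontier A \<Longrightarrow> \<exists>S\<in>popen ` \<P> \<union> cube ` I. ball x \<zeta> \<subseteq> S" by metis
  have "\<forall>P\<in>\<P>. \<exists>N. \<forall>n\<ge>N. (\<forall>U z w. U \<in> colorings n (pbase P) (pdir P) (pheight P) \<longrightarrow>
      z \<in> pblock P n U \<longrightarrow> w \<notin> pblock P n U \<longrightarrow> pt n w \<notin> A \<longrightarrow> adj z w \<longrightarrow>
      uses_edge (bd_edges U (cyl_pts n (pbase P) (pdir P) (pheight P))) z w \<or> z \<in> pcollar P n) \<and> 1 \<le> n \<and> 1 \<le> real n * pheight P"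
    by (intro ballI pblock_boundary[OF \<P>(2)])
  then obtain N where N: "\<And>P n U z w. P \<in> \<P> \<Longrightarrow> N P \<le> n \<Longrightarrow> U \<in> colorings n (pbase P) (pdir P) (pheight P) \<Longrightarrow>
      z \<in> pblock P n U \<Longrightarrow> w \<notin> pblock P n U \<Longrightarrow> pt n w \<notin> A \<Longrightarrow> adj z w \<Longrightarrow>
      uses_edge (bd_edges U (cyl_pts n (pbase P) (pdir P) (pheight P))) z w \<or> z \<in> pcollar P n"
    "\<And>P n. P \<in> \<P> \<Longrightarrow> N P \<le> n \<Longrightarrow> 1 \<le> n \<and> 1 \<le> real n * pheight P"
    by metis
  obtain N1 where N1: "inverse (real (Suc N1)) < \<zeta>" using reals_Archimedean \<zeta>(1) by blast
  define N2 where "N2 i = nat \<lceil>1 / l i\<rceil>" for i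
  \<comment> \<open>A sum of thresholds bounds each of them.\<close>
  define n0 where "n0 = Suc N1 + (\<Sum>P\<in>\<P>. N P) + (\<Sum>i\<in>I. N2 i)"
  show ?thesis
  proof (intro exI[of _ n0] allI impI)
    fix n assume n: "n0 \<le> n"
    have nP: "N P \<le> n" if "P \<in> \<P>" for P
      using member_le_sum[of P \<P> N] that \<P>(1) n by (simp add: n0_def)
    have nI: "1 \<le> real n * l i" if i: "i \<in> I" for i
    proof -
      have "N2 i \<le> n" using member_le_sum[of i I N2] i I(1) n by (simp add: n0_def)
      then have "1 / l i \<le> real n" unfolding N2_def by linarith
      then show ?thesis using I(2)[OF i] by (simp add: field_simps)
    qed
    have n1: "1 \<le> n" "1 / real n < \<zeta>"
    proof -
      have "Suc N1 \<le> n" using n by (simp add: n0_def)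
      then have "1 / real n \<le> inverse (real (Suc N1))" by (simp add: inverse_eq_divide frac_le)
      then show "1 \<le> n" "1 / real n < \<zeta>" using N1 \<open>Suc N1 \<le> n\<close> by auto
    qed
    define Z where "Z = (\<Union>P\<in>\<P>. pcollar P n) \<union> (\<Union>i\<in>I. shell (p i) (l i) n)"
    define B where "B = touching Z"
    have coll: "finite (pcollar P n)" "real (card (pcollar P n)) \<le> 4 * real ?d * lat_const TYPE('d) * (\<eta> * prad P ^ (?d - 1)) * real n ^ (?d - 1)" if P: "P \<in> \<P>" for P
    proof -
      obtain b i0 c \<rho> h where Pe: "P = (b, i0, c, \<rho>, h)" by (metis prod_cases5)
      have b: "onb b" and \<rho>: "0 < \<rho>" and h: "0 < h" "h \<le> \<eta> * \<rho>" using \<P>(2)[OF P] unfolding Pe by auto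
      have "\<eta> * \<rho> \<le> 1 * \<rho>" using \<eta> \<rho> by (intro mult_right_mono) auto
      then have h\<rho>: "h \<le> \<rho>" using h(2) by simp
      have nh: "1 \<le> real n * h" using N(2)[OF P nP[OF P]] unfolding Pe by simp
      show "finite (pcollar P n)" unfolding Pe using collar_card(1)[OF d2 b h(1) h\<rho> n1(1) nh] by simp
      have dd: "?d - 1 = Suc (?d - 2)" using d2 by simp
      have "real n * h * (real n * \<rho>) ^ (?d - 2) \<le> real n * (\<eta> * \<rho>) * (real n * \<rho>) ^ (?d - 2)"
        using h \<rho> by (intro mult_right_mono mult_left_mono) auto
      also have "\<dots> = (\<eta> * \<rho> ^ (?d - 1)) * real n ^ (?d - 1)" unfolding dd by (simp add: power_mult_distrib)
      finally have "4 * real ?d * lat_const TYPE('d) * (real n * h * (real n * \<rho>) ^ (?d - 2)) \<le> 4 * real ?d * lat_const TYPE('d) * ((\<eta> * \<rho> ^ (?d - 1)) * real n ^ (?d - 1))"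
        using lat_const_pos[where 'd='d] by (intro mult_left_mono) auto
      then show "real (card (pcollar P n)) \<le> 4 * real ?d * lat_const TYPE('d) * (\<eta> * prad P ^ (?d - 1)) * real n ^ (?d - 1)"
        using collar_card(2)[OF d2 b h(1) h\<rho> n1(1) nh, of i0 c] unfolding Pe pcollar.simps prad.simps by (simp only: mult.assoc)
    qed
    have shl: "finite (shell (p i) (l i) n)" "real (card (shell (p i) (l i) n)) \<le> 4 * real ?d * lat_const TYPE('d) * l i ^ (?d - 1) * real n ^ (?d - 1)" if i: "i \<in> I" for i
    proof -
      show "finite (shell (p i) (l i) n)" by (rule shell_card(1)[OF d2 I(2)[OF i] n1(1) nI[OF i]])
      have "real (card (shell (p i) (l i) n)) \<le> 2 * real ?d * lat_const TYPE('d) * (real n * l i) ^ (?d - 1)"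
        by (rule shell_card(2)[OF d2 I(2)[OF i] n1(1) nI[OF i]])
      also have "\<dots> \<le> 4 * real ?d * lat_const TYPE('d) * (real n * l i) ^ (?d - 1)"
        using lat_const_pos[where 'd='d] I(2)[OF i] by (intro mult_right_mono) auto
      finally show "real (card (shell (p i) (l i) n)) \<le> 4 * real ?d * lat_const TYPE('d) * l i ^ (?d - 1) * real n ^ (?d - 1)"
        by (simp add: power_mult_distrib mult_ac)
    qed
    have finZ: "finite Z" unfolding Z_def using \<P>(1) I(1) coll(1) shl(1) by blast
    have finB: "finite B" unfolding B_def by (rule touching_bound(1)[OF finZ])
    have "card Z \<le> (\<Sum>P\<in>\<P>. card (pcollar P n)) + (\<Sum>i\<in>I. card (shell (p i) (l i) n))"
      unfolding Z_def using \<P>(1) I(1) by (intro order_trans[OF card_Un_le] add_mono card_UN_le)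
    then have "real (card Z) \<le> (\<Sum>P\<in>\<P>. real (card (pcollar P n))) + (\<Sum>i\<in>I. real (card (shell (p i) (l i) n)))"
      by (simp flip: of_nat_sum of_nat_add)
    also have "\<dots> \<le> (\<Sum>P\<in>\<P>. 4 * real ?d * lat_const TYPE('d) * (\<eta> * prad P ^ (?d - 1)) * real n ^ (?d - 1))
        + (\<Sum>i\<in>I. 4 * real ?d * lat_const TYPE('d) * l i ^ (?d - 1) * real n ^ (?d - 1))"
      by (intro add_mono sum_mono coll shl)
    also have "\<dots> = 4 * real ?d * lat_const TYPE('d) * ((\<Sum>P\<in>\<P>. \<eta> * prad P ^ (?d - 1)) + (\<Sum>i\<in>I. l i ^ (?d - 1))) * real n ^ (?d - 1)"
      by (simp add: sum_distrib_left sum_distrib_right distrib_left distrib_right)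
    finally have cardZ: "real (card Z) \<le> 4 * real ?d * lat_const TYPE('d) * ((\<Sum>P\<in>\<P>. \<eta> * prad P ^ (?d - 1)) + (\<Sum>i\<in>I. l i ^ (?d - 1))) * real n ^ (?d - 1)" .
    have "real (card B) \<le> real (2 * ?d * card Z)"
      unfolding of_nat_le_iff B_def by (rule touching_bound(2)[OF finZ])
    also have "\<dots> = 2 * real ?d * real (card Z)" by simp
    also have "\<dots> \<le> 2 * real ?d * (4 * real ?d * lat_const TYPE('d) * ((\<Sum>P\<in>\<P>. \<eta> * prad P ^ (?d - 1)) + (\<Sum>i\<in>I. l i ^ (?d - 1))) * real n ^ (?d - 1))"
      by (rule mult_left_mono[OF cardZ]) simp
    also have "\<dots> = glue_const TYPE('d) * ((\<Sum>P\<in>\<P>. \<eta> * prad P ^ (?d - 1)) + (\<Sum>i\<in>I. l i ^ (?d - 1))) * real n ^ (?d - 1)"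
      by (simp add: glue_const_def power2_eq_square mult.assoc)
    finally have cardB: "real (card B) \<le> glue_const TYPE('d) * ((\<Sum>P\<in>\<P>. \<eta> * prad P ^ (?d - 1)) + (\<Sum>i\<in>I. l i ^ (?d - 1))) * real n ^ (?d - 1)" .
    have "phi_inf n A t \<le> (\<Sum>P\<in>\<P>. tau n (pbase P) (pdir P) (pheight P) t) + V t B" for t
    proof -
      let ?D = "\<lambda>P. cyl_pts n (pbase P) (pdir P) (pheight P)"
      have "\<forall>P\<in>\<P>. \<exists>U. U \<in> colorings n (pbase P) (pdir P) (pheight P) \<and> tau n (pbase P) (pdir P) (pheight P) t = V t (bd_edges U (?D P))"
        using tau_attained[OF good_patch_simple(1)[OF \<P>(2)] n1(1)] by metis
      then obtain W where W: "\<And>P. P \<in> \<P> \<Longrightarrow> W P \<in> colorings n (pbase P) (pdir P) (pheight P)"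
        "\<And>P. P \<in> \<P> \<Longrightarrow> tau n (pbase P) (pdir P) (pheight P) t = V t (bd_edges (W P) (?D P))" by metis
      have finD: "finite (?D P)" if "P \<in> \<P>" for P by (rule finite_cyl_pts[OF good_patch_simple(1)[OF \<P>(2)[OF that]] n1(1)])
      have finW: "finite (bd_edges (W P) (?D P))" if "P \<in> \<P>" for P
        by (rule finite_subset[OF bd_edges_sub_inner finite_inner_edges[OF finD[OF that]]])
      define U where "U = {z. pt n z \<in> A} \<union> (\<Union>P\<in>\<P>. pblock P n (W P)) \<union> (\<Union>i\<in>I. {z. pt n z \<in> cube i})"
      have finU: "finite U"
      proof -
        have "finite (pblock P n (W P))" if P: "P \<in> \<P>" for P
        proof -
          obtain b i0 c \<rho> h where Pe: "P = (b, i0, c, \<rho>, h)" by (metis prod_cases5)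
          have b: "onb b" and \<rho>: "0 < \<rho>" and h: "0 < h" using \<P>(2)[OF P] unfolding Pe by auto
          have "norm (x - c) \<le> sqrt (real ?d) * (\<rho> + 2 * h)" if "x \<in> slab b i0 c (\<rho> + h) (-h) (2 * h)" for x
            using \<rho> h by (intro slab_norm[OF b that]) auto
          then have "slab b i0 c (\<rho> + h) (-h) (2 * h) \<subseteq> cball c (sqrt (real ?d) * (\<rho> + 2 * h))" by (auto simp: dist_norm norm_minus_commute)
          then have "finite {z. pt n z \<in> slab b i0 c (\<rho> + h) (-h) (2 * h)}"
            by (intro finite_pt_bounded n1(1) bounded_subset[OF bounded_cball])
          moreover have "finite (W P)" using W(1)[OF P] finD[OF P] finite_subset unfolding colorings_def by blast
          ultimately show ?thesis unfolding Pe by (auto simp: patch_block_def elim: rev_finite_subset)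
        qed
        then show ?thesis unfolding U_def using \<P>(1) I(1) finite_pt_bounded[OF compact_imp_bounded[OF A] n1(1)] finite_pt_bounded[OF bounded_cube n1(1)] by blast
      qed
      have "bd_edges U UNIV \<subseteq> (\<Union>P\<in>\<P>. bd_edges (W P) (?D P)) \<union> B"
      proof (rule bd_edges_sub)
        fix z w assume zw: "adj z w" "z \<in> U" "w \<notin> U"
        let ?E = "(\<Union>P\<in>\<P>. bd_edges (W P) (?D P)) \<union> B"
        have wA: "pt n w \<notin> A" and wP: "\<And>P. P \<in> \<P> \<Longrightarrow> w \<notin> pblock P n (W P)" and wI: "\<And>i. i \<in> I \<Longrightarrow> pt n w \<notin> cube i"
          using zw(3) unfolding U_def by blast+
        have "z \<in> Z \<Longrightarrow> uses_edge ?E z w"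
          using zw(1) unfolding B_def touching_def uses_edge_def by blast
        moreover have inP: "uses_edge ?E z w \<or> z \<in> Z" if P: "P \<in> \<P>" "z \<in> pblock P n (W P)" for P
          using N(1)[OF P(1) nP[OF P(1)] W(1)[OF P(1)] P(2) wP[OF P(1)] wA zw(1)] P(1)
          unfolding Z_def uses_edge_def by blast
        moreover have inI: "z \<in> Z" if i: "i \<in> I" "pt n z \<in> cube i" for i
        proof -
          obtain j where j: "l i \<le> \<bar>(pt n w - p i) $ j\<bar>" using wI[OF i(1)] unfolding cube_def by (auto simp: not_less)
          have "\<bar>(pt n w - p i) $ j - (pt n z - p i) $ j\<bar> \<le> 1 / real n"
            using pt_adj_inner[OF zw(1) n1(1), of "axis j 1" "p i"] by (simp add: inner_axis)
          then have "l i - 1 / real n \<le> \<bar>(pt n z - p i) $ j\<bar>" using j by linarith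
          moreover have "\<forall>j. \<bar>(pt n z - p i) $ j\<bar> \<le> l i" using i(2) unfolding cube_def by (auto intro: less_imp_le)
          ultimately have "z \<in> shell (p i) (l i) n" unfolding shell_def by blast
          then show ?thesis using i(1) unfolding Z_def by blast
        qed
        moreover have "uses_edge ?E z w \<or> z \<in> Z" if zA: "pt n z \<in> A"
        proof -
          let ?S = "closed_segment (pt n z) (pt n w)"
          have "?S \<inter> frontier A \<noteq> {}" using zA wA by (intro connected_Int_frontier) auto
          then obtain x where x: "x \<in> ?S" "x \<in> frontier A" by blast
          have len: "dist (pt n z) (pt n w) = 1 / real n" using pt_adj_norm[OF zw(1) n1(1)] by (simp add: dist_norm norm_minus_commute)
          have "dist x (pt n z) \<le> 1 / real n" "dist x (pt n w) \<le> 1 / real n"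
            using dist_in_closed_segment[OF x(1)] len by (auto simp: dist_commute)
          then have "pt n z \<in> ball x \<zeta>" "pt n w \<in> ball x \<zeta>" using n1(2) by auto
          then obtain S where S: "S \<in> popen ` \<P> \<union> cube ` I" "pt n z \<in> S" "pt n w \<in> S" using \<zeta>(2)[OF x(2)] by blast
          then consider P where "P \<in> \<P>" "S = popen P" | i where "i \<in> I" "S = cube i" by blast
          then show ?thesis
          proof cases
            case 1
            obtain b i0 c \<rho> h where Pe: "P = (b, i0, c, \<rho>, h)" by (metis prod_cases5)
            have b: "onb b" and h: "0 < h" using \<P>(2)[OF 1(1)] unfolding Pe by auto
            have po: "(\<forall>i. i \<noteq> i0 \<longrightarrow> \<bar>inner (pt n z - c) (b i)\<bar> < \<rho> + h) \<and> - h < inner (pt n z - c) (b i0) \<and> inner (pt n z - c) (b i0) < h"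
              using S(2) 1(2) unfolding Pe by simp
            have "inner (pt n z - (c + (2 * h) *\<^sub>R b i0)) (b i0) = inner (pt n z - c) (b i0) - 2 * h"
              by (simp add: inner_diff_left inner_add_left onb_inner[OF b])
            \<comment> \<open>A point of \<open>popen P\<close> is below height \<open>h\<close>,
              hence in the block and under the cylinder of the cut, whatever the colouring
              \<open>W P\<close>.\<close>
            then have "z \<in> pblock P n (W P)"
              using po h unfolding Pe by (auto simp: patch_block_def slab_def less_imp_le)
            then show ?thesis using inP[OF 1(1)] by blast
          next
            case 2 then show ?thesis using S(3) wI by blast
          qed
        qed
        ultimately show "uses_edge ?E z w" using zw(2) unfolding U_def by blast
      qed
      then have "V t (bd_edges U UNIV) \<le> V t ((\<Union>P\<in>\<P>. bd_edges (W P) (?D P)) \<union> B)" by (rule V_mono)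
      also have "\<dots> \<le> V t (\<Union>P\<in>\<P>. bd_edges (W P) (?D P)) + V t B"
        using \<P>(1) finW finB by (intro V_Un_le) blast+
      also have "\<dots> \<le> (\<Sum>P\<in>\<P>. V t (bd_edges (W P) (?D P))) + V t B"
        by (intro add_right_mono V_UN_le \<P>(1) finW)
      also have "\<dots> = (\<Sum>P\<in>\<P>. tau n (pbase P) (pdir P) (pheight P) t) + V t B"
        using W(2) by (intro arg_cong2[where f="(+)"] sum.cong) auto
      finally have "V t (bd_edges U UNIV) \<le> (\<Sum>P\<in>\<P>. tau n (pbase P) (pdir P) (pheight P) t) + V t B" .
      moreover have "phi_inf n A t \<le> V t (bd_edges U UNIV)" by (rule phi_inf_le[OF finU]) (simp add: U_def)
      ultimately show ?thesis by (rule order_trans[rotated])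
    qed
    then show "\<exists>B. finite B \<and>
      real (card B) \<le> glue_const TYPE('d) * ((\<Sum>P\<in>\<P>. \<eta> * prad P ^ (?d - 1)) + (\<Sum>i\<in>I. l i ^ (?d - 1))) * real n ^ (?d - 1) \<and>
      (\<forall>t. phi_inf n A t \<le> (\<Sum>P\<in>\<P>. tau n (pbase P) (pdir P) (pheight P) t) + V t B)"
      using finB cardB by blast
  qed
qed

section \<open>The upper deviation bound\<close>

text \<open>By projection each base is no larger than the part of the frontier in its patch, and the
  patches are disjoint.\<close>

lemma patch_area_sum:
  fixes A :: "(real^'d::finite) set"
  assumes d2: "CARD('d) \<ge> 2" and A: "closed A"
    and \<P>: "finite \<P>" "\<And>P. P \<in> \<P> \<Longrightarrow> good_patch A \<nu> \<eta> \<epsilon> P" "pairwise (\<lambda>P Q. disjnt (pcyl P) (pcyl Q)) \<P>"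
  shows "ennreal (\<Sum>P\<in>\<P>. rect_area (pbase P)) \<le> hausdorff_outer (codim1 TYPE('d)) (frontier A)"
proof -
  let ?\<mu> = "hausdorff_measure (codim1 TYPE('d)) :: (real^'d) measure"
  have s: "0 < codim1 TYPE('d)" using d2 by simp
  have meas: "frontier A \<inter> pcyl P \<in> sets borel" for P by (intro borel_closed closed_Int frontier_closed closed_pcyl)
  have "ennreal (\<Sum>P\<in>\<P>. rect_area (pbase P)) = (\<Sum>P\<in>\<P>. ennreal (rect_area (pbase P)))" by simp
  also have "\<dots> \<le> (\<Sum>P\<in>\<P>. emeasure ?\<mu> (frontier A \<inter> pcyl P))"
  proof (rule sum_mono)
    fix P assume P: "P \<in> \<P>"
    show "ennreal (rect_area (pbase P)) \<le> emeasure ?\<mu> (frontier A \<inter> pcyl P)"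
      unfolding pbase_area[OF d2 \<P>(2)[OF P]] emeasure_hausdorff_measure[OF s meas]
      by (rule good_patch_area[OF d2 \<P>(2)[OF P]])
  qed
  also have "\<dots> = emeasure ?\<mu> (\<Union>P\<in>\<P>. frontier A \<inter> pcyl P)"
  proof (rule sum_emeasure)
    show "(\<lambda>P. frontier A \<inter> pcyl P) ` \<P> \<subseteq> sets ?\<mu>" using meas by auto
    show "disjoint_family_on (\<lambda>P. frontier A \<inter> pcyl P) \<P>"
      using \<P>(3) unfolding disjoint_family_on_def pairwise_def disjnt_def by blast
  qed (rule \<P>(1))
  also have "\<dots> \<le> emeasure ?\<mu> (frontier A)" by (intro emeasure_mono) auto
  also have "\<dots> = hausdorff_outer (codim1 TYPE('d)) (frontier A)" by (intro emeasure_hausdorff_measure s) simp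
  finally show ?thesis .
qed

context capacity_law
begin

text \<open>At most one patch contains a given frontier point, and there the last clause of
  \<open>good_patch\<close> bounds the integrand below by \<open>nu (pdir P) - \<epsilon>\<close>;
  base areas are at most frontier areas.\<close>

lemma flow_integral_lower:
  fixes A :: "(real^'d::finite) set"
  assumes d2: "CARD('d) \<ge> 2" and A: "closed A"
    and normal: "AE x in hausdorff_measure (codim1 TYPE('d)). x \<in> frontier A \<longrightarrow> has_normal A x"
    and \<P>: "finite \<P>" "\<And>P. P \<in> \<P> \<Longrightarrow> good_patch A nu \<eta> \<epsilon> P" "pairwise (\<lambda>P Q. disjnt (pcyl P) (pcyl Q)) \<P>"
  shows "ennreal (\<Sum>P\<in>\<P>. (nu (pdir P) - \<epsilon>) * rect_area (pbase P)) \<le> I_A G A"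
proof -
  let ?\<mu> = "hausdorff_measure (codim1 TYPE('d)) :: (real^'d) measure"
  have s: "0 < codim1 TYPE('d)" using d2 by simp
  have meas: "frontier A \<inter> pcyl P \<in> sets borel" for P by (intro borel_closed closed_Int frontier_closed closed_pcyl)
  \<comment> \<open>\<open>nu (pdir P) - \<epsilon>\<close> may be negative, so it is truncated at
    \<open>0\<close> before passing termwise to extended nonnegative reals.\<close>
  have "(\<Sum>P\<in>\<P>. (nu (pdir P) - \<epsilon>) * rect_area (pbase P)) \<le> (\<Sum>P\<in>\<P>. max 0 (nu (pdir P) - \<epsilon>) * rect_area (pbase P))"
    by (intro sum_mono mult_right_mono) auto
  then have "ennreal (\<Sum>P\<in>\<P>. (nu (pdir P) - \<epsilon>) * rect_area (pbase P)) \<le> ennreal (\<Sum>P\<in>\<P>. max 0 (nu (pdir P) - \<epsilon>) * rect_area (pbase P))"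
    by (rule ennreal_leI)
  also have "\<dots> = (\<Sum>P\<in>\<P>. ennreal (max 0 (nu (pdir P) - \<epsilon>)) * ennreal (rect_area (pbase P)))"
    by (simp add: ennreal_mult flip: sum_ennreal)
  also have "\<dots> \<le> (\<Sum>P\<in>\<P>. ennreal (max 0 (nu (pdir P) - \<epsilon>)) * emeasure ?\<mu> (frontier A \<inter> pcyl P))"
  proof (intro sum_mono mult_left_mono)
    fix P assume P: "P \<in> \<P>"
    show "ennreal (rect_area (pbase P)) \<le> emeasure ?\<mu> (frontier A \<inter> pcyl P)"
      unfolding pbase_area[OF d2 \<P>(2)[OF P]] emeasure_hausdorff_measure[OF s meas]
      by (rule good_patch_area[OF d2 \<P>(2)[OF P]])
  qed simp
  also have "\<dots> = (\<integral>\<^sup>+x. (\<Sum>P\<in>\<P>. ennreal (max 0 (nu (pdir P) - \<epsilon>)) * indicator (frontier A \<inter> pcyl P) x) \<partial>?\<mu>)"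
    using meas by (subst nn_integral_sum) (auto simp: nn_integral_cmult_indicator)
  also have "\<dots> \<le> (\<integral>\<^sup>+x. indicator (frontier A) x * flow_const G (normal A x) \<partial>?\<mu>)"
  proof (rule nn_integral_mono_AE, use normal in eventually_elim)
    fix x assume hn: "x \<in> frontier A \<longrightarrow> has_normal A x"
    let ?f = "\<lambda>P. ennreal (max 0 (nu (pdir P) - \<epsilon>)) * indicator (frontier A \<inter> pcyl P) x"
    show "(\<Sum>P\<in>\<P>. ?f P) \<le> indicator (frontier A) x * flow_const G (normal A x)"
    proof (cases "\<exists>P\<in>\<P>. x \<in> frontier A \<inter> pcyl P")
      case False
      then have "(\<Sum>P\<in>\<P>. ?f P) = 0" by (intro sum.neutral) (auto simp: indicator_def)
      then show ?thesis by simp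
    next
      case True
      then obtain P where P: "P \<in> \<P>" "x \<in> frontier A" "x \<in> pcyl P" by blast
      have zero: "?f Q = 0" if "Q \<in> \<P> - {P}" for Q
      proof -
        have "x \<notin> pcyl Q" using \<P>(3) P that unfolding pairwise_def disjnt_def by blast
        then show ?thesis by simp
      qed
      have "(\<Sum>P\<in>\<P>. ?f P) = ?f P + (\<Sum>P\<in>\<P> - {P}. ?f P)" by (rule sum.remove[OF \<P>(1) P(1)])
      also have "(\<Sum>P\<in>\<P> - {P}. ?f P) = 0" by (intro sum.neutral ballI zero)
      also have "?f P + 0 = ?f P" by (rule add_0_right)
      also have "\<dots> = ennreal (max 0 (nu (pdir P) - \<epsilon>))" using P by simp
      also have "\<dots> \<le> ennreal (nu (normal A x))"
      proof (rule ennreal_leI)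
        obtain b i0 c \<rho> h where Pe: "P = (b, i0, c, \<rho>, h)" by (metis prod_cases5)
        have "nu (b i0) \<le> nu (normal A x) + \<epsilon>" using \<P>(2)[OF P(1)] P(2,3) hn unfolding Pe by simp
        then show "max 0 (nu (pdir P) - \<epsilon>) \<le> nu (normal A x)" using nu_nonneg[of "normal A x"] unfolding Pe by simp
      qed
      also have "\<dots> = flow_const G (normal A x)"
      proof -
        have "is_outer_normal A x (normal A x)" using hn P(2) unfolding has_normal_def normal_def by (metis theI')
        then have "norm (normal A x) = 1" by (simp add: is_outer_normal_def)
        then show ?thesis using flow_const_limit(1)[OF d2] by metis
      qed
      finally show ?thesis using P(2) by simp
    qed
  qed
  finally show ?thesis unfolding I_A_def .
qed

text \<open>The gap \<open>g = lam - I0\<close> is split: replacing the integral by the patch cuts,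
  deviations included, costs \<open>g / 4\<close>, the joining edges are allowed
  \<open>g / 2\<close>, and the rest is slack. Small \<open>n\<close> are covered by the constant
  \<open>C1\<close>.\<close>

theorem phi_inf_upper_deviation:
  fixes A :: "(real^'d::finite) set"
  assumes d2: "CARD('d) \<ge> 2" and A: "compact A" "convex A"
    and normal: "AE x in hausdorff_measure (codim1 TYPE('d)). x \<in> frontier A \<longrightarrow> has_normal A x"
    and lam: "I_A G A < ennreal lam"
  shows "\<exists>C1>0. \<exists>C2>0. \<forall>n::nat. n \<ge> 1 \<longrightarrow>
           (\<exists>S \<in> sets (cap_measure G).
              {t \<in> space (cap_measure G). phi_inf n A t \<ge> ennreal (lam * real n ^ (CARD('d) - 1))} \<subseteq> S \<and>
              measure (cap_measure G) S \<le> C1 * exp (- C2 * real n ^ (CARD('d) - 1)))"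
proof -
  let ?s = "CARD('d) - 1" and ?H = "hausdorff_outer (codim1 TYPE('d)) :: (real^'d) set \<Rightarrow> ennreal"
  let ?M = "cap_measure G :: ('d edge \<Rightarrow> real) measure"
  let ?gc = "glue_const TYPE('d)" and ?hc = "hbox_const TYPE('d)"
  interpret M: prob_space ?M by (rule prob_space_cap)
  have clA: "closed A" using A(1) by (rule compact_imp_closed)
  define m where "m = enn2real (?H (frontier A))"
  have m: "?H (frontier A) = ennreal m" "0 \<le> m"
    using frontier_finite_measure[OF d2 A(2,1)] by (auto simp: m_def)
  define I0 where "I0 = enn2real (I_A G A)"
  have I0: "I_A G A = ennreal I0" "0 \<le> I0"
    using order.strict_trans[OF lam ennreal_less_top] by (auto simp: I0_def)
  define g where "g = lam - I0"
  have g: "0 < g" using lam I0 by (simp add: g_def ennreal_less_iff)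
  define L where "L = ln mgf"
  have L: "0 \<le> L" using mgf_ge_1 by (simp add: L_def)
  have gc: "0 < ?gc" unfolding glue_const_def using lat_const_pos[where 'd='d] by simp
  have hc: "0 < ?hc" by (rule hbox_const_pos[OF d2])
  define Cc where "Cc = 2 ^ ?s / haus_alpha (codim1 TYPE('d)) + 1"
  have Cc: "0 < Cc" using haus_alpha_pos[of "codim1 TYPE('d)"] d2 by (simp add: Cc_def add_pos_pos)
  \<comment> \<open>\<open>\<epsilon>\<close> enters twice, in the deviation of each patch cut and
    in the comparison with the integral; over a total area at most \<open>m\<close> this costs
    \<open>2 * \<epsilon> * m\<close>. The \<open>+ 1\<close> keeps the denominator
    positive.\<close>
  define \<epsilon> where "\<epsilon> = g / (8 * (m + 1))"
  have \<epsilon>: "0 < \<epsilon>" "2 * \<epsilon> * m \<le> g / 4"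
  proof -
    show "0 < \<epsilon>" using g m by (simp add: \<epsilon>_def)
    have "2 * \<epsilon> * m \<le> 2 * \<epsilon> * (m + 1)" using \<open>0 < \<epsilon>\<close> by simp
    also have "\<dots> = g / 4" using m by (simp add: \<epsilon>_def field_simps)
    finally show "2 * \<epsilon> * m \<le> g / 4" .
  qed
  \<comment> \<open>\<open>2 * x\<close> bounds the joining edges per \<open>n^(d-1)\<close>, one
    \<open>x\<close> for the collars and one for the shells of cubes; \<open>card B * L\<close> then
    uses at most half of the Chernoff exponent \<open>\<theta>0 * g / 2\<close>.\<close>
  define x where "x = \<theta>0 * g / (8 * (L + 1))"
  have x: "0 < x" "L * (2 * x) \<le> \<theta>0 * g / 4"
  proof -
    show "0 < x" using \<theta>0_pos g L by (simp add: x_def)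
    then have "L * (2 * x) \<le> (L + 1) * (2 * x)" by simp
    also have "\<dots> = \<theta>0 * g / 4" using L by (simp add: x_def field_simps)
    finally show "L * (2 * x) \<le> \<theta>0 * g / 4" .
  qed
  \<comment> \<open>Bounds the sum of \<open>prad P ^ (d - 1)\<close>, as the base of a patch has
    area \<open>hbox_const * (2 * prad P) ^ (d - 1)\<close>.\<close>
  define m' where "m' = m / (?hc * 2 ^ ?s)"
  have m': "0 \<le> m'" using m hc by (simp add: m'_def)
  define \<eta> where "\<eta> = min 1 (x / (?gc * (m' + 1)))"
  have \<eta>: "0 < \<eta>" "\<eta> \<le> 1" "\<eta> * m' \<le> x / ?gc"
  proof -
    show "0 < \<eta>" "\<eta> \<le> 1" using x gc m' by (simp_all add: \<eta>_def)
    have "\<eta> * m' \<le> \<eta> * (m' + 1)" using \<open>0 < \<eta>\<close> by simp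
    also have "\<dots> \<le> x / (?gc * (m' + 1)) * (m' + 1)" using m' by (intro mult_right_mono) (auto simp: \<eta>_def)
    also have "\<dots> = x / ?gc" using m' gc by (simp add: divide_simps)
    finally show "\<eta> * m' \<le> x / ?gc" .
  qed
  \<comment> \<open>The uncovered measure is at most \<open>e\<close>; the cube covering needs a
    strict bound and is applied with \<open>2 * e\<close>.\<close>
  define e where "e = x / (2 * ?gc * Cc)"
  have e: "0 < e" "Cc * (2 * e) = x / ?gc" using x gc Cc by (auto simp: e_def)
  obtain \<P> where \<P>: "finite \<P>" "\<And>P. P \<in> \<P> \<Longrightarrow> good_patch A nu \<eta> \<epsilon> P"
    "pairwise (\<lambda>P Q. disjnt (pcyl P) (pcyl Q)) \<P>" "?H (frontier A - (\<Union>P\<in>\<P>. pcyl P)) \<le> ennreal e"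
    using patch_exhaustion[where \<nu>=nu, OF d2 A(2,1) normal nu_nonneg \<eta>(1) \<epsilon>(1) e(1)] by blast
  define K where "K = frontier A - (\<Union>P\<in>\<P>. popen P)"
  have "compact K" unfolding K_def using A(1) open_popen by (intro compact_diff compact_frontier) blast+
  have "frontier A \<inter> pcyl P \<subseteq> popen P" if "P \<in> \<P>" for P by (rule frontier_pcyl_popen[OF clA \<P>(2)[OF that]])
  then have "K \<subseteq> frontier A - (\<Union>P\<in>\<P>. pcyl P)" unfolding K_def by blast
  then have "?H K \<le> ennreal e" using \<P>(4) hausdorff_outer_mono order_trans by blast
  also have "\<dots> < ennreal (2 * e)" using e(1) by (simp add: ennreal_less_iff)
  finally have HK: "?H K < ennreal (2 * e)" .
  have "0 < 2 * e" using e by simp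
  have "\<exists>(I :: nat set) p l. finite I \<and> (\<forall>i\<in>I. 0 < l i) \<and>
      K \<subseteq> (\<Union>i\<in>I. {y. \<forall>j. \<bar>(y - p i) $ j\<bar> < l i}) \<and> (\<Sum>i\<in>I. l i ^ ?s) \<le> Cc * (2 * e)"
    unfolding Cc_def
  proof (rule hausdorff_cube_cover[OF d2 \<open>compact K\<close> HK \<open>0 < 2 * e\<close>])
    fix I :: "nat set" and p l
    assume z: "finite I" "\<And>i. i \<in> I \<Longrightarrow> 0 < l i" "K \<subseteq> (\<Union>i\<in>I. {y. \<forall>j. \<bar>(y - p i) $ j\<bar> < l i})"
      "(\<Sum>i\<in>I. l i ^ ?s) \<le> (2 ^ ?s / haus_alpha (codim1 TYPE('d)) + 1) * (2 * e)"
    show "\<exists>(I :: nat set) p l. finite I \<and> (\<forall>i\<in>I. 0 < l i) \<and>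
      K \<subseteq> (\<Union>i\<in>I. {y. \<forall>j. \<bar>(y - p i) $ j\<bar> < l i}) \<and>
      (\<Sum>i\<in>I. l i ^ ?s) \<le> (2 ^ ?s / haus_alpha (codim1 TYPE('d)) + 1) * (2 * e)"
      by (rule exI[of _ I], rule exI[of _ p], rule exI[of _ l]) (intro conjI ballI z)
  qed
  then obtain I :: "nat set" where "\<exists>p l. finite I \<and> (\<forall>i\<in>I. 0 < l i) \<and>
      K \<subseteq> (\<Union>i\<in>I. {y. \<forall>j. \<bar>(y - p i) $ j\<bar> < l i}) \<and> (\<Sum>i\<in>I. l i ^ ?s) \<le> Cc * (2 * e)"
    by (rule exE)
  then obtain p where "\<exists>l. finite I \<and> (\<forall>i\<in>I. 0 < l i) \<and>
      K \<subseteq> (\<Union>i\<in>I. {y. \<forall>j. \<bar>(y - p i) $ j\<bar> < l i}) \<and> (\<Sum>i\<in>I. l i ^ ?s) \<le> Cc * (2 * e)"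
    by (rule exE)
  then obtain l where Ia: "finite I \<and> (\<forall>i\<in>I. 0 < l i) \<and>
      K \<subseteq> (\<Union>i\<in>I. {y. \<forall>j. \<bar>(y - p i) $ j\<bar> < l i}) \<and> (\<Sum>i\<in>I. l i ^ ?s) \<le> Cc * (2 * e)"
    by (rule exE)
  have I: "finite I" "\<And>i. i \<in> I \<Longrightarrow> 0 < l i" using Ia by blast+
  have I3: "K \<subseteq> (\<Union>i\<in>I. {y. \<forall>j. \<bar>(y - p i) $ j\<bar> < l i})"
    by (rule Ia[THEN conjunct2, THEN conjunct2, THEN conjunct1])
  have I4: "(\<Sum>i\<in>I. l i ^ ?s) \<le> Cc * (2 * e)"
    by (rule Ia[THEN conjunct2, THEN conjunct2, THEN conjunct2])
  have cover: "frontier A \<subseteq> (\<Union>P\<in>\<P>. popen P) \<union> (\<Union>i\<in>I. {y. \<forall>j. \<bar>(y - p i) $ j\<bar> < l i})"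
    using I3 unfolding K_def by (simp only: Diff_subset_conv)
  define a where "a P = rect_area (pbase P)" for P :: "'d patch"
  have a_nonneg: "0 \<le> a P" for P by (simp add: a_def)
  have asum: "(\<Sum>P\<in>\<P>. a P) \<le> m"
    using patch_area_sum[OF d2 clA \<P>(1-3)] m unfolding a_def by (simp add: ennreal_le_iff)
  have nusum: "(\<Sum>P\<in>\<P>. (nu (pdir P) - \<epsilon>) * a P) \<le> I0"
    using flow_integral_lower[OF d2 clA normal \<P>(1-3)] unfolding a_def I0(1) ennreal_le_iff[OF I0(2)] .
  have "(\<Sum>P\<in>\<P>. \<eta> * prad P ^ ?s) = \<eta> * ((\<Sum>P\<in>\<P>. a P) / (?hc * 2 ^ ?s))"
  proof -
    have "prad P ^ ?s = a P / (?hc * 2 ^ ?s)" if "P \<in> \<P>" for P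
      using pbase_area[OF d2 \<P>(2)[OF that]] hc unfolding a_def by (simp add: power_mult_distrib)
    then show ?thesis by (simp add: sum_distrib_left sum_divide_distrib)
  qed
  also have "\<dots> \<le> \<eta> * m'" unfolding m'_def using asum hc \<eta> by (intro mult_left_mono divide_right_mono) auto
  also have "\<dots> \<le> x / ?gc" by (rule \<eta>)
  finally have "(\<Sum>P\<in>\<P>. \<eta> * prad P ^ ?s) + (\<Sum>i\<in>I. l i ^ ?s) \<le> x / ?gc + x / ?gc"
    using I4 e(2) by simp
  then have "?gc * ((\<Sum>P\<in>\<P>. \<eta> * prad P ^ ?s) + (\<Sum>i\<in>I. l i ^ ?s)) \<le> ?gc * (x / ?gc + x / ?gc)"
    using gc by (intro mult_left_mono) auto
  also have "\<dots> = 2 * x" using gc by simp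
  finally have gl: "?gc * ((\<Sum>P\<in>\<P>. \<eta> * prad P ^ ?s) + (\<Sum>i\<in>I. l i ^ ?s)) \<le> 2 * x" .
  obtain n0 where n0: "\<And>n. n0 \<le> n \<Longrightarrow> \<exists>B. finite B \<and>
      real (card B) \<le> ?gc * ((\<Sum>P\<in>\<P>. \<eta> * prad P ^ ?s) + (\<Sum>i\<in>I. l i ^ ?s)) * real n ^ ?s \<and>
      (\<forall>t. phi_inf n A t \<le> (\<Sum>P\<in>\<P>. tau n (pbase P) (pdir P) (pheight P) t) + V t B)"
    using phi_inf_bound[OF d2 A(1) \<eta>(2) \<P>(1,2) I(1,2) cover] by blast
  have "\<forall>P\<in>\<P>. \<exists>c>0. \<exists>N. \<forall>n\<ge>N. emeasure ?M {t. ennreal ((nu (pdir P) + \<epsilon>) * a P * real n ^ ?s) \<le> tau n (pbase P) (pdir P) (pheight P) t}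
      \<le> ennreal (2 * exp (- c * real n ^ ?s))"
    unfolding a_def
  proof
    fix P assume P: "P \<in> \<P>"
    show "\<exists>c>0. \<exists>N. \<forall>n\<ge>N. emeasure ?M {t. ennreal ((nu (pdir P) + \<epsilon>) * rect_area (pbase P) * real n ^ ?s) \<le> tau n (pbase P) (pdir P) (pheight P) t}
      \<le> ennreal (2 * exp (- c * real n ^ ?s))"
      by (rule tau_upper_deviation[OF d2 good_patch_simple(1,2)[OF \<P>(2)[OF P]] \<epsilon>(1)])
  qed
  then obtain c N where cN: "\<And>P. P \<in> \<P> \<Longrightarrow> 0 < c P"
    "\<And>P n. P \<in> \<P> \<Longrightarrow> N P \<le> n \<Longrightarrow> emeasure ?M {t. ennreal ((nu (pdir P) + \<epsilon>) * a P * real n ^ ?s) \<le> tau n (pbase P) (pdir P) (pheight P) t}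
      \<le> ennreal (2 * exp (- c P * real n ^ ?s))"
    by metis
  \<comment> \<open>The inserted value is the rate of the joining edges; it also keeps the minimum
    meaningful when there are no patches.\<close>
  define C2 where "C2 = Min (insert (\<theta>0 * g / 4) (c ` \<P>))"
  have C2: "0 < C2" "C2 \<le> \<theta>0 * g / 4" "\<And>P. P \<in> \<P> \<Longrightarrow> C2 \<le> c P"
  proof -
    have fin: "finite (insert (\<theta>0 * g / 4) (c ` \<P>))" using \<P>(1) by simp
    show "C2 \<le> \<theta>0 * g / 4" unfolding C2_def by (rule Min_le[OF fin]) simp
    show "C2 \<le> c P" if "P \<in> \<P>" for P unfolding C2_def using that by (intro Min_le[OF fin]) simp
    have "C2 \<in> insert (\<theta>0 * g / 4) (c ` \<P>)" unfolding C2_def by (rule Min_in[OF fin]) simp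
    then show "0 < C2" using cN(1) mult_pos_pos[OF \<theta>0_pos g] by (elim insertE imageE) simp_all
  qed
  define n1 where "n1 = Suc n0 + (\<Sum>P\<in>\<P>. N P)"
  have large: "\<exists>S\<in>sets ?M. {t \<in> space ?M. ennreal (lam * real n ^ ?s) \<le> phi_inf n A t} \<subseteq> S \<and>
      measure ?M S \<le> (2 * real (card \<P>) + 1) * exp (- C2 * real n ^ ?s)" if n: "n1 \<le> n" for n
  proof -
    have n01: "n0 \<le> n" "1 \<le> n" using n by (auto simp: n1_def)
    have nP: "N P \<le> n" if "P \<in> \<P>" for P
      using member_le_sum[of P \<P> N] that \<P>(1) n by (simp add: n1_def)
    define q where "q = real n ^ ?s"
    have q: "0 < q" using n01 by (simp add: q_def)
    obtain B where B: "finite B" "real (card B) \<le> ?gc * ((\<Sum>P\<in>\<P>. \<eta> * prad P ^ ?s) + (\<Sum>i\<in>I. l i ^ ?s)) * q"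
      "\<And>t. phi_inf n A t \<le> (\<Sum>P\<in>\<P>. tau n (pbase P) (pdir P) (pheight P) t) + V t B"
      using n0[OF n01(1)] unfolding q_def by blast
    have cardB: "real (card B) \<le> 2 * x * q" using B(2) mult_right_mono[OF gl, of q] q by linarith
    define SP where "SP P = {t. ennreal ((nu (pdir P) + \<epsilon>) * a P * q) \<le> tau n (pbase P) (pdir P) (pheight P) t}" for P
    define SB where "SB = {t. ennreal (g / 2 * q) \<le> V t B}"
    have SP: "SP P \<in> sets ?M" if "P \<in> \<P>" for P
      using measurable_sets[OF tau_measurable[OF good_patch_simple(1)[OF \<P>(2)[OF that]] n01(2)], of "{ennreal ((nu (pdir P) + \<epsilon>) * a P * q)..}"]
      by (simp add: vimage_def SP_def)
    have SB: "SB \<in> sets ?M"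
      using measurable_sets[OF V_measurable[OF B(1)], of "{ennreal (g / 2 * q)..}"] by (simp add: vimage_def SB_def)
    have mSP: "measure ?M (SP P) \<le> 2 * exp (- C2 * q)" if P: "P \<in> \<P>" for P
    proof -
      have "measure ?M (SP P) \<le> 2 * exp (- c P * q)"
        unfolding measure_def using cN(2)[OF P nP[OF P]] unfolding SP_def q_def by (intro enn2real_leI) auto
      also have "\<dots> \<le> 2 * exp (- C2 * q)" using C2(3)[OF P] q by simp
      finally show ?thesis .
    qed
    have "mgf ^ card B = exp (L * real (card B))" using mgf_ge_1 by (simp add: L_def exp_of_nat2_mult)
    then have "exp (- \<theta>0 * (g / 2 * q)) * mgf ^ card B = exp (- \<theta>0 * (g / 2 * q) + L * real (card B))"
      by (simp only: exp_add)
    also have "\<dots> \<le> exp (- C2 * q)"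
    proof -
      have "L * real (card B) \<le> L * (2 * x * q)" using cardB L by (rule mult_left_mono)
      also have "\<dots> \<le> \<theta>0 * g / 4 * q" using mult_right_mono[OF x(2), of q] q by (simp add: mult.assoc)
      finally have "- \<theta>0 * (g / 2 * q) + L * real (card B) \<le> - (\<theta>0 * g / 4) * q" by (simp add: field_simps)
      also have "\<dots> \<le> - C2 * q" using C2(2) q by simp
      finally show ?thesis by simp
    qed
    finally have ex: "exp (- \<theta>0 * (g / 2 * q)) * mgf ^ card B \<le> exp (- C2 * q)" .
    have "0 \<le> g / 2 * q" using g q by simp
    then have "emeasure ?M SB \<le> ennreal (exp (- \<theta>0 * (g / 2 * q)) * mgf ^ card B)" unfolding SB_def by (rule V_chernoff[OF B(1)])
    also have "\<dots> \<le> ennreal (exp (- C2 * q))" using ex by (rule ennreal_leI)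
    finally have mSB: "measure ?M SB \<le> exp (- C2 * q)" unfolding measure_def by (intro enn2real_leI) auto
    \<comment> \<open>\<open>phi_inf\<close> is an infimum over uncountably many edge sets; its
      event is therefore enclosed in this measurable union.\<close>
    define S where "S = (\<Union>P\<in>\<P>. SP P) \<union> SB"
    have UP: "(\<Union>P\<in>\<P>. SP P) \<in> sets ?M" using SP \<P>(1) by (intro sets.finite_UN) auto
    then have S: "S \<in> sets ?M" using SB unfolding S_def by (rule sets.Un)
    have "measure ?M S \<le> measure ?M (\<Union>P\<in>\<P>. SP P) + measure ?M SB"
      unfolding S_def by (rule measure_Un_le[OF UP SB])
    also have "\<dots> \<le> (\<Sum>P\<in>\<P>. measure ?M (SP P)) + measure ?M SB"
      by (intro add_right_mono measure_UNION_le \<P>(1) SP)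
    also have "\<dots> \<le> (\<Sum>P\<in>\<P>. 2 * exp (- C2 * q)) + exp (- C2 * q)" by (intro add_mono sum_mono mSP mSB)
    also have "\<dots> = (2 * real (card \<P>) + 1) * exp (- C2 * q)" by (simp add: algebra_simps)
    finally have mS: "measure ?M S \<le> (2 * real (card \<P>) + 1) * exp (- C2 * q)" .
    have "t \<in> S" if t: "ennreal (lam * q) \<le> phi_inf n A t" for t
    proof (rule ccontr)
      assume "t \<notin> S"
      then have le: "\<And>P. P \<in> \<P> \<Longrightarrow> tau n (pbase P) (pdir P) (pheight P) t \<le> ennreal ((nu (pdir P) + \<epsilon>) * a P * q)"
        "V t B \<le> ennreal (g / 2 * q)"
        unfolding S_def SP_def SB_def by (auto simp: not_le less_imp_le)
      have nn: "0 \<le> (nu (pdir P) + \<epsilon>) * a P * q" for P using nu_nonneg[of "pdir P"] \<epsilon>(1) a_nonneg[of P] q by simp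
      have "phi_inf n A t \<le> (\<Sum>P\<in>\<P>. ennreal ((nu (pdir P) + \<epsilon>) * a P * q)) + ennreal (g / 2 * q)"
        using B(3)[of t] by (rule order_trans) (intro add_mono sum_mono le)
      also have "\<dots> = ennreal ((\<Sum>P\<in>\<P>. (nu (pdir P) + \<epsilon>) * a P * q) + g / 2 * q)"
        using nn g q by (simp add: ennreal_plus sum_nonneg)
      also have "\<dots> < ennreal (lam * q)"
      proof -
        have "(\<Sum>P\<in>\<P>. (nu (pdir P) + \<epsilon>) * a P) = (\<Sum>P\<in>\<P>. (nu (pdir P) - \<epsilon>) * a P) + 2 * \<epsilon> * (\<Sum>P\<in>\<P>. a P)"
          unfolding sum_distrib_left sum.distrib[symmetric] by (intro sum.cong refl) (simp add: algebra_simps)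
        also have "\<dots> \<le> I0 + 2 * \<epsilon> * m" using nusum asum \<epsilon>(1) by (intro add_mono mult_left_mono) auto
        also have "\<dots> \<le> I0 + g / 4" using \<epsilon>(2) by simp
        finally have "(\<Sum>P\<in>\<P>. (nu (pdir P) + \<epsilon>) * a P) \<le> I0 + g / 4" .
        moreover have "lam = I0 + g" by (simp add: g_def)
        ultimately have "(\<Sum>P\<in>\<P>. (nu (pdir P) + \<epsilon>) * a P) + g / 2 < lam" using g by linarith
        then have "((\<Sum>P\<in>\<P>. (nu (pdir P) + \<epsilon>) * a P) + g / 2) * q < lam * q" using q by simp
        moreover have "0 \<le> (\<Sum>P\<in>\<P>. (nu (pdir P) + \<epsilon>) * a P * q) + g / 2 * q" using nn g q by (simp add: sum_nonneg)
        ultimately show ?thesis by (simp add: ennreal_less_iff sum_distrib_right distrib_right)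
      qed
      finally show False using t by simp
    qed
    then have "{t \<in> space ?M. ennreal (lam * q) \<le> phi_inf n A t} \<subseteq> S" by blast
    then show ?thesis using S mS unfolding q_def by blast
  qed
  \<comment> \<open>For \<open>n\<close> below \<open>n1\<close> the second term makes the claimed
    bound at least \<open>1\<close>.\<close>
  define C1 where "C1 = max (2 * real (card \<P>) + 1) (exp (C2 * real n1 ^ ?s))"
  have C1: "0 < C1" by (simp add: C1_def max_def)
  show ?thesis
  proof (rule exI[of _ C1], rule conjI[OF C1], rule exI[of _ C2], rule conjI[OF C2(1)], intro allI impI)
    fix n :: nat assume "1 \<le> n"
    show "\<exists>S\<in>sets ?M. {t \<in> space ?M. ennreal (lam * real n ^ ?s) \<le> phi_inf n A t} \<subseteq> S \<and>
      measure ?M S \<le> C1 * exp (- C2 * real n ^ ?s)"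
    proof (cases "n1 \<le> n")
      case True
      have "(2 * real (card \<P>) + 1) * exp (- C2 * real n ^ ?s) \<le> C1 * exp (- C2 * real n ^ ?s)"
        by (intro mult_right_mono) (auto simp: C1_def)
      then show ?thesis using large[OF True] by (meson order_trans)
    next
      case False
      have "real n ^ ?s \<le> real n1 ^ ?s" using False by (intro power_mono) auto
      then have "C2 * real n ^ ?s \<le> C2 * real n1 ^ ?s" using C2(1) by simp
      then have "exp (C2 * real n ^ ?s) \<le> C1" unfolding C1_def by (simp add: le_max_iff_disj)
      then have "exp (C2 * real n ^ ?s) * exp (- C2 * real n ^ ?s) \<le> C1 * exp (- C2 * real n ^ ?s)"
        by (intro mult_right_mono) auto
      then have "1 \<le> C1 * exp (- C2 * real n ^ ?s)" by (simp add: exp_minus)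
      then have "measure ?M (space ?M) \<le> C1 * exp (- C2 * real n ^ ?s)" by (simp only: M.prob_space)
      then show ?thesis by (intro bexI[of _ "space ?M"] sets.top conjI) blast
    qed
  qed
qed

end

theorem theorem3:
  fixes A :: "(real^'d::finite) set" and G :: "real measure" and lam :: real
  assumes d2: "CARD('d) \<ge> 2"
    and A_compact: "compact A" and A_convex: "convex A" and A_0: "0 \<in> A"
    and A_normal: "AE x in hausdorff_measure (real CARD('d) - 1). x \<in> frontier A \<longrightarrow> has_normal A x"
    and G_prob: "prob_space G" and G_sets: "sets G = sets borel"
    and G_pos: "measure G {0..} = 1"
    and G_0: "measure G {0} < 1 - p_c TYPE('d)"
    and G_exp: "\<exists>\<theta>>0. (\<integral>\<^sup>+ x. ennreal (exp (\<theta> * x)) \<partial>G) < \<infinity>"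
    and lam_gt: "ennreal lam > I_A G A"
  shows "\<exists>C1>0. \<exists>C2>0. \<forall>n::nat. n \<ge> 1 \<longrightarrow>
           (\<exists>S \<in> sets (cap_measure G).
              {t \<in> space (cap_measure G). phi_inf n A t \<ge> ennreal (lam * real n ^ (CARD('d) - 1))} \<subseteq> S \<and>
              measure (cap_measure G) S \<le> C1 * exp (- C2 * real n ^ (CARD('d) - 1)))"
proof -
  obtain \<theta>0 where "0 < \<theta>0" "(\<integral>\<^sup>+ x. ennreal (exp (\<theta>0 * x)) \<partial>G) < \<infinity>" using G_exp by blast
  then interpret capacity_law G \<theta>0 using G_prob G_sets by (intro capacity_law.intro)
  show ?thesis by (rule phi_inf_upper_deviation[OF d2 A_compact A_convex A_normal lam_gt])
qed

end
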